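(* Let $(\Omega^1,d)$ be a first order differential calculus over $A$ with $\Omega^1$ a pivotal bimodule with dual $\mathfrak{X}^1$, and let $M,N$ be left $H\mathfrak{X}^1$-modules. The actions of $H(\Omega^1)$ on $\mathrm{Hom}_A(M,N)$ and ${}_A\mathrm{Hom}(M,N)$ extend to well-defined actions of $H\mathfrak{X}^1$ by letting $x\in\mathfrak{X}^1$ act by $$[xf](m)=x\,f(m)-(x,\rho_j)\,f\big(((\omega_i,y_j)\bullet x_i)\,m\big),$$ $$[xg](m)=y_j\,g\big((\rho_j,x)m\big)-g\big((y_j\bullet(\rho_j,x))\,m\big)$$ for $m\in M$, $f\in\mathrm{Hom}_A(M,N)$, $g\in{}_A\mathrm{Hom}(M,N)$; and with these actions the closed monoidal structure of the category ${}_A\mathcal{M}_A$ of $A$-bimodules lifts to the category of left $H\mathfrak{X}^1$-modules.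
   Context: Conventions. $\mathbb{K}$ is a field, $A$ a unital associative $\mathbb{K}$-algebra, $\otimes$ means $\otimes_A$. $A^{op}=\{\overline{a}: a\in A\}$ with $\overline{a}\,\overline{b}=\overline{ba}$; $A^e=A\otimes_{\mathbb{K}}A^{op}$ with elements written $a\overline{b}$. $A$-bimodules are identified with left $A^e$-modules via $(a\overline{b})m=amb$. Summation over repeated dual-basis indices is implicit. $T_{A^e}(V)$, $TV$ are tensor algebras, $\star$ the free product of algebras. A first order differential calculus is an $A$-bimodule $\Omega^1$ with a $\mathbb{K}$-linear $d:A\to\Omega^1$ satisfying $d(ab)=(da)b+a\,db$. Closed structure of ${}_A\mathcal{M}_A$. $\mathrm{Hom}_A(M,N)$ (right module maps) is a bimodule by $[a\overline{b}f](m)=a f(bm)$ and ${}_A\mathrm{Hom}(M,N)$ (left module maps) by $[a\overline{b}g](m)=g(ma)b$. $\mathrm{Hom}_A(M,-)$ is right adjoint to $-\otimes M$ with unit $N\to\mathrm{Hom}_A(M,N\otimes M)$, $n\mapsto(m\mapsto n\otimes m)$, and counit $\mathrm{Hom}_A(M,N)\otimes M\to N$, $f\otimes m\mapsto f(m)$. ${}_A\mathrm{Hom}(M,-)$ is right adjoint to $M\otimes-$ with unit $N\to{}_A\mathrm{Hom}(M,M\otimes N)$, $n\mapsto(m\mapsto m\otimes n)$, and counit $M\otimes{}_A\mathrm{Hom}(M,N)\to N$, $m\otimes g\mapsto g(m)$. For a left $A$-bialgebroid $B$, left $B$-modules form a monoidal category with $b(m\otimes n)=b_{(1)}m\otimes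 b_{(2)}n$ on $M\otimes N$ and unit object $A$ with $b\cdot a=\epsilon(ba)$. "The closed monoidal structure lifts to $B$-modules" means that, with the given $B$-actions on the inner homs, the units $N\to\mathrm{Hom}_A(M,N\otimes M)$, $n\mapsto(m\mapsto n\otimes m)$, and $N\to{}_A\mathrm{Hom}(M,M\otimes N)$, $n\mapsto(m\mapsto m\otimes n)$, and the counits $\mathrm{Hom}_A(M,N)\otimes M\to N$, $f\otimes m\mapsto f(m)$, and $M\otimes{}_A\mathrm{Hom}(M,N)\to N$, $m\otimes g\mapsto g(m)$, are $B$-module maps for all $B$-modules $M,N$ (so the forgetful functor to ${}_A\mathcal{M}_A$ is strong monoidal and both left and right closed; equivalently $B$ is a Schauenburg Hopf algebroid). Pivotal bimodules. $\Omega^1$ is pivotal if it is finitely generated projective on both sides and its left dual $\mathrm{Hom}_A(\Omega^1,A)$ and right dual ${}_A\mathrm{Hom}(\Omega^1,A)$ are isomorphic as bimodules. Fixing such an isomorphism, a single bimodule $\mathfrak{X}^1$ is both left and right dual of $\Omega^1$, with bimodule maps $\mathrm{ev}:\mathfrak{X}^1\otimes\Omega^1\to A$, $\mathrm{coev}:A\to\Omega^1\otimes\mathfrak{X}^1$, $\mathrm{coev}(1)=\omega_i\otimes x_i$, $\underline{\mathrm{ev}}:\Omega^1\otimes\mathfrak{X}^1\to A$, $\underline{\mathrm{coev}}:A\to\mathfrak{X}^1\otimes\Omega^1$, $\underline{\mathrm{coev}}(1)=y_j\otimes\rho_j$, satisfying $\omega=\omega_i\,\mathrm{ev}(x_i\otimes\omega)=\underline{\mathrm{ev}}(\omega\otimes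 y_j)\rho_j$ and $x=\mathrm{ev}(x\otimes\omega_i)x_i=y_j\,\underline{\mathrm{ev}}(\rho_j\otimes x)$. The bialgebroid $H(\Omega^1)$. Let $\mathfrak{Z}=(\mathfrak{X}^1\otimes_{\mathbb{K}}\Omega^1)\oplus(\Omega^1\otimes_{\mathbb{K}}\mathfrak{X}^1)$; write $(x,\omega)$ for $x\otimes_{\mathbb{K}}\omega$ in the first summand and $(\omega,x)$ for $\omega\otimes_{\mathbb{K}}x$ in the second. $\mathfrak{Z}$ is an $A^e$-bimodule via $a\overline{a'}(x,\omega)b\overline{b'}=(axb,b'\omega a')$ and $a\overline{a'}(\omega,x)b\overline{b'}=(a\omega b,b'xa')$. $H(\Omega^1)$ is the quotient of $T_{A^e}(\mathfrak{Z})$ (product $\bullet$) by the relations, for all $x\in\mathfrak{X}^1$, $\omega\in\Omega^1$, $$(\omega_i,x)\bullet(x_i,\omega)=\overline{\underline{\mathrm{ev}}(\omega\otimes x)},\quad (x,\rho_j)\bullet(\omega,y_j)=\mathrm{ev}(x\otimes\omega),$$ $$(y_j,\omega)\bullet(\rho_j,x)=\overline{\mathrm{ev}(x\otimes\omega)},\quad (\omega,x_i)\bullet(x,\omega_i)=\underline{\mathrm{ev}}(\omega\otimes x).$$ The bialgebroid $H\mathfrak{X}^1$ is the quotient of $H(\Omega^1)\star T\mathfrak{X}^1$ by the relations $a\bullet x=ax$, $x\bullet a=xa+\mathrm{ev}(x\otimes da)$, $x\bullet\overline{a}=\overline{a}\bullet x+(x,da)$ for $x\in\mathfrak{X}^1$,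 $a\in A$. It is a left $A$-bialgebroid with $\Delta(a\overline{b})=a\otimes\overline{b}$, $\Delta((x,\omega))=(x,\omega_i)\otimes(x_i,\omega)$, $\Delta((\omega,x))=(\omega,y_j)\otimes(\rho_j,x)$, $\Delta(x)=x\otimes1+(x,\omega_i)\otimes x_i$, $\epsilon(a\overline{b})=ab$, $\epsilon((x,\omega))=\mathrm{ev}(x\otimes\omega)$, $\epsilon((\omega,x))=\underline{\mathrm{ev}}(\omega\otimes x)$, $\epsilon(x)=0$, extended by $\Delta(m\bullet n)=m_{(1)}\bullet n_{(1)}\otimes m_{(2)}\bullet n_{(2)}$ (tensor product over $A$ with respect to $r\cdot b\cdot s=r\overline{s}b$) and $\epsilon(m\bullet n)=\epsilon(m\bullet\epsilon(n))$. The actions of $H(\Omega^1)$ on inner homs of $H(\Omega^1)$-modules $M,N$ are the $A^e$-actions $[a\overline{b}f](m)=a f(bm)$ and $[a\overline{b}g](m)=g(ma)b$ (for $a,b\in A$, $m\in M$, $f\in\mathrm{Hom}_A(M,N)$, $g\in{}_A\mathrm{Hom}(M,N)$) together with, for $x,y\in\mathfrak{X}^1$, $\omega,\rho\in\Omega^1$, $$[(x,\omega)f](m)=(x,\rho_j)f((\omega,y_j)m),\quad [(\rho,y)f](m)=(\rho,x_i)f((y,\omega_i)m),$$ $$[(x,\omega)g](m)=(y_j,\omega)g((\rho_j,x)m),\quad [(\rho,y)g](m)=(\omega_i,y)g((x_i,\rho)m).$$ In all formulas $[hf]$ is the result of $h$ acting on the map $f$, whereas $h f(m)$ is $h$ acting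 on the element $f(m)\in N$. *)

theory Defs
  imports "HOL-Algebra.Free_Abelian_Groups" "HOL-Algebra.QuotRing" "HOL-Algebra.Module"
begin

section \<open>Modules and bimodules over noncommutative algebras\<close>

text \<open>
  The library locale \<open>module\<close> assumes a commutative ring of scalars.  Its record is reused for
  left modules over arbitrary rings (the fields \<open>mult\<close> and \<open>one\<close> are meaningless there, as in the
  library), and also for unital associative \<open>K\<close>-algebras.
\<close>

locale left_module = R?: ring R + M?: abelian_group M
  for R :: "('r, 'c) ring_scheme" (structure) and M :: "('r, 'm, 'e) module_scheme" (structure) +
  assumes lmod_closed: "\<lbrakk>r \<in> carrier R; m \<in> carrier M\<rbrakk> \<Longrightarrow> r \<odot>\<^bsub>M\<^esub> m \<in> carrier M"
    and lmod_l_distr: "\<lbrakk>r \<in> carrier R; s \<in> carrier R; m \<in> carrier M\<rbrakk>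
      \<Longrightarrow> (r \<oplus>\<^bsub>R\<^esub> s) \<odot>\<^bsub>M\<^esub> m = r \<odot>\<^bsub>M\<^esub> m \<oplus>\<^bsub>M\<^esub> s \<odot>\<^bsub>M\<^esub> m"
    and lmod_r_distr: "\<lbrakk>r \<in> carrier R; m \<in> carrier M; n \<in> carrier M\<rbrakk>
      \<Longrightarrow> r \<odot>\<^bsub>M\<^esub> (m \<oplus>\<^bsub>M\<^esub> n) = r \<odot>\<^bsub>M\<^esub> m \<oplus>\<^bsub>M\<^esub> r \<odot>\<^bsub>M\<^esub> n"
    and lmod_assoc: "\<lbrakk>r \<in> carrier R; s \<in> carrier R; m \<in> carrier M\<rbrakk>
      \<Longrightarrow> (r \<otimes>\<^bsub>R\<^esub> s) \<odot>\<^bsub>M\<^esub> m = r \<odot>\<^bsub>M\<^esub> (s \<odot>\<^bsub>M\<^esub> m)"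
    and lmod_one: "m \<in> carrier M \<Longrightarrow> \<one>\<^bsub>R\<^esub> \<odot>\<^bsub>M\<^esub> m = m"

locale assoc_algebra = K?: field K + A?: ring A + KA?: Module.module K A
  for K :: "'k ring" (structure) and A :: "('k, 'a) module" (structure) +
  assumes scalar_mult_left: "\<lbrakk>l \<in> carrier K; a \<in> carrier A; b \<in> carrier A\<rbrakk>
      \<Longrightarrow> (l \<odot>\<^bsub>A\<^esub> a) \<otimes>\<^bsub>A\<^esub> b = l \<odot>\<^bsub>A\<^esub> (a \<otimes>\<^bsub>A\<^esub> b)"
    and scalar_mult_right: "\<lbrakk>l \<in> carrier K; a \<in> carrier A; b \<in> carrier A\<rbrakk>
      \<Longrightarrow> a \<otimes>\<^bsub>A\<^esub> (l \<odot>\<^bsub>A\<^esub> b) = l \<odot>\<^bsub>A\<^esub> (a \<otimes>\<^bsub>A\<^esub> b)"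

record ('r, 'm) bimodule = "('r, 'm) module" +
  rsmult :: "['m, 'r] \<Rightarrow> 'm" (infixl \<open>\<ddagger>\<index>\<close> 70)

text \<open>
  Bimodules over a \<open>K\<close>-algebra \<open>A\<close>, i.e. left modules over \<open>A \<otimes>\<^sub>K A\<^sup>o\<^sup>p\<close>: the field acts in the
  same way from both sides.
\<close>

locale bimodule = A?: assoc_algebra K A + M?: left_module A M
  for K :: "'k ring" (structure) and A :: "('k, 'a) module" (structure)
    and M :: "('a, 'm) bimodule" (structure) +
  assumes rmod_closed: "\<lbrakk>a \<in> carrier A; m \<in> carrier M\<rbrakk> \<Longrightarrow> m \<ddagger>\<^bsub>M\<^esub> a \<in> carrier M"
    and rmod_r_distr: "\<lbrakk>a \<in> carrier A; b \<in> carrier A; m \<in> carrier M\<rbrakk>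
      \<Longrightarrow> m \<ddagger>\<^bsub>M\<^esub> (a \<oplus>\<^bsub>A\<^esub> b) = m \<ddagger>\<^bsub>M\<^esub> a \<oplus>\<^bsub>M\<^esub> m \<ddagger>\<^bsub>M\<^esub> b"
    and rmod_l_distr: "\<lbrakk>a \<in> carrier A; m \<in> carrier M; n \<in> carrier M\<rbrakk>
      \<Longrightarrow> (m \<oplus>\<^bsub>M\<^esub> n) \<ddagger>\<^bsub>M\<^esub> a = m \<ddagger>\<^bsub>M\<^esub> a \<oplus>\<^bsub>M\<^esub> n \<ddagger>\<^bsub>M\<^esub> a"
    and rmod_assoc: "\<lbrakk>a \<in> carrier A; b \<in> carrier A; m \<in> carrier M\<rbrakk>
      \<Longrightarrow> m \<ddagger>\<^bsub>M\<^esub> (a \<otimes>\<^bsub>A\<^esub> b) = (m \<ddagger>\<^bsub>M\<^esub> a) \<ddagger>\<^bsub>M\<^esub> b"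
    and rmod_one: "m \<in> carrier M \<Longrightarrow> m \<ddagger>\<^bsub>M\<^esub> \<one>\<^bsub>A\<^esub> = m"
    and bimod_assoc: "\<lbrakk>a \<in> carrier A; b \<in> carrier A; m \<in> carrier M\<rbrakk>
      \<Longrightarrow> (a \<odot>\<^bsub>M\<^esub> m) \<ddagger>\<^bsub>M\<^esub> b = a \<odot>\<^bsub>M\<^esub> (m \<ddagger>\<^bsub>M\<^esub> b)"
    and central: "\<lbrakk>l \<in> carrier K; m \<in> carrier M\<rbrakk>
      \<Longrightarrow> (l \<odot>\<^bsub>A\<^esub> \<one>\<^bsub>A\<^esub>) \<odot>\<^bsub>M\<^esub> m = m \<ddagger>\<^bsub>M\<^esub> (l \<odot>\<^bsub>A\<^esub> \<one>\<^bsub>A\<^esub>)"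

definition additive_map ::
    "('m, 'c) ring_scheme \<Rightarrow> ('n, 'e) ring_scheme \<Rightarrow> ('m \<Rightarrow> 'n) \<Rightarrow> bool" where
  "additive_map M N f \<longleftrightarrow> f \<in> carrier M \<rightarrow> carrier N \<and>
     (\<forall>m\<in>carrier M. \<forall>m'\<in>carrier M. f (m \<oplus>\<^bsub>M\<^esub> m') = f m \<oplus>\<^bsub>N\<^esub> f m')"

definition left_map ::
    "('r, 'c) ring_scheme \<Rightarrow> ('r, 'm, 'd) module_scheme \<Rightarrow> ('r, 'n, 'e) module_scheme
      \<Rightarrow> ('m \<Rightarrow> 'n) \<Rightarrow> bool" where
  "left_map R M N f \<longleftrightarrow> additive_map M N f \<and>
     (\<forall>r\<in>carrier R. \<forall>m\<in>carrier M. f (r \<odot>\<^bsub>M\<^esub> m) = r \<odot>\<^bsub>N\<^esub> f m)"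

definition right_map ::
    "('r, 'c) ring_scheme \<Rightarrow> ('r, 'm) bimodule \<Rightarrow> ('r, 'n) bimodule \<Rightarrow> ('m \<Rightarrow> 'n) \<Rightarrow> bool" where
  "right_map R M N f \<longleftrightarrow> additive_map M N f \<and>
     (\<forall>r\<in>carrier R. \<forall>m\<in>carrier M. f (m \<ddagger>\<^bsub>M\<^esub> r) = f m \<ddagger>\<^bsub>N\<^esub> r)"

definition bimodule_map ::
    "('r, 'c) ring_scheme \<Rightarrow> ('r, 'm) bimodule \<Rightarrow> ('r, 'n) bimodule \<Rightarrow> ('m \<Rightarrow> 'n) \<Rightarrow> bool" where
  "bimodule_map R M N f \<longleftrightarrow> left_map R M N f \<and> right_map R M N f"

definition left_module_hom ::
    "('r, 'c) ring_scheme \<Rightarrow> ('r, 'm, 'd) module_scheme \<Rightarrow> ('r, 'n, 'e) module_scheme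
      \<Rightarrow> ('m \<Rightarrow> 'n) \<Rightarrow> bool" where
  "left_module_hom R M N f \<longleftrightarrow> left_module R M \<and> left_module R N \<and> left_map R M N f"

definition regular :: "('r, 'c) ring_scheme \<Rightarrow> ('r, 'r) bimodule" where
  "regular R = \<lparr>carrier = carrier R, mult = mult R, one = one R, zero = zero R, add = add R,
     smult = mult R, rsmult = mult R\<rparr>"

text \<open>
  The bimodules \<open>Hom\<^sub>A(M, N)\<close> of right module maps and \<open>\<^sub>AHom(M, N)\<close> of left module maps.
\<close>

definition right_inner_hom ::
    "('r, 'c) ring_scheme \<Rightarrow> ('r, 'm) bimodule \<Rightarrow> ('r, 'n) bimodule \<Rightarrow> ('r, 'm \<Rightarrow> 'n) bimodule" where
  "right_inner_hom R M N =
     \<lparr>carrier = {f \<in> extensional (carrier M). right_map R M N f},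
      mult = undefined, one = undefined,
      zero = (\<lambda>m\<in>carrier M. \<zero>\<^bsub>N\<^esub>),
      add = (\<lambda>f g. \<lambda>m\<in>carrier M. f m \<oplus>\<^bsub>N\<^esub> g m),
      smult = (\<lambda>a f. \<lambda>m\<in>carrier M. a \<odot>\<^bsub>N\<^esub> f m),
      rsmult = (\<lambda>f b. \<lambda>m\<in>carrier M. f (b \<odot>\<^bsub>M\<^esub> m))\<rparr>"

definition left_inner_hom ::
    "('r, 'c) ring_scheme \<Rightarrow> ('r, 'm) bimodule \<Rightarrow> ('r, 'n) bimodule \<Rightarrow> ('r, 'm \<Rightarrow> 'n) bimodule" where
  "left_inner_hom R M N =
     \<lparr>carrier = {g \<in> extensional (carrier M). left_map R M N g},
      mult = undefined, one = undefined,
      zero = (\<lambda>m\<in>carrier M. \<zero>\<^bsub>N\<^esub>),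
      add = (\<lambda>f g. \<lambda>m\<in>carrier M. f m \<oplus>\<^bsub>N\<^esub> g m),
      smult = (\<lambda>a g. \<lambda>m\<in>carrier M. g (m \<ddagger>\<^bsub>M\<^esub> a)),
      rsmult = (\<lambda>g b. \<lambda>m\<in>carrier M. g m \<ddagger>\<^bsub>N\<^esub> b)\<rparr>"

definition free_bimodule :: "('r, 'c) ring_scheme \<Rightarrow> nat \<Rightarrow> ('r, nat \<Rightarrow> 'r) bimodule" where
  "free_bimodule R n =
     \<lparr>carrier = {..<n} \<rightarrow>\<^sub>E carrier R, mult = undefined, one = undefined,
      zero = (\<lambda>i\<in>{..<n}. \<zero>\<^bsub>R\<^esub>),
      add = (\<lambda>u v. \<lambda>i\<in>{..<n}. u i \<oplus>\<^bsub>R\<^esub> v i),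
      smult = (\<lambda>a u. \<lambda>i\<in>{..<n}. a \<otimes>\<^bsub>R\<^esub> u i),
      rsmult = (\<lambda>u a. \<lambda>i\<in>{..<n}. u i \<otimes>\<^bsub>R\<^esub> a)\<rparr>"

text \<open>Finitely generated projective means: direct summand of a finite free module.\<close>

definition left_fgp :: "('r, 'c) ring_scheme \<Rightarrow> ('r, 'm) bimodule \<Rightarrow> bool" where
  "left_fgp R M \<longleftrightarrow> (\<exists>n s p. left_map R M (free_bimodule R n) s \<and>
     left_map R (free_bimodule R n) M p \<and> (\<forall>m\<in>carrier M. p (s m) = m))"

definition right_fgp :: "('r, 'c) ring_scheme \<Rightarrow> ('r, 'm) bimodule \<Rightarrow> bool" where
  "right_fgp R M \<longleftrightarrow> (\<exists>n s p. right_map R M (free_bimodule R n) s \<and>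
     right_map R (free_bimodule R n) M p \<and> (\<forall>m\<in>carrier M. p (s m) = m))"

definition pivotal_bimodule :: "('r, 'c) ring_scheme \<Rightarrow> ('r, 'm) bimodule \<Rightarrow> bool" where
  "pivotal_bimodule R M \<longleftrightarrow> left_fgp R M \<and> right_fgp R M \<and>
     (\<exists>h. bimodule_map R (right_inner_hom R M (regular R)) (left_inner_hom R M (regular R)) h \<and>
          bij_betw h (carrier (right_inner_hom R M (regular R)))
                     (carrier (left_inner_hom R M (regular R))))"


section \<open>Tensor products\<close>

text \<open>
  Elements of a tensor product are cosets in the free abelian group on the pairs.
\<close>

type_synonym ('m, 'n) tens = "('m \<times> 'n \<Rightarrow>\<^sub>0 int) set"

definition tensor_pre ::
    "('r, 'm) bimodule \<Rightarrow> ('r, 'n) bimodule \<Rightarrow> ('m \<times> 'n \<Rightarrow>\<^sub>0 int) monoid" where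
  "tensor_pre M N = free_Abelian_group (carrier M \<times> carrier N)"

definition tensor_rels ::
    "('r, 'c) ring_scheme \<Rightarrow> ('r, 'm) bimodule \<Rightarrow> ('r, 'n) bimodule \<Rightarrow> ('m, 'n) tens" where
  "tensor_rels R M N = generate (tensor_pre M N)
    ({frag_of (m \<oplus>\<^bsub>M\<^esub> m', n) - frag_of (m, n) - frag_of (m', n) |m m' n.
        m \<in> carrier M \<and> m' \<in> carrier M \<and> n \<in> carrier N} \<union>
     {frag_of (m, n \<oplus>\<^bsub>N\<^esub> n') - frag_of (m, n) - frag_of (m, n') |m n n'.
        m \<in> carrier M \<and> n \<in> carrier N \<and> n' \<in> carrier N} \<union>
     {frag_of (m \<ddagger>\<^bsub>M\<^esub> r, n) - frag_of (m, r \<odot>\<^bsub>N\<^esub> n) |m r n.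
        m \<in> carrier M \<and> r \<in> carrier R \<and> n \<in> carrier N})"

definition tens ::
    "('r, 'c) ring_scheme \<Rightarrow> ('r, 'm) bimodule \<Rightarrow> ('r, 'n) bimodule \<Rightarrow> 'm \<Rightarrow> 'n \<Rightarrow> ('m, 'n) tens" where
  "tens R M N m n = tensor_rels R M N #>\<^bsub>tensor_pre M N\<^esub> frag_of (m, n)"

text \<open>
  \<open>tens_ext G \<phi>\<close> is the additive map to \<open>G\<close> with \<open>m \<otimes> n \<mapsto> \<phi> m n\<close>, for balanced
  biadditive \<open>\<phi>\<close>: all representatives of a coset then have the same value.
\<close>

definition tens_ext :: "('g, 'c) ring_scheme \<Rightarrow> ('m \<Rightarrow> 'n \<Rightarrow> 'g) \<Rightarrow> ('m, 'n) tens \<Rightarrow> 'g" where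
  "tens_ext G \<phi> t = the_elem ((\<lambda>p. \<Oplus>\<^bsub>G\<^esub>q\<in>Poly_Mapping.keys p.
     [Poly_Mapping.lookup p q] \<cdot>\<^bsub>G\<^esub> \<phi> (fst q) (snd q)) ` t)"

definition tensor_group ::
    "('r, 'c) ring_scheme \<Rightarrow> ('r, 'm) bimodule \<Rightarrow> ('r, 'n) bimodule \<Rightarrow> ('m, 'n) tens ring" where
  "tensor_group R M N = (let G = tensor_pre M N Mod tensor_rels R M N in
     \<lparr>carrier = carrier G, mult = undefined, one = undefined,
      zero = one G, add = monoid.mult G\<rparr>)"

definition tensor ::
    "('r, 'c) ring_scheme \<Rightarrow> ('r, 'm) bimodule \<Rightarrow> ('r, 'n) bimodule
      \<Rightarrow> ('r, ('m, 'n) tens) bimodule" where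
  "tensor R M N = (let G = tensor_group R M N in
     \<lparr>carrier = carrier G, mult = undefined, one = undefined, zero = zero G, add = add G,
      smult = (\<lambda>r. tens_ext G (\<lambda>m n. tens R M N (r \<odot>\<^bsub>M\<^esub> m) n)),
      rsmult = (\<lambda>t r. tens_ext G (\<lambda>m n. tens R M N m (n \<ddagger>\<^bsub>N\<^esub> r)) t)\<rparr>)"

definition field_algebra :: "'k ring \<Rightarrow> ('k, 'k) module" where
  "field_algebra K = \<lparr>carrier = carrier K, mult = mult K, one = one K, zero = zero K, add = add K,
     smult = mult K\<rparr>"

definition alg_scalars :: "('k, 'a) module \<Rightarrow> ('k, 'a) bimodule" where
  "alg_scalars A = \<lparr>carrier = carrier A, mult = undefined, one = undefined,
     zero = zero A, add = add A, smult = smult A, rsmult = (\<lambda>a l. l \<odot>\<^bsub>A\<^esub> a)\<rparr>"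

text \<open>The underlying \<open>K\<close>-vector space of an \<open>A\<close>-bimodule.\<close>

definition scalars :: "('k, 'a) module \<Rightarrow> ('a, 'm) bimodule \<Rightarrow> ('k, 'm) bimodule" where
  "scalars A M = \<lparr>carrier = carrier M, mult = undefined, one = undefined,
     zero = zero M, add = add M,
     smult = (\<lambda>l m. (l \<odot>\<^bsub>A\<^esub> \<one>\<^bsub>A\<^esub>) \<odot>\<^bsub>M\<^esub> m),
     rsmult = (\<lambda>m l. (l \<odot>\<^bsub>A\<^esub> \<one>\<^bsub>A\<^esub>) \<odot>\<^bsub>M\<^esub> m)\<rparr>"

definition opposite :: "('k, 'a) module \<Rightarrow> ('k, 'a) module" where
  "opposite A = A\<lparr>mult := (\<lambda>a b. b \<otimes>\<^bsub>A\<^esub> a)\<rparr>"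

definition alg_tens :: "'k ring \<Rightarrow> ('k, 'a) module \<Rightarrow> ('k, 'b) module \<Rightarrow> 'a \<Rightarrow> 'b \<Rightarrow> ('a, 'b) tens" where
  "alg_tens K A B = tens K (alg_scalars A) (alg_scalars B)"

definition alg_tensor ::
    "'k ring \<Rightarrow> ('k, 'a) module \<Rightarrow> ('k, 'b) module \<Rightarrow> ('k, ('a, 'b) tens) module" where
  "alg_tensor K A B = (let T = tensor K (alg_scalars A) (alg_scalars B) in
     \<lparr>carrier = carrier T,
      mult = (\<lambda>u v. tens_ext T (\<lambda>a b. tens_ext T (\<lambda>a' b'.
                alg_tens K A B (a \<otimes>\<^bsub>A\<^esub> a') (b \<otimes>\<^bsub>B\<^esub> b')) v) u),
      one = alg_tens K A B \<one>\<^bsub>A\<^esub> \<one>\<^bsub>B\<^esub>,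
      zero = zero T, add = add T, smult = smult T\<rparr>)"

text \<open>In \<open>A\<^sup>e = A \<otimes>\<^sub>K A\<^sup>o\<^sup>p\<close> the product of \<open>a\<close> and \<open>b\<close>-bar is \<open>alg_tens K A (opposite A) a b\<close>.\<close>

definition enveloping :: "'k ring \<Rightarrow> ('k, 'a) module \<Rightarrow> ('k, ('a, 'a) tens) module" where
  "enveloping K A = alg_tensor K A (opposite A)"


section \<open>Algebras by generators and relations\<close>

text \<open>
  The free algebra \<open>K\<langle>G\<rangle>\<close>: finitely supported \<open>K\<close>-valued functions on words over \<open>G\<close>, multiplied by
  convolution along the splittings of a word.
\<close>

type_synonym ('g, 'k) free_elt = "'g list \<Rightarrow> 'k"

definition free_algebra :: "'k ring \<Rightarrow> 'g set \<Rightarrow> ('k, ('g, 'k) free_elt) module" where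
  "free_algebra K G =
     \<lparr>carrier = {p. finite {w. p w \<noteq> \<zero>\<^bsub>K\<^esub>} \<and> range p \<subseteq> carrier K \<and>
                    (\<forall>w. w \<notin> lists G \<longrightarrow> p w = \<zero>\<^bsub>K\<^esub>)},
      mult = (\<lambda>p q w. \<Oplus>\<^bsub>K\<^esub>i\<in>{..length w}. p (take i w) \<otimes>\<^bsub>K\<^esub> q (drop i w)),
      one = (\<lambda>w. if w = [] then \<one>\<^bsub>K\<^esub> else \<zero>\<^bsub>K\<^esub>),
      zero = (\<lambda>w. \<zero>\<^bsub>K\<^esub>),
      add = (\<lambda>p q w. p w \<oplus>\<^bsub>K\<^esub> q w),
      smult = (\<lambda>l p w. l \<otimes>\<^bsub>K\<^esub> p w)\<rparr>"

definition gen :: "'k ring \<Rightarrow> 'g \<Rightarrow> ('g, 'k) free_elt" where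
  "gen K g = (\<lambda>w. if w = [g] then \<one>\<^bsub>K\<^esub> else \<zero>\<^bsub>K\<^esub>)"

text \<open>The class of \<open>b\<close> in the quotient of \<open>B\<close> by the two-sided ideal generated by \<open>S\<close>.\<close>

definition cls :: "('k, 'b) module \<Rightarrow> 'b set \<Rightarrow> 'b \<Rightarrow> 'b set" where
  "cls B S b = (Idl\<^bsub>B\<^esub> S) +>\<^bsub>B\<^esub> b"

definition quot_algebra :: "('k, 'b) module \<Rightarrow> 'b set \<Rightarrow> ('k, 'b set) module" where
  "quot_algebra B S = (let Q = B Quot (Idl\<^bsub>B\<^esub> S) in
     \<lparr>carrier = carrier Q, mult = mult Q, one = one Q, zero = zero Q, add = add Q,
      smult = (\<lambda>l u. cls B S (l \<odot>\<^bsub>B\<^esub> \<one>\<^bsub>B\<^esub>) \<otimes>\<^bsub>Q\<^esub> u)\<rparr>)"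

text \<open>Relations in \<open>F\<close> turning \<open>j\<close> into a homomorphism of unital algebras.\<close>

definition hom_rels :: "'k ring \<Rightarrow> ('k, 'b) module \<Rightarrow> ('k, 'f) module \<Rightarrow> ('b \<Rightarrow> 'f) \<Rightarrow> 'f set" where
  "hom_rels K B F j =
     {j (b \<oplus>\<^bsub>B\<^esub> c) \<ominus>\<^bsub>F\<^esub> (j b \<oplus>\<^bsub>F\<^esub> j c) |b c. b \<in> carrier B \<and> c \<in> carrier B} \<union>
     {j (b \<otimes>\<^bsub>B\<^esub> c) \<ominus>\<^bsub>F\<^esub> (j b \<otimes>\<^bsub>F\<^esub> j c) |b c. b \<in> carrier B \<and> c \<in> carrier B} \<union>
     {j (l \<odot>\<^bsub>B\<^esub> b) \<ominus>\<^bsub>F\<^esub> (l \<odot>\<^bsub>F\<^esub> j b) |l b. l \<in> carrier K \<and> b \<in> carrier B} \<union>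
     {j \<one>\<^bsub>B\<^esub> \<ominus>\<^bsub>F\<^esub> \<one>\<^bsub>F\<^esub>}"

text \<open>
  The tensor algebra \<open>T\<^sub>R(V)\<close> of an \<open>R\<close>-bimodule \<open>V\<close> over a \<open>K\<close>-algebra \<open>R\<close>: generated by \<open>R\<close> as an
  algebra and by \<open>V\<close> as an \<open>R\<close>-bimodule.
\<close>

type_synonym ('r, 'v, 'k) talg = "('r + 'v, 'k) free_elt set"

definition talg_free :: "'k ring \<Rightarrow> ('k, 'r) module \<Rightarrow> ('r, 'v) bimodule
    \<Rightarrow> ('k, ('r + 'v, 'k) free_elt) module" where
  "talg_free K R V = free_algebra K (carrier R <+> carrier V)"

definition talg_rels :: "'k ring \<Rightarrow> ('k, 'r) module \<Rightarrow> ('r, 'v) bimodule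
    \<Rightarrow> ('r + 'v, 'k) free_elt set" where
  "talg_rels K R V = (let F = talg_free K R V; i = (\<lambda>r. gen K (Inl r)); j = (\<lambda>v. gen K (Inr v)) in
     hom_rels K R F i \<union>
     {j (v \<oplus>\<^bsub>V\<^esub> v') \<ominus>\<^bsub>F\<^esub> (j v \<oplus>\<^bsub>F\<^esub> j v') |v v'. v \<in> carrier V \<and> v' \<in> carrier V} \<union>
     {j (r \<odot>\<^bsub>V\<^esub> v) \<ominus>\<^bsub>F\<^esub> (i r \<otimes>\<^bsub>F\<^esub> j v) |r v. r \<in> carrier R \<and> v \<in> carrier V} \<union>
     {j (v \<ddagger>\<^bsub>V\<^esub> r) \<ominus>\<^bsub>F\<^esub> (j v \<otimes>\<^bsub>F\<^esub> i r) |r v. r \<in> carrier R \<and> v \<in> carrier V})"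

definition tensor_algebra :: "'k ring \<Rightarrow> ('k, 'r) module \<Rightarrow> ('r, 'v) bimodule
    \<Rightarrow> ('k, ('r, 'v, 'k) talg) module" where
  "tensor_algebra K R V = quot_algebra (talg_free K R V) (talg_rels K R V)"

definition talg_base :: "'k ring \<Rightarrow> ('k, 'r) module \<Rightarrow> ('r, 'v) bimodule \<Rightarrow> 'r \<Rightarrow> ('r, 'v, 'k) talg" where
  "talg_base K R V r = cls (talg_free K R V) (talg_rels K R V) (gen K (Inl r))"

definition talg_gen :: "'k ring \<Rightarrow> ('k, 'r) module \<Rightarrow> ('r, 'v) bimodule \<Rightarrow> 'v \<Rightarrow> ('r, 'v, 'k) talg" where
  "talg_gen K R V v = cls (talg_free K R V) (talg_rels K R V) (gen K (Inr v))"

text \<open>The free product of \<open>K\<close>-algebras (their coproduct).\<close>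

type_synonym ('b, 'c, 'k) fprod = "('b + 'c, 'k) free_elt set"

definition fprod_free :: "'k ring \<Rightarrow> ('k, 'b) module \<Rightarrow> ('k, 'c) module
    \<Rightarrow> ('k, ('b + 'c, 'k) free_elt) module" where
  "fprod_free K B C = free_algebra K (carrier B <+> carrier C)"

definition fprod_rels :: "'k ring \<Rightarrow> ('k, 'b) module \<Rightarrow> ('k, 'c) module
    \<Rightarrow> ('b + 'c, 'k) free_elt set" where
  "fprod_rels K B C =
     hom_rels K B (fprod_free K B C) (\<lambda>b. gen K (Inl b)) \<union>
     hom_rels K C (fprod_free K B C) (\<lambda>c. gen K (Inr c))"

definition free_product :: "'k ring \<Rightarrow> ('k, 'b) module \<Rightarrow> ('k, 'c) module
    \<Rightarrow> ('k, ('b, 'c, 'k) fprod) module" where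
  "free_product K B C = quot_algebra (fprod_free K B C) (fprod_rels K B C)"

definition fprod_left :: "'k ring \<Rightarrow> ('k, 'b) module \<Rightarrow> ('k, 'c) module \<Rightarrow> 'b \<Rightarrow> ('b, 'c, 'k) fprod" where
  "fprod_left K B C b = cls (fprod_free K B C) (fprod_rels K B C) (gen K (Inl b))"

definition fprod_right :: "'k ring \<Rightarrow> ('k, 'b) module \<Rightarrow> ('k, 'c) module \<Rightarrow> 'c \<Rightarrow> ('b, 'c, 'k) fprod" where
  "fprod_right K B C c = cls (fprod_free K B C) (fprod_rels K B C) (gen K (Inr c))"


section \<open>First order calculi with a pivotal bimodule of one-forms\<close>

text \<open>
  \<open>ev\<close>, \<open>coev\<close> make \<open>vect\<close> a left dual of \<open>form\<close>, and \<open>evu\<close>, \<open>coevu\<close> (usually written underlined) a right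
  dual.  Representations \<open>coev 1 = (\<Sum>i<nI. om i \<otimes> xb i)\<close> and \<open>coevu 1 = (\<Sum>j<nJ. yb j \<otimes> rb j)\<close> are
  part of the data.
\<close>

record ('k, 'a, 'w, 'x) calculus =
  base :: "'k ring"
  alg :: "('k, 'a) module"
  form :: "('a, 'w) bimodule"
  vect :: "('a, 'x) bimodule"
  dd :: "'a \<Rightarrow> 'w"
  ev :: "('x, 'w) tens \<Rightarrow> 'a"
  coev :: "'a \<Rightarrow> ('w, 'x) tens"
  evu :: "('w, 'x) tens \<Rightarrow> 'a"
  coevu :: "'a \<Rightarrow> ('x, 'w) tens"
  nI :: nat
  om :: "nat \<Rightarrow> 'w"
  xb :: "nat \<Rightarrow> 'x"
  nJ :: nat
  yb :: "nat \<Rightarrow> 'x"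
  rb :: "nat \<Rightarrow> 'w"

locale first_order_calculus = bimodule K A W
  for K :: "'k ring" (structure) and A :: "('k, 'a) module" (structure)
    and W :: "('a, 'w) bimodule" (structure) +
  fixes d :: "'a \<Rightarrow> 'w"
  assumes d_additive: "additive_map A W d"
    and d_scalar: "\<lbrakk>l \<in> carrier K; a \<in> carrier A\<rbrakk>
      \<Longrightarrow> d (l \<odot>\<^bsub>A\<^esub> a) = (l \<odot>\<^bsub>A\<^esub> \<one>\<^bsub>A\<^esub>) \<odot>\<^bsub>W\<^esub> d a"
    and d_leibniz: "\<lbrakk>a \<in> carrier A; b \<in> carrier A\<rbrakk>
      \<Longrightarrow> d (a \<otimes>\<^bsub>A\<^esub> b) = d a \<ddagger>\<^bsub>W\<^esub> b \<oplus>\<^bsub>W\<^esub> a \<odot>\<^bsub>W\<^esub> d b"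

definition tenXW :: "('k, 'a, 'w, 'x) calculus \<Rightarrow> 'x \<Rightarrow> 'w \<Rightarrow> ('x, 'w) tens" where
  "tenXW D = tens (alg D) (vect D) (form D)"

definition tenWX :: "('k, 'a, 'w, 'x) calculus \<Rightarrow> 'w \<Rightarrow> 'x \<Rightarrow> ('w, 'x) tens" where
  "tenWX D = tens (alg D) (form D) (vect D)"

locale pivotal_calculus =
  fixes D :: "('k, 'a, 'w, 'x) calculus"
  assumes calculus: "first_order_calculus (base D) (alg D) (form D) (dd D)"
    and pivotal: "pivotal_bimodule (alg D) (form D)"
    and vect: "bimodule (base D) (alg D) (vect D)"
    and ev: "bimodule_map (alg D) (tensor (alg D) (vect D) (form D)) (regular (alg D)) (ev D)"
    and coev: "bimodule_map (alg D) (regular (alg D)) (tensor (alg D) (form D) (vect D)) (coev D)"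
    and evu: "bimodule_map (alg D) (tensor (alg D) (form D) (vect D)) (regular (alg D)) (evu D)"
    and coevu: "bimodule_map (alg D) (regular (alg D)) (tensor (alg D) (vect D) (form D)) (coevu D)"
    and basis_I: "om D \<in> {..<nI D} \<rightarrow> carrier (form D)" "xb D \<in> {..<nI D} \<rightarrow> carrier (vect D)"
    and basis_J: "yb D \<in> {..<nJ D} \<rightarrow> carrier (vect D)" "rb D \<in> {..<nJ D} \<rightarrow> carrier (form D)"
    and coev_one: "coev D \<one>\<^bsub>alg D\<^esub> =
      (\<Oplus>\<^bsub>tensor (alg D) (form D) (vect D)\<^esub>i\<in>{..<nI D}. tenWX D (om D i) (xb D i))"
    and coevu_one: "coevu D \<one>\<^bsub>alg D\<^esub> =
      (\<Oplus>\<^bsub>tensor (alg D) (vect D) (form D)\<^esub>j\<in>{..<nJ D}. tenXW D (yb D j) (rb D j))"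
    and form_left_dual: "w \<in> carrier (form D) \<Longrightarrow>
      w = (\<Oplus>\<^bsub>form D\<^esub>i\<in>{..<nI D}. om D i \<ddagger>\<^bsub>form D\<^esub> ev D (tenXW D (xb D i) w))"
    and form_right_dual: "w \<in> carrier (form D) \<Longrightarrow>
      w = (\<Oplus>\<^bsub>form D\<^esub>j\<in>{..<nJ D}. evu D (tenWX D w (yb D j)) \<odot>\<^bsub>form D\<^esub> rb D j)"
    and vect_left_dual: "x \<in> carrier (vect D) \<Longrightarrow>
      x = (\<Oplus>\<^bsub>vect D\<^esub>i\<in>{..<nI D}. ev D (tenXW D x (om D i)) \<odot>\<^bsub>vect D\<^esub> xb D i)"
    and vect_right_dual: "x \<in> carrier (vect D) \<Longrightarrow>
      x = (\<Oplus>\<^bsub>vect D\<^esub>j\<in>{..<nJ D}. yb D j \<ddagger>\<^bsub>vect D\<^esub> evu D (tenWX D (rb D j) x))"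


section \<open>The algebra generated by forms and vector fields\<close>

text \<open>
  For \<open>A\<close>-bimodules \<open>P\<close>, \<open>Q\<close>, the space \<open>P \<otimes>\<^sub>K Q\<close> is a bimodule over \<open>A\<^sup>e\<close>; writing \<open>(a, a')\<close> for
  \<open>a\<close> times \<open>a'\<close>-bar, \<open>(a, a') (p \<otimes> q) (b, b') = a p b \<otimes> b' q a'\<close>.
\<close>

definition env_tensor :: "'k ring \<Rightarrow> ('k, 'a) module \<Rightarrow> ('a, 'p) bimodule \<Rightarrow> ('a, 'q) bimodule
    \<Rightarrow> (('a, 'a) tens, ('p, 'q) tens) bimodule" where
  "env_tensor K A P Q =
     (let T = tensor K (scalars A P) (scalars A Q); t = tens K (scalars A P) (scalars A Q) in
     \<lparr>carrier = carrier T, mult = undefined, one = undefined, zero = zero T, add = add T,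
      smult = (\<lambda>u z. tens_ext T (\<lambda>a a'.
         tens_ext T (\<lambda>p q. t (a \<odot>\<^bsub>P\<^esub> p) (q \<ddagger>\<^bsub>Q\<^esub> a')) z) u),
      rsmult = (\<lambda>z u. tens_ext T (\<lambda>b b'.
         tens_ext T (\<lambda>p q. t (p \<ddagger>\<^bsub>P\<^esub> b) (b' \<odot>\<^bsub>Q\<^esub> q)) z) u)\<rparr>)"

definition direct_sum :: "('r, 'u) bimodule \<Rightarrow> ('r, 'v) bimodule \<Rightarrow> ('r, 'u \<times> 'v) bimodule" where
  "direct_sum U V =
     \<lparr>carrier = carrier U \<times> carrier V, mult = undefined, one = undefined,
      zero = (\<zero>\<^bsub>U\<^esub>, \<zero>\<^bsub>V\<^esub>),
      add = (\<lambda>(u, v) (u', v'). (u \<oplus>\<^bsub>U\<^esub> u', v \<oplus>\<^bsub>V\<^esub> v')),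
      smult = (\<lambda>r (u, v). (r \<odot>\<^bsub>U\<^esub> u, r \<odot>\<^bsub>V\<^esub> v)),
      rsmult = (\<lambda>(u, v) r. (u \<ddagger>\<^bsub>U\<^esub> r, v \<ddagger>\<^bsub>V\<^esub> r))\<rparr>"

definition envA :: "('k, 'a, 'w, 'x) calculus \<Rightarrow> ('k, ('a, 'a) tens) module" where
  "envA D = enveloping (base D) (alg D)"

type_synonym ('w, 'x) zz = "('x, 'w) tens \<times> ('w, 'x) tens"

definition ZZ :: "('k, 'a, 'w, 'x) calculus \<Rightarrow> (('a, 'a) tens, ('w, 'x) zz) bimodule" where
  "ZZ D = direct_sum (env_tensor (base D) (alg D) (vect D) (form D))
                     (env_tensor (base D) (alg D) (form D) (vect D))"

type_synonym ('k, 'a, 'w, 'x) tz = "(('a, 'a) tens, ('w, 'x) zz, 'k) talg"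

definition TZ :: "('k, 'a, 'w, 'x) calculus \<Rightarrow> ('k, ('k, 'a, 'w, 'x) tz) module" where
  "TZ D = tensor_algebra (base D) (envA D) (ZZ D)"

definition TZ_env :: "('k, 'a, 'w, 'x) calculus \<Rightarrow> 'a \<Rightarrow> 'a \<Rightarrow> ('k, 'a, 'w, 'x) tz" where
  "TZ_env D a b = talg_base (base D) (envA D) (ZZ D)
     (alg_tens (base D) (alg D) (opposite (alg D)) a b)"

definition TZ_xw :: "('k, 'a, 'w, 'x) calculus \<Rightarrow> 'x \<Rightarrow> 'w \<Rightarrow> ('k, 'a, 'w, 'x) tz" where
  "TZ_xw D x w = talg_gen (base D) (envA D) (ZZ D)
     (tens (base D) (scalars (alg D) (vect D)) (scalars (alg D) (form D)) x w,
      zero (env_tensor (base D) (alg D) (form D) (vect D)))"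

definition TZ_wx :: "('k, 'a, 'w, 'x) calculus \<Rightarrow> 'w \<Rightarrow> 'x \<Rightarrow> ('k, 'a, 'w, 'x) tz" where
  "TZ_wx D w x = talg_gen (base D) (envA D) (ZZ D)
     (zero (env_tensor (base D) (alg D) (vect D) (form D)),
      tens (base D) (scalars (alg D) (form D)) (scalars (alg D) (vect D)) w x)"

definition HO_rels :: "('k, 'a, 'w, 'x) calculus \<Rightarrow> ('k, 'a, 'w, 'x) tz set" where
  "HO_rels D = (let T = TZ D; I = {..<nI D}; J = {..<nJ D};
       W = carrier (form D); X = carrier (vect D); u = \<one>\<^bsub>alg D\<^esub> in
     {(\<Oplus>\<^bsub>T\<^esub>i\<in>I. TZ_wx D (om D i) x \<otimes>\<^bsub>T\<^esub> TZ_xw D (xb D i) w)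
        \<ominus>\<^bsub>T\<^esub> TZ_env D u (evu D (tenWX D w x)) |x w. x \<in> X \<and> w \<in> W} \<union>
     {(\<Oplus>\<^bsub>T\<^esub>j\<in>J. TZ_xw D x (rb D j) \<otimes>\<^bsub>T\<^esub> TZ_wx D w (yb D j))
        \<ominus>\<^bsub>T\<^esub> TZ_env D (ev D (tenXW D x w)) u |x w. x \<in> X \<and> w \<in> W} \<union>
     {(\<Oplus>\<^bsub>T\<^esub>j\<in>J. TZ_xw D (yb D j) w \<otimes>\<^bsub>T\<^esub> TZ_wx D (rb D j) x)
        \<ominus>\<^bsub>T\<^esub> TZ_env D u (ev D (tenXW D x w)) |x w. x \<in> X \<and> w \<in> W} \<union>
     {(\<Oplus>\<^bsub>T\<^esub>i\<in>I. TZ_wx D w (xb D i) \<otimes>\<^bsub>T\<^esub> TZ_xw D x (om D i))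
        \<ominus>\<^bsub>T\<^esub> TZ_env D (evu D (tenWX D w x)) u |x w. x \<in> X \<and> w \<in> W})"

type_synonym ('k, 'a, 'w, 'x) ho = "('k, 'a, 'w, 'x) tz set"

definition HO :: "('k, 'a, 'w, 'x) calculus \<Rightarrow> ('k, ('k, 'a, 'w, 'x) ho) module" where
  "HO D = quot_algebra (TZ D) (HO_rels D)"


section \<open>The algebra of differential operators\<close>

text \<open>
  \<open>TX D\<close> is the tensor algebra over the field \<open>K\<close>: the \<open>A\<close>-module structure of the vector fields
  enters only through the relations \<open>HX_rels\<close>, where it is twisted by the calculus.
\<close>

type_synonym ('k, 'a, 'w, 'x) fp = "(('k, 'a, 'w, 'x) ho, ('k, 'x, 'k) talg, 'k) fprod"

definition TX :: "('k, 'a, 'w, 'x) calculus \<Rightarrow> ('k, ('k, 'x, 'k) talg) module" where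
  "TX D = tensor_algebra (base D) (field_algebra (base D)) (scalars (alg D) (vect D))"

definition FP :: "('k, 'a, 'w, 'x) calculus \<Rightarrow> ('k, ('k, 'a, 'w, 'x) fp) module" where
  "FP D = free_product (base D) (HO D) (TX D)"

definition FP_of_TZ :: "('k, 'a, 'w, 'x) calculus \<Rightarrow> ('k, 'a, 'w, 'x) tz \<Rightarrow> ('k, 'a, 'w, 'x) fp" where
  "FP_of_TZ D z = fprod_left (base D) (HO D) (TX D) (cls (TZ D) (HO_rels D) z)"

definition FP_x :: "('k, 'a, 'w, 'x) calculus \<Rightarrow> 'x \<Rightarrow> ('k, 'a, 'w, 'x) fp" where
  "FP_x D x = fprod_right (base D) (HO D) (TX D)
     (talg_gen (base D) (field_algebra (base D)) (scalars (alg D) (vect D)) x)"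

definition HX_rels :: "('k, 'a, 'w, 'x) calculus \<Rightarrow> ('k, 'a, 'w, 'x) fp set" where
  "HX_rels D = (let P = FP D; A = carrier (alg D); X = carrier (vect D); u = \<one>\<^bsub>alg D\<^esub> in
     {FP_of_TZ D (TZ_env D a u) \<otimes>\<^bsub>P\<^esub> FP_x D x \<ominus>\<^bsub>P\<^esub> FP_x D (a \<odot>\<^bsub>vect D\<^esub> x) |a x. a \<in> A \<and> x \<in> X} \<union>
     {FP_x D x \<otimes>\<^bsub>P\<^esub> FP_of_TZ D (TZ_env D a u)
        \<ominus>\<^bsub>P\<^esub> (FP_x D (x \<ddagger>\<^bsub>vect D\<^esub> a) \<oplus>\<^bsub>P\<^esub> FP_of_TZ D (TZ_env D (ev D (tenXW D x (dd D a))) u))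
        |a x. a \<in> A \<and> x \<in> X} \<union>
     {FP_x D x \<otimes>\<^bsub>P\<^esub> FP_of_TZ D (TZ_env D u a)
        \<ominus>\<^bsub>P\<^esub> (FP_of_TZ D (TZ_env D u a) \<otimes>\<^bsub>P\<^esub> FP_x D x \<oplus>\<^bsub>P\<^esub> FP_of_TZ D (TZ_xw D x (dd D a)))
        |a x. a \<in> A \<and> x \<in> X})"

type_synonym ('k, 'a, 'w, 'x) hx = "('k, 'a, 'w, 'x) fp set"

definition HX :: "('k, 'a, 'w, 'x) calculus \<Rightarrow> ('k, ('k, 'a, 'w, 'x) hx) module" where
  "HX D = quot_algebra (FP D) (HX_rels D)"

text \<open>
  The images in \<open>HX D\<close> of \<open>a\<close> times \<open>b\<close>-bar, of \<open>(x, \<omega>)\<close>, of \<open>(\<omega>, x)\<close> and of \<open>x\<close>.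
\<close>

definition HX_env :: "('k, 'a, 'w, 'x) calculus \<Rightarrow> 'a \<Rightarrow> 'a \<Rightarrow> ('k, 'a, 'w, 'x) hx" where
  "HX_env D a b = cls (FP D) (HX_rels D) (FP_of_TZ D (TZ_env D a b))"

definition HX_xw :: "('k, 'a, 'w, 'x) calculus \<Rightarrow> 'x \<Rightarrow> 'w \<Rightarrow> ('k, 'a, 'w, 'x) hx" where
  "HX_xw D x w = cls (FP D) (HX_rels D) (FP_of_TZ D (TZ_xw D x w))"

definition HX_wx :: "('k, 'a, 'w, 'x) calculus \<Rightarrow> 'w \<Rightarrow> 'x \<Rightarrow> ('k, 'a, 'w, 'x) hx" where
  "HX_wx D w x = cls (FP D) (HX_rels D) (FP_of_TZ D (TZ_wx D w x))"

definition HX_x :: "('k, 'a, 'w, 'x) calculus \<Rightarrow> 'x \<Rightarrow> ('k, 'a, 'w, 'x) hx" where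
  "HX_x D x = cls (FP D) (HX_rels D) (FP_x D x)"


section \<open>Tensor products of modules\<close>

definition underlying :: "('k, 'a, 'w, 'x) calculus \<Rightarrow> (('k, 'a, 'w, 'x) hx, 'm) module
    \<Rightarrow> ('a, 'm) bimodule" where
  "underlying D M =
     \<lparr>carrier = carrier M, mult = undefined, one = undefined, zero = zero M, add = add M,
      smult = (\<lambda>a m. HX_env D a \<one>\<^bsub>alg D\<^esub> \<odot>\<^bsub>M\<^esub> m),
      rsmult = (\<lambda>m b. HX_env D \<one>\<^bsub>alg D\<^esub> b \<odot>\<^bsub>M\<^esub> m)\<rparr>"

definition HX_regular :: "('k, 'a, 'w, 'x) calculus
    \<Rightarrow> (('k, 'a, 'w, 'x) hx, ('k, 'a, 'w, 'x) hx) module" where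
  "HX_regular D = \<lparr>carrier = carrier (HX D), mult = mult (HX D), one = one (HX D),
     zero = zero (HX D), add = add (HX D), smult = mult (HX D)\<rparr>"

definition mod_tens :: "('k, 'a, 'w, 'x) calculus \<Rightarrow> (('k, 'a, 'w, 'x) hx, 'm) module
    \<Rightarrow> (('k, 'a, 'w, 'x) hx, 'n) module \<Rightarrow> 'm \<Rightarrow> 'n \<Rightarrow> ('m, 'n) tens" where
  "mod_tens D M N = tens (alg D) (underlying D M) (underlying D N)"

text \<open>
  The target of the coproduct: \<open>B \<otimes>\<^sub>A B\<close> for \<open>B = HX D\<close> with the \<open>A\<close>-bimodule structure given by
  left multiplication with elements of \<open>A\<^sup>e\<close>.
\<close>

type_synonym ('k, 'a, 'w, 'x) hx2 = "(('k, 'a, 'w, 'x) hx, ('k, 'a, 'w, 'x) hx) tens"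

definition HX2 :: "('k, 'a, 'w, 'x) calculus \<Rightarrow> ('a, ('k, 'a, 'w, 'x) hx2) bimodule" where
  "HX2 D = tensor (alg D) (underlying D (HX_regular D)) (underlying D (HX_regular D))"

definition HX_tens :: "('k, 'a, 'w, 'x) calculus \<Rightarrow> ('k, 'a, 'w, 'x) hx \<Rightarrow> ('k, 'a, 'w, 'x) hx
    \<Rightarrow> ('k, 'a, 'w, 'x) hx2" where
  "HX_tens D = mod_tens D (HX_regular D) (HX_regular D)"

text \<open>
  In the multiplicativity of the coproduct the expression \<open>m\<^sub>1 \<bullet> n\<^sub>1 \<otimes> m\<^sub>2 \<bullet> n\<^sub>2\<close> is balanced in
  \<open>m\<^sub>1 \<otimes> m\<^sub>2\<close> for fixed \<open>n\<^sub>1\<close>, \<open>n\<^sub>2\<close>, but not conversely; hence the order of the two extensions.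
\<close>

definition is_coproduct :: "('k, 'a, 'w, 'x) calculus
    \<Rightarrow> (('k, 'a, 'w, 'x) hx \<Rightarrow> ('k, 'a, 'w, 'x) hx2) \<Rightarrow> bool" where
  "is_coproduct D \<Delta> \<longleftrightarrow> (let H = HX D; A = carrier (alg D); W = carrier (form D);
       X = carrier (vect D); u = \<one>\<^bsub>alg D\<^esub> in
     \<Delta> \<in> extensional (carrier H) \<and> additive_map H (HX2 D) \<Delta> \<and>
     (\<forall>a\<in>A. \<forall>b\<in>A. \<Delta> (HX_env D a b) = HX_tens D (HX_env D a u) (HX_env D u b)) \<and>
     (\<forall>x\<in>X. \<forall>w\<in>W. \<Delta> (HX_xw D x w) =
        (\<Oplus>\<^bsub>HX2 D\<^esub>i\<in>{..<nI D}. HX_tens D (HX_xw D x (om D i)) (HX_xw D (xb D i) w))) \<and>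
     (\<forall>w\<in>W. \<forall>x\<in>X. \<Delta> (HX_wx D w x) =
        (\<Oplus>\<^bsub>HX2 D\<^esub>j\<in>{..<nJ D}. HX_tens D (HX_wx D w (yb D j)) (HX_wx D (rb D j) x))) \<and>
     (\<forall>x\<in>X. \<Delta> (HX_x D x) = HX_tens D (HX_x D x) \<one>\<^bsub>H\<^esub> \<oplus>\<^bsub>HX2 D\<^esub>
        (\<Oplus>\<^bsub>HX2 D\<^esub>i\<in>{..<nI D}. HX_tens D (HX_xw D x (om D i)) (HX_x D (xb D i)))) \<and>
     (\<forall>m\<in>carrier H. \<forall>n\<in>carrier H. \<Delta> (m \<otimes>\<^bsub>H\<^esub> n) =
        tens_ext (HX2 D) (\<lambda>n1 n2. tens_ext (HX2 D) (\<lambda>m1 m2.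
          HX_tens D (m1 \<otimes>\<^bsub>H\<^esub> n1) (m2 \<otimes>\<^bsub>H\<^esub> n2)) (\<Delta> m)) (\<Delta> n)))"

definition coproduct :: "('k, 'a, 'w, 'x) calculus
    \<Rightarrow> ('k, 'a, 'w, 'x) hx \<Rightarrow> ('k, 'a, 'w, 'x) hx2" where
  "coproduct D = (THE \<Delta>. is_coproduct D \<Delta>)"

text \<open>\<open>M \<otimes>\<^sub>A N\<close> with \<open>b (m \<otimes> n) = b\<^sub>1 m \<otimes> b\<^sub>2 n\<close>.\<close>

definition mod_tensor :: "('k, 'a, 'w, 'x) calculus \<Rightarrow> (('k, 'a, 'w, 'x) hx, 'm) module
    \<Rightarrow> (('k, 'a, 'w, 'x) hx, 'n) module \<Rightarrow> (('k, 'a, 'w, 'x) hx, ('m, 'n) tens) module" where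
  "mod_tensor D M N = (let T = tensor (alg D) (underlying D M) (underlying D N) in
     \<lparr>carrier = carrier T, mult = undefined, one = undefined, zero = zero T, add = add T,
      smult = (\<lambda>b. tens_ext T (\<lambda>m n. tens_ext T (\<lambda>b1 b2.
         mod_tens D M N (b1 \<odot>\<^bsub>M\<^esub> m) (b2 \<odot>\<^bsub>N\<^esub> n)) (coproduct D b)))\<rparr>)"


section \<open>Actions on inner homs\<close>

definition with_action :: "('r, 'm) bimodule \<Rightarrow> ('h \<Rightarrow> 'm \<Rightarrow> 'm) \<Rightarrow> ('h, 'm) module" where
  "with_action M act = \<lparr>carrier = carrier M, mult = undefined, one = undefined,
     zero = zero M, add = add M, smult = act\<rparr>"

abbreviation right_homs :: "('k, 'a, 'w, 'x) calculus \<Rightarrow> (('k, 'a, 'w, 'x) hx, 'm) module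
    \<Rightarrow> (('k, 'a, 'w, 'x) hx, 'n) module \<Rightarrow> ('a, 'm \<Rightarrow> 'n) bimodule" where
  "right_homs D M N \<equiv> right_inner_hom (alg D) (underlying D M) (underlying D N)"

abbreviation left_homs :: "('k, 'a, 'w, 'x) calculus \<Rightarrow> (('k, 'a, 'w, 'x) hx, 'm) module
    \<Rightarrow> (('k, 'a, 'w, 'x) hx, 'n) module \<Rightarrow> ('a, 'm \<Rightarrow> 'n) bimodule" where
  "left_homs D M N \<equiv> left_inner_hom (alg D) (underlying D M) (underlying D N)"

text \<open>
  \<open>act\<close> is an action of \<open>HX D\<close> on the inner hom which extends the given action of the subalgebra
  generated by \<open>A\<^sup>e\<close> and the elements \<open>(x, \<omega>)\<close>, \<open>(\<omega>, x)\<close>, and lets \<open>x\<close> act by the formula in the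
  last clause.
\<close>

definition is_right_hom_action :: "('k, 'a, 'w, 'x) calculus
    \<Rightarrow> (('k, 'a, 'w, 'x) hx, 'm) module \<Rightarrow> (('k, 'a, 'w, 'x) hx, 'n) module
    \<Rightarrow> (('k, 'a, 'w, 'x) hx \<Rightarrow> ('m \<Rightarrow> 'n) \<Rightarrow> ('m \<Rightarrow> 'n)) \<Rightarrow> bool" where
  "is_right_hom_action D M N act \<longleftrightarrow> (let H = HX D; A = carrier (alg D); W = carrier (form D);
       X = carrier (vect D); u = \<one>\<^bsub>alg D\<^esub>; I = {..<nI D}; J = {..<nJ D};
       F = carrier (right_homs D M N) in
     act \<in> carrier H \<rightarrow>\<^sub>E F \<rightarrow>\<^sub>E F \<and>
     left_module H (with_action (right_homs D M N) act) \<and>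
     (\<forall>f\<in>F. \<forall>m\<in>carrier M.
       (\<forall>a\<in>A. \<forall>b\<in>A. act (HX_env D a b) f m = HX_env D a u \<odot>\<^bsub>N\<^esub> f (HX_env D b u \<odot>\<^bsub>M\<^esub> m)) \<and>
       (\<forall>x\<in>X. \<forall>w\<in>W. act (HX_xw D x w) f m =
          (\<Oplus>\<^bsub>N\<^esub>j\<in>J. HX_xw D x (rb D j) \<odot>\<^bsub>N\<^esub> f (HX_wx D w (yb D j) \<odot>\<^bsub>M\<^esub> m))) \<and>
       (\<forall>w\<in>W. \<forall>y\<in>X. act (HX_wx D w y) f m =
          (\<Oplus>\<^bsub>N\<^esub>i\<in>I. HX_wx D w (xb D i) \<odot>\<^bsub>N\<^esub> f (HX_xw D y (om D i) \<odot>\<^bsub>M\<^esub> m))) \<and>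
       (\<forall>x\<in>X. act (HX_x D x) f m = HX_x D x \<odot>\<^bsub>N\<^esub> f m \<ominus>\<^bsub>N\<^esub>
          (\<Oplus>\<^bsub>N\<^esub>j\<in>J. \<Oplus>\<^bsub>N\<^esub>i\<in>I. HX_xw D x (rb D j) \<odot>\<^bsub>N\<^esub>
             f ((HX_wx D (om D i) (yb D j) \<otimes>\<^bsub>H\<^esub> HX_x D (xb D i)) \<odot>\<^bsub>M\<^esub> m)))))"

definition is_left_hom_action :: "('k, 'a, 'w, 'x) calculus
    \<Rightarrow> (('k, 'a, 'w, 'x) hx, 'm) module \<Rightarrow> (('k, 'a, 'w, 'x) hx, 'n) module
    \<Rightarrow> (('k, 'a, 'w, 'x) hx \<Rightarrow> ('m \<Rightarrow> 'n) \<Rightarrow> ('m \<Rightarrow> 'n)) \<Rightarrow> bool" where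
  "is_left_hom_action D M N act \<longleftrightarrow> (let H = HX D; A = carrier (alg D); W = carrier (form D);
       X = carrier (vect D); u = \<one>\<^bsub>alg D\<^esub>; I = {..<nI D}; J = {..<nJ D};
       F = carrier (left_homs D M N) in
     act \<in> carrier H \<rightarrow>\<^sub>E F \<rightarrow>\<^sub>E F \<and>
     left_module H (with_action (left_homs D M N) act) \<and>
     (\<forall>g\<in>F. \<forall>m\<in>carrier M.
       (\<forall>a\<in>A. \<forall>b\<in>A. act (HX_env D a b) g m = HX_env D u b \<odot>\<^bsub>N\<^esub> g (HX_env D u a \<odot>\<^bsub>M\<^esub> m)) \<and>
       (\<forall>x\<in>X. \<forall>w\<in>W. act (HX_xw D x w) g m =
          (\<Oplus>\<^bsub>N\<^esub>j\<in>J. HX_xw D (yb D j) w \<odot>\<^bsub>N\<^esub> g (HX_wx D (rb D j) x \<odot>\<^bsub>M\<^esub> m))) \<and>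
       (\<forall>w\<in>W. \<forall>y\<in>X. act (HX_wx D w y) g m =
          (\<Oplus>\<^bsub>N\<^esub>i\<in>I. HX_wx D (om D i) y \<odot>\<^bsub>N\<^esub> g (HX_xw D (xb D i) w \<odot>\<^bsub>M\<^esub> m))) \<and>
       (\<forall>x\<in>X. act (HX_x D x) g m =
          (\<Oplus>\<^bsub>N\<^esub>j\<in>J. HX_x D (yb D j) \<odot>\<^bsub>N\<^esub> g (HX_wx D (rb D j) x \<odot>\<^bsub>M\<^esub> m)) \<ominus>\<^bsub>N\<^esub>
          (\<Oplus>\<^bsub>N\<^esub>j\<in>J. g ((HX_x D (yb D j) \<otimes>\<^bsub>H\<^esub> HX_wx D (rb D j) x) \<odot>\<^bsub>M\<^esub> m)))))"

definition right_hom_module :: "('k, 'a, 'w, 'x) calculus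
    \<Rightarrow> (('k, 'a, 'w, 'x) hx, 'm) module \<Rightarrow> (('k, 'a, 'w, 'x) hx, 'n) module
    \<Rightarrow> (('k, 'a, 'w, 'x) hx, 'm \<Rightarrow> 'n) module" where
  "right_hom_module D M N =
     with_action (right_homs D M N) (THE act. is_right_hom_action D M N act)"

definition left_hom_module :: "('k, 'a, 'w, 'x) calculus
    \<Rightarrow> (('k, 'a, 'w, 'x) hx, 'm) module \<Rightarrow> (('k, 'a, 'w, 'x) hx, 'n) module
    \<Rightarrow> (('k, 'a, 'w, 'x) hx, 'm \<Rightarrow> 'n) module" where
  "left_hom_module D M N =
     with_action (left_homs D M N) (THE act. is_left_hom_action D M N act)"

end

theory Submission
  imports Defs
begin

text \<open>
  The generators of \<open>HX\<close> act on tensor products and on inner homs by sums over the dual bases.  A sum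
  over a dual basis of a balanced expression collapses by the dual basis identities, and this yields
  the relations of \<open>HX\<close>.  Exchanging forms and vector fields swaps \<open>(x, \<omega>)\<close> and \<open>(\<omega>, x)\<close>, so that half of
  the relations suffice.  By the universal property of \<open>HX\<close> these operators define module structures.

  In particular \<open>HX\<close> acts on the tensor square of its regular module, and \<open>b \<mapsto> b (1 \<otimes> 1)\<close> is the
  coproduct: naturality in the maps \<open>b \<mapsto> b m\<close> gives \<open>b (m \<otimes> n) = b\<^sub>1 m \<otimes> b\<^sub>2 n\<close>, hence multiplicativity.
  A map of modules is one that commutes with the generators, and for the units and counits this is once
  more a dual basis computation.
\<close>

section \<open>Additive maps\<close>

text \<open>The coproduct does not come from the universal property directly:
  \<open>HX \<otimes> HX\<close> over \<open>A\<close> has no factorwise product, because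
  \<open>m1 n1 \<otimes> m2 n2\<close> is not balanced in \<open>n1 \<otimes> n2\<close>.
  Homomorphisms out of \<open>HX\<close> are therefore constructed only into endomorphism rings of
  abelian groups, where the relations can be checked by evaluation. Their input is a
  \<open>rep\<close>: a group with an operator for each generator. Tensor products and inner homs of
  such data have closed formulas, before any coproduct is available.

  The mirror symmetry stops at the operators of x, since d takes values in forms. There the laws of
  Leibniz type leave terms with d a, which have to cancel; the formulas for x on inner homs are
  forced by the counits.

  The coproduct and the hom actions are definite descriptions. Existence comes from the universal
  property, uniqueness from the fact that the generators generate. What is described agrees with the
  closed formulas on carriers only, so modules and representations are related by
  \<open>realizes\<close> and not by equality.\<close>

lemma additive_mapI:
  assumes "\<And>m. m \<in> carrier M \<Longrightarrow> f m \<in> carrier N"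
    and "\<And>m m'. \<lbrakk>m \<in> carrier M; m' \<in> carrier M\<rbrakk> \<Longrightarrow> f (m \<oplus>\<^bsub>M\<^esub> m') = f m \<oplus>\<^bsub>N\<^esub> f m'"
  shows "additive_map M N f"
  using assms by (auto simp: additive_map_def)

lemma additive_map_closed: "additive_map M N f \<Longrightarrow> m \<in> carrier M \<Longrightarrow> f m \<in> carrier N"
  by (auto simp: additive_map_def)

lemma additive_map_add:
  "additive_map M N f \<Longrightarrow> m \<in> carrier M \<Longrightarrow> m' \<in> carrier M \<Longrightarrow> f (m \<oplus>\<^bsub>M\<^esub> m') = f m \<oplus>\<^bsub>N\<^esub> f m'"
  by (auto simp: additive_map_def)

lemma additive_map_comp:
  "additive_map M N f \<Longrightarrow> additive_map N L g \<Longrightarrow> additive_map M L (\<lambda>m. g (f m))"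
  by (auto simp: additive_map_def Pi_iff)

lemma additive_map_zero:
  assumes "abelian_group M" "abelian_group N" "additive_map M N f"
  shows "f \<zero>\<^bsub>M\<^esub> = \<zero>\<^bsub>N\<^esub>"
proof -
  interpret M: abelian_group M by fact
  interpret N: abelian_group N by fact
  have "f \<zero>\<^bsub>M\<^esub> \<oplus>\<^bsub>N\<^esub> f \<zero>\<^bsub>M\<^esub> = f \<zero>\<^bsub>M\<^esub>"
    using additive_map_add[OF assms(3) M.zero_closed M.zero_closed] by simp
  then show ?thesis
    using additive_map_closed[OF assms(3) M.zero_closed] by (metis N.add.r_cancel_one)
qed

lemma additive_map_inv:
  assumes "abelian_group M" "abelian_group N" "additive_map M N f" "m \<in> carrier M"
  shows "f (\<ominus>\<^bsub>M\<^esub> m) = \<ominus>\<^bsub>N\<^esub> f m"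
proof -
  interpret M: abelian_group M by fact
  interpret N: abelian_group N by fact
  have "f m \<oplus>\<^bsub>N\<^esub> f (\<ominus>\<^bsub>M\<^esub> m) = \<zero>\<^bsub>N\<^esub>"
    using additive_map_add[OF assms(3), of m "\<ominus>\<^bsub>M\<^esub> m"] additive_map_zero[OF assms(1-3)] assms(4)
    by (simp add: M.r_neg)
  then show ?thesis
    using additive_map_closed[OF assms(3)] assms(4)
    by (metis M.a_inv_closed N.add.inv_comm N.minus_equality)
qed

lemma additive_map_diff:
  assumes "abelian_group M" "abelian_group N" "additive_map M N f" "m \<in> carrier M" "m' \<in> carrier M"
  shows "f (m \<ominus>\<^bsub>M\<^esub> m') = f m \<ominus>\<^bsub>N\<^esub> f m'"
  using assms additive_map_inv[OF assms(1-3)] additive_map_add[OF assms(3)]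
  by (simp add: a_minus_def abelian_group.a_inv_closed)

lemma additive_map_finsum:
  assumes "abelian_group M" "abelian_group N" "additive_map M N f" "finite I" "g \<in> I \<rightarrow> carrier M"
  shows "f (finsum M g I) = finsum N (\<lambda>i. f (g i)) I"
proof -
  interpret M: abelian_group M by fact
  interpret N: abelian_group N by fact
  show ?thesis
    using assms(4,5)
  proof (induction I rule: finite_induct)
    case empty
    then show ?case using additive_map_zero[OF assms(1-3)] by simp
  next
    case (insert x F)
    then have "g \<in> F \<rightarrow> carrier M" "(\<lambda>i. f (g i)) \<in> F \<rightarrow> carrier N" "f (g x) \<in> carrier N" "g x \<in> carrier M"
      using additive_map_closed[OF assms(3)] by auto
    then show ?case
      using insert additive_map_add[OF assms(3)] by (simp add: M.finsum_closed)
  qed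
qed

lemma additive_map_sub:
  assumes "abelian_group N" "additive_map M N f" "additive_map M N g" "abelian_group M"
  shows "additive_map M N (\<lambda>m. f m \<oplus>\<^bsub>N\<^esub> g m)"
proof -
  interpret N: abelian_group N by fact
  show ?thesis
    using additive_map_closed[OF assms(2)] additive_map_closed[OF assms(3)]
      additive_map_add[OF assms(2)] additive_map_add[OF assms(3)]
    by (intro additive_mapI) (auto simp: N.add.m_ac)
qed

section \<open>Bimodules over rings and their tensor products\<close>

text \<open>Bimodules over a bare ring, so that one construction of the tensor product serves over
  \<open>A\<close> as well as, for \<open>scalars\<close> and \<open>alg_scalars\<close>, over
  \<open>K\<close>.\<close>

locale bimod = left_module R M
  for R :: "('r, 'c) ring_scheme" and M :: "('r, 'm) bimodule" +
  assumes rcl: "\<lbrakk>a \<in> carrier R; m \<in> carrier M\<rbrakk> \<Longrightarrow> m \<ddagger>\<^bsub>M\<^esub> a \<in> carrier M"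
    and r_r_distr: "\<lbrakk>a \<in> carrier R; b \<in> carrier R; m \<in> carrier M\<rbrakk>
      \<Longrightarrow> m \<ddagger>\<^bsub>M\<^esub> (a \<oplus>\<^bsub>R\<^esub> b) = m \<ddagger>\<^bsub>M\<^esub> a \<oplus>\<^bsub>M\<^esub> m \<ddagger>\<^bsub>M\<^esub> b"
    and r_l_distr: "\<lbrakk>a \<in> carrier R; m \<in> carrier M; n \<in> carrier M\<rbrakk>
      \<Longrightarrow> (m \<oplus>\<^bsub>M\<^esub> n) \<ddagger>\<^bsub>M\<^esub> a = m \<ddagger>\<^bsub>M\<^esub> a \<oplus>\<^bsub>M\<^esub> n \<ddagger>\<^bsub>M\<^esub> a"
    and r_assoc: "\<lbrakk>a \<in> carrier R; b \<in> carrier R; m \<in> carrier M\<rbrakk>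
      \<Longrightarrow> m \<ddagger>\<^bsub>M\<^esub> (a \<otimes>\<^bsub>R\<^esub> b) = (m \<ddagger>\<^bsub>M\<^esub> a) \<ddagger>\<^bsub>M\<^esub> b"
    and r_one: "m \<in> carrier M \<Longrightarrow> m \<ddagger>\<^bsub>M\<^esub> \<one>\<^bsub>R\<^esub> = m"
    and bi_assoc: "\<lbrakk>a \<in> carrier R; b \<in> carrier R; m \<in> carrier M\<rbrakk>
      \<Longrightarrow> (a \<odot>\<^bsub>M\<^esub> m) \<ddagger>\<^bsub>M\<^esub> b = a \<odot>\<^bsub>M\<^esub> (m \<ddagger>\<^bsub>M\<^esub> b)"

text \<open>The condition under which \<open>tens_ext\<close> does not depend on the representative.
  Additivity in one variable is demanded only while the other lies in its carrier, because the
  operations are uncontrolled outside.\<close>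

definition balanced ::
    "('r, 'c) ring_scheme \<Rightarrow> ('r, 'm) bimodule \<Rightarrow> ('r, 'n) bimodule \<Rightarrow> ('g, 'd) ring_scheme
      \<Rightarrow> ('m \<Rightarrow> 'n \<Rightarrow> 'g) \<Rightarrow> bool" where
  "balanced R M N G \<phi> \<longleftrightarrow>
     (\<forall>n\<in>carrier N. additive_map M G (\<lambda>m. \<phi> m n)) \<and> (\<forall>m\<in>carrier M. additive_map N G (\<phi> m)) \<and>
     (\<forall>m\<in>carrier M. \<forall>n\<in>carrier N. \<forall>r\<in>carrier R. \<phi> (m \<ddagger>\<^bsub>M\<^esub> r) n = \<phi> m (r \<odot>\<^bsub>N\<^esub> n))"

lemma balancedI:
  assumes "\<And>m n. \<lbrakk>m \<in> carrier M; n \<in> carrier N\<rbrakk> \<Longrightarrow> \<phi> m n \<in> carrier G"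
    and "\<And>m m' n. \<lbrakk>m \<in> carrier M; m' \<in> carrier M; n \<in> carrier N\<rbrakk> \<Longrightarrow> \<phi> (m \<oplus>\<^bsub>M\<^esub> m') n = \<phi> m n \<oplus>\<^bsub>G\<^esub> \<phi> m' n"
    and "\<And>m n n'. \<lbrakk>m \<in> carrier M; n \<in> carrier N; n' \<in> carrier N\<rbrakk> \<Longrightarrow> \<phi> m (n \<oplus>\<^bsub>N\<^esub> n') = \<phi> m n \<oplus>\<^bsub>G\<^esub> \<phi> m n'"
    and "\<And>m n r. \<lbrakk>m \<in> carrier M; n \<in> carrier N; r \<in> carrier R\<rbrakk> \<Longrightarrow> \<phi> (m \<ddagger>\<^bsub>M\<^esub> r) n = \<phi> m (r \<odot>\<^bsub>N\<^esub> n)"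
  shows "balanced R M N G \<phi>"
  using assms by (auto simp: balanced_def intro!: additive_mapI)

lemma balanced_closed: "balanced R M N G \<phi> \<Longrightarrow> m \<in> carrier M \<Longrightarrow> n \<in> carrier N \<Longrightarrow> \<phi> m n \<in> carrier G"
  by (auto simp: balanced_def additive_map_def)

text \<open>The generating set of \<open>tensor_rels\<close> under a name of its own, so that the
  vanishing of an extension can be proved by induction over \<open>generate\<close>.\<close>

definition tensor_gens ::
    "('r, 'c) ring_scheme \<Rightarrow> ('r, 'm) bimodule \<Rightarrow> ('r, 'n) bimodule \<Rightarrow> ('m, 'n) tens" where
  "tensor_gens R M N =
    {frag_of (m \<oplus>\<^bsub>M\<^esub> m', n) - frag_of (m, n) - frag_of (m', n) |m m' n.
        m \<in> carrier M \<and> m' \<in> carrier M \<and> n \<in> carrier N} \<union>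
     {frag_of (m, n \<oplus>\<^bsub>N\<^esub> n') - frag_of (m, n) - frag_of (m, n') |m n n'.
        m \<in> carrier M \<and> n \<in> carrier N \<and> n' \<in> carrier N} \<union>
     {frag_of (m \<ddagger>\<^bsub>M\<^esub> r, n) - frag_of (m, r \<odot>\<^bsub>N\<^esub> n) |m r n.
        m \<in> carrier M \<and> r \<in> carrier R \<and> n \<in> carrier N}"

text \<open>\<open>tens_ext\<close> reads only the additive group of its target. The same group
  appears as \<open>tensor_group\<close>, as \<open>tensor\<close>, as a module and as a
  representation; this makes the extensions into them interchangeable.\<close>

lemma tens_ext_cong_group:
  fixes G :: "('g, 'c) ring_scheme" and G' :: "('g, 'd) ring_scheme"
  assumes "carrier G = carrier G'" "add G = add G'" "zero G = zero G'"
  shows "tens_ext G \<phi> = tens_ext G' \<phi>"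
  unfolding tens_ext_def using assms
  by (intro ext) (simp add: finsum_def finprod_def add_pow_def int_pow_def nat_pow_def m_inv_def
      cong: if_cong)

section \<open>The tensor product of two bimodules and its universal property\<close>

locale bimod_pair = M: bimod R M + N: bimod R N
  for R :: "('r, 'c) ring_scheme" and M :: "('r, 'm) bimodule" and N :: "('r, 'n) bimodule"
begin

abbreviation "pre \<equiv> tensor_pre M N"
abbreviation "rels \<equiv> tensor_rels R M N"
abbreviation "T \<equiv> tensor R M N"
abbreviation "tn \<equiv> tens R M N"

lemma carrier_pre: "p \<in> carrier pre \<longleftrightarrow> Poly_Mapping.keys p \<subseteq> carrier M \<times> carrier N"
  by (simp add: tensor_pre_def)

lemma group_pre: "group pre" by (simp add: tensor_pre_def)
lemma comm_group_pre: "comm_group pre" by (simp add: tensor_pre_def abelian_free_Abelian_group)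
lemma mult_pre: "p \<otimes>\<^bsub>pre\<^esub> q = p + q" by (simp add: tensor_pre_def)
lemma inv_pre: "p \<in> carrier pre \<Longrightarrow> inv\<^bsub>pre\<^esub> p = - p"
  by (simp add: tensor_pre_def)

lemma diff_pre: "p \<in> carrier pre \<Longrightarrow> q \<in> carrier pre \<Longrightarrow> p - q \<in> carrier pre"
  unfolding carrier_pre using keys_diff by fastforce

lemma gens_pre: "tensor_gens R M N \<subseteq> carrier pre"
  unfolding tensor_gens_def
  by (auto intro!: diff_pre simp: carrier_pre M.rcl N.lmod_closed simp del: keys_diff)

lemma rels_eq: "rels = generate pre (tensor_gens R M N)"
  by (simp add: tensor_rels_def tensor_gens_def)

lemma rels_subgroup: "subgroup rels pre"
  unfolding rels_eq using group.generate_is_subgroup[OF group_pre gens_pre] .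

lemma rels_normal: "rels \<lhd> pre"
  using comm_group.subgroup_imp_normal[OF comm_group_pre rels_subgroup] .

lemma carrier_T: "carrier T = rcosets\<^bsub>pre\<^esub> rels"
  by (simp add: tensor_def tensor_group_def FactGroup_def Let_def)
lemma add_T: "add T = set_mult pre"
  by (simp add: tensor_def tensor_group_def FactGroup_def Let_def)
lemma zero_T: "zero T = rels"
  by (simp add: tensor_def tensor_group_def FactGroup_def Let_def)

lemma abelian_group_tensor: "abelian_group T"
proof -
  interpret Q: comm_group "pre Mod rels"
    by (rule comm_group.abelian_FactGroup[OF comm_group_pre rels_subgroup])
  have *: "carrier T = carrier (pre Mod rels)" "add T = monoid.mult (pre Mod rels)" "zero T = one (pre Mod rels)"
    by (simp_all add: carrier_T add_T zero_T FactGroup_def)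
  show ?thesis
  proof (rule abelian_groupI, unfold *)
    fix x assume "x \<in> carrier (pre Mod rels)"
    then show "\<exists>y\<in>carrier (pre Mod rels). y \<otimes>\<^bsub>pre Mod rels\<^esub> x = \<one>\<^bsub>pre Mod rels\<^esub>"
      using Q.l_inv Q.inv_closed by (intro bexI[of _ "inv\<^bsub>pre Mod rels\<^esub> x"])
  qed (rule Q.m_closed Q.one_closed Q.m_assoc Q.m_comm Q.l_one; assumption)+
qed

sublocale T: abelian_group T by (rule abelian_group_tensor)

lemma coset_add:
  "p \<in> carrier pre \<Longrightarrow> q \<in> carrier pre \<Longrightarrow> (rels #>\<^bsub>pre\<^esub> p) \<oplus>\<^bsub>T\<^esub> (rels #>\<^bsub>pre\<^esub> q) = rels #>\<^bsub>pre\<^esub> (p + q)"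
  using normal.rcos_sum[OF rels_normal] by (simp add: add_T mult_pre)

lemma coset_closed: "p \<in> carrier pre \<Longrightarrow> rels #>\<^bsub>pre\<^esub> p \<in> carrier T"
  unfolding carrier_T using group.rcosetsI[OF group_pre subgroup.subset[OF rels_subgroup]] by blast

lemma coset_eqI:
  assumes "p \<in> carrier pre" "q \<in> carrier pre" "p - q \<in> rels"
  shows "rels #>\<^bsub>pre\<^esub> p = rels #>\<^bsub>pre\<^esub> q"
proof -
  have "p \<in> rels #>\<^bsub>pre\<^esub> q"
    using assms(3) by (force simp: r_coset_def mult_pre)
  then show ?thesis
    using group.repr_independence[OF group_pre _ assms(2) rels_subgroup] by simp
qed

lemma frag_pre: "m \<in> carrier M \<Longrightarrow> n \<in> carrier N \<Longrightarrow> frag_of (m, n) \<in> carrier pre"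
  by (simp add: carrier_pre)

lemma tens_closed: "m \<in> carrier M \<Longrightarrow> n \<in> carrier N \<Longrightarrow> tn m n \<in> carrier T"
  unfolding tens_def by (intro coset_closed frag_pre)

lemma rels_gen: "g \<in> tensor_gens R M N \<Longrightarrow> g \<in> rels"
  unfolding rels_eq by (rule generate.incl)

lemma add_pre: "p \<in> carrier pre \<Longrightarrow> q \<in> carrier pre \<Longrightarrow> p + q \<in> carrier pre"
  using group.is_monoid[OF group_pre, THEN monoid.m_closed] by (simp add: mult_pre)

lemma tens_add_left:
  assumes "m \<in> carrier M" "m' \<in> carrier M" "n \<in> carrier N"
  shows "tn (m \<oplus>\<^bsub>M\<^esub> m') n = tn m n \<oplus>\<^bsub>T\<^esub> tn m' n"
proof -
  have *: "frag_of (m \<oplus>\<^bsub>M\<^esub> m', n) - (frag_of (m, n) + frag_of (m', n)) \<in> rels"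
    by (rule rels_gen) (use assms in \<open>auto simp: tensor_gens_def diff_diff_eq[symmetric]\<close>)
  then show ?thesis
    unfolding tens_def using assms coset_eqI[OF _ _ *]
    by (simp add: coset_add frag_pre add_pre)
qed

lemma tens_add_right:
  assumes "m \<in> carrier M" "n \<in> carrier N" "n' \<in> carrier N"
  shows "tn m (n \<oplus>\<^bsub>N\<^esub> n') = tn m n \<oplus>\<^bsub>T\<^esub> tn m n'"
proof -
  have *: "frag_of (m, n \<oplus>\<^bsub>N\<^esub> n') - (frag_of (m, n) + frag_of (m, n')) \<in> rels"
    by (rule rels_gen) (use assms in \<open>auto simp: tensor_gens_def diff_diff_eq[symmetric]\<close>)
  then show ?thesis
    unfolding tens_def using assms coset_eqI[OF _ _ *]
    by (simp add: coset_add frag_pre add_pre)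
qed

lemma tens_balance:
  assumes "m \<in> carrier M" "n \<in> carrier N" "r \<in> carrier R"
  shows "tn (m \<ddagger>\<^bsub>M\<^esub> r) n = tn m (r \<odot>\<^bsub>N\<^esub> n)"
proof -
  have *: "frag_of (m \<ddagger>\<^bsub>M\<^esub> r, n) - frag_of (m, r \<odot>\<^bsub>N\<^esub> n) \<in> rels"
    by (rule rels_gen) (use assms in \<open>auto simp: tensor_gens_def\<close>)
  then show ?thesis
    unfolding tens_def using assms coset_eqI[OF _ _ *]
    by (simp add: frag_pre M.rcl N.lmod_closed)
qed

text \<open>The difference case covers sums and negatives at once; this is how the free abelian
  group on the pairs is generated.\<close>

lemma tensor_induct [consumes 1, case_names zero tens diff]:
  assumes "t \<in> carrier T" "P \<zero>\<^bsub>T\<^esub>"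
    and "\<And>m n. \<lbrakk>m \<in> carrier M; n \<in> carrier N\<rbrakk> \<Longrightarrow> P (tn m n)"
    and "\<And>t u. \<lbrakk>t \<in> carrier T; u \<in> carrier T; P t; P u\<rbrakk> \<Longrightarrow> P (t \<ominus>\<^bsub>T\<^esub> u)"
  shows "P t"
proof -
  obtain p where p: "p \<in> carrier pre" "t = rels #>\<^bsub>pre\<^esub> p"
    using assms(1) by (auto simp: carrier_T RCOSETS_def)
  have zero: "rels #>\<^bsub>pre\<^esub> 0 = \<zero>\<^bsub>T\<^esub>"
    using group.coset_mult_one[OF group_pre subgroup.subset[OF rels_subgroup]]
    by (simp add: zero_T tensor_pre_def)
  have 0: "0 \<in> carrier pre" by (simp add: carrier_pre)
  have inv: "rels #>\<^bsub>pre\<^esub> (p - q) = (rels #>\<^bsub>pre\<^esub> p) \<ominus>\<^bsub>T\<^esub> (rels #>\<^bsub>pre\<^esub> q)"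
    if "p \<in> carrier pre" "q \<in> carrier pre" for p q
  proof -
    have "(rels #>\<^bsub>pre\<^esub> (p - q)) \<oplus>\<^bsub>T\<^esub> (rels #>\<^bsub>pre\<^esub> q) = rels #>\<^bsub>pre\<^esub> p"
      using that by (simp add: coset_add diff_pre)
    then show ?thesis
      using that coset_closed diff_pre
      by (metis T.add.inv_closed T.a_assoc T.r_neg T.r_zero a_minus_def)
  qed
  have "Poly_Mapping.keys p \<subseteq> carrier M \<times> carrier N"
    using p(1) unfolding carrier_pre .
  then have "P (rels #>\<^bsub>pre\<^esub> p)"
  proof (induction p rule: free_Abelian_group_induct[consumes 1, case_names zero diff frag])
    case zero
    then show ?case using assms(2) \<open>rels #>\<^bsub>pre\<^esub> 0 = \<zero>\<^bsub>T\<^esub>\<close> by simp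
  next
    case (diff x y)
    then show ?case
      using assms(4) inv coset_closed by (simp add: carrier_pre)
  next
    case (frag a)
    then show ?case using assms(3)[of "fst a" "snd a"] by (auto simp: tens_def)
  qed
  then show ?thesis using p by simp
qed

text \<open>The linear extension of \<open>\<phi>\<close> to the free abelian group kills every
  generator of \<open>tensor_rels\<close>, as \<open>\<phi>\<close> is balanced. Hence it is
  constant on cosets, which is the fourth claim.\<close>

lemma tens_ext_pre:
  fixes \<phi> :: "'m \<Rightarrow> 'n \<Rightarrow> 'g" and G :: "('g, 'd) ring_scheme"
  defines "e \<equiv> (\<lambda>p. \<Oplus>\<^bsub>G\<^esub>q\<in>Poly_Mapping.keys p. [Poly_Mapping.lookup p q] \<cdot>\<^bsub>G\<^esub> \<phi> (fst q) (snd q))"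
  assumes G: "abelian_group G" and bal: "balanced R M N G \<phi>"
  shows "\<And>p. p \<in> carrier pre \<Longrightarrow> e p \<in> carrier G"
    and "\<And>p q. p \<in> carrier pre \<Longrightarrow> q \<in> carrier pre \<Longrightarrow> e (p + q) = e p \<oplus>\<^bsub>G\<^esub> e q"
    and "\<And>m n. m \<in> carrier M \<Longrightarrow> n \<in> carrier N \<Longrightarrow> e (frag_of (m, n)) = \<phi> m n"
    and "\<And>p q. p \<in> carrier pre \<Longrightarrow> q \<in> rels \<Longrightarrow> e (p + q) = e p"
proof -
  interpret G: abelian_group G by fact
  let ?t = "\<lambda>(p :: 'm \<times> 'n \<Rightarrow>\<^sub>0 int) q. [Poly_Mapping.lookup p q] \<cdot>\<^bsub>G\<^esub> \<phi> (fst q) (snd q)"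
  have cl: "?t p q \<in> carrier G" if "q \<in> carrier M \<times> carrier N" for p q
    unfolding add_pow_def using balanced_closed[OF bal, of "fst q" "snd q"] that
      group.int_pow_closed[OF G.a_group, of "\<phi> (fst q) (snd q)"] by auto
  \<comment> \<open>The supports of \<open>p\<close>, \<open>q\<close> and \<open>p + q\<close>
    differ. With a common finite index set their sums can be compared term by term.\<close>
  have big: "e p = finsum G (?t p) S"
    if "Poly_Mapping.keys p \<subseteq> S" "finite S" "S \<subseteq> carrier M \<times> carrier N" for p S
    unfolding e_def
  proof (rule G.add.finprod_mono_neutral_cong_left)
    show "?t p \<in> S \<rightarrow> carrier G" using that cl by blast
    show "?t p i = \<zero>\<^bsub>G\<^esub>" if "i \<in> S - Poly_Mapping.keys p" for i
      using that by (simp add: in_keys_iff add_pow_def int_pow_def)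
  qed (use that in auto)
  show closed: "e p \<in> carrier G" if "p \<in> carrier pre" for p
    unfolding e_def by (rule G.finsum_closed) (use that cl in \<open>auto simp: carrier_pre\<close>)
  show add: "e (p + q) = e p \<oplus>\<^bsub>G\<^esub> e q" if "p \<in> carrier pre" "q \<in> carrier pre" for p q
  proof -
    define S where "S = Poly_Mapping.keys p \<union> Poly_Mapping.keys q"
    have S: "finite S" "S \<subseteq> carrier M \<times> carrier N" "Poly_Mapping.keys p \<subseteq> S" "Poly_Mapping.keys q \<subseteq> S"
      "Poly_Mapping.keys (p + q) \<subseteq> S"
      using that keys_add[of p q] by (auto simp: carrier_pre S_def)
    have cl': "?t p \<in> S \<rightarrow> carrier G" for p using S cl by blast
    have "\<phi> (fst s) (snd s) \<in> carrier G" if "s \<in> S" for s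
      using that S balanced_closed[OF bal] by (auto dest!: subsetD)
    then have t: "?t (p + q) s = ?t p s \<oplus>\<^bsub>G\<^esub> ?t q s" if "s \<in> S" for s
      using that group.int_pow_mult[OF G.a_group] by (simp add: lookup_add add_pow_def)
    have "e (p + q) = finsum G (?t (p + q)) S"
      using S by (intro big) auto
    also have "\<dots> = (\<Oplus>\<^bsub>G\<^esub>s\<in>S. ?t p s \<oplus>\<^bsub>G\<^esub> ?t q s)"
      using t cl' by (intro G.finsum_cong') (simp_all add: Pi_iff)
    also have "\<dots> = e p \<oplus>\<^bsub>G\<^esub> e q"
      using S cl' by (subst G.finsum_addf) (auto simp: big[of _ S])
    finally show ?thesis .
  qed
  show frag: "e (frag_of (m, n)) = \<phi> m n" if "m \<in> carrier M" "n \<in> carrier N" for m n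
  proof -
    have "\<phi> m n \<in> carrier G" using balanced_closed[OF bal that] .
    then show ?thesis
      by (simp add: e_def G.add.finprod_insert[of "{}", simplified])
  qed
  have neg: "e (p - q) = e p \<ominus>\<^bsub>G\<^esub> e q" if "p \<in> carrier pre" "q \<in> carrier pre" for p q
  proof -
    have "e (p - q) \<oplus>\<^bsub>G\<^esub> e q = e p" using add[of "p - q" q] that by (simp add: diff_pre)
    then show ?thesis
      using that closed diff_pre
      by (metis G.add.inv_closed G.a_assoc G.r_neg G.r_zero a_minus_def)
  qed
  \<comment> \<open>Balance gives zero on the generators, and additivity carries this through the
    generated subgroup.\<close>
  have z: "e q = \<zero>\<^bsub>G\<^esub>" if "q \<in> rels" for q
  proof -
    have 0: "e 0 = \<zero>\<^bsub>G\<^esub>" by (simp add: e_def)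
    have gen: "e g = \<zero>\<^bsub>G\<^esub>" if "g \<in> tensor_gens R M N" for g
      using that unfolding tensor_gens_def
      apply (elim UnE CollectE exE conjE)
      subgoal for m m' n
        using bal by (auto simp: neg frag frag_pre diff_pre balanced_def additive_map_def Pi_iff
           a_minus_def G.minus_add G.a_ac G.r_neg)
           (metis G.a_inv_closed G.add.m_assoc G.add.m_closed G.add.m_comm G.r_neg G.r_zero)?
      subgoal for m n n'
        using bal by (auto simp: neg frag frag_pre diff_pre balanced_def additive_map_def Pi_iff
           a_minus_def G.minus_add G.a_ac G.r_neg)
           (metis G.a_inv_closed G.add.m_assoc G.add.m_closed G.add.m_comm G.r_neg G.r_zero)?
      subgoal for m r n
        using bal by (auto simp: neg frag frag_pre diff_pre balanced_def additive_map_def Pi_iff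
           a_minus_def G.r_neg M.rcl N.lmod_closed)
      done
    have "q \<in> generate pre (tensor_gens R M N)" using that by (simp add: rels_eq)
    then have "q \<in> carrier pre \<and> e q = \<zero>\<^bsub>G\<^esub>"
    proof (induction rule: generate.induct)
      case one
      then show ?case using 0 by (simp add: tensor_pre_def)
    next
      case (incl h)
      then show ?case using gen gens_pre by auto
    next
      case (inv h)
      then have "h \<in> carrier pre" using gens_pre by auto
      then show ?case
        using gen[OF inv] neg[of 0 h] 0 by (simp add: inv_pre carrier_pre a_minus_def)
    next
      case (eng h1 h2)
      then show ?case by (simp add: mult_pre add_pre add)
    qed
    then show ?thesis by simp
  qed
  show "e (p + q) = e p" if "p \<in> carrier pre" "q \<in> rels" for p q
    using that z add[of p q] subgroup.mem_carrier[OF rels_subgroup] closed by auto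
qed

text \<open>The extension maps the coset onto a singleton, so \<open>the_elem\<close> returns its
  value at any representative.\<close>

lemma tens_ext_coset:
  assumes "abelian_group G" "balanced R M N G \<phi>" "p \<in> carrier pre"
  shows "tens_ext G \<phi> (rels #>\<^bsub>pre\<^esub> p) = 
    (\<Oplus>\<^bsub>G\<^esub>q\<in>Poly_Mapping.keys p. [Poly_Mapping.lookup p q] \<cdot>\<^bsub>G\<^esub> \<phi> (fst q) (snd q))"
    (is "_ = ?e p")
proof -
  have "?e ` (rels #>\<^bsub>pre\<^esub> p) = {?e p}"
  proof safe
    fix t assume "t \<in> rels #>\<^bsub>pre\<^esub> p"
    then obtain q where "q \<in> rels" "t = p + q" by (auto simp: r_coset_def mult_pre add.commute)
    then show "?e t = ?e p" using tens_ext_pre(4)[OF assms(1,2,3)] by simp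
  next
    show "?e p \<in> ?e ` (rels #>\<^bsub>pre\<^esub> p)"
      using group.rcos_self[OF group_pre assms(3) rels_subgroup] by blast
  qed
  then show ?thesis by (simp add: tens_ext_def)
qed

lemma tens_ext_tens:
  assumes "abelian_group G" "balanced R M N G \<phi>" "m \<in> carrier M" "n \<in> carrier N"
  shows "tens_ext G \<phi> (tn m n) = \<phi> m n"
  unfolding tens_def
  by (subst tens_ext_coset[OF assms(1,2)]) (use assms tens_ext_pre(3)[OF assms] in \<open>simp_all add: frag_pre\<close>)

lemma tens_ext_additive:
  assumes "abelian_group G" "balanced R M N G \<phi>"
  shows "additive_map T G (tens_ext G \<phi>)"
proof (rule additive_mapI)
  fix t assume "t \<in> carrier T"
  then show "tens_ext G \<phi> t \<in> carrier G"
    using tens_ext_pre(1)[OF assms] by (auto simp: carrier_T RCOSETS_def tens_ext_coset[OF assms])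
next
  fix t u assume "t \<in> carrier T" "u \<in> carrier T"
  then show "tens_ext G \<phi> (t \<oplus>\<^bsub>T\<^esub> u) = tens_ext G \<phi> t \<oplus>\<^bsub>G\<^esub> tens_ext G \<phi> u"
    using tens_ext_pre(2)[OF assms]
    by (auto simp: carrier_T RCOSETS_def tens_ext_coset[OF assms] coset_add add_pre)
qed

lemma tensor_map_eqI:
  assumes "abelian_group G" "additive_map T G f" "additive_map T G g"
    and "\<And>m n. \<lbrakk>m \<in> carrier M; n \<in> carrier N\<rbrakk> \<Longrightarrow> f (tn m n) = g (tn m n)"
    and "t \<in> carrier T"
  shows "f t = g t"
  using assms(5)
  by (induction rule: tensor_induct)
     (use assms in \<open>auto simp: additive_map_zero[OF T.abelian_group_axioms assms(1)]
       additive_map_diff[OF T.abelian_group_axioms assms(1)]\<close>)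

text \<open>Left multiplication on the left factor respects the balance because the two actions on a
  bimodule commute.\<close>

lemma balanced_smult:
  assumes "r \<in> carrier R"
  shows "balanced R M N T (\<lambda>m n. tn (r \<odot>\<^bsub>M\<^esub> m) n)"
  using assms by (intro balancedI)
    (auto simp: tens_closed M.lmod_closed M.lmod_r_distr tens_add_left tens_add_right M.bi_assoc[symmetric]
       tens_balance[symmetric])

lemma balanced_rsmult:
  assumes "r \<in> carrier R"
  shows "balanced R M N T (\<lambda>m n. tn m (n \<ddagger>\<^bsub>N\<^esub> r))"
  using assms by (intro balancedI)
    (auto simp: tens_closed N.rcl N.r_l_distr tens_add_left tens_add_right N.bi_assoc
       tens_balance)

text \<open>The actions in \<open>tensor\<close> are defined by extensions into
  \<open>tensor_group\<close>, since \<open>tensor\<close> cannot refer to itself. The additive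
  groups coincide, so the extensions may be taken into \<open>tensor\<close>.\<close>

lemma tens_ext_tensor_group: "tens_ext (tensor_group R M N) = tens_ext T"
  by (rule ext, rule tens_ext_cong_group) (simp_all add: tensor_def Let_def)

lemma smult_T: "smult T r = tens_ext T (\<lambda>m n. tn (r \<odot>\<^bsub>M\<^esub> m) n)"
  by (subst tens_ext_tensor_group[symmetric]) (simp add: tensor_def Let_def)

lemma rsmult_T: "rsmult T t r = tens_ext T (\<lambda>m n. tn m (n \<ddagger>\<^bsub>N\<^esub> r)) t"
  by (subst tens_ext_tensor_group[symmetric]) (simp add: tensor_def Let_def)

lemma smult_additive: "r \<in> carrier R \<Longrightarrow> additive_map T T (smult T r)"
  unfolding smult_T by (rule tens_ext_additive[OF T.abelian_group_axioms balanced_smult])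

lemma rsmult_additive: "r \<in> carrier R \<Longrightarrow> additive_map T T (\<lambda>t. rsmult T t r)"
  unfolding rsmult_T by (rule tens_ext_additive[OF T.abelian_group_axioms balanced_rsmult])

lemma smult_tens: "\<lbrakk>r \<in> carrier R; m \<in> carrier M; n \<in> carrier N\<rbrakk> \<Longrightarrow> r \<odot>\<^bsub>T\<^esub> tn m n = tn (r \<odot>\<^bsub>M\<^esub> m) n"
  unfolding smult_T by (rule tens_ext_tens[OF T.abelian_group_axioms balanced_smult])

lemma rsmult_tens: "\<lbrakk>r \<in> carrier R; m \<in> carrier M; n \<in> carrier N\<rbrakk> \<Longrightarrow> tn m n \<ddagger>\<^bsub>T\<^esub> r = tn m (n \<ddagger>\<^bsub>N\<^esub> r)"
  unfolding rsmult_T by (rule tens_ext_tens[OF T.abelian_group_axioms balanced_rsmult])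

text \<open>Every law equates two additive maps and is therefore checked on pure tensors, where each
  action touches a single factor.\<close>

lemma bimod_tensor: "bimod R T"
proof (intro bimod.intro left_module.intro left_module_axioms.intro bimod_axioms.intro)
  note a = additive_map_closed additive_map_add
  note ad = smult_additive rsmult_additive
    additive_map_sub[OF T.abelian_group_axioms smult_additive smult_additive T.abelian_group_axioms]
    additive_map_sub[OF T.abelian_group_axioms rsmult_additive rsmult_additive T.abelian_group_axioms]
  show "ring R" "abelian_group T" by unfold_locales
  show "r \<odot>\<^bsub>T\<^esub> t \<in> carrier T" "t \<ddagger>\<^bsub>T\<^esub> r \<in> carrier T" if "r \<in> carrier R" "t \<in> carrier T" for r t
    using that a(1)[OF smult_additive] a(1)[OF rsmult_additive] by auto
  show "r \<odot>\<^bsub>T\<^esub> (t \<oplus>\<^bsub>T\<^esub> u) = r \<odot>\<^bsub>T\<^esub> t \<oplus>\<^bsub>T\<^esub> r \<odot>\<^bsub>T\<^esub> u" "(t \<oplus>\<^bsub>T\<^esub> u) \<ddagger>\<^bsub>T\<^esub> r = t \<ddagger>\<^bsub>T\<^esub> r \<oplus>\<^bsub>T\<^esub> u \<ddagger>\<^bsub>T\<^esub> r"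
    if "r \<in> carrier R" "t \<in> carrier T" "u \<in> carrier T" for r t u
    using that a(2)[OF smult_additive] a(2)[OF rsmult_additive] by auto
  note eqI = tensor_map_eqI[OF T.abelian_group_axioms]
  show "(r \<oplus>\<^bsub>R\<^esub> s) \<odot>\<^bsub>T\<^esub> t = r \<odot>\<^bsub>T\<^esub> t \<oplus>\<^bsub>T\<^esub> s \<odot>\<^bsub>T\<^esub> t" if "r \<in> carrier R" "s \<in> carrier R" "t \<in> carrier T" for r s t
    by (rule eqI) (use that in \<open>auto intro!: ad simp: smult_tens M.lmod_closed tens_add_left M.lmod_l_distr\<close>)
  show "(r \<otimes>\<^bsub>R\<^esub> s) \<odot>\<^bsub>T\<^esub> t = r \<odot>\<^bsub>T\<^esub> (s \<odot>\<^bsub>T\<^esub> t)" if "r \<in> carrier R" "s \<in> carrier R" "t \<in> carrier T" for r s t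
    by (rule eqI) (use that in \<open>auto intro!: smult_additive additive_map_comp[OF smult_additive smult_additive]
        simp: smult_tens M.lmod_closed M.lmod_assoc\<close>)
  show "\<one>\<^bsub>R\<^esub> \<odot>\<^bsub>T\<^esub> t = t" if "t \<in> carrier T" for t
    by (rule eqI[of _ "\<lambda>t. t"]) (use that in \<open>auto intro!: smult_additive additive_mapI simp: smult_tens M.lmod_one\<close>)
  show "t \<ddagger>\<^bsub>T\<^esub> (r \<oplus>\<^bsub>R\<^esub> s) = t \<ddagger>\<^bsub>T\<^esub> r \<oplus>\<^bsub>T\<^esub> t \<ddagger>\<^bsub>T\<^esub> s" if "r \<in> carrier R" "s \<in> carrier R" "t \<in> carrier T" for r s t
    by (rule eqI) (use that in \<open>auto intro!: ad simp: rsmult_tens N.rcl tens_add_right N.r_r_distr\<close>)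
  show "t \<ddagger>\<^bsub>T\<^esub> (r \<otimes>\<^bsub>R\<^esub> s) = t \<ddagger>\<^bsub>T\<^esub> r \<ddagger>\<^bsub>T\<^esub> s" if "r \<in> carrier R" "s \<in> carrier R" "t \<in> carrier T" for r s t
    by (rule eqI) (use that in \<open>auto intro!: rsmult_additive additive_map_comp[OF rsmult_additive rsmult_additive]
        simp: rsmult_tens N.rcl N.r_assoc\<close>)
  show "t \<ddagger>\<^bsub>T\<^esub> \<one>\<^bsub>R\<^esub> = t" if "t \<in> carrier T" for t
    by (rule eqI[of _ "\<lambda>t. t"]) (use that in \<open>auto intro!: rsmult_additive additive_mapI simp: rsmult_tens N.r_one\<close>)
  show "(r \<odot>\<^bsub>T\<^esub> t) \<ddagger>\<^bsub>T\<^esub> s = r \<odot>\<^bsub>T\<^esub> (t \<ddagger>\<^bsub>T\<^esub> s)" if "r \<in> carrier R" "s \<in> carrier R" "t \<in> carrier T" for r s t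
    by (rule eqI) (use that in \<open>auto intro!: additive_map_comp[OF rsmult_additive smult_additive]
        additive_map_comp[OF smult_additive rsmult_additive]
        simp: rsmult_tens smult_tens N.rcl M.lmod_closed\<close>)
qed

end

section \<open>Algebras by generators and relations\<close>

text \<open>The ring axioms see five fields only and pass to any record that agrees in them, in
  particular from the factor ring to \<open>quot_algebra\<close>.\<close>

lemma ring_cong:
  fixes R :: "('r, 'c) ring_scheme" and R' :: "('r, 'd) ring_scheme"
  assumes "ring R" "carrier R = carrier R'" "mult R = mult R'" "one R = one R'"
    "zero R = zero R'" "add R = add R'"
  shows "ring R'"
proof -
  interpret R: ring R by fact
  have "abelian_group R'"
  proof (rule abelian_groupI)
    fix x assume "x \<in> carrier R'"
    then show "\<exists>y\<in>carrier R'. y \<oplus>\<^bsub>R'\<^esub> x = \<zero>\<^bsub>R'\<^esub>"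
      using R.l_neg[of x] R.a_inv_closed[of x] by (auto simp: assms(2-)[symmetric])
  qed (simp_all add: assms(2-)[symmetric] R.a_assoc, metis R.a_comm)
  moreover have "monoid R'"
    by (rule monoidI) (simp_all add: assms(2-)[symmetric] R.m_assoc)
  ultimately show ?thesis
    by (rule ringI) (simp_all add: assms(2-)[symmetric] R.l_distr R.r_distr)
qed

section \<open>Quotients by generated ideals\<close>

locale quot_alg = ring B for B :: "('k, 'b) module" (structure) +
  fixes S assumes gens: "S \<subseteq> carrier B"
begin

abbreviation "I \<equiv> Idl\<^bsub>B\<^esub> S"
abbreviation "Q \<equiv> quot_algebra B S"
abbreviation "c \<equiv> cls B S"

lemma ideal: "ideal I B" by (rule genideal_ideal[OF gens])

lemma Q_simps: "carrier Q = carrier (B Quot I)" "mult Q = mult (B Quot I)" "one Q = one (B Quot I)"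
  "zero Q = zero (B Quot I)" "add Q = add (B Quot I)"
  "l \<odot>\<^bsub>Q\<^esub> u = c (l \<odot>\<^bsub>B\<^esub> \<one>\<^bsub>B\<^esub>) \<otimes>\<^bsub>Q\<^esub> u"
  by (simp_all add: quot_algebra_def Let_def)

lemma ring_quot: "ring Q"
  by (rule ring_cong[OF ideal.quotient_is_ring[OF ideal]]) (simp_all add: Q_simps)

lemma cls_hom: "c \<in> ring_hom B Q"
proof -
  have "c = (+>) I" by (simp add: cls_def fun_eq_iff)
  then show ?thesis
    using ideal.rcos_ring_hom[OF ideal] by (simp add: ring_hom_def Q_simps)
qed

lemma cls_surj: "u \<in> carrier Q \<Longrightarrow> \<exists>b\<in>carrier B. u = c b"
  by (auto simp: Q_simps FactRing_simps cls_def)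

lemma cls_eq: "\<lbrakk>a \<in> carrier B; b \<in> carrier B; a \<ominus>\<^bsub>B\<^esub> b \<in> S\<rbrakk> \<Longrightarrow> c a = c b"
  using quotient_eq_iff_same_a_r_cos[OF ideal] genideal_self[OF gens] by (auto simp: cls_def)

text \<open>The kernel of \<open>\<phi>\<close> is an ideal that contains \<open>S\<close>, hence
  the ideal generated by it. So \<open>\<phi>\<close> takes one value on each coset, and this value
  defines the induced map.\<close>

lemma quot_lift:
  assumes C: "ring C" and \<phi>: "\<phi> \<in> ring_hom B C" and kill: "\<And>s. s \<in> S \<Longrightarrow> \<phi> s = \<zero>\<^bsub>C\<^esub>"
  shows "\<exists>\<psi>\<in>ring_hom Q C. \<forall>b\<in>carrier B. \<psi> (c b) = \<phi> b"
proof -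
  interpret H: ring_hom_ring B C \<phi>
    by (rule ring_hom_ringI2[OF ring_axioms C \<phi>])
  have ker: "ideal (a_kernel B C \<phi>) B" by (rule H.kernel_is_ideal)
  have "S \<subseteq> a_kernel B C \<phi>"
    using gens kill unfolding a_kernel_def' by blast
  then have sub: "I \<subseteq> a_kernel B C \<phi>"
    by (rule genideal_minimal[OF ker])
  have val: "\<phi> x = \<phi> b" if b: "b \<in> carrier B" and x: "x \<in> c b" for b x
  proof -
    obtain i where i: "i \<in> I" "x = i \<oplus>\<^bsub>B\<^esub> b" using x by (auto simp: cls_def a_r_coset_def')
    then have "i \<in> carrier B" "\<phi> i = \<zero>\<^bsub>C\<^esub>" using sub unfolding a_kernel_def' by blast+
    then show ?thesis using i b by simp
  qed
  have self: "b \<in> c b" if "b \<in> carrier B" for b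
    using that additive_subgroup.zero_closed[OF ideal.axioms(1)[OF ideal]]
    by (force simp: cls_def a_r_coset_def')
  define \<psi> where "\<psi> = (\<lambda>u. the_elem (\<phi> ` u))"
  have \<psi>: "\<psi> (c b) = \<phi> b" if "b \<in> carrier B" for b
  proof -
    have "\<phi> ` c b = {\<phi> b}" using val[OF that] self[OF that] by blast
    then show ?thesis by (simp add: \<psi>_def)
  qed
  interpret Q: ring Q by (rule ring_quot)
  have "\<psi> \<in> ring_hom Q C"
  proof (rule ring_hom_memI)
    fix x y assume "x \<in> carrier Q" "y \<in> carrier Q"
    then obtain a b where ab: "a \<in> carrier B" "b \<in> carrier B" "x = c a" "y = c b"
      using cls_surj by metis
    show "\<psi> (x \<otimes>\<^bsub>Q\<^esub> y) = \<psi> x \<otimes>\<^bsub>C\<^esub> \<psi> y"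
      using ab by (simp add: ring_hom_mult[OF cls_hom, symmetric] \<psi>)
    show "\<psi> (x \<oplus>\<^bsub>Q\<^esub> y) = \<psi> x \<oplus>\<^bsub>C\<^esub> \<psi> y"
      using ab by (simp add: ring_hom_add[OF cls_hom, symmetric] \<psi>)
  next
    fix x assume "x \<in> carrier Q"
    then show "\<psi> x \<in> carrier C" using cls_surj \<psi> by fastforce
  next
    show "\<psi> \<one>\<^bsub>Q\<^esub> = \<one>\<^bsub>C\<^esub>"
      using \<psi>[of "\<one>\<^bsub>B\<^esub>"] by (simp add: ring_hom_one[OF cls_hom, symmetric])
  qed
  with \<psi> show ?thesis by blast
qed

end

text \<open>Scalars enter only through the central elements \<open>l \<cdot> 1\<close>.\<close>

locale kalg = K: cring K + ring B for K :: "'k ring" and B :: "('k, 'b) module" (structure) +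
  assumes scal_hom: "(\<lambda>l. l \<odot>\<^bsub>B\<^esub> \<one>\<^bsub>B\<^esub>) \<in> ring_hom K B"
    and smult_eq: "\<lbrakk>l \<in> carrier K; b \<in> carrier B\<rbrakk> \<Longrightarrow> l \<odot>\<^bsub>B\<^esub> b = (l \<odot>\<^bsub>B\<^esub> \<one>\<^bsub>B\<^esub>) \<otimes>\<^bsub>B\<^esub> b"
    and scal_central: "\<lbrakk>l \<in> carrier K; b \<in> carrier B\<rbrakk> \<Longrightarrow> b \<otimes>\<^bsub>B\<^esub> (l \<odot>\<^bsub>B\<^esub> \<one>\<^bsub>B\<^esub>) = l \<odot>\<^bsub>B\<^esub> b"
begin

lemma smult_cl: "\<lbrakk>l \<in> carrier K; b \<in> carrier B\<rbrakk> \<Longrightarrow> l \<odot>\<^bsub>B\<^esub> b \<in> carrier B"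
  using ring_hom_closed[OF scal_hom] by (subst smult_eq) auto

lemma kalg_quot:
  assumes "S \<subseteq> carrier B"
  shows "kalg K (quot_algebra B S)"
proof -
  interpret q: quot_alg B S by unfold_locales fact
  interpret Q: ring q.Q by (rule q.ring_quot)
  have one: "l \<odot>\<^bsub>q.Q\<^esub> \<one>\<^bsub>q.Q\<^esub> = q.c (l \<odot>\<^bsub>B\<^esub> \<one>\<^bsub>B\<^esub>)" if "l \<in> carrier K" for l
    using ring_hom_closed[OF q.cls_hom] smult_cl[OF that one_closed] by (subst q.Q_simps(6)) simp
  show ?thesis
  proof (intro_locales, rule kalg_axioms.intro)
    show "(\<lambda>l. l \<odot>\<^bsub>q.Q\<^esub> \<one>\<^bsub>q.Q\<^esub>) \<in> ring_hom K q.Q"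
      by (rule ring_hom_memI)
         (simp_all add: one ring_hom_closed[OF q.cls_hom] smult_cl ring_hom_closed[OF scal_hom]
           ring_hom_mult[OF scal_hom] ring_hom_mult[OF q.cls_hom] ring_hom_add[OF scal_hom] 
           ring_hom_add[OF q.cls_hom] ring_hom_one[OF scal_hom] ring_hom_one[OF q.cls_hom])
    fix l b assume l: "l \<in> carrier K" and b: "b \<in> carrier q.Q"
    show "l \<odot>\<^bsub>q.Q\<^esub> b = (l \<odot>\<^bsub>q.Q\<^esub> \<one>\<^bsub>q.Q\<^esub>) \<otimes>\<^bsub>q.Q\<^esub> b"
      by (simp add: one[OF l] q.Q_simps(6)[of l b])
    obtain b' where b': "b' \<in> carrier B" "b = q.c b'" using q.cls_surj[OF b] by auto
    show "b \<otimes>\<^bsub>q.Q\<^esub> (l \<odot>\<^bsub>q.Q\<^esub> \<one>\<^bsub>q.Q\<^esub>) = l \<odot>\<^bsub>q.Q\<^esub> b"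
      using b' l by (simp add: one q.Q_simps(6)[of l "q.c b'"] ring_hom_mult[OF q.cls_hom, symmetric] smult_cl
          scal_central smult_eq[symmetric])
  qed
qed

lemma cls_scal:
  assumes "S \<subseteq> carrier B" "l \<in> carrier K"
  shows "cls B S (l \<odot>\<^bsub>B\<^esub> \<one>\<^bsub>B\<^esub>) = l \<odot>\<^bsub>quot_algebra B S\<^esub> \<one>\<^bsub>quot_algebra B S\<^esub>"
proof -
  interpret q: quot_alg B S by unfold_locales fact
  interpret Q: ring q.Q by (rule q.ring_quot)
  show ?thesis
    using ring_hom_closed[OF q.cls_hom] smult_cl[OF assms(2) one_closed] by (subst q.Q_simps(6)) simp
qed

end

text \<open>The target is a bare ring: the endomorphism rings to which this is applied carry no
  scalar multiplication. The map \<open>\<kappa>\<close> records where the scalars go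
  instead.\<close>

definition khom :: "'k ring \<Rightarrow> ('k, 'b) module \<Rightarrow> ('c, 'd) ring_scheme \<Rightarrow> ('k \<Rightarrow> 'c) \<Rightarrow> ('b \<Rightarrow> 'c) \<Rightarrow> bool" where
  "khom K B C \<kappa> \<phi> \<longleftrightarrow> \<phi> \<in> ring_hom B C \<and> (\<forall>l\<in>carrier K. \<phi> (l \<odot>\<^bsub>B\<^esub> \<one>\<^bsub>B\<^esub>) = \<kappa> l)"

lemma khom_smult:
  assumes "kalg K B" "khom K B C \<kappa> \<phi>" "l \<in> carrier K" "b \<in> carrier B"
  shows "\<phi> (l \<odot>\<^bsub>B\<^esub> b) = \<kappa> l \<otimes>\<^bsub>C\<^esub> \<phi> b"
proof -
  interpret kalg K B by fact
  have "\<phi> (l \<odot>\<^bsub>B\<^esub> b) = \<phi> (l \<odot>\<^bsub>B\<^esub> \<one>\<^bsub>B\<^esub>) \<otimes>\<^bsub>C\<^esub> \<phi> b"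
    using assms by (subst smult_eq) (auto simp: khom_def ring_hom_mult smult_cl)
  then show ?thesis using assms by (simp add: khom_def)
qed

lemma khom_quot_lift:
  assumes B: "kalg K B" and S: "S \<subseteq> carrier B" and C: "ring C" and \<phi>: "khom K B C \<kappa> \<phi>"
    and kill: "\<And>s. s \<in> S \<Longrightarrow> \<phi> s = \<zero>\<^bsub>C\<^esub>"
  shows "\<exists>\<psi>. khom K (quot_algebra B S) C \<kappa> \<psi> \<and> (\<forall>b\<in>carrier B. \<psi> (cls B S b) = \<phi> b)"
proof -
  interpret kalg K B by fact
  interpret q: quot_alg B S by unfold_locales fact
  obtain \<psi> where "\<psi> \<in> ring_hom q.Q C" "\<forall>b\<in>carrier B. \<psi> (q.c b) = \<phi> b"
    using q.quot_lift[of C \<phi>, OF C _ kill] \<phi> by (auto simp: khom_def)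
  then show ?thesis
    using \<phi> by (intro exI[of _ \<psi>]) (auto simp: khom_def cls_scal[OF S, symmetric] smult_cl)
qed

text \<open>Generation as an induction principle. In a \<open>K\<close>-algebra, zero and negatives
  need no clause of their own, as they are multiples by the scalars 0 and -1.\<close>

definition kgen :: "'k ring \<Rightarrow> ('k, 'b) module \<Rightarrow> 'b set \<Rightarrow> bool" where
  "kgen K B G \<longleftrightarrow> G \<subseteq> carrier B \<and> (\<forall>S. G \<subseteq> S \<longrightarrow> (\<forall>l\<in>carrier K. l \<odot>\<^bsub>B\<^esub> \<one>\<^bsub>B\<^esub> \<in> S) \<longrightarrow>
     (\<forall>a\<in>S\<inter>carrier B. \<forall>b\<in>S\<inter>carrier B. a \<oplus>\<^bsub>B\<^esub> b \<in> S \<and> a \<otimes>\<^bsub>B\<^esub> b \<in> S) \<longrightarrow> carrier B \<subseteq> S)"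

lemma kgen_induct [consumes 2, case_names gen scal add mult]:
  assumes "kgen K B G" "b \<in> carrier B"
    and "\<And>g. g \<in> G \<Longrightarrow> P g" "\<And>l. l \<in> carrier K \<Longrightarrow> P (l \<odot>\<^bsub>B\<^esub> \<one>\<^bsub>B\<^esub>)"
    and "\<And>a b. \<lbrakk>a \<in> carrier B; b \<in> carrier B; P a; P b\<rbrakk> \<Longrightarrow> P (a \<oplus>\<^bsub>B\<^esub> b)"
    and "\<And>a b. \<lbrakk>a \<in> carrier B; b \<in> carrier B; P a; P b\<rbrakk> \<Longrightarrow> P (a \<otimes>\<^bsub>B\<^esub> b)"
  shows "P b"
  using assms(1)[unfolded kgen_def, THEN conjunct2, rule_format, of "Collect P"] assms(2-) by auto

lemma kgenI:
  assumes "G \<subseteq> carrier B"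
    and "\<And>P b. \<lbrakk>b \<in> carrier B; \<And>g. g \<in> G \<Longrightarrow> P g; \<And>l. l \<in> carrier K \<Longrightarrow> P (l \<odot>\<^bsub>B\<^esub> \<one>\<^bsub>B\<^esub>);
      \<And>a b. \<lbrakk>a \<in> carrier B; b \<in> carrier B; P a; P b\<rbrakk> \<Longrightarrow> P (a \<oplus>\<^bsub>B\<^esub> b);
      \<And>a b. \<lbrakk>a \<in> carrier B; b \<in> carrier B; P a; P b\<rbrakk> \<Longrightarrow> P (a \<otimes>\<^bsub>B\<^esub> b)\<rbrakk> \<Longrightarrow> P b"
  shows "kgen K B G"
proof -
  have "carrier B \<subseteq> S" if "G \<subseteq> S" "\<forall>l\<in>carrier K. l \<odot>\<^bsub>B\<^esub> \<one>\<^bsub>B\<^esub> \<in> S"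
     "\<forall>a\<in>S\<inter>carrier B. \<forall>b\<in>S\<inter>carrier B. a \<oplus>\<^bsub>B\<^esub> b \<in> S \<and> a \<otimes>\<^bsub>B\<^esub> b \<in> S" for S
    using assms(2)[of _ "\<lambda>b. b \<in> S"] that by auto
  then show ?thesis using assms(1) by (auto simp: kgen_def)
qed

lemma kgen_quot:
  assumes B: "kalg K B" and S: "S \<subseteq> carrier B" and G: "kgen K B G"
  shows "kgen K (quot_algebra B S) (cls B S ` G)"
proof (rule kgenI)
  interpret kalg K B by fact
  interpret q: quot_alg B S by unfold_locales fact
  show "cls B S ` G \<subseteq> carrier q.Q" using G ring_hom_closed[OF q.cls_hom] by (auto simp: kgen_def)
  fix P u assume u: "u \<in> carrier q.Q" and gen: "\<And>g. g \<in> cls B S ` G \<Longrightarrow> P g"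
    and scal: "\<And>l. l \<in> carrier K \<Longrightarrow> P (l \<odot>\<^bsub>q.Q\<^esub> \<one>\<^bsub>q.Q\<^esub>)"
    and add: "\<And>a b. \<lbrakk>a \<in> carrier q.Q; b \<in> carrier q.Q; P a; P b\<rbrakk> \<Longrightarrow> P (a \<oplus>\<^bsub>q.Q\<^esub> b)"
    and mult: "\<And>a b. \<lbrakk>a \<in> carrier q.Q; b \<in> carrier q.Q; P a; P b\<rbrakk> \<Longrightarrow> P (a \<otimes>\<^bsub>q.Q\<^esub> b)"
  obtain b where b: "b \<in> carrier B" "u = q.c b" using q.cls_surj[OF u] by auto
  have "P (q.c b)" using G b(1)
    by (induction rule: kgen_induct)
       (auto simp: gen cls_scal[OF S] scal ring_hom_add[OF q.cls_hom] ring_hom_mult[OF q.cls_hom]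
          ring_hom_closed[OF q.cls_hom] intro!: add mult)
  then show "P u" using b by simp
qed

section \<open>Free algebras\<close>

locale free_alg = K: cring K for K :: "'k ring" + fixes G :: "'g set"
begin

abbreviation "F \<equiv> free_algebra K G"

text \<open>The product of \<open>free_algebra\<close> at a single word, detached from the record so
  that it can be unfolded along the word for arbitrary \<open>K\<close>-valued functions.\<close>

definition conv where "conv p q w = (\<Oplus>\<^bsub>K\<^esub>i\<in>{..length w}. p (take i w) \<otimes>\<^bsub>K\<^esub> q (drop i (w :: 'g list)))"

definition mono where "mono l v = (\<lambda>w :: 'g list. if w = v then l else \<zero>\<^bsub>K\<^esub>)"

lemma F_simps: "p \<otimes>\<^bsub>F\<^esub> q = conv p q" "p \<oplus>\<^bsub>F\<^esub> q = (\<lambda>w. p w \<oplus>\<^bsub>K\<^esub> q w)" "\<zero>\<^bsub>F\<^esub> = (\<lambda>w. \<zero>\<^bsub>K\<^esub>)"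
  "\<one>\<^bsub>F\<^esub> = mono \<one>\<^bsub>K\<^esub> []" "l \<odot>\<^bsub>F\<^esub> p = (\<lambda>w. l \<otimes>\<^bsub>K\<^esub> p w)"
  by (auto simp: free_algebra_def conv_def mono_def fun_eq_iff)

lemma carrier_F: "p \<in> carrier F \<longleftrightarrow> finite {w. p w \<noteq> \<zero>\<^bsub>K\<^esub>} \<and> (\<forall>w. p w \<in> carrier K) \<and> (\<forall>w. w \<notin> lists G \<longrightarrow> p w = \<zero>\<^bsub>K\<^esub>)"
  by (auto simp: free_algebra_def)

lemma conv_Nil: "p [] \<in> carrier K \<Longrightarrow> q [] \<in> carrier K \<Longrightarrow> conv p q [] = p [] \<otimes>\<^bsub>K\<^esub> q []"
  by (simp add: conv_def)

text \<open>The cut lies either before the first letter or after it. In the second case the letter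
  belongs to the left part, and \<open>p\<close> is replaced by its shift under that letter.\<close>

lemma conv_Cons:
  assumes "\<forall>w. p w \<in> carrier K" "\<forall>w. q w \<in> carrier K"
  shows "conv p q (a # w) = conv (\<lambda>v. p (a # v)) q w \<oplus>\<^bsub>K\<^esub> p [] \<otimes>\<^bsub>K\<^esub> q (a # w)"
  unfolding conv_def using assms by (simp add: K.finsum_Suc2 del: K.finsum_Suc)

lemma conv_closed: "\<forall>w. p w \<in> carrier K \<Longrightarrow> \<forall>w. q w \<in> carrier K \<Longrightarrow> conv p q w \<in> carrier K"
  unfolding conv_def by (intro K.finsum_closed) auto

lemma conv_add_left: "\<forall>w. p w \<in> carrier K \<Longrightarrow> \<forall>w. p' w \<in> carrier K \<Longrightarrow> \<forall>w. q w \<in> carrier K \<Longrightarrow>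
    conv (\<lambda>w. p w \<oplus>\<^bsub>K\<^esub> p' w) q w = conv p q w \<oplus>\<^bsub>K\<^esub> conv p' q w"
  unfolding conv_def by (simp add: K.l_distr K.finsum_addf)

lemma conv_add_right: "\<forall>w. p w \<in> carrier K \<Longrightarrow> \<forall>w. p' w \<in> carrier K \<Longrightarrow> \<forall>w. q w \<in> carrier K \<Longrightarrow>
    conv q (\<lambda>w. p w \<oplus>\<^bsub>K\<^esub> p' w) w = conv q p w \<oplus>\<^bsub>K\<^esub> conv q p' w"
  unfolding conv_def by (simp add: K.r_distr K.finsum_addf)

lemma conv_smult_left: "\<forall>w. p w \<in> carrier K \<Longrightarrow> l \<in> carrier K \<Longrightarrow> \<forall>w. q w \<in> carrier K \<Longrightarrow>
    conv (\<lambda>w. l \<otimes>\<^bsub>K\<^esub> p w) q w = l \<otimes>\<^bsub>K\<^esub> conv p q w"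
  unfolding conv_def by (subst K.finsum_rdistr) (auto simp: K.m_assoc)

text \<open>Induction on the word. Since \<open>conv_Cons\<close> passes to shifted functions, the
  functions are generalized.\<close>

lemma conv_assoc:
  "\<forall>w. p w \<in> carrier K \<Longrightarrow> \<forall>w. q w \<in> carrier K \<Longrightarrow> \<forall>w. r w \<in> carrier K \<Longrightarrow>
    conv (conv p q) r w = conv p (conv q r) w"
proof (induction w arbitrary: p q r)
  case Nil
  then show ?case by (simp add: conv_Nil K.m_assoc)
next
  case (Cons a w)
  note cl = Cons.prems conv_closed[OF Cons.prems(1,2)] conv_closed[OF Cons.prems(2,3)]
  have cl': "\<forall>w. p (a # w) \<in> carrier K" "\<forall>w. q (a # w) \<in> carrier K" using cl by auto
  note cl2 = conv_closed[OF cl'(1) cl(2)] conv_closed[OF cl'(2) cl(3)]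
  have *: "(\<lambda>v. conv p q (a # v)) = (\<lambda>v. conv (\<lambda>v. p (a # v)) q v \<oplus>\<^bsub>K\<^esub> p [] \<otimes>\<^bsub>K\<^esub> q (a # v))"
    by (intro ext conv_Cons cl)
  have "conv (conv p q) r (a # w) = 
     conv (conv (\<lambda>v. p (a # v)) q) r w \<oplus>\<^bsub>K\<^esub> p [] \<otimes>\<^bsub>K\<^esub> conv (\<lambda>v. q (a # v)) r w \<oplus>\<^bsub>K\<^esub> (p [] \<otimes>\<^bsub>K\<^esub> q []) \<otimes>\<^bsub>K\<^esub> r (a # w)"
    using cl cl' cl2 by (simp add: conv_Cons * conv_add_left conv_smult_left conv_Nil)
  also have "\<dots> = conv p (conv q r) (a # w)"
    using cl cl' cl2 conv_closed[OF _ cl(3), of "conv (\<lambda>v. p (a # v)) q"]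
      conv_closed[OF cl'(1), of "conv q r"]
    by (simp add: conv_Cons[where q = r] conv_Cons[of p "conv q r"] Cons.IH K.r_distr K.m_assoc K.a_assoc)
  finally show ?case .
qed

lemma mono_closed: "l \<in> carrier K \<Longrightarrow> mono l v w \<in> carrier K"
  by (simp add: mono_def)

lemma conv_zero_left: "\<forall>w. q w \<in> carrier K \<Longrightarrow> conv (\<lambda>_. \<zero>\<^bsub>K\<^esub>) q w = \<zero>\<^bsub>K\<^esub>"
  unfolding conv_def by simp

lemma conv_scal_left: "\<forall>w. q w \<in> carrier K \<Longrightarrow> l \<in> carrier K \<Longrightarrow> conv (mono l []) q w = l \<otimes>\<^bsub>K\<^esub> q w"
  by (cases w) (simp_all add: conv_Nil conv_Cons mono_def conv_zero_left)

lemma conv_scal_right: "\<forall>w. p w \<in> carrier K \<Longrightarrow> l \<in> carrier K \<Longrightarrow> conv p (mono l []) w = p w \<otimes>\<^bsub>K\<^esub> l"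
proof (induction w arbitrary: p)
  case Nil
  then show ?case by (simp add: conv_Nil mono_def)
next
  case (Cons a w)
  then have "conv (\<lambda>v. p (a # v)) (mono l []) w = p (a # w) \<otimes>\<^bsub>K\<^esub> l" by simp
  with Cons show ?case by (subst conv_Cons) (simp_all add: mono_def)
qed

lemma conv_support:
  assumes "conv p q w \<noteq> \<zero>\<^bsub>K\<^esub>" "\<forall>w. p w \<in> carrier K" "\<forall>w. q w \<in> carrier K"
  shows "\<exists>u v. w = u @ v \<and> p u \<noteq> \<zero>\<^bsub>K\<^esub> \<and> q v \<noteq> \<zero>\<^bsub>K\<^esub>"
proof (rule ccontr)
  assume *: "\<not> ?thesis"
  have "p (take i w) \<otimes>\<^bsub>K\<^esub> q (drop i w) = \<zero>\<^bsub>K\<^esub>" for i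
  proof (cases "p (take i w) = \<zero>\<^bsub>K\<^esub>")
    case False
    then have "q (drop i w) = \<zero>\<^bsub>K\<^esub>" using * by (metis append_take_drop_id)
    then show ?thesis using assms by simp
  qed (use assms in simp)
  then show False using assms(1) by (simp add: conv_def)
qed

text \<open>A word in the support of a product is a concatenation of words from the supports of the
  factors. This gives finiteness and confines the support to words over \<open>G\<close>.\<close>

lemma conv_F:
  assumes pq: "p \<in> carrier F" "q \<in> carrier F"
  shows "conv p q \<in> carrier F"
proof -
  have cl: "\<forall>w. p w \<in> carrier K" "\<forall>w. q w \<in> carrier K" using pq by (simp_all add: carrier_F)
  have fin: "finite {w. p w \<noteq> \<zero>\<^bsub>K\<^esub>}" "finite {w. q w \<noteq> \<zero>\<^bsub>K\<^esub>}" using pq by (simp_all add: carrier_F)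
  have "{w. conv p q w \<noteq> \<zero>\<^bsub>K\<^esub>} \<subseteq> (\<lambda>(u, v). u @ v) ` ({w. p w \<noteq> \<zero>\<^bsub>K\<^esub>} \<times> {w. q w \<noteq> \<zero>\<^bsub>K\<^esub>})"
  proof
    fix w assume "w \<in> {w. conv p q w \<noteq> \<zero>\<^bsub>K\<^esub>}"
    then obtain u v where "w = u @ v" "p u \<noteq> \<zero>\<^bsub>K\<^esub>" "q v \<noteq> \<zero>\<^bsub>K\<^esub>"
      using conv_support[OF _ cl] by blast
    then show "w \<in> (\<lambda>(u, v). u @ v) ` ({w. p w \<noteq> \<zero>\<^bsub>K\<^esub>} \<times> {w. q w \<noteq> \<zero>\<^bsub>K\<^esub>})"
      by (intro image_eqI[of _ _ "(u, v)"]) simp_all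
  qed
  then have "finite {w. conv p q w \<noteq> \<zero>\<^bsub>K\<^esub>}"
    using fin by (rule finite_subset[OF _ finite_imageI[OF finite_cartesian_product]])
  moreover have "w \<in> lists G" if nz: "conv p q w \<noteq> \<zero>\<^bsub>K\<^esub>" for w
  proof -
    obtain u v where uv: "w = u @ v" "p u \<noteq> \<zero>\<^bsub>K\<^esub>" "q v \<noteq> \<zero>\<^bsub>K\<^esub>"
      using conv_support[OF nz cl] by blast
    then have "u \<in> lists G" "v \<in> lists G" using pq unfolding carrier_F by blast+
    then show ?thesis using uv(1) by simp
  qed
  ultimately show ?thesis using conv_closed[OF cl] unfolding carrier_F by blast
qed

lemma mono_F: "l \<in> carrier K \<Longrightarrow> v \<in> lists G \<Longrightarrow> mono l v \<in> carrier F"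
  unfolding carrier_F by (auto simp: mono_def)

lemma add_F: "p \<in> carrier F \<Longrightarrow> q \<in> carrier F \<Longrightarrow> (\<lambda>w. p w \<oplus>\<^bsub>K\<^esub> q w) \<in> carrier F"
  unfolding carrier_F
  by (auto intro: finite_subset[of _ "{w. p w \<noteq> \<zero>\<^bsub>K\<^esub>} \<union> {w. q w \<noteq> \<zero>\<^bsub>K\<^esub>}"])

lemma ring_F: "ring F"
proof (rule ringI)
  show "abelian_group F"
  proof (rule abelian_groupI)
    fix p assume p: "p \<in> carrier F"
    then have "(\<lambda>w. \<ominus>\<^bsub>K\<^esub> p w) \<in> carrier F"
      unfolding carrier_F by (auto intro: finite_subset[of _ "{w. p w \<noteq> \<zero>\<^bsub>K\<^esub>}"])
    with p show "\<exists>q\<in>carrier F. q \<oplus>\<^bsub>F\<^esub> p = \<zero>\<^bsub>F\<^esub>"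
      by (intro bexI[of _ "\<lambda>w. \<ominus>\<^bsub>K\<^esub> p w"]) (auto simp: F_simps carrier_F K.l_neg)
  next
    show "p \<oplus>\<^bsub>F\<^esub> q \<in> carrier F" if "p \<in> carrier F" "q \<in> carrier F" for p q
      using add_F[OF that] by (simp add: F_simps)
    show "\<zero>\<^bsub>F\<^esub> \<in> carrier F" by (simp add: F_simps carrier_F)
  qed (simp_all add: F_simps fun_eq_iff carrier_F K.a_ac)
  show "monoid F"
    by (rule monoidI)
       (simp_all add: F_simps conv_F mono_F, simp_all add: fun_eq_iff conv_scal_left conv_scal_right carrier_F conv_assoc)
qed (simp_all add: F_simps fun_eq_iff carrier_F conv_add_left conv_add_right)

lemma scal_F: "l \<in> carrier K \<Longrightarrow> l \<odot>\<^bsub>F\<^esub> \<one>\<^bsub>F\<^esub> = mono l []"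
  by (auto simp: F_simps mono_def fun_eq_iff)

lemma kalg_F: "kalg K F"
proof -
  interpret F: ring F by (rule ring_F)
  show ?thesis
  proof (intro_locales, rule kalg_axioms.intro)
    show "(\<lambda>l. l \<odot>\<^bsub>F\<^esub> \<one>\<^bsub>F\<^esub>) \<in> ring_hom K F"
    proof (rule ring_hom_memI)
      fix l m assume "l \<in> carrier K" "m \<in> carrier K"
      then show "(l \<otimes>\<^bsub>K\<^esub> m) \<odot>\<^bsub>F\<^esub> \<one>\<^bsub>F\<^esub> = (l \<odot>\<^bsub>F\<^esub> \<one>\<^bsub>F\<^esub>) \<otimes>\<^bsub>F\<^esub> (m \<odot>\<^bsub>F\<^esub> \<one>\<^bsub>F\<^esub>)"
        by (simp add: scal_F F_simps(1) fun_eq_iff conv_scal_left mono_closed) (simp add: mono_def)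
      show "(l \<oplus>\<^bsub>K\<^esub> m) \<odot>\<^bsub>F\<^esub> \<one>\<^bsub>F\<^esub> = l \<odot>\<^bsub>F\<^esub> \<one>\<^bsub>F\<^esub> \<oplus>\<^bsub>F\<^esub> m \<odot>\<^bsub>F\<^esub> \<one>\<^bsub>F\<^esub>"
        using \<open>l \<in> _\<close> \<open>m \<in> _\<close> by (simp add: scal_F) (simp add: F_simps(2) fun_eq_iff mono_def)
    qed (simp_all add: scal_F mono_F, simp add: F_simps)
  qed (auto simp: scal_F, auto simp: F_simps carrier_F conv_scal_left conv_scal_right fun_eq_iff K.m_comm)
qed

lemma gen_mono: "gen K g = mono \<one>\<^bsub>K\<^esub> [g]"
  by (auto simp: gen_def mono_def)

lemma gen_F: "g \<in> G \<Longrightarrow> gen K g \<in> carrier F"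
  unfolding gen_mono by (rule mono_F) auto

text \<open>The induction runs over a finite set containing the support, so that the word split off
  as a monomial may also have coefficient zero.\<close>

lemma F_induct [consumes 1, case_names mono add]:
  assumes "p \<in> carrier F" "\<And>l v. \<lbrakk>l \<in> carrier K; v \<in> lists G\<rbrakk> \<Longrightarrow> P (mono l v)"
    and "\<And>p q. \<lbrakk>p \<in> carrier F; q \<in> carrier F; P p; P q\<rbrakk> \<Longrightarrow> P (\<lambda>w. p w \<oplus>\<^bsub>K\<^esub> q w)"
  shows "P p"
proof -
  have "finite S \<Longrightarrow> p \<in> carrier F \<Longrightarrow> {w. p w \<noteq> \<zero>\<^bsub>K\<^esub>} \<subseteq> S \<Longrightarrow> P p" for S
  proof (induction S arbitrary: p rule: finite_induct)
    case empty
    then have "p = mono \<zero>\<^bsub>K\<^esub> []" by (auto simp: mono_def)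
    then show ?case using assms(2)[of "\<zero>\<^bsub>K\<^esub>" "[]"] by simp
  next
    case (insert w S)
    define q where "q = (\<lambda>v. if v = w then \<zero>\<^bsub>K\<^esub> else p v)"
    have q: "q \<in> carrier F" using insert.prems(1) unfolding carrier_F
      by (auto simp: q_def intro: finite_subset[of _ "{w. p w \<noteq> \<zero>\<^bsub>K\<^esub>}"])
    have "{v. q v \<noteq> \<zero>\<^bsub>K\<^esub>} \<subseteq> S" using insert.prems(2) by (auto simp: q_def)
    then have "P q" using insert.IH q by simp
    show ?case
    proof (cases "w \<in> lists G")
      case True
      have m: "mono (p w) w \<in> carrier F" "P (mono (p w) w)"
        using True insert.prems(1) by (simp_all add: carrier_F[of p] mono_F assms(2) del: in_lists_conv_set)
      have "(\<lambda>v. mono (p w) w v \<oplus>\<^bsub>K\<^esub> q v) = p"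
        using insert.prems(1) by (auto simp: fun_eq_iff mono_def q_def carrier_F)
      then show ?thesis using assms(3)[OF m(1) q m(2) \<open>P q\<close>] by simp
    next
      case False
      then have "p w = \<zero>\<^bsub>K\<^esub>" using insert.prems(1) by (auto simp: carrier_F)
      then have "q = p" by (auto simp: q_def)
      then show ?thesis using \<open>P q\<close> by simp
    qed
  qed
  then show ?thesis using assms(1) by (auto simp: carrier_F)
qed

lemma mono_mult:
  assumes "l \<in> carrier K" "m \<in> carrier K"
  shows "conv (mono l u) (mono m v) = mono (l \<otimes>\<^bsub>K\<^esub> m) (u @ v)"
proof
  fix w
  show "conv (mono l u) (mono m v) w = mono (l \<otimes>\<^bsub>K\<^esub> m) (u @ v) w"
  proof (induction u arbitrary: w)
    case Nil
    then show ?case using assms by (simp add: conv_scal_left mono_closed) (simp add: mono_def)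
  next
    case (Cons a u)
    show ?case
    proof (cases w)
      case (Cons b w')
      have "(\<lambda>v. mono l (a # u) (b # v)) = (if a = b then mono l u else (\<lambda>_. \<zero>\<^bsub>K\<^esub>))"
        by (auto simp: mono_def fun_eq_iff)
      then show ?thesis using Cons.IH[of w'] assms Cons
        by (subst Cons, subst conv_Cons)
           (auto simp: mono_closed conv_zero_left, simp_all add: mono_def)
    qed (use assms in \<open>simp add: conv_Nil mono_def\<close>)
  qed
qed

text \<open>A monomial arises from its scalar by multiplying with the letters one after another; the
  empty word is the scalar itself.\<close>

lemma kgen_F: "kgen K F (gen K ` G)"
proof (rule kgenI)
  fix P p assume p: "p \<in> carrier F" and gen: "\<And>g. g \<in> gen K ` G \<Longrightarrow> P g"
    and scal: "\<And>l. l \<in> carrier K \<Longrightarrow> P (l \<odot>\<^bsub>F\<^esub> \<one>\<^bsub>F\<^esub>)"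
    and add: "\<And>a b. \<lbrakk>a \<in> carrier F; b \<in> carrier F; P a; P b\<rbrakk> \<Longrightarrow> P (a \<oplus>\<^bsub>F\<^esub> b)"
    and mult: "\<And>a b. \<lbrakk>a \<in> carrier F; b \<in> carrier F; P a; P b\<rbrakk> \<Longrightarrow> P (a \<otimes>\<^bsub>F\<^esub> b)"
  show "P p" using p
  proof (induction rule: F_induct)
    case (mono l v)
    then show ?case
    proof (induction v)
      case Nil
      then show ?case using scal by (simp add: scal_F)
    next
      case (Cons g v)
      then have "mono l (g # v) = gen K g \<otimes>\<^bsub>F\<^esub> mono l v"
        by (simp add: F_simps(1) gen_mono mono_mult)
      then show ?case using Cons gen mult[OF gen_F mono_F] by auto
    qed
  qed (use add in \<open>simp add: F_simps(2)\<close>)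
qed (auto simp: gen_F)

text \<open>A word goes to the product of the images of its letters and a coefficient through
  \<open>\<kappa>\<close>. The images of scalars have to commute with those of letters for this to
  be multiplicative, and in a bare ring that must be assumed.\<close>

lemma free_lift:
  assumes C: "ring C" and \<kappa>: "\<kappa> \<in> ring_hom K C" and \<phi>: "\<And>g. g \<in> G \<Longrightarrow> \<phi> g \<in> carrier C"
    and comm: "\<And>l g. \<lbrakk>l \<in> carrier K; g \<in> G\<rbrakk> \<Longrightarrow> \<phi> g \<otimes>\<^bsub>C\<^esub> \<kappa> l = \<kappa> l \<otimes>\<^bsub>C\<^esub> \<phi> g"
  shows "\<exists>\<psi>. khom K F C \<kappa> \<psi> \<and> (\<forall>g\<in>G. \<psi> (gen K g) = \<phi> g)"
proof -
  interpret C: ring C by fact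
  define wd where "wd = (\<lambda>w. foldr (\<lambda>g c. \<phi> g \<otimes>\<^bsub>C\<^esub> c) w \<one>\<^bsub>C\<^esub>)"
  have wd: "wd w \<in> carrier C" if "w \<in> lists G" for w
    using that by (induction w) (auto simp: wd_def \<phi>)
  have wd_app: "wd (u @ v) = wd u \<otimes>\<^bsub>C\<^esub> wd v" if "u \<in> lists G" "v \<in> lists G" for u v
    using that
  proof (induction u)
    case (Cons g u)
    then show ?case using wd[of u] wd[of v] \<phi> by (auto simp: wd_def C.m_assoc)
  qed (use wd[of v] in \<open>auto simp: wd_def\<close>)
  have wd_comm: "wd w \<otimes>\<^bsub>C\<^esub> \<kappa> l = \<kappa> l \<otimes>\<^bsub>C\<^esub> wd w" if "w \<in> lists G" "l \<in> carrier K" for w l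
    using that
  proof (induction w)
    case (Cons g w)
    note cl = \<phi>[of g] wd[of w] ring_hom_closed[OF \<kappa>, of l]
    have "wd (g # w) \<otimes>\<^bsub>C\<^esub> \<kappa> l = \<phi> g \<otimes>\<^bsub>C\<^esub> (wd w \<otimes>\<^bsub>C\<^esub> \<kappa> l)"
      using Cons cl by (simp add: wd_def C.m_assoc)
    also have "\<dots> = (\<phi> g \<otimes>\<^bsub>C\<^esub> \<kappa> l) \<otimes>\<^bsub>C\<^esub> wd w"
      using Cons cl by (simp add: C.m_assoc)
    also have "\<dots> = \<kappa> l \<otimes>\<^bsub>C\<^esub> wd (g # w)"
      using Cons cl comm[of l g] by (simp add: C.m_assoc wd_def)
    finally show ?case .
  qed (use ring_hom_closed[OF \<kappa>, of l] in \<open>simp add: wd_def\<close>)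
  have \<kappa>0: "\<kappa> \<zero>\<^bsub>K\<^esub> = \<zero>\<^bsub>C\<^esub>" using ring_hom_zero[OF \<kappa> K.ring_axioms C] .
  note \<kappa>cl = ring_hom_closed[OF \<kappa>]
  have tcl: "\<kappa> (p w) \<otimes>\<^bsub>C\<^esub> wd w \<in> carrier C" if "p \<in> carrier F" "w \<in> lists G" for p w
    using that wd[of w] \<kappa>cl[of "p w"] by (simp add: carrier_F del: in_lists_conv_set)
  define \<psi> where "\<psi> = (\<lambda>p. \<Oplus>\<^bsub>C\<^esub>w\<in>{w. p w \<noteq> \<zero>\<^bsub>K\<^esub>}. \<kappa> (p w) \<otimes>\<^bsub>C\<^esub> wd w)"
  have big: "\<psi> p = (\<Oplus>\<^bsub>C\<^esub>w\<in>S. \<kappa> (p w) \<otimes>\<^bsub>C\<^esub> wd w)"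
    if "p \<in> carrier F" "finite S" "{w. p w \<noteq> \<zero>\<^bsub>K\<^esub>} \<subseteq> S" "S \<subseteq> lists G" for p S
    unfolding \<psi>_def
  proof (rule C.add.finprod_mono_neutral_cong_left)
    show "(\<lambda>w. \<kappa> (p w) \<otimes>\<^bsub>C\<^esub> wd w) \<in> S \<rightarrow> carrier C"
      using tcl that by blast
    show "\<kappa> (p i) \<otimes>\<^bsub>C\<^esub> wd i = \<zero>\<^bsub>C\<^esub>" if "i \<in> S - {w. p w \<noteq> \<zero>\<^bsub>K\<^esub>}" for i
      using that \<kappa>0 wd[of i] subsetD[OF \<open>S \<subseteq> lists G\<close>, of i] by simp
  qed (use that in auto)
  have sup: "finite {w. p w \<noteq> \<zero>\<^bsub>K\<^esub>}" "{w. p w \<noteq> \<zero>\<^bsub>K\<^esub>} \<subseteq> lists G" if "p \<in> carrier F" for p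
    using that by (auto simp: carrier_F simp del: in_lists_conv_set)
  have \<psi>cl: "\<psi> p \<in> carrier C" if "p \<in> carrier F" for p
    unfolding \<psi>_def
  proof (rule C.finsum_closed)
    show "(\<lambda>w. \<kappa> (p w) \<otimes>\<^bsub>C\<^esub> wd w) \<in> {w. p w \<noteq> \<zero>\<^bsub>K\<^esub>} \<rightarrow> carrier C"
      using tcl that sup(2)[OF that] by blast
  qed
  have \<psi>add: "\<psi> (\<lambda>w. p w \<oplus>\<^bsub>K\<^esub> q w) = \<psi> p \<oplus>\<^bsub>C\<^esub> \<psi> q" if "p \<in> carrier F" "q \<in> carrier F" for p q
  proof -
    define S where "S = {w. p w \<noteq> \<zero>\<^bsub>K\<^esub>} \<union> {w. q w \<noteq> \<zero>\<^bsub>K\<^esub>}"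
    have S: "finite S" "S \<subseteq> lists G" using sup that by (auto simp: S_def simp del: in_lists_conv_set)
    have sub: "{w. p w \<noteq> \<zero>\<^bsub>K\<^esub>} \<subseteq> S" "{w. q w \<noteq> \<zero>\<^bsub>K\<^esub>} \<subseteq> S" "{w. p w \<oplus>\<^bsub>K\<^esub> q w \<noteq> \<zero>\<^bsub>K\<^esub>} \<subseteq> S"
      by (auto simp: S_def)
    have cl: "(\<lambda>w. \<kappa> (p w) \<otimes>\<^bsub>C\<^esub> wd w) \<in> S \<rightarrow> carrier C" "(\<lambda>w. \<kappa> (q w) \<otimes>\<^bsub>C\<^esub> wd w) \<in> S \<rightarrow> carrier C"
      using tcl that S(2) by blast+
    have eq: "\<kappa> (p w \<oplus>\<^bsub>K\<^esub> q w) \<otimes>\<^bsub>C\<^esub> wd w = \<kappa> (p w) \<otimes>\<^bsub>C\<^esub> wd w \<oplus>\<^bsub>C\<^esub> \<kappa> (q w) \<otimes>\<^bsub>C\<^esub> wd w"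
      if "w \<in> S" for w
      using wd[OF subsetD[OF S(2) that]] \<kappa>cl \<open>p \<in> _\<close> \<open>q \<in> _\<close>
      by (auto simp: carrier_F ring_hom_add[OF \<kappa>] C.l_distr simp del: in_lists_conv_set)
    have "\<psi> (\<lambda>w. p w \<oplus>\<^bsub>K\<^esub> q w) = (\<Oplus>\<^bsub>C\<^esub>w\<in>S. \<kappa> (p w \<oplus>\<^bsub>K\<^esub> q w) \<otimes>\<^bsub>C\<^esub> wd w)"
      by (rule big[OF add_F[OF that] S(1) sub(3) S(2)])
    also have "\<dots> = (\<Oplus>\<^bsub>C\<^esub>w\<in>S. \<kappa> (p w) \<otimes>\<^bsub>C\<^esub> wd w \<oplus>\<^bsub>C\<^esub> \<kappa> (q w) \<otimes>\<^bsub>C\<^esub> wd w)"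
      using eq cl by (intro C.finsum_cong') (simp_all add: Pi_iff)
    also have "\<dots> = \<psi> p \<oplus>\<^bsub>C\<^esub> \<psi> q"
      using cl by (simp only: C.finsum_addf big[OF that(1) S(1) sub(1) S(2)] big[OF that(2) S(1) sub(2) S(2)])
    finally show ?thesis .
  qed
  have \<psi>mono: "\<psi> (mono l v) = \<kappa> l \<otimes>\<^bsub>C\<^esub> wd v" if "l \<in> carrier K" "v \<in> lists G" for l v
  proof -
    have "\<psi> (mono l v) = (\<Oplus>\<^bsub>C\<^esub>w\<in>{v}. \<kappa> (mono l v w) \<otimes>\<^bsub>C\<^esub> wd w)"
      using that by (intro big mono_F) (auto simp: mono_def)
    then show ?thesis
      using wd[OF that(2)] \<kappa>cl[OF that(1)] by (simp add: mono_def)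
  qed
  \<comment> \<open>Both factors are reduced to monomials. There the scalar of the second is moved
    past the word of the first by \<open>wd_comm\<close>.\<close>
  have \<psi>mult: "\<psi> (conv p q) = \<psi> p \<otimes>\<^bsub>C\<^esub> \<psi> q" if "p \<in> carrier F" "q \<in> carrier F" for p q
    using that
  proof (induction rule: F_induct)
    case (mono l u)
    from mono(3) show ?case
    proof (induction rule: F_induct)
      case (mono m v)
      note cl = wd[of u] wd[of v] \<kappa>cl[of l] \<kappa>cl[of m]
      have "\<psi> (conv (local.mono l u) (local.mono m v)) = \<kappa> l \<otimes>\<^bsub>C\<^esub> (\<kappa> m \<otimes>\<^bsub>C\<^esub> wd u) \<otimes>\<^bsub>C\<^esub> wd v"
        using mono \<open>l \<in> _\<close> \<open>u \<in> _\<close> cl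
        by (simp add: mono_mult \<psi>mono ring_hom_mult[OF \<kappa>] wd_app C.m_assoc)
      then show ?case
        using mono \<open>l \<in> _\<close> \<open>u \<in> _\<close> cl
        by (simp add: wd_comm[of u m, symmetric] \<psi>mono C.m_assoc)
    next
      case (add p q)
      have "conv (local.mono l u) (\<lambda>w. p w \<oplus>\<^bsub>K\<^esub> q w) = (\<lambda>w. conv (local.mono l u) p w \<oplus>\<^bsub>K\<^esub> conv (local.mono l u) q w)"
        using add mono_F[OF mono(1,2)] by (auto simp: fun_eq_iff conv_add_right carrier_F)
      then show ?case
        using add mono_F[OF mono(1,2)] by (simp add: \<psi>add conv_F C.r_distr \<psi>cl)
    qed
  next
    case (add p p')
    have "conv (\<lambda>w. p w \<oplus>\<^bsub>K\<^esub> p' w) q = (\<lambda>w. conv p q w \<oplus>\<^bsub>K\<^esub> conv p' q w)"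
      using add by (auto simp: fun_eq_iff conv_add_left carrier_F)
    then show ?case
      using add by (simp add: \<psi>add conv_F C.l_distr \<psi>cl)
  qed
  have wd1: "wd [] = \<one>\<^bsub>C\<^esub>" "\<And>g. g \<in> G \<Longrightarrow> wd [g] = \<phi> g" using \<phi> by (auto simp: wd_def)
  have "\<psi> \<in> ring_hom F C"
    by (rule ring_hom_memI)
       (auto simp: F_simps \<psi>cl \<psi>add \<psi>mult \<psi>mono ring_hom_one[OF \<kappa>] wd1)
  moreover have "\<psi> (gen K g) = \<phi> g" if "g \<in> G" for g
    using that \<phi> by (simp add: gen_mono \<psi>mono wd1 ring_hom_one[OF \<kappa>])
  moreover have "\<psi> (l \<odot>\<^bsub>F\<^esub> \<one>\<^bsub>F\<^esub>) = \<kappa> l" if "l \<in> carrier K" for l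
    using that \<kappa>cl by (simp add: scal_F \<psi>mono wd1)
  ultimately show ?thesis by (auto simp: khom_def)
qed

end

section \<open>Tensor algebras and free products\<close>

text \<open>What it takes to form \<open>hom_rels\<close> inside a free algebra. It is checked for
  \<open>A^e\<close> and for \<open>K\<close> as base of a tensor algebra, and for the factors of
  the free product.\<close>

definition opsclosed :: "'k ring \<Rightarrow> ('k, 'b) module \<Rightarrow> bool" where
  "opsclosed K B \<longleftrightarrow> \<one>\<^bsub>B\<^esub> \<in> carrier B \<and> (\<forall>b\<in>carrier B. \<forall>c\<in>carrier B. b \<oplus>\<^bsub>B\<^esub> c \<in> carrier B \<and> b \<otimes>\<^bsub>B\<^esub> c \<in> carrier B)
     \<and> (\<forall>l\<in>carrier K. \<forall>b\<in>carrier B. l \<odot>\<^bsub>B\<^esub> b \<in> carrier B)"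

text \<open>A version of \<open>khom\<close> for sources known only to be closed under their
  operations: scalar multiplication cannot be reduced to the elements \<open>l \<cdot> 1\<close>
  there, so its compatibility is demanded for all elements.\<close>

definition premap :: "'k ring \<Rightarrow> ('k, 'b) module \<Rightarrow> ('c, 'd) ring_scheme \<Rightarrow> ('k \<Rightarrow> 'c) \<Rightarrow> ('b \<Rightarrow> 'c) \<Rightarrow> bool" where
  "premap K B C \<kappa> \<phi> \<longleftrightarrow> \<phi> \<in> ring_hom B C \<and>
     (\<forall>l\<in>carrier K. \<forall>b\<in>carrier B. \<phi> (l \<odot>\<^bsub>B\<^esub> b) = \<kappa> l \<otimes>\<^bsub>C\<^esub> \<phi> b)"

lemma kalg_opsclosed: "kalg K B \<Longrightarrow> opsclosed K B"
proof -
  assume "kalg K B"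
  then interpret kalg K B .
  show ?thesis by (auto simp: opsclosed_def smult_cl)
qed

lemma khom_premap: "kalg K B \<Longrightarrow> khom K B C \<kappa> \<phi> \<Longrightarrow> premap K B C \<kappa> \<phi>"
  using khom_smult by (fastforce simp: premap_def khom_def)

lemma premap_khom:
  assumes "opsclosed K B" "ring C" "\<And>l. l \<in> carrier K \<Longrightarrow> \<kappa> l \<in> carrier C" "premap K B C \<kappa> \<phi>"
  shows "khom K B C \<kappa> \<phi>"
proof -
  interpret C: ring C by fact
  show ?thesis using assms ring_hom_one[of \<phi> B C] by (auto simp: premap_def khom_def opsclosed_def)
qed

lemma hom_rels_carrier:
  assumes "kalg K F" "opsclosed K B" "\<And>b. b \<in> carrier B \<Longrightarrow> j b \<in> carrier F"
  shows "hom_rels K B F j \<subseteq> carrier F"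
proof -
  interpret kalg K F by fact
  show ?thesis using assms(2,3) by (auto simp: hom_rels_def opsclosed_def smult_cl)
qed

text \<open>One half of the universal property of \<open>hom_rels\<close>: every clause is one of
  the relations, read through \<open>cls_eq\<close>.\<close>

lemma hom_rels_quot:
  assumes F: "kalg K F" and B: "opsclosed K B" and j: "\<And>b. b \<in> carrier B \<Longrightarrow> j b \<in> carrier F"
    and S: "S \<subseteq> carrier F" "hom_rels K B F j \<subseteq> S"
  shows "premap K B (quot_algebra F S) (\<lambda>l. l \<odot>\<^bsub>quot_algebra F S\<^esub> \<one>\<^bsub>quot_algebra F S\<^esub>) (\<lambda>b. cls F S (j b))"
proof -
  interpret kalg K F by fact
  interpret q: quot_alg F S by unfold_locales fact
  note hom = q.cls_hom
  note eq = q.cls_eq[OF _ _ subsetD[OF S(2)]]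
  show ?thesis unfolding premap_def
  proof (intro conjI ring_hom_memI ballI)
    show "q.c (j b) \<in> carrier q.Q" if "b \<in> carrier B" for b
      using ring_hom_closed[OF hom j[OF that]] .
    show "q.c (j (b \<otimes>\<^bsub>B\<^esub> c)) = q.c (j b) \<otimes>\<^bsub>q.Q\<^esub> q.c (j c)" if "b \<in> carrier B" "c \<in> carrier B" for b c
      using that B j by (subst ring_hom_mult[OF hom, symmetric], simp, simp)
        (rule eq, auto simp: opsclosed_def hom_rels_def)
    show "q.c (j (b \<oplus>\<^bsub>B\<^esub> c)) = q.c (j b) \<oplus>\<^bsub>q.Q\<^esub> q.c (j c)" if "b \<in> carrier B" "c \<in> carrier B" for b c
      using that B j by (subst ring_hom_add[OF hom, symmetric], simp, simp)
        (rule eq, auto simp: opsclosed_def hom_rels_def)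
    show "q.c (j \<one>\<^bsub>B\<^esub>) = \<one>\<^bsub>q.Q\<^esub>"
      using B j by (subst ring_hom_one[OF hom, symmetric])
        (rule eq, auto simp: opsclosed_def hom_rels_def)
    show "q.c (j (l \<odot>\<^bsub>B\<^esub> b)) = (l \<odot>\<^bsub>q.Q\<^esub> \<one>\<^bsub>q.Q\<^esub>) \<otimes>\<^bsub>q.Q\<^esub> q.c (j b)"
      if "l \<in> carrier K" "b \<in> carrier B" for l b
    proof -
      have "q.c (j (l \<odot>\<^bsub>B\<^esub> b)) = q.c (l \<odot>\<^bsub>F\<^esub> j b)"
        by (rule eq) (use that B j in \<open>auto simp: opsclosed_def hom_rels_def smult_cl\<close>)
      also have "\<dots> = q.c ((l \<odot>\<^bsub>F\<^esub> \<one>\<^bsub>F\<^esub>) \<otimes>\<^bsub>F\<^esub> j b)"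
        using smult_eq[OF that(1) j[OF that(2)]] by simp
      also have "\<dots> = q.c (l \<odot>\<^bsub>F\<^esub> \<one>\<^bsub>F\<^esub>) \<otimes>\<^bsub>q.Q\<^esub> q.c (j b)"
        using that j by (simp add: ring_hom_mult[OF hom] smult_cl)
      finally show ?thesis using cls_scal[OF S(1) that(1)] by simp
    qed
  qed
qed

text \<open>The other half: each relation is a difference whose two terms have the same
  image.\<close>

lemma hom_rels_kill:
  assumes F: "kalg K F" and B: "opsclosed K B" and j: "\<And>b. b \<in> carrier B \<Longrightarrow> j b \<in> carrier F"
    and C: "ring C" and \<psi>: "khom K F C \<kappa> \<psi>" and \<phi>: "premap K B C \<kappa> (\<lambda>b. \<psi> (j b))" and r: "r \<in> hom_rels K B F j"
  shows "\<psi> r = \<zero>\<^bsub>C\<^esub>"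
proof -
  interpret kalg K F by fact
  interpret C: ring C by fact
  interpret H: ring_hom_ring F C \<psi>
    by (rule ring_hom_ringI2[OF ring_axioms C]) (use \<psi> in \<open>simp add: khom_def\<close>)
  have sub: "\<psi> (x \<ominus>\<^bsub>F\<^esub> y) = \<zero>\<^bsub>C\<^esub>" if "\<psi> x = \<psi> y" "x \<in> carrier F" "y \<in> carrier F" for x y
    using that by (simp add: a_minus_def C.r_neg)
  have hom: "(\<lambda>b. \<psi> (j b)) \<in> ring_hom B C" using \<phi> by (simp add: premap_def)
  show ?thesis
    using r unfolding hom_rels_def
    apply (elim UnE CollectE exE conjE)
    subgoal by (simp, rule sub) (use B j ring_hom_add[OF hom] in \<open>auto simp: opsclosed_def\<close>)
    subgoal by (simp, rule sub) (use B j ring_hom_mult[OF hom] in \<open>auto simp: opsclosed_def\<close>)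
    subgoal by (simp, rule sub) (use B j \<phi> khom_smult[OF F \<psi>] in \<open>auto simp: opsclosed_def premap_def smult_cl\<close>)
    subgoal by (simp, rule sub) (use B j ring_hom_one[OF hom] in \<open>auto simp: opsclosed_def\<close>)
    done
qed

lemma kgen_sub: "kgen K B G \<Longrightarrow> G \<subseteq> carrier B"
  unfolding kgen_def by (rule conjunct1)

section \<open>Tensor algebras\<close>

locale talg = K: cring K for K :: "'k ring" + fixes R :: "('k, 'r) module" and V :: "('r, 'v) bimodule"
  assumes R: "opsclosed K R"
    and Vadd: "\<lbrakk>v \<in> carrier V; w \<in> carrier V\<rbrakk> \<Longrightarrow> v \<oplus>\<^bsub>V\<^esub> w \<in> carrier V"
    and Vsm: "\<lbrakk>r \<in> carrier R; v \<in> carrier V\<rbrakk> \<Longrightarrow> r \<odot>\<^bsub>V\<^esub> v \<in> carrier V"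
    and Vrs: "\<lbrakk>r \<in> carrier R; v \<in> carrier V\<rbrakk> \<Longrightarrow> v \<ddagger>\<^bsub>V\<^esub> r \<in> carrier V"
begin

sublocale free_alg K "carrier R <+> carrier V" ..

abbreviation "S \<equiv> talg_rels K R V"
abbreviation "TA \<equiv> tensor_algebra K R V"
abbreviation "bs \<equiv> talg_base K R V"
abbreviation "gn \<equiv> talg_gen K R V"

sublocale F: kalg K F by (rule kalg_F)

lemma Fj: "r \<in> carrier R \<Longrightarrow> gen K (Inl r) \<in> carrier F" "v \<in> carrier V \<Longrightarrow> gen K (Inr v) \<in> carrier F"
  by (auto intro!: gen_F)

lemma rels_F: "S \<subseteq> carrier F"
proof -
  have "hom_rels K R F (\<lambda>r. gen K (Inl r)) \<subseteq> carrier F"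
    by (rule hom_rels_carrier[OF kalg_F R Fj(1)])
  then show ?thesis using Fj Vadd Vsm Vrs by (auto simp: talg_rels_def Let_def talg_free_def)
qed

lemma TA_eq: "TA = quot_algebra F S" by (simp add: tensor_algebra_def talg_free_def)

lemma kalg_TA: "kalg K TA" unfolding TA_eq by (rule F.kalg_quot[OF rels_F])

sublocale q: quot_alg F S by unfold_locales (rule rels_F)

lemma hom_S: "hom_rels K R F (\<lambda>r. gen K (Inl r)) \<subseteq> S"
  by (auto simp: talg_rels_def Let_def talg_free_def)

lemma base_premap: "premap K R TA (\<lambda>l. l \<odot>\<^bsub>TA\<^esub> \<one>\<^bsub>TA\<^esub>) bs"
  using hom_rels_quot[OF kalg_F R Fj(1) rels_F hom_S] by (simp add: TA_eq talg_base_def[abs_def] talg_free_def)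

lemma gen_closed: "v \<in> carrier V \<Longrightarrow> gn v \<in> carrier TA"
  using ring_hom_closed[OF q.cls_hom Fj(2)] by (simp add: TA_eq talg_gen_def talg_free_def)

lemma gen_add: "\<lbrakk>v \<in> carrier V; w \<in> carrier V\<rbrakk> \<Longrightarrow> gn (v \<oplus>\<^bsub>V\<^esub> w) = gn v \<oplus>\<^bsub>TA\<^esub> gn w"
  unfolding TA_eq talg_gen_def talg_free_def
  by (subst ring_hom_add[OF q.cls_hom, symmetric], simp_all add: Fj)
     (rule q.cls_eq, auto simp: Fj Vadd talg_rels_def Let_def talg_free_def)

lemma gen_smult: "\<lbrakk>r \<in> carrier R; v \<in> carrier V\<rbrakk> \<Longrightarrow> gn (r \<odot>\<^bsub>V\<^esub> v) = bs r \<otimes>\<^bsub>TA\<^esub> gn v"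
  unfolding TA_eq talg_gen_def talg_base_def talg_free_def
  by (subst ring_hom_mult[OF q.cls_hom, symmetric], simp_all add: Fj)
     (rule q.cls_eq, auto simp: Fj Vsm talg_rels_def Let_def talg_free_def)

lemma gen_rsmult: "\<lbrakk>r \<in> carrier R; v \<in> carrier V\<rbrakk> \<Longrightarrow> gn (v \<ddagger>\<^bsub>V\<^esub> r) = gn v \<otimes>\<^bsub>TA\<^esub> bs r"
  unfolding TA_eq talg_gen_def talg_base_def talg_free_def
  by (subst ring_hom_mult[OF q.cls_hom, symmetric], simp_all add: Fj)
     (rule q.cls_eq, auto simp: Fj Vrs talg_rels_def Let_def talg_free_def)

lemma kgen_TA: "kgen K TA (bs ` carrier R \<union> gn ` carrier V)"
proof -
  have "bs ` carrier R \<union> gn ` carrier V = cls F S ` gen K ` (carrier R <+> carrier V)"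
    by (auto simp: talg_base_def talg_gen_def talg_free_def image_image)
  then show ?thesis using kgen_quot[OF kalg_F rels_F kgen_F] by (simp add: TA_eq)
qed

text \<open>The lift starts from the free algebra on the disjoint sum of \<open>R\<close> and
  \<open>V\<close>, with \<open>\<beta>\<close> and \<open>\<gamma>\<close> on the summands. The
  hypotheses on \<open>\<beta>\<close> and \<open>\<gamma>\<close> are the defining relations read
  in \<open>C\<close>, together with commutation with scalars.\<close>

lemma talg_lift:
  assumes C: "ring C" and \<kappa>: "\<kappa> \<in> ring_hom K C" and \<beta>: "premap K R C \<kappa> \<beta>"
    and comm: "\<And>l r. \<lbrakk>l \<in> carrier K; r \<in> carrier R\<rbrakk> \<Longrightarrow> \<beta> r \<otimes>\<^bsub>C\<^esub> \<kappa> l = \<kappa> l \<otimes>\<^bsub>C\<^esub> \<beta> r"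
    and \<gamma>: "additive_map V C \<gamma>"
    and comm': "\<And>l v. \<lbrakk>l \<in> carrier K; v \<in> carrier V\<rbrakk> \<Longrightarrow> \<gamma> v \<otimes>\<^bsub>C\<^esub> \<kappa> l = \<kappa> l \<otimes>\<^bsub>C\<^esub> \<gamma> v"
    and sm: "\<And>r v. \<lbrakk>r \<in> carrier R; v \<in> carrier V\<rbrakk> \<Longrightarrow> \<gamma> (r \<odot>\<^bsub>V\<^esub> v) = \<beta> r \<otimes>\<^bsub>C\<^esub> \<gamma> v"
    and rs: "\<And>r v. \<lbrakk>r \<in> carrier R; v \<in> carrier V\<rbrakk> \<Longrightarrow> \<gamma> (v \<ddagger>\<^bsub>V\<^esub> r) = \<gamma> v \<otimes>\<^bsub>C\<^esub> \<beta> r"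
  shows "\<exists>\<psi>. khom K TA C \<kappa> \<psi> \<and> (\<forall>r\<in>carrier R. \<psi> (bs r) = \<beta> r) \<and> (\<forall>v\<in>carrier V. \<psi> (gn v) = \<gamma> v)"
proof -
  interpret C: ring C by fact
  have \<beta>h: "\<beta> \<in> ring_hom R C" using \<beta> by (simp add: premap_def)
  have "\<exists>\<psi>. khom K F C \<kappa> \<psi> \<and> (\<forall>g\<in>carrier R <+> carrier V. \<psi> (gen K g) = case_sum \<beta> \<gamma> g)"
    by (rule free_lift[OF C \<kappa>])
      (use comm comm' ring_hom_closed[OF \<beta>h] additive_map_closed[OF \<gamma>] in auto)
  then obtain \<psi> where \<psi>: "khom K F C \<kappa> \<psi>" and *: "\<forall>g\<in>carrier R <+> carrier V. \<psi> (gen K g) = case_sum \<beta> \<gamma> g" by blast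
  then have v: "\<And>r. r \<in> carrier R \<Longrightarrow> \<psi> (gen K (Inl r)) = \<beta> r" "\<And>v. v \<in> carrier V \<Longrightarrow> \<psi> (gen K (Inr v)) = \<gamma> v"
    using bspec[OF * InlI] bspec[OF * InrI] by simp_all
  interpret H: ring_hom_ring F C \<psi>
    by (rule ring_hom_ringI2[OF F.ring_axioms C]) (use \<psi> in \<open>simp add: khom_def\<close>)
  have sub: "\<psi> (x \<ominus>\<^bsub>F\<^esub> y) = \<zero>\<^bsub>C\<^esub>" if "\<psi> x = \<psi> y" "x \<in> carrier F" "y \<in> carrier F" for x y
    using that by (simp add: a_minus_def C.r_neg)
  have pm: "premap K R C \<kappa> (\<lambda>b. \<psi> (gen K (Inl b)))"
    using \<beta> R v(1) unfolding premap_def opsclosed_def ring_hom_def by (auto simp: Pi_iff)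
  have kill: "\<psi> s = \<zero>\<^bsub>C\<^esub>" if "s \<in> S" for s
    using that unfolding talg_rels_def Let_def talg_free_def
    apply (elim UnE)
    subgoal by (rule hom_rels_kill[where j = "\<lambda>b. gen K (Inl b)" and \<psi> = \<psi>, OF kalg_F R Fj(1) C \<psi> pm])
    subgoal by (elim CollectE exE conjE, simp, rule sub) (use v Fj Vadd additive_map_add[OF \<gamma>] in auto)
    subgoal by (elim CollectE exE conjE, simp, rule sub) (use v Fj Vsm sm in auto)
    subgoal by (elim CollectE exE conjE, simp, rule sub) (use v Fj Vrs rs in auto)
    done
  obtain \<psi>' where "khom K TA C \<kappa> \<psi>'" "\<forall>b\<in>carrier F. \<psi>' (cls F S b) = \<psi> b"
    using khom_quot_lift[OF kalg_F rels_F C \<psi> kill] by (auto simp: TA_eq)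
  then show ?thesis
    using v Fj by (intro exI[of _ \<psi>']) (auto simp: talg_base_def talg_gen_def talg_free_def)
qed

end

section \<open>Free products of algebras\<close>

locale fprod = K: cring K for K :: "'k ring" + fixes B :: "('k, 'b) module" and C :: "('k, 'c) module"
  assumes B: "kalg K B" and C: "kalg K C"
begin

sublocale free_alg K "carrier B <+> carrier C" ..

abbreviation "S \<equiv> fprod_rels K B C"
abbreviation "P \<equiv> free_product K B C"
abbreviation "lf \<equiv> fprod_left K B C"
abbreviation "rt \<equiv> fprod_right K B C"

sublocale F: kalg K F by (rule kalg_F)
sublocale B: kalg K B by (rule B)
sublocale C: kalg K C by (rule C)

lemma Fj: "r \<in> carrier B \<Longrightarrow> gen K (Inl r) \<in> carrier F" "v \<in> carrier C \<Longrightarrow> gen K (Inr v) \<in> carrier F"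
  by (auto intro!: gen_F)

lemma rels_F: "S \<subseteq> carrier F"
  using hom_rels_carrier[OF kalg_F kalg_opsclosed[OF B] Fj(1)]
    hom_rels_carrier[OF kalg_F kalg_opsclosed[OF C] Fj(2)]
  by (simp add: fprod_rels_def fprod_free_def)

lemma P_eq: "P = quot_algebra F S" by (simp add: free_product_def fprod_free_def)

lemma kalg_P: "kalg K P" unfolding P_eq by (rule F.kalg_quot[OF rels_F])

sublocale q: quot_alg F S by unfold_locales (rule rels_F)

sublocale P: kalg K P by (rule kalg_P)

lemma lf_khom: "khom K B P (\<lambda>l. l \<odot>\<^bsub>P\<^esub> \<one>\<^bsub>P\<^esub>) lf"
proof (rule premap_khom[OF kalg_opsclosed[OF B] P.ring_axioms])
  have "hom_rels K B F (\<lambda>r. gen K (Inl r)) \<subseteq> S"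
    by (simp add: fprod_rels_def fprod_free_def)
  then show "premap K B P (\<lambda>l. l \<odot>\<^bsub>P\<^esub> \<one>\<^bsub>P\<^esub>) lf"
    using hom_rels_quot[OF kalg_F kalg_opsclosed[OF B] Fj(1) rels_F] 
    by (simp add: P_eq fprod_left_def[abs_def] fprod_free_def)
qed (simp add: P.smult_cl)

lemma rt_khom: "khom K C P (\<lambda>l. l \<odot>\<^bsub>P\<^esub> \<one>\<^bsub>P\<^esub>) rt"
proof (rule premap_khom[OF kalg_opsclosed[OF C] P.ring_axioms])
  have "hom_rels K C F (\<lambda>r. gen K (Inr r)) \<subseteq> S"
    by (simp add: fprod_rels_def fprod_free_def)
  then show "premap K C P (\<lambda>l. l \<odot>\<^bsub>P\<^esub> \<one>\<^bsub>P\<^esub>) rt"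
    using hom_rels_quot[OF kalg_F kalg_opsclosed[OF C] Fj(2) rels_F] 
    by (simp add: P_eq fprod_right_def[abs_def] fprod_free_def)
qed (simp add: P.smult_cl)

lemma lf_hom: "lf \<in> ring_hom B P" and rt_hom: "rt \<in> ring_hom C P"
  using lf_khom rt_khom by (simp_all add: khom_def)

text \<open>Every element of a factor is built from the generators of that factor by operations that
  the inclusions preserve.\<close>

lemma kgen_P:
  assumes G: "kgen K B G" and H: "kgen K C H"
  shows "kgen K P (lf ` G \<union> rt ` H)"
proof (rule kgenI)
  show "lf ` G \<union> rt ` H \<subseteq> carrier P"
    using kgen_sub[OF G] kgen_sub[OF H] ring_hom_closed[OF lf_hom] ring_hom_closed[OF rt_hom] by blast
next
  fix Pr b assume b: "b \<in> carrier P" and gen': "\<And>g. g \<in> lf ` G \<union> rt ` H \<Longrightarrow> Pr g"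
    and scal': "\<And>l. l \<in> carrier K \<Longrightarrow> Pr (l \<odot>\<^bsub>P\<^esub> \<one>\<^bsub>P\<^esub>)"
    and add': "\<And>a b. \<lbrakk>a \<in> carrier P; b \<in> carrier P; Pr a; Pr b\<rbrakk> \<Longrightarrow> Pr (a \<oplus>\<^bsub>P\<^esub> b)"
    and mult': "\<And>a b. \<lbrakk>a \<in> carrier P; b \<in> carrier P; Pr a; Pr b\<rbrakk> \<Longrightarrow> Pr (a \<otimes>\<^bsub>P\<^esub> b)"
  have l: "Pr (lf b)" if "b \<in> carrier B" for b
    using G that
  proof (induction rule: kgen_induct)
    case (gen g)
    then show ?case using gen' by blast
  next
    case (scal l)
    then show ?case using lf_khom scal' by (simp add: khom_def)
  next
    case (add a b)
    then show ?case using add' ring_hom_closed[OF lf_hom] by (simp add: ring_hom_add[OF lf_hom])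
  next
    case (mult a b)
    then show ?case using mult' ring_hom_closed[OF lf_hom] by (simp add: ring_hom_mult[OF lf_hom])
  qed
  have r: "Pr (rt b)" if "b \<in> carrier C" for b
    using H that
  proof (induction rule: kgen_induct)
    case (gen g)
    then show ?case using gen' by blast
  next
    case (scal l)
    then show ?case using rt_khom scal' by (simp add: khom_def)
  next
    case (add a b)
    then show ?case using add' ring_hom_closed[OF rt_hom] by (simp add: ring_hom_add[OF rt_hom])
  next
    case (mult a b)
    then show ?case using mult' ring_hom_closed[OF rt_hom] by (simp add: ring_hom_mult[OF rt_hom])
  qed
  have "kgen K P (cls F S ` gen K ` (carrier B <+> carrier C))"
    using kgen_quot[OF kalg_F rels_F kgen_F] by (simp add: P_eq)
  then show "Pr b" using b
  proof (induction rule: kgen_induct)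
    case (gen g)
    then show ?case
      using l[unfolded fprod_left_def fprod_free_def] r[unfolded fprod_right_def fprod_free_def] by blast
  qed (rule scal' add' mult'; assumption)+
qed

lemma fprod_lift:
  assumes D: "ring D" and \<kappa>: "\<kappa> \<in> ring_hom K D" and \<beta>: "khom K B D \<kappa> \<beta>" and \<gamma>: "khom K C D \<kappa> \<gamma>"
  shows "\<exists>\<psi>. khom K P D \<kappa> \<psi> \<and> (\<forall>r\<in>carrier B. \<psi> (lf r) = \<beta> r) \<and> (\<forall>v\<in>carrier C. \<psi> (rt v) = \<gamma> v)"
proof -
  interpret D: ring D by fact
  have h: "\<beta> \<in> ring_hom B D" "\<gamma> \<in> ring_hom C D" using \<beta> \<gamma> by (auto simp: khom_def)
  \<comment> \<open>Scalars are central in \<open>B\<close>, so their images commute with the image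
    of \<open>B\<close>, as the lift from the free algebra requires.\<close>
  have c1: "\<beta> b \<otimes>\<^bsub>D\<^esub> \<kappa> l = \<kappa> l \<otimes>\<^bsub>D\<^esub> \<beta> b" if "l \<in> carrier K" "b \<in> carrier B" for l b
    using \<beta> that khom_smult[OF B \<beta> that] B.scal_central[OF that] ring_hom_mult[OF h(1), of b "l \<odot>\<^bsub>B\<^esub> \<one>\<^bsub>B\<^esub>"]
    by (simp add: khom_def B.smult_cl)
  have c2: "\<gamma> b \<otimes>\<^bsub>D\<^esub> \<kappa> l = \<kappa> l \<otimes>\<^bsub>D\<^esub> \<gamma> b" if "l \<in> carrier K" "b \<in> carrier C" for l b
    using \<gamma> that khom_smult[OF C \<gamma> that] C.scal_central[OF that] ring_hom_mult[OF h(2), of b "l \<odot>\<^bsub>C\<^esub> \<one>\<^bsub>C\<^esub>"]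
    by (simp add: khom_def C.smult_cl)
  have "\<exists>\<psi>. khom K F D \<kappa> \<psi> \<and> (\<forall>g\<in>carrier B <+> carrier C. \<psi> (gen K g) = case_sum \<beta> \<gamma> g)"
    by (rule free_lift[OF D \<kappa>])
      (use c1 c2 ring_hom_closed[OF h(1)] ring_hom_closed[OF h(2)] in auto)
  then obtain \<psi> where \<psi>: "khom K F D \<kappa> \<psi>" and *: "\<forall>g\<in>carrier B <+> carrier C. \<psi> (gen K g) = case_sum \<beta> \<gamma> g" by blast
  then have v: "\<And>r. r \<in> carrier B \<Longrightarrow> \<psi> (gen K (Inl r)) = \<beta> r" "\<And>v. v \<in> carrier C \<Longrightarrow> \<psi> (gen K (Inr v)) = \<gamma> v"
    using bspec[OF * InlI] bspec[OF * InrI] by simp_all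
  have pm: "premap K B D \<kappa> (\<lambda>b. \<psi> (gen K (Inl b)))"
    using khom_premap[OF B \<beta>] kalg_opsclosed[OF B] v(1) unfolding premap_def opsclosed_def ring_hom_def by (auto simp: Pi_iff)
  have pm': "premap K C D \<kappa> (\<lambda>b. \<psi> (gen K (Inr b)))"
    using khom_premap[OF C \<gamma>] kalg_opsclosed[OF C] v(2) unfolding premap_def opsclosed_def ring_hom_def by (auto simp: Pi_iff)
  have kill: "\<psi> s = \<zero>\<^bsub>D\<^esub>" if "s \<in> S" for s
    using that hom_rels_kill[where j = "\<lambda>b. gen K (Inl b)" and \<psi> = \<psi>, OF kalg_F kalg_opsclosed[OF B] Fj(1) D \<psi> pm]
       hom_rels_kill[where j = "\<lambda>b. gen K (Inr b)" and \<psi> = \<psi>, OF kalg_F kalg_opsclosed[OF C] Fj(2) D \<psi> pm']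
    unfolding fprod_rels_def fprod_free_def by blast
  obtain \<psi>' where "khom K P D \<kappa> \<psi>'" "\<forall>b\<in>carrier F. \<psi>' (cls F S b) = \<psi> b"
    using khom_quot_lift[OF kalg_F rels_F D \<psi> kill] by (auto simp: P_eq)
  then show ?thesis
    using v Fj by (intro exI[of _ \<psi>']) (auto simp: fprod_left_def fprod_right_def fprod_free_def)
qed

end

section \<open>Dual bases\<close>

lemma foldSetD_cong:
  assumes "(B, y) \<in> foldSetD D f e" "\<And>i. i \<in> B \<Longrightarrow> f i = g i"
  shows "(B, y) \<in> foldSetD D g e"
  using assms by (induction rule: foldSetD.induct) (auto intro: foldSetD.intros)

text \<open>The underlying fold sees only the values on \<open>I\<close>, so the terms of a sum may
  be rewritten before they are known to lie in the carrier.\<close>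

lemma finsum_cong_weak:
  assumes "\<And>i. i \<in> I \<Longrightarrow> f i = g i"
  shows "finsum G f I = finsum G g I"
proof -
  have "(I, y) \<in> foldSetD D (add G \<circ> f) e \<longleftrightarrow> (I, y) \<in> foldSetD D (add G \<circ> g) e" for y D e
    using foldSetD_cong[of I y D "add G \<circ> f" e "add G \<circ> g"] foldSetD_cong[of I y D "add G \<circ> g" e "add G \<circ> f"] assms
    by (metis comp_apply)
  then show ?thesis by (simp add: finsum_def finprod_def foldD_def)
qed

lemma finsum_swap:
  assumes "abelian_group G" "finite I" "finite J" "\<And>i j. \<lbrakk>i \<in> I; j \<in> J\<rbrakk> \<Longrightarrow> f i j \<in> carrier G"
  shows "(\<Oplus>\<^bsub>G\<^esub>i\<in>I. \<Oplus>\<^bsub>G\<^esub>j\<in>J. f i j) = (\<Oplus>\<^bsub>G\<^esub>j\<in>J. \<Oplus>\<^bsub>G\<^esub>i\<in>I. f i j)"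
proof -
  interpret G: abelian_group G by fact
  show ?thesis
    using assms(2,4)
  proof (induction I rule: finite_induct)
    case (insert k I)
    have cl: "(\<lambda>i. finsum G (f i) J) \<in> I \<rightarrow> carrier G" "finsum G (f k) J \<in> carrier G"
      using insert.prems by (auto intro!: G.finsum_closed)
    have "(\<Oplus>\<^bsub>G\<^esub>j\<in>J. \<Oplus>\<^bsub>G\<^esub>i\<in>insert k I. f i j) = (\<Oplus>\<^bsub>G\<^esub>j\<in>J. f k j \<oplus>\<^bsub>G\<^esub> (\<Oplus>\<^bsub>G\<^esub>i\<in>I. f i j))"
      using insert.hyps insert.prems by (intro finsum_cong_weak G.finsum_insert) auto
    also have "\<dots> = (\<Oplus>\<^bsub>G\<^esub>j\<in>J. f k j) \<oplus>\<^bsub>G\<^esub> (\<Oplus>\<^bsub>G\<^esub>j\<in>J. \<Oplus>\<^bsub>G\<^esub>i\<in>I. f i j)"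
      using insert.prems by (intro G.finsum_addf) (auto intro!: G.finsum_closed)
    finally show ?case
      using insert cl by simp
  qed simp
qed

text \<open>The dual bases and pairings of a calculus, without d and with the pairings curried. In
  this form the exchange of forms and vector fields is a mere relabelling of fields:
  \<open>de\<close> and \<open>dE\<close> are ev and its underlined variant.\<close>

record ('k, 'a, 'w, 'x) dual_data =
  dbase :: "'k ring"
  dalg :: "('k, 'a) module"
  dW :: "('a, 'w) bimodule"
  dX :: "('a, 'x) bimodule"
  de :: "'x \<Rightarrow> 'w \<Rightarrow> 'a"
  dE :: "'w \<Rightarrow> 'x \<Rightarrow> 'a"
  dI :: nat
  dom :: "nat \<Rightarrow> 'w"
  dxb :: "nat \<Rightarrow> 'x"
  dJ :: nat
  dyb :: "nat \<Rightarrow> 'x"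
  drb :: "nat \<Rightarrow> 'w"

text \<open>All axioms are symmetric under exchanging the bimodule with its dual.\<close>

definition swapd :: "('k, 'a, 'w, 'x) dual_data \<Rightarrow> ('k, 'a, 'x, 'w) dual_data" where
  "swapd E = \<lparr>dbase = dbase E, dalg = dalg E, dW = dX E, dX = dW E, de = dE E, dE = de E,
     dI = dJ E, dom = dyb E, dxb = drb E, dJ = dI E, dyb = dom E, drb = dxb E\<rparr>"

lemma swapd_simps [simp]:
  "dbase (swapd E) = dbase E" "dalg (swapd E) = dalg E" "dW (swapd E) = dX E" "dX (swapd E) = dW E"
  "de (swapd E) = dE E" "dE (swapd E) = de E" "dI (swapd E) = dJ E" "dJ (swapd E) = dI E"
  "dom (swapd E) = dyb E" "dxb (swapd E) = drb E" "dyb (swapd E) = dom E" "drb (swapd E) = dxb E"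
  by (simp_all add: swapd_def)

text \<open>Summation against coev(1) = \<omega>_i \<otimes> x_i. Its mirror image \<open>SJ\<close>
  sums against the underlined coev(1) = y_j \<otimes> \<rho>_j.\<close>

definition SI :: "('k, 'a, 'w, 'x) dual_data \<Rightarrow> ('g, 'c) ring_scheme \<Rightarrow> ('w \<Rightarrow> 'x \<Rightarrow> 'g) \<Rightarrow> 'g" where
  "SI E G \<phi> = (\<Oplus>\<^bsub>G\<^esub>i\<in>{..<dI E}. \<phi> (dom E i) (dxb E i))"

definition SJ :: "('k, 'a, 'w, 'x) dual_data \<Rightarrow> ('g, 'c) ring_scheme \<Rightarrow> ('x \<Rightarrow> 'w \<Rightarrow> 'g) \<Rightarrow> 'g" where
  "SJ E G \<phi> = (\<Oplus>\<^bsub>G\<^esub>j\<in>{..<dJ E}. \<phi> (dyb E j) (drb E j))"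

lemma SI_swapd [simp]: "SI (swapd E) = SJ E" and SJ_swapd [simp]: "SJ (swapd E) = SI E"
  by (simp_all add: SI_def SJ_def fun_eq_iff)

text \<open>\<open>D1\<close> to \<open>D4\<close> are the zigzag identities of the two dualities in
  terms of dual bases; all collapsing of sums goes back to them.\<close>

locale dual =
  fixes E :: "('k, 'a, 'w, 'x) dual_data"
  assumes ring_A: "ring (dalg E)" and bimod_W: "bimod (dalg E) (dW E)" and bimod_X: "bimod (dalg E) (dX E)"
    and scal_A: "l \<in> carrier (dbase E) \<Longrightarrow> l \<odot>\<^bsub>dalg E\<^esub> \<one>\<^bsub>dalg E\<^esub> \<in> carrier (dalg E)"
    and bal_e: "balanced (dalg E) (dX E) (dW E) (dalg E) (de E)"
    and e_l: "\<lbrakk>a \<in> carrier (dalg E); x \<in> carrier (dX E); w \<in> carrier (dW E)\<rbrakk>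
      \<Longrightarrow> de E (a \<odot>\<^bsub>dX E\<^esub> x) w = a \<otimes>\<^bsub>dalg E\<^esub> de E x w"
    and e_r: "\<lbrakk>a \<in> carrier (dalg E); x \<in> carrier (dX E); w \<in> carrier (dW E)\<rbrakk>
      \<Longrightarrow> de E x (w \<ddagger>\<^bsub>dW E\<^esub> a) = de E x w \<otimes>\<^bsub>dalg E\<^esub> a"
    and bal_E: "balanced (dalg E) (dW E) (dX E) (dalg E) (dE E)"
    and E_l: "\<lbrakk>a \<in> carrier (dalg E); x \<in> carrier (dX E); w \<in> carrier (dW E)\<rbrakk>
      \<Longrightarrow> dE E (a \<odot>\<^bsub>dW E\<^esub> w) x = a \<otimes>\<^bsub>dalg E\<^esub> dE E w x"
    and E_r: "\<lbrakk>a \<in> carrier (dalg E); x \<in> carrier (dX E); w \<in> carrier (dW E)\<rbrakk>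
      \<Longrightarrow> dE E w (x \<ddagger>\<^bsub>dX E\<^esub> a) = dE E w x \<otimes>\<^bsub>dalg E\<^esub> a"
    and om: "i < dI E \<Longrightarrow> dom E i \<in> carrier (dW E)" and xb: "i < dI E \<Longrightarrow> dxb E i \<in> carrier (dX E)"
    and yb: "j < dJ E \<Longrightarrow> dyb E j \<in> carrier (dX E)" and rb: "j < dJ E \<Longrightarrow> drb E j \<in> carrier (dW E)"
    and D1: "w \<in> carrier (dW E) \<Longrightarrow> SI E (dW E) (\<lambda>w' x. w' \<ddagger>\<^bsub>dW E\<^esub> de E x w) = w"
    and D2: "x \<in> carrier (dX E) \<Longrightarrow> SI E (dX E) (\<lambda>w x'. de E x w \<odot>\<^bsub>dX E\<^esub> x') = x"
    and D3: "w \<in> carrier (dW E) \<Longrightarrow> SJ E (dW E) (\<lambda>y r. dE E w y \<odot>\<^bsub>dW E\<^esub> r) = w"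
    and D4: "x \<in> carrier (dX E) \<Longrightarrow> SJ E (dX E) (\<lambda>y r. y \<ddagger>\<^bsub>dX E\<^esub> dE E r x) = x"

lemma dual_swapd: "dual E \<Longrightarrow> dual (swapd E)"
  unfolding dual_def by simp

section \<open>Collapsing sums over dual bases\<close>

context dual
begin

abbreviation "A \<equiv> dalg E"
abbreviation "W \<equiv> dW E"
abbreviation "X \<equiv> dX E"
abbreviation "e \<equiv> de E"
abbreviation "e' \<equiv> dE E"

sublocale A: ring A by (rule ring_A)
sublocale W: bimod A W by (rule bimod_W)
sublocale X: bimod A X by (rule bimod_X)

lemma SI_cong: "(\<And>w x. \<lbrakk>w \<in> carrier W; x \<in> carrier X\<rbrakk> \<Longrightarrow> \<phi> w x = \<psi> w x) \<Longrightarrow> SI E G \<phi> = SI E G \<psi>"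
  unfolding SI_def using om xb by (intro finsum_cong_weak) auto

lemma SI_closed [simp]:
  assumes "abelian_group G" "\<And>w x. \<lbrakk>w \<in> carrier W; x \<in> carrier X\<rbrakk> \<Longrightarrow> \<phi> w x \<in> carrier G"
  shows "SI E G \<phi> \<in> carrier G"
proof -
  interpret abelian_group G by fact
  show ?thesis unfolding SI_def using om xb assms(2) by (intro finsum_closed) auto
qed

lemma SI_hom:
  assumes "abelian_group G" "abelian_group H" "additive_map G H h"
    and "\<And>w x. \<lbrakk>w \<in> carrier W; x \<in> carrier X\<rbrakk> \<Longrightarrow> \<phi> w x \<in> carrier G"
  shows "h (SI E G \<phi>) = SI E H (\<lambda>w x. h (\<phi> w x))"
  unfolding SI_def using om xb assms(4) by (intro additive_map_finsum[OF assms(1-3)]) auto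

lemma SI_add:
  assumes "abelian_group G"
    and "\<And>w x. \<lbrakk>w \<in> carrier W; x \<in> carrier X\<rbrakk> \<Longrightarrow> \<phi> w x \<in> carrier G"
    and "\<And>w x. \<lbrakk>w \<in> carrier W; x \<in> carrier X\<rbrakk> \<Longrightarrow> \<psi> w x \<in> carrier G"
  shows "SI E G (\<lambda>w x. \<phi> w x \<oplus>\<^bsub>G\<^esub> \<psi> w x) = SI E G \<phi> \<oplus>\<^bsub>G\<^esub> SI E G \<psi>"
proof -
  interpret abelian_group G by fact
  show ?thesis unfolding SI_def using om xb assms(2,3) by (intro finsum_addf) auto
qed

lemma SI_SI:
  assumes "abelian_group G"
    and "\<And>w x w' x'. \<lbrakk>w \<in> carrier W; x \<in> carrier X; w' \<in> carrier W; x' \<in> carrier X\<rbrakk> \<Longrightarrow> \<phi> w x w' x' \<in> carrier G"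
  shows "SI E G (\<lambda>w x. SI E G (\<phi> w x)) = SI E G (\<lambda>w' x'. SI E G (\<lambda>w x. \<phi> w x w' x'))"
  unfolding SI_def using om xb assms(2) by (intro finsum_swap[OF assms(1)]) auto

lemma SI_SJ:
  assumes "abelian_group G"
    and "\<And>w x y r. \<lbrakk>w \<in> carrier W; x \<in> carrier X; y \<in> carrier X; r \<in> carrier W\<rbrakk> \<Longrightarrow> \<phi> w x y r \<in> carrier G"
  shows "SI E G (\<lambda>w x. SJ E G (\<phi> w x)) = SJ E G (\<lambda>y r. SI E G (\<lambda>w x. \<phi> w x y r))"
  unfolding SI_def SJ_def using om xb yb rb assms(2) by (intro finsum_swap[OF assms(1)]) auto

lemma e_cl [simp]: "x \<in> carrier X \<Longrightarrow> w \<in> carrier W \<Longrightarrow> e x w \<in> carrier A"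
  using balanced_closed[OF bal_e] .

lemma e_bal: "\<lbrakk>a \<in> carrier A; x \<in> carrier X; w \<in> carrier W\<rbrakk> \<Longrightarrow> e (x \<ddagger>\<^bsub>X\<^esub> a) w = e x (a \<odot>\<^bsub>W\<^esub> w)"
  using bal_e by (auto simp: balanced_def)

text \<open>The additive map \<open>h\<close> is taken out of the sum, where the dual basis identity
  applies. With \<open>C2\<close> and the mirror images \<open>C3\<close> and \<open>C4\<close> this
  is how a summation is removed from a balanced expression.\<close>

lemma C1:
  assumes "abelian_group G" "additive_map W G h" "w \<in> carrier W"
  shows "SI E G (\<lambda>w' x. h (w' \<ddagger>\<^bsub>W\<^esub> e x w)) = h w"
  by (subst SI_hom[OF W.abelian_group_axioms assms(1,2), symmetric])
     (use assms in \<open>simp_all add: D1 W.rcl\<close>)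

lemma C2:
  assumes "abelian_group G" "additive_map X G h" "x \<in> carrier X"
  shows "SI E G (\<lambda>w x'. h (e x w \<odot>\<^bsub>X\<^esub> x')) = h x"
  by (subst SI_hom[OF X.abelian_group_axioms assms(1,2), symmetric])
     (use assms in \<open>simp_all add: D2 X.lmod_closed\<close>)

text \<open>In other words, a \<omega>_i \<otimes> x_i = \<omega>_i \<otimes> x_i a. The form a
  \<omega>_i is expanded in the dual basis, its coefficient crosses over to the vector field, a
  moves to the other argument of the pairing, and the original sum contracts.\<close>

lemma coev_central:
  assumes G: "abelian_group G" and \<phi>: "balanced A W X G \<phi>" and a: "a \<in> carrier A"
  shows "SI E G (\<lambda>w x. \<phi> (a \<odot>\<^bsub>W\<^esub> w) x) = SI E G (\<lambda>w x. \<phi> w (x \<ddagger>\<^bsub>X\<^esub> a))"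
proof -
  note cl = W.lmod_closed X.lmod_closed W.rcl X.rcl balanced_closed[OF \<phi>]
  have "SI E G (\<lambda>w x. \<phi> (a \<odot>\<^bsub>W\<^esub> w) x) = SI E G (\<lambda>w x. SI E G (\<lambda>w' x'. \<phi> (w' \<ddagger>\<^bsub>W\<^esub> e x' (a \<odot>\<^bsub>W\<^esub> w)) x))"
    using \<phi> a by (intro SI_cong C1[symmetric, OF G]) (simp_all add: balanced_def cl)
  also have "\<dots> = SI E G (\<lambda>w' x'. SI E G (\<lambda>w x. \<phi> (w' \<ddagger>\<^bsub>W\<^esub> e x' (a \<odot>\<^bsub>W\<^esub> w)) x))"
    using a by (intro SI_SI[OF G]) (simp add: cl)
  also have "\<dots> = SI E G (\<lambda>w' x'. SI E G (\<lambda>w x. \<phi> w' (e (x' \<ddagger>\<^bsub>X\<^esub> a) w \<odot>\<^bsub>X\<^esub> x)))"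
    using a \<phi> by (intro SI_cong) (simp add: cl balanced_def e_bal)
  also have "\<dots> = SI E G (\<lambda>w' x'. \<phi> w' (x' \<ddagger>\<^bsub>X\<^esub> a))"
    using \<phi> a by (intro SI_cong C2[OF G]) (simp_all add: balanced_def cl)
  finally show ?thesis .
qed

end

context dual
begin

interpretation sw: dual "swapd E" by (rule dual_swapd) (rule dual_axioms)

text \<open>Mirror images of the statements about \<open>SI\<close>: \<open>C3\<close> arises from
  \<open>C2\<close> and \<open>C4\<close> from \<open>C1\<close>.\<close>

lemmas SJ_cong = sw.SI_cong[simplified]
lemmas SJ_closed [simp] = sw.SI_closed[simplified]
lemmas SJ_hom = sw.SI_hom[simplified]
lemmas SJ_add = sw.SI_add[simplified]
lemmas SJ_SJ = sw.SI_SI[simplified]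
lemmas SJ_SI = sw.SI_SJ[simplified]
lemmas e'_cl [simp] = sw.e_cl[simplified]
lemmas C3 = sw.C2[simplified]
lemmas C4 = sw.C1[simplified]
lemmas coev'_central = sw.coev_central[simplified]

end

section \<open>Operator representations\<close>

text \<open>Operators on an abelian group: \<open>sl\<close> for a, \<open>tr\<close> for a-bar,
  \<open>PP\<close> for (x, \<omega>) and \<open>QQ\<close> for (\<omega>, x). Describing a module
  by its operators allows tensor products and inner homs to be formed and compared on generators
  alone.\<close>

record ('a, 'w, 'x, 'v) rep = "'v ring" +
  sl :: "'a \<Rightarrow> 'v \<Rightarrow> 'v"
  tr :: "'a \<Rightarrow> 'v \<Rightarrow> 'v"
  PP :: "'x \<Rightarrow> 'w \<Rightarrow> 'v \<Rightarrow> 'v"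
  QQ :: "'w \<Rightarrow> 'x \<Rightarrow> 'v \<Rightarrow> 'v"

definition swapr :: "('a, 'w, 'x, 'v) rep \<Rightarrow> ('a, 'x, 'w, 'v) rep" where
  "swapr V = \<lparr>carrier = carrier V, mult = mult V, one = one V, zero = zero V, add = add V,
     sl = sl V, tr = tr V, PP = QQ V, QQ = PP V\<rparr>"

lemma swapr_simps [simp]:
  "carrier (swapr V) = carrier V" "mult (swapr V) = mult V" "one (swapr V) = one V" "zero (swapr V) = zero V" "add (swapr V) = add V"
  "sl (swapr V) = sl V" "tr (swapr V) = tr V" "PP (swapr V) = QQ V" "QQ (swapr V) = PP V"
  by (simp_all add: swapr_def)

definition bim :: "('a, 'w, 'x, 'v) rep \<Rightarrow> ('a, 'v) bimodule" where
  "bim V = \<lparr>carrier = carrier V, mult = undefined, one = undefined, zero = zero V, add = add V,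
     smult = sl V, rsmult = (\<lambda>v a. tr V a v)\<rparr>"

lemma bim_simps [simp]:
  "carrier (bim V) = carrier V" "zero (bim V) = zero V" "add (bim V) = add V"
  "smult (bim V) = sl V" "rsmult (bim V) v a = tr V a v"
  by (simp_all add: bim_def)

lemma bim_swapr [simp]: "bim (swapr V) = bim V"
  by (simp add: bim_def)

locale prerep = dual E for E :: "('k, 'a, 'w, 'x) dual_data" +
  fixes V :: "('a, 'w, 'x, 'v) rep"
  assumes abelian_V: "abelian_group V"
    and bimod_V: "bimod (dalg E) (bim V)"
    and V_scal: "\<lbrakk>l \<in> carrier (dbase E); v \<in> carrier V\<rbrakk>
      \<Longrightarrow> sl V (l \<odot>\<^bsub>dalg E\<^esub> \<one>\<^bsub>dalg E\<^esub>) v = tr V (l \<odot>\<^bsub>dalg E\<^esub> \<one>\<^bsub>dalg E\<^esub>) v"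

text \<open>The bimodule laws of the (x, \<omega>) only; those of the (\<omega>, x) are the same
  laws for the swapped data. In the second variable left and right are reversed, because a-bar
  belongs to the opposite algebra: (x, \<omega>) a-bar = (x, a \<omega>).\<close>

locale hrep = prerep +
  assumes P_cl [simp]: "\<lbrakk>x \<in> carrier (dX E); w \<in> carrier (dW E); v \<in> carrier V\<rbrakk> \<Longrightarrow> PP V x w v \<in> carrier V"
    and P_add [simp]: "\<lbrakk>x \<in> carrier (dX E); w \<in> carrier (dW E); v \<in> carrier V; v' \<in> carrier V\<rbrakk>
      \<Longrightarrow> PP V x w (v \<oplus>\<^bsub>V\<^esub> v') = PP V x w v \<oplus>\<^bsub>V\<^esub> PP V x w v'"
    and P_addX [simp]: "\<lbrakk>x \<in> carrier (dX E); x' \<in> carrier (dX E); w \<in> carrier (dW E); v \<in> carrier V\<rbrakk>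
      \<Longrightarrow> PP V (x \<oplus>\<^bsub>dX E\<^esub> x') w v = PP V x w v \<oplus>\<^bsub>V\<^esub> PP V x' w v"
    and P_addW [simp]: "\<lbrakk>x \<in> carrier (dX E); w \<in> carrier (dW E); w' \<in> carrier (dW E); v \<in> carrier V\<rbrakk>
      \<Longrightarrow> PP V x (w \<oplus>\<^bsub>dW E\<^esub> w') v = PP V x w v \<oplus>\<^bsub>V\<^esub> PP V x w' v"
    and P_l [simp]: "\<lbrakk>a \<in> carrier (dalg E); x \<in> carrier (dX E); w \<in> carrier (dW E); v \<in> carrier V\<rbrakk>
      \<Longrightarrow> PP V (a \<odot>\<^bsub>dX E\<^esub> x) w v = sl V a (PP V x w v)"
    and P_r [simp]: "\<lbrakk>a \<in> carrier (dalg E); x \<in> carrier (dX E); w \<in> carrier (dW E); v \<in> carrier V\<rbrakk>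
      \<Longrightarrow> PP V (x \<ddagger>\<^bsub>dX E\<^esub> a) w v = PP V x w (sl V a v)"
    and P_l' [simp]: "\<lbrakk>a \<in> carrier (dalg E); x \<in> carrier (dX E); w \<in> carrier (dW E); v \<in> carrier V\<rbrakk>
      \<Longrightarrow> PP V x (a \<odot>\<^bsub>dW E\<^esub> w) v = PP V x w (tr V a v)"
    and P_r' [simp]: "\<lbrakk>a \<in> carrier (dalg E); x \<in> carrier (dX E); w \<in> carrier (dW E); v \<in> carrier V\<rbrakk>
      \<Longrightarrow> PP V x (w \<ddagger>\<^bsub>dW E\<^esub> a) v = tr V a (PP V x w v)"

text \<open>The first two relations of the bialgebroid of the bimodule; the other two are their mirror images.\<close>

locale rels = prerep +
  assumes H1: "\<lbrakk>x \<in> carrier (dX E); w \<in> carrier (dW E); v \<in> carrier V\<rbrakk>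
      \<Longrightarrow> SI E V (\<lambda>w' x'. QQ V w' x (PP V x' w v)) = tr V (dE E w x) v"
    and H2: "\<lbrakk>x \<in> carrier (dX E); w \<in> carrier (dW E); v \<in> carrier V\<rbrakk>
      \<Longrightarrow> SJ E V (\<lambda>y r. PP V x r (QQ V w y v)) = sl V (de E x w) v"

text \<open>\<open>Q\<close> and \<open>R'\<close> are \<open>P\<close> and \<open>R\<close> for the
  mirror image. They contribute the laws of \<open>QQ\<close> and the third and fourth relations,
  available as \<open>H3\<close> and \<open>H4\<close>.\<close>

locale rep = P: hrep E V + Q: hrep "swapd E" "swapr V" + R: rels E V + R': rels "swapd E" "swapr V"
  for E :: "('k, 'a, 'w, 'x) dual_data" and V :: "('a, 'w, 'x, 'v) rep"

lemma swapd_swapd [simp]: "swapd (swapd E) = E"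
  by (simp add: swapd_def)

lemma swapr_swapr [simp]: "swapr (swapr V) = V"
  by (simp add: swapr_def)

lemma rep_swap: "rep E V \<Longrightarrow> rep (swapd E) (swapr V)"
  by (simp add: rep_def)

lemma finsum_cong_group:
  fixes G :: "('g, 'c) ring_scheme" and G' :: "('g, 'd) ring_scheme"
  assumes "carrier G = carrier G'" "add G = add G'" "zero G = zero G'"
  shows "finsum G = finsum G'"
  using assms by (intro ext) (simp add: finsum_def finprod_def)

lemma SI_swapr [simp]: "SI E (swapr V) = SI E V" and SJ_swapr [simp]: "SJ E (swapr V) = SJ E V"
  by (simp_all add: SI_def SJ_def fun_eq_iff finsum_cong_group[of "swapr V" V])

lemma additive_map_swapr [simp]: "additive_map (swapr V) G h = additive_map V G h"
  by (simp add: additive_map_def)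

lemma abelian_group_cong:
  fixes G :: "('g, 'c) ring_scheme" and G' :: "('g, 'd) ring_scheme"
  assumes "abelian_group G" "carrier G = carrier G'" "add G = add G'" "zero G = zero G'"
  shows "abelian_group G'"
proof -
  interpret G: abelian_group G by fact
  show ?thesis
  proof (rule abelian_groupI)
    fix x assume "x \<in> carrier G'"
    then show "\<exists>y\<in>carrier G'. y \<oplus>\<^bsub>G'\<^esub> x = \<zero>\<^bsub>G'\<^esub>"
      using G.l_neg[of x] G.a_inv_closed[of x] by (auto simp: assms(2-)[symmetric])
  qed (simp_all add: assms(2-)[symmetric] G.a_assoc, metis G.a_comm)
qed

context prerep
begin

sublocale V: abelian_group V by (rule abelian_V)

lemmas sl_cl [simp] = left_module.lmod_closed[OF bimod.axioms(1)[OF bimod_V], simplified]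
lemmas sl_addA [simp] = left_module.lmod_l_distr[OF bimod.axioms(1)[OF bimod_V], simplified]
lemmas sl_add [simp] = left_module.lmod_r_distr[OF bimod.axioms(1)[OF bimod_V], simplified]
lemmas sl_mult [simp] = left_module.lmod_assoc[OF bimod.axioms(1)[OF bimod_V], simplified]
lemmas sl_one [simp] = left_module.lmod_one[OF bimod.axioms(1)[OF bimod_V], simplified]
lemmas tr_cl [simp] = bimod.rcl[OF bimod_V, simplified]
lemmas tr_addA [simp] = bimod.r_r_distr[OF bimod_V, simplified]
lemmas tr_add [simp] = bimod.r_l_distr[OF bimod_V, simplified]
lemmas tr_mult [simp] = bimod.r_assoc[OF bimod_V, simplified]
lemmas tr_one [simp] = bimod.r_one[OF bimod_V, simplified]
lemmas tr_sl [simp] = bimod.bi_assoc[OF bimod_V, simplified]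

end

context rep
begin

lemmas Q_cl [simp] = Q.P_cl[simplified]
lemmas Q_add [simp] = Q.P_add[simplified]
lemmas Q_addW [simp] = Q.P_addX[simplified]
lemmas Q_addX [simp] = Q.P_addW[simplified]
lemmas Q_l [simp] = Q.P_l[simplified]
lemmas Q_r [simp] = Q.P_r[simplified]
lemmas Q_l' [simp] = Q.P_l'[simplified]
lemmas Q_r' [simp] = Q.P_r'[simplified]
lemmas H3 = R'.H1[simplified]
lemmas H4 = R'.H2[simplified]

text \<open>The relation under an additive map, which is how it is met inside tensors, homs and
  iterated operators.\<close>

lemma H1h:
  assumes "abelian_group G" "additive_map V G h" "x \<in> carrier (dX E)" "w \<in> carrier (dW E)" "v \<in> carrier V"
  shows "SI E G (\<lambda>w' x'. h (QQ V w' x (PP V x' w v))) = h (tr V (dE E w x) v)"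
  using assms by (subst P.SI_hom[OF P.V.abelian_group_axioms assms(1,2), symmetric]) (simp_all add: R.H1)

lemma H2h:
  assumes "abelian_group G" "additive_map V G h" "x \<in> carrier (dX E)" "w \<in> carrier (dW E)" "v \<in> carrier V"
  shows "SJ E G (\<lambda>y r. h (PP V x r (QQ V w y v))) = h (sl V (de E x w) v)"
  using assms by (subst P.SJ_hom[OF P.V.abelian_group_axioms assms(1,2), symmetric]) (simp_all add: R.H2)

end

context rep
begin

interpretation sw: rep "swapd E" "swapr V" by (rule rep_swap) (rule rep_axioms)

lemmas H3h = sw.H1h[simplified]
lemmas H4h = sw.H2h[simplified]

end

section \<open>Tensor products of representations\<close>

text \<open>The operators dictated by the coproduct: (x, \<omega>) acts by (x, \<omega>_i) \<otimes>
  (x_i, \<omega>) and (\<omega>, x) by (\<omega>, y_j) \<otimes> (\<rho>_j, x).\<close>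

definition tens_rep ::
    "('k, 'a, 'w, 'x) dual_data \<Rightarrow> ('a, 'w, 'x, 'm) rep \<Rightarrow> ('a, 'w, 'x, 'n) rep \<Rightarrow> ('a, 'w, 'x, ('m, 'n) tens) rep" where
  "tens_rep E M N = (let T = tensor (dalg E) (bim M) (bim N); t = tens (dalg E) (bim M) (bim N) in
     \<lparr>carrier = carrier T, mult = undefined, one = undefined, zero = zero T, add = add T,
      sl = smult T, tr = (\<lambda>a u. rsmult T u a),
      PP = (\<lambda>x w. tens_ext T (\<lambda>m n. SI E T (\<lambda>w' x'. t (PP M x w' m) (PP N x' w n)))),
      QQ = (\<lambda>w x. tens_ext T (\<lambda>m n. SJ E T (\<lambda>y r. t (QQ M w y m) (QQ N r x n))))\<rparr>)"

lemma tens_rep_simps [simp]: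
  "carrier (tens_rep E M N) = carrier (tensor (dalg E) (bim M) (bim N))"
  "zero (tens_rep E M N) = zero (tensor (dalg E) (bim M) (bim N))"
  "add (tens_rep E M N) = add (tensor (dalg E) (bim M) (bim N))"
  "sl (tens_rep E M N) = smult (tensor (dalg E) (bim M) (bim N))"
  "tr (tens_rep E M N) a u = rsmult (tensor (dalg E) (bim M) (bim N)) u a"
  by (simp_all add: tens_rep_def Let_def)

text \<open>The coproducts of the two kinds of generators are mirror images of each other, so facts
  about \<open>PP\<close> on a tensor product yield those about \<open>QQ\<close>.\<close>

lemma tens_rep_swap: "tens_rep (swapd E) (swapr M) (swapr N) = swapr (tens_rep E M N)"
  by (rule rep.equality) (simp_all add: tens_rep_def Let_def)

lemma bim_tens_rep: "bim (tens_rep E M N) = tensor (dalg E) (bim M) (bim N)"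
  by (simp add: tens_rep_def bim_def tensor_def Let_def)

locale reps2 = M: rep E M + N: rep E N
  for E :: "('k, 'a, 'w, 'x) dual_data" and M :: "('a, 'w, 'x, 'm) rep" and N :: "('a, 'w, 'x, 'n) rep"
begin

sublocale T: bimod_pair "dalg E" "bim M" "bim N"
  using M.P.bimod_V N.P.bimod_V by (rule bimod_pair.intro)

abbreviation "T \<equiv> tensor (dalg E) (bim M) (bim N)"
abbreviation "tn \<equiv> tens (dalg E) (bim M) (bim N)"
abbreviation "TR \<equiv> tens_rep E M N"

lemma tn_cl [simp]: "m \<in> carrier M \<Longrightarrow> n \<in> carrier N \<Longrightarrow> tn m n \<in> carrier T"
  using T.tens_closed by simp

lemma tn_add1 [simp]: "\<lbrakk>m \<in> carrier M; m' \<in> carrier M; n \<in> carrier N\<rbrakk> \<Longrightarrow> tn (m \<oplus>\<^bsub>M\<^esub> m') n = tn m n \<oplus>\<^bsub>T\<^esub> tn m' n"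
  using T.tens_add_left by simp

lemma tn_add2 [simp]: "\<lbrakk>m \<in> carrier M; n \<in> carrier N; n' \<in> carrier N\<rbrakk> \<Longrightarrow> tn m (n \<oplus>\<^bsub>N\<^esub> n') = tn m n \<oplus>\<^bsub>T\<^esub> tn m n'"
  using T.tens_add_right by simp

lemma tn_tr [simp]: "\<lbrakk>m \<in> carrier M; n \<in> carrier N; a \<in> carrier (dalg E)\<rbrakk> \<Longrightarrow> tn (tr M a m) n = tn m (sl N a n)"
  using T.tens_balance by simp

lemma T_ab [simp]: "abelian_group T" by (rule T.abelian_group_tensor)

lemma tn_am1: "n \<in> carrier N \<Longrightarrow> additive_map M T (\<lambda>m. tn m n)" and
  tn_am2: "m \<in> carrier M \<Longrightarrow> additive_map N T (tn m)"
  by (rule additive_mapI; simp)+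

lemma T_induct [consumes 3, case_names tn]:
  assumes "additive_map T G f" "additive_map T G g" "t \<in> carrier T"
    "\<And>m n. \<lbrakk>m \<in> carrier M; n \<in> carrier N\<rbrakk> \<Longrightarrow> f (tn m n) = g (tn m n)" "abelian_group G"
  shows "f t = g t"
  using T.tensor_map_eqI[OF assms(5,1,2)] assms(3,4) by simp

lemma T_balancedI:
  assumes "\<And>m n. \<lbrakk>m \<in> carrier M; n \<in> carrier N\<rbrakk> \<Longrightarrow> \<phi> m n \<in> carrier G"
    and "\<And>m m' n. \<lbrakk>m \<in> carrier M; m' \<in> carrier M; n \<in> carrier N\<rbrakk> \<Longrightarrow> \<phi> (m \<oplus>\<^bsub>M\<^esub> m') n = \<phi> m n \<oplus>\<^bsub>G\<^esub> \<phi> m' n"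
    and "\<And>m n n'. \<lbrakk>m \<in> carrier M; n \<in> carrier N; n' \<in> carrier N\<rbrakk> \<Longrightarrow> \<phi> m (n \<oplus>\<^bsub>N\<^esub> n') = \<phi> m n \<oplus>\<^bsub>G\<^esub> \<phi> m n'"
    and "\<And>m n a. \<lbrakk>m \<in> carrier M; n \<in> carrier N; a \<in> carrier (dalg E)\<rbrakk> \<Longrightarrow> \<phi> (tr M a m) n = \<phi> m (sl N a n)"
  shows "balanced (dalg E) (bim M) (bim N) G \<phi>"
  using assms by (intro balancedI) simp_all

abbreviation "PT x w m n \<equiv> SI E T (\<lambda>w' x'. tn (PP M x w' m) (PP N x' w n))"

text \<open>An a-bar on m turns \<omega>_i into a \<omega>_i; by \<open>coev_central\<close> it
  becomes x_i a in the second factor, which is a acting on n.\<close>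

lemma PT_balanced:
  assumes [simp]: "x \<in> carrier (dX E)" "w \<in> carrier (dW E)"
  shows "balanced (dalg E) (bim M) (bim N) T (PT x w)"
proof (rule T_balancedI)
  fix m n a assume [simp]: "m \<in> carrier M" "n \<in> carrier N" "a \<in> carrier (dalg E)"
  have "balanced (dalg E) (dW E) (dX E) T (\<lambda>w' x'. tn (PP M x w' m) (PP N x' w n))"
    by (rule balancedI; simp)
  from M.P.coev_central[OF T_ab this, of a]
  show "PT x w (tr M a m) n = PT x w m (sl N a n)"
    by (simp cong: M.P.SI_cong)
qed (simp_all add: M.P.SI_add cong: M.P.SI_cong)

lemma PT_am: "\<lbrakk>x \<in> carrier (dX E); w \<in> carrier (dW E)\<rbrakk> \<Longrightarrow> additive_map T T (PP TR x w)"
  using T.tens_ext_additive[OF T_ab PT_balanced] by (simp add: tens_rep_def Let_def)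

lemma PT_tn: "\<lbrakk>x \<in> carrier (dX E); w \<in> carrier (dW E); m \<in> carrier M; n \<in> carrier N\<rbrakk> \<Longrightarrow>
    PP TR x w (tn m n) = PT x w m n"
  using T.tens_ext_tens[OF T_ab PT_balanced] by (simp add: tens_rep_def Let_def)

lemma sl_tn [simp]: "\<lbrakk>a \<in> carrier (dalg E); m \<in> carrier M; n \<in> carrier N\<rbrakk> \<Longrightarrow> a \<odot>\<^bsub>T\<^esub> tn m n = tn (sl M a m) n"
  using T.smult_tens by simp

lemma tr_tn [simp]: "\<lbrakk>a \<in> carrier (dalg E); m \<in> carrier M; n \<in> carrier N\<rbrakk> \<Longrightarrow> tn m n \<ddagger>\<^bsub>T\<^esub> a = tn m (tr N a n)"
  using T.rsmult_tens by simp

lemma prerep_T: "prerep E TR"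
proof (intro prerep.intro prerep_axioms.intro)
  show "dual E" ..
  show "abelian_group TR" by (rule abelian_group_cong[OF T_ab]) simp_all
  show "bimod (dalg E) (bim TR)" unfolding bim_tens_rep by (rule T.bimod_tensor)
  fix l t assume l: "l \<in> carrier (dbase E)" and t: "t \<in> carrier TR"
  have a: "l \<odot>\<^bsub>dalg E\<^esub> \<one>\<^bsub>dalg E\<^esub> \<in> carrier (dalg E)" using M.P.scal_A[OF l] .
  have "(l \<odot>\<^bsub>dalg E\<^esub> \<one>\<^bsub>dalg E\<^esub>) \<odot>\<^bsub>T\<^esub> t = t \<ddagger>\<^bsub>T\<^esub> (l \<odot>\<^bsub>dalg E\<^esub> \<one>\<^bsub>dalg E\<^esub>)"
  proof (rule T_induct[OF T.smult_additive[OF a] T.rsmult_additive[OF a] _ _ T_ab])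
    fix m n assume "m \<in> carrier M" "n \<in> carrier N"
    then show "(l \<odot>\<^bsub>dalg E\<^esub> \<one>\<^bsub>dalg E\<^esub>) \<odot>\<^bsub>T\<^esub> tn m n = tn m n \<ddagger>\<^bsub>T\<^esub> (l \<odot>\<^bsub>dalg E\<^esub> \<one>\<^bsub>dalg E\<^esub>)"
      using a by (simp add: M.P.V_scal[OF l] N.P.V_scal[OF l])
  qed (use t in simp)
  then show "sl TR (l \<odot>\<^bsub>dalg E\<^esub> \<one>\<^bsub>dalg E\<^esub>) t = tr TR (l \<odot>\<^bsub>dalg E\<^esub> \<one>\<^bsub>dalg E\<^esub>) t" by simp
qed

lemma SI_T_hom:
  assumes "additive_map T T h" "\<And>w x. \<lbrakk>w \<in> carrier (dW E); x \<in> carrier (dX E)\<rbrakk> \<Longrightarrow> \<phi> w x \<in> carrier T"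
  shows "h (SI E T \<phi>) = SI E T (\<lambda>w x. h (\<phi> w x))"
  by (rule M.P.SI_hom[OF T_ab T_ab]) fact+

lemma SJ_T_hom:
  assumes "additive_map T T h" "\<And>w x. \<lbrakk>w \<in> carrier (dW E); x \<in> carrier (dX E)\<rbrakk> \<Longrightarrow> \<phi> x w \<in> carrier T"
  shows "h (SJ E T \<phi>) = SJ E T (\<lambda>x w. h (\<phi> x w))"
  by (rule M.P.SJ_hom[OF T_ab T_ab]) (use assms in auto)

lemma hrep_T: "hrep E TR"
proof (intro hrep.intro hrep_axioms.intro)
  show "prerep E TR" by (rule prerep_T)
  note am = T_ab additive_map_sub[OF T_ab PT_am PT_am T_ab]
    additive_map_comp[OF PT_am T.smult_additive] additive_map_comp[OF PT_am T.rsmult_additive]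
    additive_map_comp[OF T.smult_additive PT_am] additive_map_comp[OF T.rsmult_additive PT_am]
  note cl = M.P.X.lmod_closed M.P.X.rcl M.P.W.lmod_closed M.P.W.rcl
  note s = SI_T_hom[OF T.smult_additive] SI_T_hom[OF T.rsmult_additive]
  show "PP TR x w v \<in> carrier TR" if "x \<in> carrier (dX E)" "w \<in> carrier (dW E)" "v \<in> carrier TR" for x w v
    using that additive_map_closed[OF PT_am] by simp
  show "PP TR x w (v \<oplus>\<^bsub>TR\<^esub> v') = PP TR x w v \<oplus>\<^bsub>TR\<^esub> PP TR x w v'"
    if "x \<in> carrier (dX E)" "w \<in> carrier (dW E)" "v \<in> carrier TR" "v' \<in> carrier TR" for x w v v'
    using that additive_map_add[OF PT_am] by simp
  show "PP TR (x \<oplus>\<^bsub>dX E\<^esub> x') w v = PP TR x w v \<oplus>\<^bsub>TR\<^esub> PP TR x' w v"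
    if [simp]: "x \<in> carrier (dX E)" "x' \<in> carrier (dX E)" "w \<in> carrier (dW E)" and v: "v \<in> carrier TR" for x x' w v
    unfolding tens_rep_simps
    by (rule T_induct[where t = v])
       (use v in \<open>auto intro!: PT_am am simp: PT_tn M.P.SI_add cong: M.P.SI_cong\<close>)
  show "PP TR x (w \<oplus>\<^bsub>dW E\<^esub> w') v = PP TR x w v \<oplus>\<^bsub>TR\<^esub> PP TR x w' v"
    if [simp]: "x \<in> carrier (dX E)" "w' \<in> carrier (dW E)" "w \<in> carrier (dW E)" and v: "v \<in> carrier TR" for x w' w v
    unfolding tens_rep_simps
    by (rule T_induct[where t = v])
       (use v in \<open>auto intro!: PT_am am simp: PT_tn M.P.SI_add cong: M.P.SI_cong\<close>)
  fix a x w v assume [simp]: "a \<in> carrier (dalg E)" "x \<in> carrier (dX E)" "w \<in> carrier (dW E)" and v: "v \<in> carrier TR"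
  show "PP TR (a \<odot>\<^bsub>dX E\<^esub> x) w v = sl TR a (PP TR x w v)"
    unfolding tens_rep_simps
    by (rule T_induct[where t = v])
       (use v in \<open>auto intro!: PT_am am simp: PT_tn s cl cong: M.P.SI_cong\<close>)
  show "PP TR (x \<ddagger>\<^bsub>dX E\<^esub> a) w v = PP TR x w (sl TR a v)"
    unfolding tens_rep_simps
    by (rule T_induct[where t = v])
       (use v in \<open>auto intro!: PT_am am simp: PT_tn cl cong: M.P.SI_cong\<close>)
  show "PP TR x (a \<odot>\<^bsub>dW E\<^esub> w) v = PP TR x w (tr TR a v)"
    unfolding tens_rep_simps
    by (rule T_induct[where t = v])
       (use v in \<open>auto intro!: PT_am am simp: PT_tn cl cong: M.P.SI_cong\<close>)
  show "PP TR x (w \<ddagger>\<^bsub>dW E\<^esub> a) v = tr TR a (PP TR x w v)"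
    unfolding tens_rep_simps
    by (rule T_induct[where t = v])
       (use v in \<open>auto intro!: PT_am am simp: PT_tn s cl cong: M.P.SI_cong\<close>)
qed

end

lemma reps2_swap: "reps2 E M N \<Longrightarrow> reps2 (swapd E) (swapr M) (swapr N)"
  by (simp add: reps2_def rep_swap)

context reps2
begin

interpretation sw: reps2 "swapd E" "swapr M" "swapr N"
  by (rule reps2_swap) (rule reps2_axioms)

lemmas QT_am = sw.PT_am[unfolded tens_rep_swap, simplified]
lemmas QT_tn = sw.PT_tn[unfolded tens_rep_swap, simplified]

lemma SI_am:
  assumes "\<And>w x. \<lbrakk>w \<in> carrier (dW E); x \<in> carrier (dX E)\<rbrakk> \<Longrightarrow> additive_map T T (h w x)"
  shows "additive_map T T (\<lambda>t. SI E T (\<lambda>w x. h w x t))"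
  by (rule additive_mapI)
     (use additive_map_closed[OF assms] additive_map_add[OF assms] in \<open>simp_all add: M.P.SI_add cong: M.P.SI_cong\<close>)

lemma SJ_am:
  assumes "\<And>w x. \<lbrakk>w \<in> carrier (dW E); x \<in> carrier (dX E)\<rbrakk> \<Longrightarrow> additive_map T T (h x w)"
  shows "additive_map T T (\<lambda>t. SJ E T (\<lambda>x w. h x w t))"
  by (rule additive_mapI)
     (use additive_map_closed[OF assms] additive_map_add[OF assms] in \<open>simp_all add: M.P.SJ_add cong: M.P.SJ_cong\<close>)

text \<open>For the first relation the sums are reordered so that the operators on m collapse first.
  An element of \<open>A\<close> remains, which crosses the tensor sign and contracts one further
  sum, leaving the same relation on n. For the second relation the roles of m and n are
  exchanged.\<close>

lemma rels_T: "rels E TR"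
proof (intro rels.intro rels_axioms.intro)
  show "prerep E TR" by (rule prerep_T)
  have eq: "SI E TR = SI E T" "SJ E TR = SJ E T"
    by (simp_all add: SI_def SJ_def fun_eq_iff finsum_cong_group[of TR T])
  fix x w t assume xw [simp]: "x \<in> carrier (dX E)" "w \<in> carrier (dW E)" and t: "t \<in> carrier TR"
  show "SI E TR (\<lambda>w' x'. QQ TR w' x (PP TR x' w t)) = tr TR (dE E w x) t"
    unfolding eq tens_rep_simps
  proof (rule T_induct[where t = t])
    fix m n assume mn [simp]: "m \<in> carrier M" "n \<in> carrier N"
    let ?f = "\<lambda>w1 x1 w2 x2 y r. tn (QQ M w1 y (PP M x1 w2 m)) (QQ N r x (PP N x2 w n))"
    have "SI E T (\<lambda>w1 x1. QQ TR w1 x (PP TR x1 w (tn m n))) =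
      SI E T (\<lambda>w1 x1. SI E T (\<lambda>w2 x2. SJ E T (?f w1 x1 w2 x2)))"
      by (intro M.P.SI_cong) (simp add: PT_tn SI_T_hom[OF QT_am] QT_tn cong: M.P.SI_cong)
    also have "\<dots> = SI E T (\<lambda>w2 x2. SI E T (\<lambda>w1 x1. SJ E T (?f w1 x1 w2 x2)))"
      by (intro M.P.SI_SI) simp_all
    also have "\<dots> = SI E T (\<lambda>w2 x2. SJ E T (\<lambda>y r. SI E T (\<lambda>w1 x1. ?f w1 x1 w2 x2 y r)))"
      by (intro M.P.SI_cong M.P.SI_SJ) simp_all
    also have "\<dots> = SI E T (\<lambda>w2 x2. SJ E T (\<lambda>y r. tn m (QQ N (dE E w2 y \<odot>\<^bsub>dW E\<^esub> r) x (PP N x2 w n))))"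
      by (intro M.P.SI_cong M.P.SJ_cong) (simp add: M.H1h[OF T_ab tn_am1])
    also have "\<dots> = SI E T (\<lambda>w2 x2. tn m (QQ N w2 x (PP N x2 w n)))"
      by (intro M.P.SI_cong M.P.C3[OF T_ab]) (simp_all add: additive_mapI)
    also have "\<dots> = tn m n \<ddagger>\<^bsub>T\<^esub> dE E w x"
      by (simp add: N.H1h[OF T_ab tn_am2])
    finally show "SI E T (\<lambda>w1 x1. QQ TR w1 x (PP TR x1 w (tn m n))) = tn m n \<ddagger>\<^bsub>T\<^esub> dE E w x" .
  qed (use t in \<open>auto intro!: SI_am additive_map_comp[OF PT_am QT_am] T.rsmult_additive\<close>)
  show "SJ E TR (\<lambda>y r. PP TR x r (QQ TR w y t)) = sl TR (de E x w) t"
    unfolding eq tens_rep_simps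
  proof (rule T_induct[where t = t])
    fix m n assume mn [simp]: "m \<in> carrier M" "n \<in> carrier N"
    let ?f = "\<lambda>y r y' r' w' x'. tn (PP M x w' (QQ M w y' m)) (PP N x' r (QQ N r' y n))"
    have "SJ E T (\<lambda>y r. PP TR x r (QQ TR w y (tn m n))) =
      SJ E T (\<lambda>y r. SJ E T (\<lambda>y' r'. SI E T (?f y r y' r')))"
      by (intro M.P.SJ_cong) (simp add: QT_tn SJ_T_hom[OF PT_am] PT_tn cong: M.P.SJ_cong)
    also have "\<dots> = SJ E T (\<lambda>y' r'. SJ E T (\<lambda>y r. SI E T (?f y r y' r')))"
      by (intro M.P.SJ_SJ) simp_all
    also have "\<dots> = SJ E T (\<lambda>y' r'. SI E T (\<lambda>w' x'. SJ E T (\<lambda>y r. ?f y r y' r' w' x')))"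
      by (intro M.P.SJ_cong M.P.SJ_SI) simp_all
    \<comment> \<open>The second relation on n leaves ev(x' \<otimes> r') there; moved to m, it
      turns w' into a multiple of a basis form, ready for \<open>C1\<close>.\<close>
    also have "\<dots> = SJ E T (\<lambda>y' r'. SI E T (\<lambda>w' x'. tn (PP M x (w' \<ddagger>\<^bsub>dW E\<^esub> de E x' r') (QQ M w y' m)) n))"
      by (intro M.P.SJ_cong M.P.SI_cong) (simp add: N.H2h[OF T_ab tn_am2])
    also have "\<dots> = SJ E T (\<lambda>y' r'. tn (PP M x r' (QQ M w y' m)) n)"
      by (intro M.P.SJ_cong M.P.C1[OF T_ab]) (simp_all add: additive_mapI)
    also have "\<dots> = de E x w \<odot>\<^bsub>T\<^esub> tn m n"
      by (simp add: M.H2h[OF T_ab tn_am1])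
    finally show "SJ E T (\<lambda>y r. PP TR x r (QQ TR w y (tn m n))) = de E x w \<odot>\<^bsub>T\<^esub> tn m n" .
  qed (use t in \<open>auto intro!: SJ_am additive_map_comp[OF QT_am PT_am] T.smult_additive\<close>)
qed

end

text \<open>The missing half of the laws is the proved half for the swapped factors.\<close>

lemma rep_tens:
  assumes "rep E M" "rep E N"
  shows "rep E (tens_rep E M N)"
proof -
  have r: "reps2 E M N" using assms by (rule reps2.intro)
  show ?thesis
    using reps2.hrep_T[OF r] reps2.rels_T[OF r] reps2.hrep_T[OF reps2_swap[OF r]] reps2.rels_T[OF reps2_swap[OF r]]
    unfolding rep_def tens_rep_swap by simp
qed

section \<open>Inner homs of representations\<close>

text \<open>The given formulas for the action of the bialgebroid of the bimodule. Restriction to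
  \<open>M\<close> keeps the results extensional, so that homs are equal once they agree on
  \<open>M\<close>.\<close>

definition rhom_rep ::
    "('k, 'a, 'w, 'x) dual_data \<Rightarrow> ('a, 'w, 'x, 'm) rep \<Rightarrow> ('a, 'w, 'x, 'n) rep \<Rightarrow> ('a, 'w, 'x, 'm \<Rightarrow> 'n) rep" where
  "rhom_rep E M N = (let F = right_inner_hom (dalg E) (bim M) (bim N) in
     \<lparr>carrier = carrier F, mult = undefined, one = undefined, zero = zero F, add = add F,
      sl = smult F, tr = (\<lambda>a f. rsmult F f a),
      PP = (\<lambda>x w f. \<lambda>m\<in>carrier M. SJ E N (\<lambda>y r. PP N x r (f (QQ M w y m)))),
      QQ = (\<lambda>w y f. \<lambda>m\<in>carrier M. SI E N (\<lambda>w' x'. QQ N w x' (f (PP M y w' m))))\<rparr>)"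

definition lhom_rep ::
    "('k, 'a, 'w, 'x) dual_data \<Rightarrow> ('a, 'w, 'x, 'm) rep \<Rightarrow> ('a, 'w, 'x, 'n) rep \<Rightarrow> ('a, 'w, 'x, 'm \<Rightarrow> 'n) rep" where
  "lhom_rep E M N = (let F = left_inner_hom (dalg E) (bim M) (bim N) in
     \<lparr>carrier = carrier F, mult = undefined, one = undefined, zero = zero F, add = add F,
      sl = smult F, tr = (\<lambda>a f. rsmult F f a),
      PP = (\<lambda>x w g. \<lambda>m\<in>carrier M. SJ E N (\<lambda>y r. PP N y w (g (QQ M r x m)))),
      QQ = (\<lambda>w y g. \<lambda>m\<in>carrier M. SI E N (\<lambda>w' x'. QQ N w' y (g (PP M x' w m))))\<rparr>)"

text \<open>The mirror symmetry exchanges the formulas for (x, \<omega>) and (\<omega>, y), while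
  left and right homs are each preserved.\<close>

lemma rhom_rep_swap: "rhom_rep (swapd E) (swapr M) (swapr N) = swapr (rhom_rep E M N)"
  by (rule rep.equality) (simp_all add: rhom_rep_def Let_def)

lemma lhom_rep_swap: "lhom_rep (swapd E) (swapr M) (swapr N) = swapr (lhom_rep E M N)"
  by (rule rep.equality) (simp_all add: lhom_rep_def Let_def)

text \<open>Common to right homs, left homs and endomorphisms: groups of extensional functions with
  pointwise operations.\<close>

lemma hom_group:
  assumes N: "abelian_group N"
    and F: "carrier F \<subseteq> extensional S" "\<And>f m. \<lbrakk>f \<in> carrier F; m \<in> S\<rbrakk> \<Longrightarrow> f m \<in> carrier N"
    and ops: "\<zero>\<^bsub>F\<^esub> = (\<lambda>m\<in>S. \<zero>\<^bsub>N\<^esub>)" "\<And>f g. f \<oplus>\<^bsub>F\<^esub> g = (\<lambda>m\<in>S. f m \<oplus>\<^bsub>N\<^esub> g m)"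
    and cl: "\<zero>\<^bsub>F\<^esub> \<in> carrier F" "\<And>f g. \<lbrakk>f \<in> carrier F; g \<in> carrier F\<rbrakk> \<Longrightarrow> f \<oplus>\<^bsub>F\<^esub> g \<in> carrier F"
      "\<And>f. f \<in> carrier F \<Longrightarrow> (\<lambda>m\<in>S. \<ominus>\<^bsub>N\<^esub> f m) \<in> carrier F"
  shows "abelian_group F"
proof -
  interpret N: abelian_group N by fact
  have ext: "f = g" if "f \<in> carrier F" "g \<in> carrier F" "\<And>m. m \<in> S \<Longrightarrow> f m = g m" for f g
    using that F(1) by (blast intro: extensionalityI)
  show ?thesis
  proof (rule abelian_groupI)
    fix f g h assume [simp]: "f \<in> carrier F" "g \<in> carrier F" "h \<in> carrier F"
    show "(f \<oplus>\<^bsub>F\<^esub> g) \<oplus>\<^bsub>F\<^esub> h = f \<oplus>\<^bsub>F\<^esub> (g \<oplus>\<^bsub>F\<^esub> h)"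
      by (rule ext) (simp_all add: cl(2), simp add: ops(2) F(2) N.a_assoc)
  next
    fix f g assume [simp]: "f \<in> carrier F" "g \<in> carrier F"
    show "f \<oplus>\<^bsub>F\<^esub> g = g \<oplus>\<^bsub>F\<^esub> f"
      by (rule ext) (simp_all add: cl(2), simp add: ops(2) F(2) N.a_comm)
  next
    fix f assume [simp]: "f \<in> carrier F"
    show "\<zero>\<^bsub>F\<^esub> \<oplus>\<^bsub>F\<^esub> f = f"
      by (rule ext) (simp_all add: cl(1,2), simp add: ops F(2))
    have "(\<lambda>m\<in>S. \<ominus>\<^bsub>N\<^esub> f m) \<oplus>\<^bsub>F\<^esub> f = \<zero>\<^bsub>F\<^esub>"
      by (rule ext) (simp_all add: cl, simp add: ops F(2) N.l_neg)
    then show "\<exists>g\<in>carrier F. g \<oplus>\<^bsub>F\<^esub> f = \<zero>\<^bsub>F\<^esub>" using cl(3)[of f] by auto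
  qed (use cl in auto)
qed

context rep
begin

lemma sl_am: "a \<in> carrier (dalg E) \<Longrightarrow> additive_map V V (sl V a)"
  and tr_am: "a \<in> carrier (dalg E) \<Longrightarrow> additive_map V V (tr V a)"
  and P_am: "\<lbrakk>x \<in> carrier (dX E); w \<in> carrier (dW E)\<rbrakk> \<Longrightarrow> additive_map V V (PP V x w)"
  and Q_am: "\<lbrakk>x \<in> carrier (dX E); w \<in> carrier (dW E)\<rbrakk> \<Longrightarrow> additive_map V V (QQ V w x)"
  by (rule additive_mapI; simp)+

lemmas SIs = P.SI_hom[OF P.V.abelian_group_axioms P.V.abelian_group_axioms]
lemmas SJs = P.SJ_hom[OF P.V.abelian_group_axioms P.V.abelian_group_axioms]
lemmas op_SI = SIs[OF sl_am] SIs[OF tr_am] SIs[OF P_am] SIs[OF Q_am]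
lemmas op_SJ = SJs[OF sl_am] SJs[OF tr_am] SJs[OF P_am] SJs[OF Q_am]

end

subsection \<open>Right module maps\<close>

context reps2
begin

abbreviation "RH \<equiv> rhom_rep E M N"

lemma RH_iff: "f \<in> carrier RH \<longleftrightarrow> f \<in> extensional (carrier M) \<and> additive_map M N f \<and>
   (\<forall>a\<in>carrier (dalg E). \<forall>m\<in>carrier M. f (tr M a m) = tr N a (f m))"
  by (auto simp: rhom_rep_def Let_def right_inner_hom_def right_map_def additive_map_def)

lemma RH_ops: "\<zero>\<^bsub>RH\<^esub> = (\<lambda>m\<in>carrier M. \<zero>\<^bsub>N\<^esub>)" "f \<oplus>\<^bsub>RH\<^esub> g = (\<lambda>m\<in>carrier M. f m \<oplus>\<^bsub>N\<^esub> g m)"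
  "sl RH a f = (\<lambda>m\<in>carrier M. sl N a (f m))" "tr RH a f = (\<lambda>m\<in>carrier M. f (sl M a m))"
  "PP RH x w f = (\<lambda>m\<in>carrier M. SJ E N (\<lambda>y r. PP N x r (f (QQ M w y m))))"
  "QQ RH w y f = (\<lambda>m\<in>carrier M. SI E N (\<lambda>w' x'. QQ N w x' (f (PP M y w' m))))"
  by (auto simp: rhom_rep_def Let_def right_inner_hom_def)

lemma RH_cl: "f \<in> carrier RH \<Longrightarrow> m \<in> carrier M \<Longrightarrow> f m \<in> carrier N"
  and RH_add: "f \<in> carrier RH \<Longrightarrow> m \<in> carrier M \<Longrightarrow> m' \<in> carrier M \<Longrightarrow> f (m \<oplus>\<^bsub>M\<^esub> m') = f m \<oplus>\<^bsub>N\<^esub> f m'"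
  and RH_tr: "f \<in> carrier RH \<Longrightarrow> a \<in> carrier (dalg E) \<Longrightarrow> m \<in> carrier M \<Longrightarrow> f (tr M a m) = tr N a (f m)"
  and RH_am: "f \<in> carrier RH \<Longrightarrow> additive_map M N f"
  by (auto simp: RH_iff additive_map_def)

lemma RH_I:
  assumes "\<And>m. m \<in> carrier M \<Longrightarrow> \<phi> m \<in> carrier N"
    "\<And>m m'. \<lbrakk>m \<in> carrier M; m' \<in> carrier M\<rbrakk> \<Longrightarrow> \<phi> (m \<oplus>\<^bsub>M\<^esub> m') = \<phi> m \<oplus>\<^bsub>N\<^esub> \<phi> m'"
    "\<And>a m. \<lbrakk>a \<in> carrier (dalg E); m \<in> carrier M\<rbrakk> \<Longrightarrow> \<phi> (tr M a m) = tr N a (\<phi> m)"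
  shows "(\<lambda>m\<in>carrier M. \<phi> m) \<in> carrier RH"
  using assms by (auto simp: RH_iff intro!: additive_mapI)

lemma RH_eqI: "\<lbrakk>f \<in> carrier RH; g \<in> carrier RH; \<And>m. m \<in> carrier M \<Longrightarrow> f m = g m\<rbrakk> \<Longrightarrow> f = g"
  by (auto simp: RH_iff intro: extensionalityI)

lemma N_am_inv:
  "\<lbrakk>additive_map N N h; n \<in> carrier N\<rbrakk> \<Longrightarrow> h (\<ominus>\<^bsub>N\<^esub> n) = \<ominus>\<^bsub>N\<^esub> h n"
  by (rule additive_map_inv) unfold_locales

lemma N_am_zero: "additive_map N N h \<Longrightarrow> h \<zero>\<^bsub>N\<^esub> = \<zero>\<^bsub>N\<^esub>"
  by (rule additive_map_zero) unfold_locales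

lemma abelian_RH: "abelian_group RH"
proof (rule hom_group[OF N.P.V.abelian_group_axioms])
  show "carrier RH \<subseteq> extensional (carrier M)" by (auto simp: RH_iff)
  show "\<zero>\<^bsub>RH\<^esub> \<in> carrier RH" unfolding RH_ops by (rule RH_I) (simp_all add: N_am_zero[OF N.tr_am])
  show "f \<oplus>\<^bsub>RH\<^esub> g \<in> carrier RH" if "f \<in> carrier RH" "g \<in> carrier RH" for f g
    unfolding RH_ops by (rule RH_I) (simp_all add: RH_cl[OF that(1)] RH_cl[OF that(2)] RH_add[OF that(1)]
      RH_add[OF that(2)] RH_tr[OF that(1)] RH_tr[OF that(2)] N.P.V.a_ac)
  show "(\<lambda>m\<in>carrier M. \<ominus>\<^bsub>N\<^esub> f m) \<in> carrier RH" if "f \<in> carrier RH" for f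
    by (rule RH_I) (simp_all add: RH_cl[OF that] RH_add[OF that] RH_tr[OF that] N.P.V.minus_add N_am_inv[OF N.tr_am])
qed (auto simp: RH_ops RH_cl)

lemma RH_eval: "m \<in> carrier M \<Longrightarrow> additive_map RH N (\<lambda>f. f m)"
  by (rule additive_mapI) (simp_all add: RH_cl RH_ops)

lemma RH_sl: "a \<in> carrier (dalg E) \<Longrightarrow> f \<in> carrier RH \<Longrightarrow> sl RH a f \<in> carrier RH"
  unfolding RH_ops by (rule RH_I) (simp_all add: RH_cl RH_add RH_tr)

lemma RH_tr': "a \<in> carrier (dalg E) \<Longrightarrow> f \<in> carrier RH \<Longrightarrow> tr RH a f \<in> carrier RH"
  unfolding RH_ops by (rule RH_I) (simp_all add: RH_cl RH_add RH_tr flip: M.P.tr_sl)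

lemma RH_add_cl: "f \<in> carrier RH \<Longrightarrow> g \<in> carrier RH \<Longrightarrow> f \<oplus>\<^bsub>RH\<^esub> g \<in> carrier RH"
  using abelian_RH by (rule abelian_groupE)

lemma prerep_RH: "prerep E RH"
proof (intro prerep.intro prerep_axioms.intro)
  show "dual E" ..
  show ab: "abelian_group RH" by (rule abelian_RH)
  note [simp] = RH_sl RH_tr' RH_add_cl
  show "bimod (dalg E) (bim RH)"
  proof (intro bimod.intro left_module.intro left_module_axioms.intro bimod_axioms.intro; (unfold bim_simps)?)
    show "ring (dalg E)" by unfold_locales
    show "abelian_group (bim RH)" by (rule abelian_group_cong[OF ab]) simp_all
    show "sl RH \<one>\<^bsub>dalg E\<^esub> f = f" "tr RH \<one>\<^bsub>dalg E\<^esub> f = f" if "f \<in> carrier RH" for f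
      using that by (auto intro!: RH_eqI, simp_all add: RH_ops RH_cl)
    fix r s f g assume [simp]: "r \<in> carrier (dalg E)" "s \<in> carrier (dalg E)" and f [simp]: "f \<in> carrier RH" and g [simp]: "g \<in> carrier RH"
    note [simp] = RH_cl[OF f] RH_cl[OF g] RH_add[OF f]
    show "sl RH r f \<in> carrier RH" "tr RH r f \<in> carrier RH" by simp_all
    show "sl RH (r \<oplus>\<^bsub>dalg E\<^esub> s) f = sl RH r f \<oplus>\<^bsub>RH\<^esub> sl RH s f"
      by (rule RH_eqI) (simp_all, simp add: RH_ops)
    show "sl RH r (f \<oplus>\<^bsub>RH\<^esub> g) = sl RH r f \<oplus>\<^bsub>RH\<^esub> sl RH r g"
      by (rule RH_eqI) (simp_all, simp add: RH_ops)
    show "sl RH (r \<otimes>\<^bsub>dalg E\<^esub> s) f = sl RH r (sl RH s f)"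
      by (rule RH_eqI) (simp_all, simp add: RH_ops)
    show "tr RH (r \<oplus>\<^bsub>dalg E\<^esub> s) f = tr RH r f \<oplus>\<^bsub>RH\<^esub> tr RH s f"
      by (rule RH_eqI) (simp_all, simp add: RH_ops)
    show "tr RH r (f \<oplus>\<^bsub>RH\<^esub> g) = tr RH r f \<oplus>\<^bsub>RH\<^esub> tr RH r g"
      by (rule RH_eqI) (simp_all, simp add: RH_ops)
    show "tr RH (r \<otimes>\<^bsub>dalg E\<^esub> s) f = tr RH s (tr RH r f)"
      by (rule RH_eqI) (simp_all, simp add: RH_ops)
    show "tr RH s (sl RH r f) = sl RH r (tr RH s f)"
      by (rule RH_eqI) (simp_all, simp add: RH_ops)
  qed
  fix l f assume l: "l \<in> carrier (dbase E)" and f: "f \<in> carrier RH"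
  have a: "l \<odot>\<^bsub>dalg E\<^esub> \<one>\<^bsub>dalg E\<^esub> \<in> carrier (dalg E)" using M.P.scal_A[OF l] .
  show "sl RH (l \<odot>\<^bsub>dalg E\<^esub> \<one>\<^bsub>dalg E\<^esub>) f = tr RH (l \<odot>\<^bsub>dalg E\<^esub> \<one>\<^bsub>dalg E\<^esub>) f"
    using a f by (intro RH_eqI)
     (simp_all, simp add: RH_ops M.P.V_scal[OF l] N.P.V_scal[OF l] RH_cl RH_tr)
qed

text \<open>An a-bar on m turns y_j into a y_j; \<open>coev'_central\<close> makes this \<rho>_j a,
  which is a-bar applied to the value.\<close>

lemma RH_P:
  assumes [simp]: "x \<in> carrier (dX E)" "w \<in> carrier (dW E)" and f: "f \<in> carrier RH"
  shows "PP RH x w f \<in> carrier RH"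
  unfolding RH_ops
proof (rule RH_I)
  note [simp] = RH_cl[OF f] RH_add[OF f] RH_tr[OF f]
  fix a m assume [simp]: "m \<in> carrier M" "a \<in> carrier (dalg E)"
  have "balanced (dalg E) (dX E) (dW E) N (\<lambda>y r. PP N x r (f (QQ M w y m)))"
    by (rule balancedI; simp)
  from M.P.coev'_central[OF N.P.V.abelian_group_axioms this, of a]
  show "SJ E N (\<lambda>y r. PP N x r (f (QQ M w y (tr M a m)))) = tr N a (SJ E N (\<lambda>y r. PP N x r (f (QQ M w y m))))"
    by (simp add: N.op_SJ cong: M.P.SJ_cong)
qed (simp_all add: RH_cl[OF f] RH_add[OF f] M.P.SJ_add N.P.V.abelian_group_axioms cong: M.P.SJ_cong)

lemma hrep_RH: "hrep E RH"
proof (intro hrep.intro hrep_axioms.intro)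
  show "prerep E RH" by (rule prerep_RH)
  note [simp] = RH_sl RH_tr' RH_add_cl RH_P
  note cl [simp] = M.P.X.lmod_closed M.P.X.rcl M.P.W.lmod_closed M.P.W.rcl N.P.V.abelian_group_axioms
  fix x w f assume [simp]: "x \<in> carrier (dX E)" "w \<in> carrier (dW E)" and f [simp]: "f \<in> carrier RH"
  note [simp] = RH_cl[OF f] RH_add[OF f] RH_tr[OF f]
  show "PP RH x w f \<in> carrier RH" by simp
  show "PP RH x w (f \<oplus>\<^bsub>RH\<^esub> f') = PP RH x w f \<oplus>\<^bsub>RH\<^esub> PP RH x w f'" if f': "f' \<in> carrier RH" for f'
    by (rule RH_eqI) (simp_all add: f', simp add: RH_ops M.P.SJ_add RH_cl[OF f'] cong: M.P.SJ_cong)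
  show "PP RH (x \<oplus>\<^bsub>dX E\<^esub> x') w f = PP RH x w f \<oplus>\<^bsub>RH\<^esub> PP RH x' w f" if "x' \<in> carrier (dX E)" for x'
    by (rule RH_eqI) (simp_all add: that, simp add: that RH_ops M.P.SJ_add cong: M.P.SJ_cong)
  show "PP RH x (w \<oplus>\<^bsub>dW E\<^esub> w') f = PP RH x w f \<oplus>\<^bsub>RH\<^esub> PP RH x w' f" if "w' \<in> carrier (dW E)" for w'
    by (rule RH_eqI) (simp_all add: that, simp add: that RH_ops M.P.SJ_add cong: M.P.SJ_cong)
  fix a assume [simp]: "a \<in> carrier (dalg E)"
  show "PP RH (a \<odot>\<^bsub>dX E\<^esub> x) w f = sl RH a (PP RH x w f)"
    by (rule RH_eqI) (simp_all, simp add: RH_ops N.op_SJ cong: M.P.SJ_cong)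
  show "PP RH (x \<ddagger>\<^bsub>dX E\<^esub> a) w f = PP RH x w (sl RH a f)"
    by (rule RH_eqI) (simp_all, simp add: RH_ops cong: M.P.SJ_cong)
  show "PP RH x (a \<odot>\<^bsub>dW E\<^esub> w) f = PP RH x w (tr RH a f)"
    by (rule RH_eqI) (simp_all, simp add: RH_ops cong: M.P.SJ_cong)
  show "PP RH x (w \<ddagger>\<^bsub>dW E\<^esub> a) f = tr RH a (PP RH x w f)"
    by (rule RH_eqI) (simp_all, simp add: RH_ops cong: M.P.SJ_cong)
qed

end

context reps2
begin

interpretation sw: reps2 "swapd E" "swapr M" "swapr N"
  by (rule reps2_swap) (rule reps2_axioms)

lemmas RH_Q = sw.RH_P[unfolded rhom_rep_swap, simplified]

text \<open>On a hom the operators of \<open>N\<close> compose in the given order and those of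
  \<open>M\<close> in the opposite one. So the first relation combines the first relation on
  \<open>N\<close> with the fourth on \<open>M\<close>, and the second combines the third on
  \<open>M\<close> with the second on \<open>N\<close>.\<close>

lemma rels_RH: "rels E RH"
proof (intro rels.intro rels_axioms.intro)
  show "prerep E RH" by (rule prerep_RH)
  note abN = N.P.V.abelian_group_axioms
  note [simp] = RH_sl RH_tr' RH_P RH_Q abelian_RH abN
  fix x w f assume xw [simp]: "x \<in> carrier (dX E)" "w \<in> carrier (dW E)" and f [simp]: "f \<in> carrier RH"
  note [simp] = RH_cl[OF f] RH_add[OF f] RH_tr[OF f]
  show "SI E RH (\<lambda>w' x'. QQ RH w' x (PP RH x' w f)) = tr RH (dE E w x) f"
  proof (rule RH_eqI)
    fix m assume m [simp]: "m \<in> carrier M"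
    let ?f = "\<lambda>w1 x1 w2 x2 y r. QQ N w1 x2 (PP N x1 r (f (QQ M w y (PP M x w2 m))))"
    have "SI E RH (\<lambda>w' x'. QQ RH w' x (PP RH x' w f)) m = SI E N (\<lambda>w1 x1. QQ RH w1 x (PP RH x1 w f) m)"
      by (rule M.P.SI_hom[OF abelian_RH abN RH_eval]) simp_all
    also have "\<dots> = SI E N (\<lambda>w1 x1. SI E N (\<lambda>w2 x2. SJ E N (?f w1 x1 w2 x2)))"
      by (intro M.P.SI_cong) (simp add: RH_ops N.op_SJ cong: M.P.SI_cong)
    also have "\<dots> = SI E N (\<lambda>w2 x2. SI E N (\<lambda>w1 x1. SJ E N (?f w1 x1 w2 x2)))"
      by (intro M.P.SI_SI) simp_all
    also have "\<dots> = SI E N (\<lambda>w2 x2. SJ E N (\<lambda>y r. SI E N (\<lambda>w1 x1. ?f w1 x1 w2 x2 y r)))"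
      by (intro M.P.SI_cong M.P.SI_SJ) simp_all
    also have "\<dots> = SI E N (\<lambda>w2 x2. SJ E N (\<lambda>y r. f (QQ M w (y \<ddagger>\<^bsub>dX E\<^esub> dE E r x2) (PP M x w2 m))))"
      by (intro M.P.SI_cong M.P.SJ_cong) (simp add: N.R.H1)
    also have "\<dots> = SI E N (\<lambda>w2 x2. f (QQ M w x2 (PP M x w2 m)))"
      by (intro M.P.SI_cong M.P.C4[OF abN]) (simp_all add: additive_mapI)
    also have "\<dots> = tr RH (dE E w x) f m"
      by (simp add: M.H4h[OF abN RH_am] RH_ops)
    finally show "SI E RH (\<lambda>w' x'. QQ RH w' x (PP RH x' w f)) m = tr RH (dE E w x) f m" .
  qed simp_all
  show "SJ E RH (\<lambda>y r. PP RH x r (QQ RH w y f)) = sl RH (de E x w) f"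
  proof (rule RH_eqI)
    fix m assume m [simp]: "m \<in> carrier M"
    let ?f = "\<lambda>y r y' r' w' x'. PP N x r' (QQ N w x' (f (PP M y w' (QQ M r y' m))))"
    have "SJ E RH (\<lambda>y r. PP RH x r (QQ RH w y f)) m = SJ E N (\<lambda>y r. PP RH x r (QQ RH w y f) m)"
      by (rule M.P.SJ_hom[OF abelian_RH abN RH_eval]) simp_all
    also have "\<dots> = SJ E N (\<lambda>y r. SJ E N (\<lambda>y' r'. SI E N (?f y r y' r')))"
      by (intro M.P.SJ_cong) (simp add: RH_ops N.op_SI cong: M.P.SJ_cong)
    also have "\<dots> = SJ E N (\<lambda>y' r'. SJ E N (\<lambda>y r. SI E N (?f y r y' r')))"
      by (intro M.P.SJ_SJ) simp_all
    also have "\<dots> = SJ E N (\<lambda>y' r'. SI E N (\<lambda>w' x'. SJ E N (\<lambda>y r. ?f y r y' r' w' x')))"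
      by (intro M.P.SJ_cong M.P.SJ_SI) simp_all
    also have "\<dots> = SJ E N (\<lambda>y' r'. SI E N (\<lambda>w' x'. PP N x r' (QQ N w (de E y' w' \<odot>\<^bsub>dX E\<^esub> x') (f m))))"
    \<comment> \<open>The third relation on \<open>M\<close> is used under \<open>f\<close> followed
      by operators of \<open>N\<close>. The element of \<open>A\<close> left over passes through
      \<open>f\<close> by right linearity and is absorbed into x'.\<close>
    proof (intro M.P.SJ_cong M.P.SI_cong)
      fix y' r' w' x' assume [simp]: "y' \<in> carrier (dX E)" "r' \<in> carrier (dW E)" "w' \<in> carrier (dW E)" "x' \<in> carrier (dX E)"
      have "SJ E N (\<lambda>y r. ?f y r y' r' w' x') = PP N x r' (QQ N w x' (f (tr M (de E y' w') m)))"
        by (rule M.H3h[OF abN, where h = "\<lambda>v. PP N x r' (QQ N w x' (f v))"]) (simp_all add: additive_mapI)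
      then show "SJ E N (\<lambda>y r. ?f y r y' r' w' x') = PP N x r' (QQ N w (de E y' w' \<odot>\<^bsub>dX E\<^esub> x') (f m))"
        by simp
    qed
    also have "\<dots> = SJ E N (\<lambda>y' r'. PP N x r' (QQ N w y' (f m)))"
      by (intro M.P.SJ_cong M.P.C2[OF abN]) (simp_all add: additive_mapI)
    also have "\<dots> = sl RH (de E x w) f m"
      by (simp add: N.R.H2 RH_ops)
    finally show "SJ E RH (\<lambda>y r. PP RH x r (QQ RH w y f)) m = sl RH (de E x w) f m" .
  qed simp_all
qed

end

lemma rep_rhom:
  assumes "rep E M" "rep E N"
  shows "rep E (rhom_rep E M N)"
proof -
  have r: "reps2 E M N" using assms by (rule reps2.intro)
  show ?thesis
    using reps2.hrep_RH[OF r] reps2.rels_RH[OF r] reps2.hrep_RH[OF reps2_swap[OF r]] reps2.rels_RH[OF reps2_swap[OF r]]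
    unfolding rep_def rhom_rep_swap by simp
qed

subsection \<open>Left module maps\<close>

context reps2
begin

abbreviation "LH \<equiv> lhom_rep E M N"

lemma LH_iff: "f \<in> carrier LH \<longleftrightarrow> f \<in> extensional (carrier M) \<and> additive_map M N f \<and>
   (\<forall>a\<in>carrier (dalg E). \<forall>m\<in>carrier M. f (sl M a m) = sl N a (f m))"
  by (auto simp: lhom_rep_def Let_def left_inner_hom_def left_map_def additive_map_def)

lemma LH_ops: "\<zero>\<^bsub>LH\<^esub> = (\<lambda>m\<in>carrier M. \<zero>\<^bsub>N\<^esub>)" "f \<oplus>\<^bsub>LH\<^esub> g = (\<lambda>m\<in>carrier M. f m \<oplus>\<^bsub>N\<^esub> g m)"
  "sl LH a f = (\<lambda>m\<in>carrier M. f (tr M a m))" "tr LH a f = (\<lambda>m\<in>carrier M. tr N a (f m))"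
  "PP LH x w f = (\<lambda>m\<in>carrier M. SJ E N (\<lambda>y r. PP N y w (f (QQ M r x m))))"
  "QQ LH w y f = (\<lambda>m\<in>carrier M. SI E N (\<lambda>w' x'. QQ N w' y (f (PP M x' w m))))"
  by (auto simp: lhom_rep_def Let_def left_inner_hom_def)

lemma LH_cl: "f \<in> carrier LH \<Longrightarrow> m \<in> carrier M \<Longrightarrow> f m \<in> carrier N"
  and LH_add: "f \<in> carrier LH \<Longrightarrow> m \<in> carrier M \<Longrightarrow> m' \<in> carrier M \<Longrightarrow> f (m \<oplus>\<^bsub>M\<^esub> m') = f m \<oplus>\<^bsub>N\<^esub> f m'"
  and LH_lin: "f \<in> carrier LH \<Longrightarrow> a \<in> carrier (dalg E) \<Longrightarrow> m \<in> carrier M \<Longrightarrow> f (sl M a m) = sl N a (f m)"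
  and LH_am: "f \<in> carrier LH \<Longrightarrow> additive_map M N f"
  by (auto simp: LH_iff additive_map_def)

lemma LH_I:
  assumes "\<And>m. m \<in> carrier M \<Longrightarrow> \<phi> m \<in> carrier N"
    "\<And>m m'. \<lbrakk>m \<in> carrier M; m' \<in> carrier M\<rbrakk> \<Longrightarrow> \<phi> (m \<oplus>\<^bsub>M\<^esub> m') = \<phi> m \<oplus>\<^bsub>N\<^esub> \<phi> m'"
    "\<And>a m. \<lbrakk>a \<in> carrier (dalg E); m \<in> carrier M\<rbrakk> \<Longrightarrow> \<phi> (sl M a m) = sl N a (\<phi> m)"
  shows "(\<lambda>m\<in>carrier M. \<phi> m) \<in> carrier LH"
  using assms by (auto simp: LH_iff intro!: additive_mapI)

lemma LH_eqI: "\<lbrakk>f \<in> carrier LH; g \<in> carrier LH; \<And>m. m \<in> carrier M \<Longrightarrow> f m = g m\<rbrakk> \<Longrightarrow> f = g"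
  by (auto simp: LH_iff intro: extensionalityI)

lemma abelian_LH: "abelian_group LH"
proof (rule hom_group[OF N.P.V.abelian_group_axioms])
  show "carrier LH \<subseteq> extensional (carrier M)" by (auto simp: LH_iff)
  show "\<zero>\<^bsub>LH\<^esub> \<in> carrier LH" unfolding LH_ops by (rule LH_I) (simp_all add: N_am_zero[OF N.sl_am])
  show "f \<oplus>\<^bsub>LH\<^esub> g \<in> carrier LH" if "f \<in> carrier LH" "g \<in> carrier LH" for f g
    unfolding LH_ops by (rule LH_I) (simp_all add: LH_cl[OF that(1)] LH_cl[OF that(2)] LH_add[OF that(1)]
      LH_add[OF that(2)] LH_lin[OF that(1)] LH_lin[OF that(2)] N.P.V.a_ac)
  show "(\<lambda>m\<in>carrier M. \<ominus>\<^bsub>N\<^esub> f m) \<in> carrier LH" if "f \<in> carrier LH" for f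
    by (rule LH_I) (simp_all add: LH_cl[OF that] LH_add[OF that] LH_lin[OF that] N.P.V.minus_add N_am_inv[OF N.sl_am])
qed (auto simp: LH_ops LH_cl)

lemma LH_eval: "m \<in> carrier M \<Longrightarrow> additive_map LH N (\<lambda>f. f m)"
  by (rule additive_mapI) (simp_all add: LH_cl LH_ops)

lemma LH_sl: "a \<in> carrier (dalg E) \<Longrightarrow> f \<in> carrier LH \<Longrightarrow> sl LH a f \<in> carrier LH"
  unfolding LH_ops by (rule LH_I) (simp_all add: LH_cl LH_add LH_lin)

lemma LH_tr: "a \<in> carrier (dalg E) \<Longrightarrow> f \<in> carrier LH \<Longrightarrow> tr LH a f \<in> carrier LH"
  unfolding LH_ops by (rule LH_I) (simp_all add: LH_cl LH_add LH_lin)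

lemma LH_add_cl: "f \<in> carrier LH \<Longrightarrow> g \<in> carrier LH \<Longrightarrow> f \<oplus>\<^bsub>LH\<^esub> g \<in> carrier LH"
  using abelian_LH by (rule abelian_groupE)

lemma prerep_LH: "prerep E LH"
proof (intro prerep.intro prerep_axioms.intro)
  show "dual E" ..
  show ab: "abelian_group LH" by (rule abelian_LH)
  note [simp] = LH_sl LH_tr LH_add_cl
  show "bimod (dalg E) (bim LH)"
  proof (intro bimod.intro left_module.intro left_module_axioms.intro bimod_axioms.intro; (unfold bim_simps)?)
    show "ring (dalg E)" by unfold_locales
    show "abelian_group (bim LH)" by (rule abelian_group_cong[OF ab]) simp_all
    show "sl LH \<one>\<^bsub>dalg E\<^esub> f = f" "tr LH \<one>\<^bsub>dalg E\<^esub> f = f" if "f \<in> carrier LH" for f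
      using that by (auto intro!: LH_eqI, simp_all add: LH_ops LH_cl)
    fix r s f g assume [simp]: "r \<in> carrier (dalg E)" "s \<in> carrier (dalg E)" and f [simp]: "f \<in> carrier LH" and g [simp]: "g \<in> carrier LH"
    note [simp] = LH_cl[OF f] LH_cl[OF g] LH_add[OF f]
    show "sl LH r f \<in> carrier LH" "tr LH r f \<in> carrier LH" by simp_all
    show "sl LH (r \<oplus>\<^bsub>dalg E\<^esub> s) f = sl LH r f \<oplus>\<^bsub>LH\<^esub> sl LH s f"
      by (rule LH_eqI) (simp_all, simp add: LH_ops)
    show "sl LH r (f \<oplus>\<^bsub>LH\<^esub> g) = sl LH r f \<oplus>\<^bsub>LH\<^esub> sl LH r g"
      by (rule LH_eqI) (simp_all, simp add: LH_ops)
    show "sl LH (r \<otimes>\<^bsub>dalg E\<^esub> s) f = sl LH r (sl LH s f)"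
      by (rule LH_eqI) (simp_all, simp add: LH_ops)
    show "tr LH (r \<oplus>\<^bsub>dalg E\<^esub> s) f = tr LH r f \<oplus>\<^bsub>LH\<^esub> tr LH s f"
      by (rule LH_eqI) (simp_all, simp add: LH_ops)
    show "tr LH r (f \<oplus>\<^bsub>LH\<^esub> g) = tr LH r f \<oplus>\<^bsub>LH\<^esub> tr LH r g"
      by (rule LH_eqI) (simp_all, simp add: LH_ops)
    show "tr LH (r \<otimes>\<^bsub>dalg E\<^esub> s) f = tr LH s (tr LH r f)"
      by (rule LH_eqI) (simp_all, simp add: LH_ops)
    show "tr LH s (sl LH r f) = sl LH r (tr LH s f)"
      by (rule LH_eqI) (simp_all, simp add: LH_ops)
  qed
  fix l f assume l: "l \<in> carrier (dbase E)" and f: "f \<in> carrier LH"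
  have a: "l \<odot>\<^bsub>dalg E\<^esub> \<one>\<^bsub>dalg E\<^esub> \<in> carrier (dalg E)" using M.P.scal_A[OF l] .
  show "sl LH (l \<odot>\<^bsub>dalg E\<^esub> \<one>\<^bsub>dalg E\<^esub>) f = tr LH (l \<odot>\<^bsub>dalg E\<^esub> \<one>\<^bsub>dalg E\<^esub>) f"
    using a f by (intro LH_eqI)
     (simp_all, simp add: LH_ops M.P.V_scal[OF l, symmetric] N.P.V_scal[OF l, symmetric] LH_cl LH_lin)
qed

text \<open>Here a acting on m turns \<rho>_j into \<rho>_j a, which \<open>coev'_central\<close>
  converts into a y_j, that is, a applied to the value.\<close>

lemma LH_P:
  assumes [simp]: "x \<in> carrier (dX E)" "w \<in> carrier (dW E)" and f: "f \<in> carrier LH"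
  shows "PP LH x w f \<in> carrier LH"
  unfolding LH_ops
proof (rule LH_I)
  note [simp] = LH_cl[OF f] LH_add[OF f] LH_lin[OF f]
  fix a m assume [simp]: "m \<in> carrier M" "a \<in> carrier (dalg E)"
  have "balanced (dalg E) (dX E) (dW E) N (\<lambda>y r. PP N y w (f (QQ M r x m)))"
    by (rule balancedI; simp)
  from M.P.coev'_central[OF N.P.V.abelian_group_axioms this, of a]
  show "SJ E N (\<lambda>y r. PP N y w (f (QQ M r x (sl M a m)))) = sl N a (SJ E N (\<lambda>y r. PP N y w (f (QQ M r x m))))"
    by (simp add: N.op_SJ cong: M.P.SJ_cong)
qed (simp_all add: LH_cl[OF f] LH_add[OF f] M.P.SJ_add N.P.V.abelian_group_axioms cong: M.P.SJ_cong)

lemma hrep_LH: "hrep E LH"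
proof (intro hrep.intro hrep_axioms.intro)
  show "prerep E LH" by (rule prerep_LH)
  note [simp] = LH_sl LH_tr LH_add_cl LH_P
  note cl [simp] = M.P.X.lmod_closed M.P.X.rcl M.P.W.lmod_closed M.P.W.rcl N.P.V.abelian_group_axioms
  fix x w f assume [simp]: "x \<in> carrier (dX E)" "w \<in> carrier (dW E)" and f [simp]: "f \<in> carrier LH"
  note [simp] = LH_cl[OF f] LH_add[OF f] LH_lin[OF f]
  show "PP LH x w f \<in> carrier LH" by simp
  show "PP LH x w (f \<oplus>\<^bsub>LH\<^esub> f') = PP LH x w f \<oplus>\<^bsub>LH\<^esub> PP LH x w f'" if f': "f' \<in> carrier LH" for f'
    by (rule LH_eqI) (simp_all add: f', simp add: LH_ops M.P.SJ_add LH_cl[OF f'] cong: M.P.SJ_cong)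
  show "PP LH (x \<oplus>\<^bsub>dX E\<^esub> x') w f = PP LH x w f \<oplus>\<^bsub>LH\<^esub> PP LH x' w f" if "x' \<in> carrier (dX E)" for x'
    by (rule LH_eqI) (simp_all add: that, simp add: that LH_ops M.P.SJ_add cong: M.P.SJ_cong)
  show "PP LH x (w \<oplus>\<^bsub>dW E\<^esub> w') f = PP LH x w f \<oplus>\<^bsub>LH\<^esub> PP LH x w' f" if "w' \<in> carrier (dW E)" for w'
    by (rule LH_eqI) (simp_all add: that, simp add: that LH_ops M.P.SJ_add cong: M.P.SJ_cong)
  fix a assume [simp]: "a \<in> carrier (dalg E)"
  show "PP LH (a \<odot>\<^bsub>dX E\<^esub> x) w f = sl LH a (PP LH x w f)"
    by (rule LH_eqI) (simp_all, simp add: LH_ops cong: M.P.SJ_cong)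
  show "PP LH (x \<ddagger>\<^bsub>dX E\<^esub> a) w f = PP LH x w (sl LH a f)"
    by (rule LH_eqI) (simp_all, simp add: LH_ops cong: M.P.SJ_cong)
  show "PP LH x (a \<odot>\<^bsub>dW E\<^esub> w) f = PP LH x w (tr LH a f)"
    by (rule LH_eqI) (simp_all, simp add: LH_ops cong: M.P.SJ_cong)
  show "PP LH x (w \<ddagger>\<^bsub>dW E\<^esub> a) f = tr LH a (PP LH x w f)"
    by (rule LH_eqI) (simp_all, simp add: LH_ops N.op_SJ cong: M.P.SJ_cong)
qed

end

context reps2
begin

interpretation sw: reps2 "swapd E" "swapr M" "swapr N"
  by (rule reps2_swap) (rule reps2_axioms)

lemmas LH_Q = sw.LH_P[unfolded lhom_rep_swap, simplified]

text \<open>The same four relations of \<open>M\<close> and \<open>N\<close> enter as for right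
  homs, but the inner sums collapse in the other order: for the first relation those on
  \<open>M\<close> before those on \<open>N\<close>, for the second those on \<open>N\<close>
  first.\<close>

lemma rels_LH: "rels E LH"
proof (intro rels.intro rels_axioms.intro)
  show "prerep E LH" by (rule prerep_LH)
  note abN = N.P.V.abelian_group_axioms
  note [simp] = LH_sl LH_tr LH_P LH_Q abelian_LH abN
  fix x w f assume xw [simp]: "x \<in> carrier (dX E)" "w \<in> carrier (dW E)" and f [simp]: "f \<in> carrier LH"
  note [simp] = LH_cl[OF f] LH_add[OF f] LH_lin[OF f]
  show "SI E LH (\<lambda>w' x'. QQ LH w' x (PP LH x' w f)) = tr LH (dE E w x) f"
  proof (rule LH_eqI)
    fix m assume m [simp]: "m \<in> carrier M"
    let ?f = "\<lambda>w1 x1 w2 x2 y r. QQ N w2 x (PP N y w (f (QQ M r x1 (PP M x2 w1 m))))"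
    have "SI E LH (\<lambda>w' x'. QQ LH w' x (PP LH x' w f)) m = SI E N (\<lambda>w1 x1. QQ LH w1 x (PP LH x1 w f) m)"
      by (rule M.P.SI_hom[OF abelian_LH abN LH_eval]) simp_all
    also have "\<dots> = SI E N (\<lambda>w1 x1. SI E N (\<lambda>w2 x2. SJ E N (?f w1 x1 w2 x2)))"
      by (intro M.P.SI_cong) (simp add: LH_ops N.op_SJ cong: M.P.SI_cong)
    also have "\<dots> = SI E N (\<lambda>w2 x2. SI E N (\<lambda>w1 x1. SJ E N (?f w1 x1 w2 x2)))"
      by (intro M.P.SI_SI) simp_all
    also have "\<dots> = SI E N (\<lambda>w2 x2. SJ E N (\<lambda>y r. SI E N (\<lambda>w1 x1. ?f w1 x1 w2 x2 y r)))"
      by (intro M.P.SI_cong M.P.SI_SJ) simp_all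
    also have "\<dots> = SI E N (\<lambda>w2 x2. SJ E N (\<lambda>y r. QQ N w2 x (PP N (y \<ddagger>\<^bsub>dX E\<^esub> dE E r x2) w (f m))))"
    proof (intro M.P.SI_cong M.P.SJ_cong)
      fix w2 x2 y r assume [simp]: "w2 \<in> carrier (dW E)" "x2 \<in> carrier (dX E)" "y \<in> carrier (dX E)" "r \<in> carrier (dW E)"
      have "SI E N (\<lambda>w1 x1. ?f w1 x1 w2 x2 y r) = QQ N w2 x (PP N y w (f (sl M (dE E r x2) m)))"
        by (rule M.H4h[OF abN, where h = "\<lambda>v. QQ N w2 x (PP N y w (f v))"]) (simp_all add: additive_mapI)
      then show "SI E N (\<lambda>w1 x1. ?f w1 x1 w2 x2 y r) = QQ N w2 x (PP N (y \<ddagger>\<^bsub>dX E\<^esub> dE E r x2) w (f m))"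
        by simp
    qed
    also have "\<dots> = SI E N (\<lambda>w2 x2. QQ N w2 x (PP N x2 w (f m)))"
      by (intro M.P.SI_cong M.P.C4[OF abN]) (simp_all add: additive_mapI)
    also have "\<dots> = tr LH (dE E w x) f m"
      by (simp add: N.R.H1 LH_ops)
    finally show "SI E LH (\<lambda>w' x'. QQ LH w' x (PP LH x' w f)) m = tr LH (dE E w x) f m" .
  qed simp_all
  show "SJ E LH (\<lambda>y r. PP LH x r (QQ LH w y f)) = sl LH (de E x w) f"
  proof (rule LH_eqI)
    fix m assume m [simp]: "m \<in> carrier M"
    let ?f = "\<lambda>y r y' r' w' x'. PP N y' r (QQ N w' y (f (PP M x' w (QQ M r' x m))))"
    have "SJ E LH (\<lambda>y r. PP LH x r (QQ LH w y f)) m = SJ E N (\<lambda>y r. PP LH x r (QQ LH w y f) m)"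
      by (rule M.P.SJ_hom[OF abelian_LH abN LH_eval]) simp_all
    also have "\<dots> = SJ E N (\<lambda>y r. SJ E N (\<lambda>y' r'. SI E N (?f y r y' r')))"
      by (intro M.P.SJ_cong) (simp add: LH_ops N.op_SI cong: M.P.SJ_cong)
    also have "\<dots> = SJ E N (\<lambda>y' r'. SJ E N (\<lambda>y r. SI E N (?f y r y' r')))"
      by (intro M.P.SJ_SJ) simp_all
    also have "\<dots> = SJ E N (\<lambda>y' r'. SI E N (\<lambda>w' x'. SJ E N (\<lambda>y r. ?f y r y' r' w' x')))"
      by (intro M.P.SJ_cong M.P.SJ_SI) simp_all
    also have "\<dots> = SJ E N (\<lambda>y' r'. SI E N (\<lambda>w' x'. f (PP M (de E y' w' \<odot>\<^bsub>dX E\<^esub> x') w (QQ M r' x m))))"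
      by (intro M.P.SJ_cong M.P.SI_cong) (simp add: N.R.H2)
    also have "\<dots> = SJ E N (\<lambda>y' r'. f (PP M y' w (QQ M r' x m)))"
      by (intro M.P.SJ_cong M.P.C2[OF abN]) (simp_all add: additive_mapI)
    also have "\<dots> = sl LH (de E x w) f m"
      by (simp add: M.H3h[OF abN LH_am] LH_ops)
    finally show "SJ E LH (\<lambda>y r. PP LH x r (QQ LH w y f)) m = sl LH (de E x w) f m" .
  qed simp_all
qed

end

lemma rep_lhom:
  assumes "rep E M" "rep E N"
  shows "rep E (lhom_rep E M N)"
proof -
  have r: "reps2 E M N" using assms by (rule reps2.intro)
  show ?thesis
    using reps2.hrep_LH[OF r] reps2.rels_LH[OF r] reps2.hrep_LH[OF reps2_swap[OF r]] reps2.rels_LH[OF reps2_swap[OF r]]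
    unfolding rep_def lhom_rep_swap by simp
qed

section \<open>Vector fields acting as differential operators\<close>

text \<open>\<open>L_sl\<close> and \<open>L_tr\<close> are the relations for x a and x a-bar read
  on vectors. No mirror image exists from here on, as d takes values in forms only.\<close>

locale xrep = rep E V for E :: "('k, 'a, 'w, 'x) dual_data" and V :: "('a, 'w, 'x, 'v) rep" +
  fixes d :: "'a \<Rightarrow> 'w" and L :: "'x \<Rightarrow> 'v \<Rightarrow> 'v"
  assumes d_cl [simp]: "a \<in> carrier (dalg E) \<Longrightarrow> d a \<in> carrier (dW E)"
    and L_cl [simp]: "\<lbrakk>x \<in> carrier (dX E); v \<in> carrier V\<rbrakk> \<Longrightarrow> L x v \<in> carrier V"
    and L_add [simp]: "\<lbrakk>x \<in> carrier (dX E); v \<in> carrier V; v' \<in> carrier V\<rbrakk> \<Longrightarrow> L x (v \<oplus>\<^bsub>V\<^esub> v') = L x v \<oplus>\<^bsub>V\<^esub> L x v'"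
    and L_addX [simp]: "\<lbrakk>x \<in> carrier (dX E); x' \<in> carrier (dX E); v \<in> carrier V\<rbrakk>
      \<Longrightarrow> L (x \<oplus>\<^bsub>dX E\<^esub> x') v = L x v \<oplus>\<^bsub>V\<^esub> L x' v"
    and L_l [simp]: "\<lbrakk>a \<in> carrier (dalg E); x \<in> carrier (dX E); v \<in> carrier V\<rbrakk> \<Longrightarrow> L (a \<odot>\<^bsub>dX E\<^esub> x) v = sl V a (L x v)"
    and L_sl [simp]: "\<lbrakk>a \<in> carrier (dalg E); x \<in> carrier (dX E); v \<in> carrier V\<rbrakk>
      \<Longrightarrow> L x (sl V a v) = L (x \<ddagger>\<^bsub>dX E\<^esub> a) v \<oplus>\<^bsub>V\<^esub> sl V (de E x (d a)) v"
    and L_tr [simp]: "\<lbrakk>a \<in> carrier (dalg E); x \<in> carrier (dX E); v \<in> carrier V\<rbrakk>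
      \<Longrightarrow> L x (tr V a v) = tr V a (L x v) \<oplus>\<^bsub>V\<^esub> PP V x (d a) v"
begin

lemma L_am: "x \<in> carrier (dX E) \<Longrightarrow> additive_map V V (L x)"
  by (rule additive_mapI) simp_all

end

text \<open>In the differences that define the hom actions both terms produce the same contribution
  with d a; this lemma and the next one remove it.\<close>

lemma (in abelian_group) diff_cancel:
  "\<lbrakk>u \<in> carrier G; v \<in> carrier G; p \<in> carrier G\<rbrakk> \<Longrightarrow> (u \<oplus> p) \<ominus> (v \<oplus> p) = u \<ominus> v"
proof -
  assume c: "u \<in> carrier G" "v \<in> carrier G" "p \<in> carrier G"
  have "(u \<oplus> p) \<ominus> (v \<oplus> p) = (u \<ominus> v) \<oplus> (p \<oplus> \<ominus> p)"
    using c by (simp add: a_minus_def minus_add a_ac)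
  then show ?thesis using c by (simp add: r_neg)
qed

lemma (in abelian_group) diff_add_cancel:
  "\<lbrakk>u \<in> carrier G; v \<in> carrier G; p \<in> carrier G\<rbrakk> \<Longrightarrow> (u \<ominus> (v \<oplus> p)) \<oplus> p = u \<ominus> v"
proof -
  assume c: "u \<in> carrier G" "v \<in> carrier G" "p \<in> carrier G"
  have "(u \<ominus> (v \<oplus> p)) \<oplus> p = (u \<ominus> v) \<oplus> (p \<oplus> \<ominus> p)"
    using c by (simp add: a_minus_def minus_add a_ac)
  then show ?thesis using c by (simp add: r_neg)
qed

lemma (in abelian_group) add_diff:
  "\<lbrakk>u \<in> carrier G; v \<in> carrier G; u' \<in> carrier G; v' \<in> carrier G\<rbrakk> \<Longrightarrow> (u \<oplus> u') \<ominus> (v \<oplus> v') = (u \<ominus> v) \<oplus> (u' \<ominus> v')"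
  by (simp add: a_minus_def minus_add a_ac)

lemma (in dual) SJ_diff:
  assumes "abelian_group G"
    and "\<And>y r. \<lbrakk>y \<in> carrier X; r \<in> carrier W\<rbrakk> \<Longrightarrow> \<phi> y r \<in> carrier G"
    and "\<And>y r. \<lbrakk>y \<in> carrier X; r \<in> carrier W\<rbrakk> \<Longrightarrow> \<psi> y r \<in> carrier G"
  shows "SJ E G (\<lambda>y r. \<phi> y r \<ominus>\<^bsub>G\<^esub> \<psi> y r) = SJ E G \<phi> \<ominus>\<^bsub>G\<^esub> SJ E G \<psi>"
proof -
  interpret abelian_group G by fact
  have "additive_map G G (\<lambda>v. \<ominus>\<^bsub>G\<^esub> v)" by (rule additive_mapI) (simp_all add: minus_add)
  from SJ_hom[OF assms(1,1) this, of \<psi>] assms show ?thesis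
    by (simp add: a_minus_def SJ_add)
qed

text \<open>The operator dictated by the coproduct x \<otimes> 1 + (x, \<omega>_i) \<otimes>
  x_i.\<close>

definition tensL where
  "tensL E M LM N LN x = (let T = tensor (dalg E) (bim M) (bim N); t = tens (dalg E) (bim M) (bim N) in
     tens_ext T (\<lambda>m n. t (LM x m) n \<oplus>\<^bsub>T\<^esub> SI E T (\<lambda>w' x'. t (PP M x w' m) (LN x' n))))"

text \<open>The formula is forced: equivariance of the counit on f \<otimes> m reads x f(m) =
  [x f](m) + [(x, \<omega>_i) f](x_i m). Solving for [x f](m) and inserting the action of (x,
  \<omega>_i) gives the subtracted double sum.\<close>

definition rhomL where
  "rhomL E M LM N LN x f = (\<lambda>m\<in>carrier M. LN x (f m) \<ominus>\<^bsub>N\<^esub>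
     SJ E N (\<lambda>y r. SI E N (\<lambda>w' x'. PP N x r (f (QQ M w' y (LM x' m))))))"

text \<open>Also forced by the counit, which requires z g(m) = g(z m) + [x_i g]((z, \<omega>_i) m).
  With z = y_j and (\<rho>_j, x) m in place of m, the sum over j collapses by the third relation to
  [x g](m) = y_j g((\<rho>_j, x) m) - g(y_j (\<rho>_j, x) m).\<close>

definition lhomL where
  "lhomL E M LM N LN x g = (\<lambda>m\<in>carrier M. SJ E N (\<lambda>y r. LN y (g (QQ M r x m))) \<ominus>\<^bsub>N\<^esub>
     SJ E N (\<lambda>y r. g (LM y (QQ M r x m))))"

section \<open>Vector fields on tensor products\<close>

locale xreps2 = M: xrep E M d LM + N: xrep E N d LN
  for E :: "('k, 'a, 'w, 'x) dual_data" and d :: "'a \<Rightarrow> 'w" and M :: "('a, 'w, 'x, 'm) rep" and LM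
    and N :: "('a, 'w, 'x, 'n) rep" and LN
begin

sublocale reps2 E M N ..

abbreviation "LT \<equiv> tensL E M LM N LN"
abbreviation "LTmn x m n \<equiv> tn (LM x m) n \<oplus>\<^bsub>T\<^esub> SI E T (\<lambda>w' x'. tn (PP M x w' m) (LN x' n))"

text \<open>Neither summand is balanced. Moving a-bar past x on m produces (x, d a) m, and moving a
  past x_i on n produces ev(x_i \<otimes> d a) n; after summation both contribute (x, d a) m
  \<otimes> n.\<close>

lemma LT_balanced:
  assumes [simp]: "x \<in> carrier (dX E)"
  shows "balanced (dalg E) (bim M) (bim N) T (LTmn x)"
proof (rule T_balancedI)
  fix m n a assume [simp]: "m \<in> carrier M" "n \<in> carrier N" "a \<in> carrier (dalg E)"
  have "balanced (dalg E) (dW E) (dX E) T (\<lambda>w' x'. tn (PP M x w' m) (LN x' n))"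
    by (rule balancedI; simp)
  from M.P.coev_central[OF T_ab this, of a]
  have 1: "SI E T (\<lambda>w' x'. tn (PP M x w' (tr M a m)) (LN x' n)) = SI E T (\<lambda>w' x'. tn (PP M x w' m) (LN (x' \<ddagger>\<^bsub>dX E\<^esub> a) n))"
    by (simp cong: M.P.SI_cong)
  \<comment> \<open>The coefficient ev(x_i \<otimes> d a) has crossed to m and is absorbed into
    \<omega>_i; the dual basis then restores d a.\<close>
  have 2: "SI E T (\<lambda>w' x'. tn (PP M x (w' \<ddagger>\<^bsub>dW E\<^esub> de E x' (d a)) m) n) = tn (PP M x (d a) m) n"
    by (rule M.P.C1[OF T_ab]) (simp_all add: additive_mapI)
  show "LTmn x (tr M a m) n = LTmn x m (sl N a n)"
    using 1 2 by (simp add: M.P.SI_add M.P.X.rcl T.T.a_ac cong: M.P.SI_cong)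
qed (simp_all add: M.P.SI_add T.T.a_ac cong: M.P.SI_cong)

lemma LT_am: "x \<in> carrier (dX E) \<Longrightarrow> additive_map T T (LT x)"
  using T.tens_ext_additive[OF T_ab LT_balanced] by (simp add: tensL_def Let_def)

lemma LT_tn: "\<lbrakk>x \<in> carrier (dX E); m \<in> carrier M; n \<in> carrier N\<rbrakk> \<Longrightarrow> LT x (tn m n) = LTmn x m n"
  using T.tens_ext_tens[OF T_ab LT_balanced] by (simp add: tensL_def Let_def)

lemma xrep_T: "xrep E TR d LT"
proof (intro xrep.intro xrep_axioms.intro)
  show "rep E TR" by (rule rep_tens) unfold_locales
  note sub = additive_map_sub[OF T_ab _ _ T_ab]
  note ams = LT_am T.smult_additive T.rsmult_additive PT_am
    additive_map_comp[OF LT_am T.smult_additive] additive_map_comp[OF LT_am T.rsmult_additive]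
    additive_map_comp[OF T.smult_additive LT_am] additive_map_comp[OF T.rsmult_additive LT_am]
  note am = ams sub[OF LT_am LT_am] sub[OF LT_am T.smult_additive]
    sub[OF additive_map_comp[OF LT_am T.rsmult_additive] PT_am]
  note cl = M.P.X.lmod_closed M.P.X.rcl
  note s = SI_T_hom[OF T.smult_additive] SI_T_hom[OF T.rsmult_additive]
    additive_map_add[OF T.smult_additive] additive_map_add[OF T.rsmult_additive]
  show "d a \<in> carrier (dW E)" if "a \<in> carrier (dalg E)" for a using that by simp
  fix x t assume x [simp]: "x \<in> carrier (dX E)" and t: "t \<in> carrier TR"
  show "LT x t \<in> carrier TR" using additive_map_closed[OF LT_am] t by simp
  show "LT x (t \<oplus>\<^bsub>TR\<^esub> t') = LT x t \<oplus>\<^bsub>TR\<^esub> LT x t'" if "t' \<in> carrier TR" for t'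
    using additive_map_add[OF LT_am] t that by simp
  show "LT (x \<oplus>\<^bsub>dX E\<^esub> x') t = LT x t \<oplus>\<^bsub>TR\<^esub> LT x' t" if [simp]: "x' \<in> carrier (dX E)" for x'
    unfolding tens_rep_simps
    by (rule T_induct[where t = t])
       (use t in \<open>auto intro!: am simp: LT_tn M.P.SI_add T.T.a_ac cong: M.P.SI_cong\<close>)
  fix a assume a [simp]: "a \<in> carrier (dalg E)"
  show "LT (a \<odot>\<^bsub>dX E\<^esub> x) t = sl TR a (LT x t)"
    unfolding tens_rep_simps
    by (rule T_induct[where t = t])
       (use t in \<open>auto intro!: am simp: LT_tn cl s cong: M.P.SI_cong\<close>)
  show "LT x (sl TR a t) = LT (x \<ddagger>\<^bsub>dX E\<^esub> a) t \<oplus>\<^bsub>TR\<^esub> sl TR (de E x (d a)) t"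
    unfolding tens_rep_simps
    by (rule T_induct[where t = t])
       (use t in \<open>auto intro!: am simp: LT_tn cl s T.T.a_ac cong: M.P.SI_cong\<close>)
  show "LT x (tr TR a t) = tr TR a (LT x t) \<oplus>\<^bsub>TR\<^esub> PP TR x (d a) t"
    unfolding tens_rep_simps
    by (rule T_induct[where t = t])
       (use t in \<open>auto intro!: am simp: LT_tn PT_tn cl s M.P.SI_add T.T.a_ac cong: M.P.SI_cong\<close>)
qed

lemma N_diff:
  assumes "additive_map N N h" "u \<in> carrier N" "v \<in> carrier N"
  shows "h (u \<ominus>\<^bsub>N\<^esub> v) = h u \<ominus>\<^bsub>N\<^esub> h v"
  by (rule additive_map_diff[OF N.P.V.abelian_group_axioms N.P.V.abelian_group_axioms]) fact+

section \<open>Vector fields on right module maps\<close>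

abbreviation "LR \<equiv> rhomL E M LM N LN"
abbreviation "LRs x f m \<equiv> SJ E N (\<lambda>y r. SI E N (\<lambda>w' x'. PP N x r (f (QQ M w' y (LM x' m)))))"

text \<open>Neither term of the difference is right linear, but both deviate by the same (x, d a)
  f(m).\<close>

lemma LR_closed:
  assumes [simp]: "x \<in> carrier (dX E)" and f: "f \<in> carrier RH"
  shows "LR x f \<in> carrier RH"
  unfolding rhomL_def
proof (rule RH_I)
  note abN [simp] = N.P.V.abelian_group_axioms
  note [simp] = RH_cl[OF f] RH_add[OF f] RH_tr[OF f]
  note cl = M.P.X.lmod_closed M.P.X.rcl M.P.W.lmod_closed M.P.W.rcl
  fix m assume m [simp]: "m \<in> carrier M"
  show "LN x (f m) \<ominus>\<^bsub>N\<^esub> LRs x f m \<in> carrier N" by simp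
  show "LN x (f (m \<oplus>\<^bsub>M\<^esub> m')) \<ominus>\<^bsub>N\<^esub> LRs x f (m \<oplus>\<^bsub>M\<^esub> m') =
     LN x (f m) \<ominus>\<^bsub>N\<^esub> LRs x f m \<oplus>\<^bsub>N\<^esub> (LN x (f m') \<ominus>\<^bsub>N\<^esub> LRs x f m')" if [simp]: "m' \<in> carrier M" for m'
    by (simp add: M.P.SI_add M.P.SJ_add N.P.V.add_diff cong: M.P.SI_cong M.P.SJ_cong)
  fix a assume a [simp]: "a \<in> carrier (dalg E)"
  have "balanced (dalg E) (dX E) (dW E) N (\<lambda>y r. SI E N (\<lambda>w' x'. PP N x r (f (QQ M w' y (LM x' m)))))"
    by (rule balancedI) (simp_all add: M.P.SI_add cl N.op_SI cong: M.P.SI_cong)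
  from M.P.coev'_central[OF abN this a]
  \<comment> \<open>The part without d: a-bar turns y_j into a y_j, which
    \<open>coev'_central\<close> exchanges for \<rho>_j a.\<close>
  have 1: "SJ E N (\<lambda>y r. SI E N (\<lambda>w' x'. PP N x r (f (QQ M w' y (tr M a (LM x' m)))))) = tr N a (LRs x f m)"
    by (simp add: N.op_SI N.op_SJ cong: M.P.SI_cong M.P.SJ_cong)
  \<comment> \<open>The part with d: by the first relation the operators on m collapse to the
    pairing of d a with y_j, and the sum over j then contracts in \<open>3\<close> to (x, d
    a).\<close>
  have 2: "SI E N (\<lambda>w' x'. PP N x r (f (QQ M w' y (PP M x' (d a) m)))) = PP N x (dE E (d a) y \<odot>\<^bsub>dW E\<^esub> r) (f m)"
    if [simp]: "y \<in> carrier (dX E)" "r \<in> carrier (dW E)" for y r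
  proof -
    have "SI E N (\<lambda>w' x'. PP N x r (f (QQ M w' y (PP M x' (d a) m)))) = PP N x r (f (tr M (dE E (d a) y) m))"
      by (rule M.H1h[OF abN, where h = "\<lambda>v. PP N x r (f v)"]) (simp_all add: additive_mapI)
    then show ?thesis by simp
  qed
  have 3: "SJ E N (\<lambda>y r. PP N x (dE E (d a) y \<odot>\<^bsub>dW E\<^esub> r) (f m)) = PP N x (d a) (f m)"
    by (rule M.P.C3[OF abN]) (simp_all add: additive_mapI)
  have "LRs x f (tr M a m) = SJ E N (\<lambda>y r. SI E N (\<lambda>w' x'. PP N x r (f (QQ M w' y (tr M a (LM x' m)))))
      \<oplus>\<^bsub>N\<^esub> SI E N (\<lambda>w' x'. PP N x r (f (QQ M w' y (PP M x' (d a) m)))))"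
    by (simp add: M.P.SI_add cong: M.P.SI_cong M.P.SJ_cong)
  also have "\<dots> = SJ E N (\<lambda>y r. SI E N (\<lambda>w' x'. PP N x r (f (QQ M w' y (tr M a (LM x' m))))))
      \<oplus>\<^bsub>N\<^esub> SJ E N (\<lambda>y r. SI E N (\<lambda>w' x'. PP N x r (f (QQ M w' y (PP M x' (d a) m)))))"
    by (rule M.P.SJ_add) simp_all
  also have "\<dots> = tr N a (LRs x f m) \<oplus>\<^bsub>N\<^esub> PP N x (d a) (f m)"
    unfolding 1 by (subst 3[symmetric]) (simp only: 2 cong: M.P.SJ_cong)
  finally show "LN x (f (tr M a m)) \<ominus>\<^bsub>N\<^esub> LRs x f (tr M a m) = tr N a (LN x (f m) \<ominus>\<^bsub>N\<^esub> LRs x f m)"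
    by (simp add: N_diff[OF N.tr_am] N.P.V.diff_cancel)
qed

lemma LR_app: "m \<in> carrier M \<Longrightarrow> LR x f m = LN x (f m) \<ominus>\<^bsub>N\<^esub> LRs x f m"
  by (simp add: rhomL_def)

lemma xrep_RH: "xrep E RH d LR"
proof (intro xrep.intro xrep_axioms.intro)
  show "rep E RH" by (rule rep_rhom) unfold_locales
  note abN [simp] = N.P.V.abelian_group_axioms
  note cl [simp] = M.P.X.lmod_closed M.P.X.rcl M.P.W.lmod_closed M.P.W.rcl
  note [simp] = RH_sl RH_tr' RH_add_cl RH_P LR_closed LR_app
  show "d a \<in> carrier (dW E)" if "a \<in> carrier (dalg E)" for a using that by simp
  fix x f assume x [simp]: "x \<in> carrier (dX E)" and f [simp]: "f \<in> carrier RH"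
  note [simp] = RH_cl[OF f] RH_add[OF f] RH_tr[OF f]
  show "LR x f \<in> carrier RH" by simp
  show "LR x (f \<oplus>\<^bsub>RH\<^esub> f') = LR x f \<oplus>\<^bsub>RH\<^esub> LR x f'" if f': "f' \<in> carrier RH" for f'
    by (rule RH_eqI) (simp_all add: f', simp add: RH_ops RH_cl[OF f'] M.P.SI_add M.P.SJ_add N.P.V.add_diff
       cong: M.P.SI_cong M.P.SJ_cong)
  show "LR (x \<oplus>\<^bsub>dX E\<^esub> x') f = LR x f \<oplus>\<^bsub>RH\<^esub> LR x' f" if x' [simp]: "x' \<in> carrier (dX E)" for x'
    by (rule RH_eqI) (simp_all, simp add: RH_ops M.P.SI_add M.P.SJ_add N.P.V.add_diff
       cong: M.P.SI_cong M.P.SJ_cong)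
  fix a assume a [simp]: "a \<in> carrier (dalg E)"
  show "LR (a \<odot>\<^bsub>dX E\<^esub> x) f = sl RH a (LR x f)"
    by (rule RH_eqI) (simp_all, simp add: RH_ops N_diff[OF N.sl_am] N.op_SI N.op_SJ cong: M.P.SI_cong M.P.SJ_cong)
  show "LR x (sl RH a f) = LR (x \<ddagger>\<^bsub>dX E\<^esub> a) f \<oplus>\<^bsub>RH\<^esub> sl RH (de E x (d a)) f"
    by (rule RH_eqI) (simp_all, simp add: RH_ops a_minus_def N.P.V.a_ac cong: M.P.SI_cong M.P.SJ_cong)
  show "LR x (tr RH a f) = tr RH a (LR x f) \<oplus>\<^bsub>RH\<^esub> PP RH x (d a) f"
  proof (rule RH_eqI)
    fix m assume m [simp]: "m \<in> carrier M"
    let ?p = "\<lambda>y r. PP N x r (f (QQ M (d a) y m))"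
    \<comment> \<open>The a in front of (\<omega>_i, y) becomes a right factor of x_i by
      \<open>coev_central\<close>.\<close>
    have 1: "SI E N (\<lambda>w' x'. PP N x r (f (sl M a (QQ M w' y (LM x' m))))) =
       SI E N (\<lambda>w' x'. PP N x r (f (QQ M w' y (LM (x' \<ddagger>\<^bsub>dX E\<^esub> a) m))))"
      if [simp]: "y \<in> carrier (dX E)" "r \<in> carrier (dW E)" for y r
    proof -
      have "balanced (dalg E) (dW E) (dX E) N (\<lambda>w x'. PP N x r (f (QQ M w y (LM x' m))))"
        by (rule balancedI; simp)
      from M.P.coev_central[OF abN this a] show ?thesis by (simp cong: M.P.SI_cong)
    qed
    \<comment> \<open>The derivation part of x_i (a m): the coefficient ev(x_i \<otimes> d a) is
      absorbed into \<omega>_i, and the sum yields (d a, y). This is the extra term that the law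
      demands.\<close>
    have 2: "SI E N (\<lambda>w' x'. PP N x r (f (QQ M (w' \<ddagger>\<^bsub>dW E\<^esub> de E x' (d a)) y m))) = ?p y r"
      if [simp]: "y \<in> carrier (dX E)" "r \<in> carrier (dW E)" for y r
      by (rule M.P.C1[OF abN]) (simp_all add: additive_mapI)
    have "LRs x f (sl M a m) = SJ E N (\<lambda>y r. SI E N (\<lambda>w' x'. PP N x r (f (QQ M w' y (LM (x' \<ddagger>\<^bsub>dX E\<^esub> a) m))))
       \<oplus>\<^bsub>N\<^esub> SI E N (\<lambda>w' x'. PP N x r (f (QQ M (w' \<ddagger>\<^bsub>dW E\<^esub> de E x' (d a)) y m))))"
      by (simp add: M.P.SI_add cong: M.P.SI_cong M.P.SJ_cong)
    also have "\<dots> = SJ E N (\<lambda>y r. SI E N (\<lambda>w' x'. PP N x r (f (sl M a (QQ M w' y (LM x' m))))) \<oplus>\<^bsub>N\<^esub> ?p y r)"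
      by (simp only: 1 2 cong: M.P.SJ_cong)
    also have "\<dots> = SJ E N (\<lambda>y r. SI E N (\<lambda>w' x'. PP N x r (f (sl M a (QQ M w' y (LM x' m)))))) \<oplus>\<^bsub>N\<^esub> SJ E N ?p"
      by (rule M.P.SJ_add) simp_all
    finally have "LRs x f (sl M a m) = SJ E N (\<lambda>y r. SI E N (\<lambda>w' x'. PP N x r (f (sl M a (QQ M w' y (LM x' m)))))) \<oplus>\<^bsub>N\<^esub> SJ E N ?p" .
    then show "LR x (tr RH a f) m = (tr RH a (LR x f) \<oplus>\<^bsub>RH\<^esub> PP RH x (d a) f) m"
      by (simp add: RH_ops N.P.V.diff_add_cancel cong: M.P.SI_cong M.P.SJ_cong)
  qed simp_all
qed

section \<open>Vector fields on left module maps\<close>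

abbreviation "LL \<equiv> lhomL E M LM N LN"
abbreviation "Lphi x g m y r \<equiv> LN y (g (QQ M r x m)) \<ominus>\<^bsub>N\<^esub> g (LM y (QQ M r x m))"

text \<open>The two sums of the definition are merged into one, because only the difference of their
  terms is balanced in y and \<rho>.\<close>

lemma LL_app:
  assumes "x \<in> carrier (dX E)" "g \<in> carrier LH" "m \<in> carrier M"
  shows "LL x g m = SJ E N (Lphi x g m)"
  using assms LH_cl[OF assms(2)] by (simp add: lhomL_def M.P.SJ_diff N.P.V.abelian_group_axioms)

text \<open>Moving a from y to \<rho> changes both terms of \<open>Lphi\<close> by ev(y \<otimes> d
  a) times the same vector, as g is left linear. The difference is therefore balanced, and
  \<open>coev'_central\<close> applies.\<close>

lemma LL_closed:
  assumes [simp]: "x \<in> carrier (dX E)" and f: "f \<in> carrier LH"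
  shows "LL x f \<in> carrier LH"
proof -
  note abN [simp] = N.P.V.abelian_group_axioms
  note [simp] = LH_cl[OF f] LH_add[OF f] LH_lin[OF f]
  note cl = M.P.X.lmod_closed M.P.X.rcl M.P.W.lmod_closed M.P.W.rcl
  have "(\<lambda>m\<in>carrier M. SJ E N (Lphi x f m)) \<in> carrier LH"
  proof (rule LH_I)
    fix m assume m [simp]: "m \<in> carrier M"
    show "SJ E N (Lphi x f m) \<in> carrier N" by simp
    show "SJ E N (Lphi x f (m \<oplus>\<^bsub>M\<^esub> m')) = SJ E N (Lphi x f m) \<oplus>\<^bsub>N\<^esub> SJ E N (Lphi x f m')" if [simp]: "m' \<in> carrier M" for m'
      by (simp add: M.P.SJ_add N.P.V.add_diff cong: M.P.SJ_cong)
    fix a assume a [simp]: "a \<in> carrier (dalg E)"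
    have "balanced (dalg E) (dX E) (dW E) N (Lphi x f m)"
      by (rule balancedI) (simp_all add: cl N.P.V.add_diff N.P.V.diff_cancel a_minus_def[of N v v for v] N.P.V.r_neg)
    from M.P.coev'_central[OF abN this a]
    show "SJ E N (Lphi x f (sl M a m)) = sl N a (SJ E N (Lphi x f m))"
      by (simp add: cl N.op_SJ N_diff[OF N.sl_am] cong: M.P.SJ_cong)
  qed
  moreover have "LL x f = (\<lambda>m\<in>carrier M. SJ E N (Lphi x f m))"
    by (rule extensionalityI[of _ "carrier M"]) (simp_all add: LL_app f, simp add: lhomL_def)
  ultimately show ?thesis by simp
qed

lemma xrep_LH: "xrep E LH d LL"
proof (intro xrep.intro xrep_axioms.intro)
  show "rep E LH" by (rule rep_lhom) unfold_locales
  note abN [simp] = N.P.V.abelian_group_axioms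
  note cl [simp] = M.P.X.lmod_closed M.P.X.rcl M.P.W.lmod_closed M.P.W.rcl
  note [simp] = LH_sl LH_tr LH_add_cl LH_P LL_closed LL_app
  show "d a \<in> carrier (dW E)" if "a \<in> carrier (dalg E)" for a using that by simp
  fix x f assume x [simp]: "x \<in> carrier (dX E)" and f [simp]: "f \<in> carrier LH"
  note [simp] = LH_cl[OF f] LH_add[OF f] LH_lin[OF f]
  show "LL x f \<in> carrier LH" by simp
  show "LL x (f \<oplus>\<^bsub>LH\<^esub> f') = LL x f \<oplus>\<^bsub>LH\<^esub> LL x f'" if f': "f' \<in> carrier LH" for f'
    by (rule LH_eqI) (simp_all add: f', simp add: f' LH_ops LH_cl[OF f'] M.P.SJ_add[symmetric] N.P.V.add_diff
       cong: M.P.SJ_cong)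
  show "LL (x \<oplus>\<^bsub>dX E\<^esub> x') f = LL x f \<oplus>\<^bsub>LH\<^esub> LL x' f" if x' [simp]: "x' \<in> carrier (dX E)" for x'
    by (rule LH_eqI) (simp_all, simp add: LH_ops M.P.SJ_add[symmetric] N.P.V.add_diff
       cong: M.P.SJ_cong)
  fix a assume a [simp]: "a \<in> carrier (dalg E)"
  show "LL (a \<odot>\<^bsub>dX E\<^esub> x) f = sl LH a (LL x f)"
    by (rule LH_eqI) (simp_all, simp add: LH_ops cong: M.P.SJ_cong)
  show "LL x (sl LH a f) = LL (x \<ddagger>\<^bsub>dX E\<^esub> a) f \<oplus>\<^bsub>LH\<^esub> sl LH (de E x (d a)) f"
  proof (rule LH_eqI)
    fix m assume m [simp]: "m \<in> carrier M"
    \<comment> \<open>The action of a on g inserts a-bar before y_j acts on m, which leaves the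
      terms (y_j, d a)(\<rho>_j, x); by the third relation they sum to ev(x \<otimes> d
      a)-bar.\<close>
    have "SJ E N (\<lambda>y r. f (PP M y (d a) (QQ M r x m))) = f (tr M (de E x (d a)) m)"
      by (rule M.H3h[OF abN LH_am]) simp_all
    then have "(LL (x \<ddagger>\<^bsub>dX E\<^esub> a) f \<oplus>\<^bsub>LH\<^esub> sl LH (de E x (d a)) f) m =
        SJ E N (Lphi (x \<ddagger>\<^bsub>dX E\<^esub> a) f m) \<oplus>\<^bsub>N\<^esub> SJ E N (\<lambda>y r. f (PP M y (d a) (QQ M r x m)))"
      by (simp add: LH_ops)
    also have "\<dots> = SJ E N (\<lambda>y r. Lphi (x \<ddagger>\<^bsub>dX E\<^esub> a) f m y r \<oplus>\<^bsub>N\<^esub> f (PP M y (d a) (QQ M r x m)))"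
      by (rule M.P.SJ_add[symmetric]) simp_all
    also have "\<dots> = SJ E N (Lphi x (sl LH a f) m)"
      by (simp add: LH_ops N.P.V.diff_add_cancel cong: M.P.SJ_cong)
    also have "\<dots> = LL x (sl LH a f) m" by simp
    finally show "LL x (sl LH a f) m = (LL (x \<ddagger>\<^bsub>dX E\<^esub> a) f \<oplus>\<^bsub>LH\<^esub> sl LH (de E x (d a)) f) m" ..
  qed simp_all
  show "LL x (tr LH a f) = tr LH a (LL x f) \<oplus>\<^bsub>LH\<^esub> PP LH x (d a) f"
    by (rule LH_eqI) (simp_all, simp add: LH_ops N.op_SJ M.P.SJ_add[symmetric] N_diff[OF N.tr_am]
       a_minus_def N_am_inv[OF N.tr_am] N.P.V.a_ac cong: M.P.SJ_cong)
qed

end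

section \<open>Units and counits\<close>

definition rep_hom ::
    "('k, 'a, 'w, 'x) dual_data \<Rightarrow> ('a, 'w, 'x, 'u) rep \<Rightarrow> ('x \<Rightarrow> 'u \<Rightarrow> 'u) \<Rightarrow> ('a, 'w, 'x, 'v) rep
      \<Rightarrow> ('x \<Rightarrow> 'v \<Rightarrow> 'v) \<Rightarrow> ('u \<Rightarrow> 'v) \<Rightarrow> bool" where
  "rep_hom E U LU V LV F \<longleftrightarrow> additive_map U V F \<and>
     (\<forall>a\<in>carrier (dalg E). \<forall>u\<in>carrier U. F (sl U a u) = sl V a (F u) \<and> F (tr U a u) = tr V a (F u)) \<and>
     (\<forall>x\<in>carrier (dX E). \<forall>w\<in>carrier (dW E). \<forall>u\<in>carrier U.
        F (PP U x w u) = PP V x w (F u) \<and> F (QQ U w x u) = QQ V w x (F u)) \<and>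
     (\<forall>x\<in>carrier (dX E). \<forall>u\<in>carrier U. F (LU x u) = LV x (F u))"

lemma rep_homI:
  assumes "additive_map U V F"
    and "\<And>a u. \<lbrakk>a \<in> carrier (dalg E); u \<in> carrier U\<rbrakk> \<Longrightarrow> F (sl U a u) = sl V a (F u)"
    and "\<And>a u. \<lbrakk>a \<in> carrier (dalg E); u \<in> carrier U\<rbrakk> \<Longrightarrow> F (tr U a u) = tr V a (F u)"
    and "\<And>x w u. \<lbrakk>x \<in> carrier (dX E); w \<in> carrier (dW E); u \<in> carrier U\<rbrakk> \<Longrightarrow> F (PP U x w u) = PP V x w (F u)"
    and "\<And>x w u. \<lbrakk>x \<in> carrier (dX E); w \<in> carrier (dW E); u \<in> carrier U\<rbrakk> \<Longrightarrow> F (QQ U w x u) = QQ V w x (F u)"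
    and "\<And>x u. \<lbrakk>x \<in> carrier (dX E); u \<in> carrier U\<rbrakk> \<Longrightarrow> F (LU x u) = LV x (F u)"
  shows "rep_hom E U LU V LV F"
  using assms by (simp add: rep_hom_def)

context reps2
begin

lemma SI_TR: "SI E TR = SI E T" and SJ_TR: "SJ E TR = SJ E T"
  by (simp_all add: SI_def SJ_def fun_eq_iff finsum_cong_group[of TR T])

lemma diff_TR: "t \<ominus>\<^bsub>TR\<^esub> u = t \<ominus>\<^bsub>T\<^esub> u"
  by (simp add: a_minus_def a_inv_def m_inv_def)

lemma additive_TR: "additive_map TR G f = additive_map T G f"
  by (simp add: additive_map_def)

end

text \<open>In contrast to \<open>xreps2\<close> no order of the factors is fixed: both tensor
  products occur, as well as homs into them and tensor products with homs.\<close>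

locale xreps_pair = M: xrep E M d LM + N: xrep E N d LN
  for E :: "('k, 'a, 'w, 'x) dual_data" and d :: "'a \<Rightarrow> 'w" and M :: "('a, 'w, 'x, 'm) rep" and LM
    and N :: "('a, 'w, 'x, 'n) rep" and LN
begin

text \<open>For (x, \<omega>) the operators on m collapse by the second relation, for (\<omega>, x)
  by the fourth. For x the subtracted double sum collapses by the second relation to (x, \<omega>_i)
  n \<otimes> x_i m, which is the second half of the coproduct, so that x n \<otimes> m
  remains.\<close>

lemma unit_r: "rep_hom E N LN (rhom_rep E M (tens_rep E N M)) (rhomL E M LM (tens_rep E N M) (tensL E N LN M LM))
    (\<lambda>n. \<lambda>m\<in>carrier M. tens (dalg E) (bim N) (bim M) n m)"
proof -
  interpret S: xreps2 E d N LN M LM by unfold_locales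
  interpret TX: xrep E S.TR d S.LT by (rule S.xrep_T)
  interpret R: xreps2 E d M LM S.TR S.LT by unfold_locales
  have eta [simp]: "(\<lambda>m\<in>carrier M. S.tn n m) \<in> carrier R.RH" if [simp]: "n \<in> carrier N" for n
    by (rule R.RH_I) simp_all
  note [simp] = R.RH_sl R.RH_tr' R.RH_add_cl R.RH_P R.RH_Q R.LR_closed
  note T [simp] = S.T_ab
  note cl [simp] = M.P.X.lmod_closed M.P.X.rcl M.P.W.lmod_closed M.P.W.rcl
  show ?thesis
  proof (rule rep_homI)
    show "additive_map N R.RH (\<lambda>n. \<lambda>m\<in>carrier M. S.tn n m)"
      by (rule additive_mapI, simp, rule R.RH_eqI) (simp_all, simp add: R.RH_ops)
    fix a n assume [simp]: "a \<in> carrier (dalg E)" "n \<in> carrier N"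
    show "(\<lambda>m\<in>carrier M. S.tn (sl N a n) m) = sl R.RH a (\<lambda>m\<in>carrier M. S.tn n m)"
      by (rule R.RH_eqI) (simp_all, simp add: R.RH_ops)
    show "(\<lambda>m\<in>carrier M. S.tn (tr N a n) m) = tr R.RH a (\<lambda>m\<in>carrier M. S.tn n m)"
      by (rule R.RH_eqI) (simp_all, simp add: R.RH_ops)
  next
    fix x w n assume [simp]: "x \<in> carrier (dX E)" "w \<in> carrier (dW E)" "n \<in> carrier N"
    show "(\<lambda>m\<in>carrier M. S.tn (PP N x w n) m) = PP R.RH x w (\<lambda>m\<in>carrier M. S.tn n m)"
    proof (rule R.RH_eqI)
      fix m assume m [simp]: "m \<in> carrier M"
      have "PP R.RH x w (\<lambda>m\<in>carrier M. S.tn n m) m =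
          SJ E S.T (\<lambda>y r. SI E S.T (\<lambda>w' x'. S.tn (PP N x w' n) (PP M x' r (QQ M w y m))))"
        by (simp add: R.RH_ops S.SJ_TR S.PT_tn cong: M.P.SJ_cong)
      also have "\<dots> = SI E S.T (\<lambda>w' x'. SJ E S.T (\<lambda>y r. S.tn (PP N x w' n) (PP M x' r (QQ M w y m))))"
        by (rule M.P.SJ_SI) simp_all
      also have "\<dots> = SI E S.T (\<lambda>w' x'. S.tn (PP N x (w' \<ddagger>\<^bsub>dW E\<^esub> de E x' w) n) m)"
        by (intro M.P.SI_cong) (simp add: M.H2h[OF T S.tn_am2])
      also have "\<dots> = S.tn (PP N x w n) m"
        by (rule M.P.C1[OF T]) (simp_all add: additive_mapI)
      finally show "(\<lambda>m\<in>carrier M. S.tn (PP N x w n) m) m = PP R.RH x w (\<lambda>m\<in>carrier M. S.tn n m) m" by simp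
    qed simp_all
    show "(\<lambda>m\<in>carrier M. S.tn (QQ N w x n) m) = QQ R.RH w x (\<lambda>m\<in>carrier M. S.tn n m)"
    proof (rule R.RH_eqI)
      fix m assume m [simp]: "m \<in> carrier M"
      have "QQ R.RH w x (\<lambda>m\<in>carrier M. S.tn n m) m =
          SI E S.T (\<lambda>w' x'. SJ E S.T (\<lambda>y r. S.tn (QQ N w y n) (QQ M r x' (PP M x w' m))))"
        by (simp add: R.RH_ops S.SI_TR S.QT_tn cong: M.P.SI_cong)
      also have "\<dots> = SJ E S.T (\<lambda>y r. SI E S.T (\<lambda>w' x'. S.tn (QQ N w y n) (QQ M r x' (PP M x w' m))))"
        by (rule M.P.SI_SJ) simp_all
      also have "\<dots> = SJ E S.T (\<lambda>y r. S.tn (QQ N w (y \<ddagger>\<^bsub>dX E\<^esub> dE E r x) n) m)"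
        by (intro M.P.SJ_cong) (simp add: M.H4h[OF T S.tn_am2])
      also have "\<dots> = S.tn (QQ N w x n) m"
        by (rule M.P.C4[OF T]) (simp_all add: additive_mapI)
      finally show "(\<lambda>m\<in>carrier M. S.tn (QQ N w x n) m) m = QQ R.RH w x (\<lambda>m\<in>carrier M. S.tn n m) m" by simp
    qed simp_all
  next
    fix x n assume [simp]: "x \<in> carrier (dX E)" "n \<in> carrier N"
    show "(\<lambda>m\<in>carrier M. S.tn (LN x n) m) = R.LR x (\<lambda>m\<in>carrier M. S.tn n m)"
    proof (rule R.RH_eqI)
      fix m assume m [simp]: "m \<in> carrier M"
      let ?f = "\<lambda>y r w' x' w2 x2. S.tn (PP N x w2 n) (PP M x2 r (QQ M w' y (LM x' m)))"
      have "SJ E S.T (\<lambda>y r. SI E S.T (\<lambda>w' x'. SI E S.T (?f y r w' x'))) =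
         SJ E S.T (\<lambda>y r. SI E S.T (\<lambda>w2 x2. SI E S.T (\<lambda>w' x'. ?f y r w' x' w2 x2)))"
        by (intro M.P.SJ_cong M.P.SI_SI) simp_all
      also have "\<dots> = SI E S.T (\<lambda>w2 x2. SJ E S.T (\<lambda>y r. SI E S.T (\<lambda>w' x'. ?f y r w' x' w2 x2)))"
        by (rule M.P.SJ_SI) simp_all
      also have "\<dots> = SI E S.T (\<lambda>w2 x2. SI E S.T (\<lambda>w' x'. SJ E S.T (\<lambda>y r. ?f y r w' x' w2 x2)))"
        by (intro M.P.SI_cong M.P.SJ_SI) simp_all
      also have "\<dots> = SI E S.T (\<lambda>w2 x2. SI E S.T (\<lambda>w' x'. S.tn (PP N x w2 n) (LM (de E x2 w' \<odot>\<^bsub>dX E\<^esub> x') m)))"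
        by (intro M.P.SI_cong) (simp add: M.H2h[OF T S.tn_am2])
      also have "\<dots> = SI E S.T (\<lambda>w2 x2. S.tn (PP N x w2 n) (LM x2 m))"
        by (intro M.P.SI_cong M.P.C2[OF T]) (simp_all add: additive_mapI)
      finally have "R.LR x (\<lambda>m\<in>carrier M. S.tn n m) m = S.LTmn x n m \<ominus>\<^bsub>S.T\<^esub> SI E S.T (\<lambda>w2 x2. S.tn (PP N x w2 n) (LM x2 m))"
        by (simp add: R.LR_app S.SI_TR S.SJ_TR S.diff_TR S.PT_tn S.LT_tn cong: M.P.SI_cong M.P.SJ_cong)
      also have "\<dots> = S.tn (LN x n) m"
        by (simp add: a_minus_def S.T.T.a_assoc S.T.T.r_neg)
      finally show "(\<lambda>m\<in>carrier M. S.tn (LN x n) m) m = R.LR x (\<lambda>m\<in>carrier M. S.tn n m) m" by simp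
    qed simp_all
  qed
qed

text \<open>The first relation on \<open>M\<close> settles (x, \<omega>) and the third (\<omega>,
  x). For x the definition of the action is the required identity, solved for [x f](m), up to the
  order of summation.\<close>

lemma counit_r: "rep_hom E (tens_rep E (rhom_rep E M N) M) (tensL E (rhom_rep E M N) (rhomL E M LM N LN) M LM) N LN
    (tens_ext N (\<lambda>f m. f m))"
proof -
  interpret R: xreps2 E d M LM N LN by unfold_locales
  interpret RX: xrep E R.RH d R.LR by (rule R.xrep_RH)
  interpret S: xreps2 E d R.RH R.LR M LM by unfold_locales
  note abN [simp] = N.P.V.abelian_group_axioms
  note cl [simp] = M.P.X.lmod_closed M.P.X.rcl M.P.W.lmod_closed M.P.W.rcl
  note [simp] = R.RH_cl R.RH_add R.RH_tr
  have bal: "balanced (dalg E) (bim R.RH) (bim M) N (\<lambda>f m. f m)"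
    by (rule S.T_balancedI) (simp_all, simp_all add: R.RH_ops)
  let ?ev = "tens_ext N (\<lambda>f m. f m)"
  have am: "additive_map S.T N ?ev" by (rule S.T.tens_ext_additive[OF abN bal])
  have ev [simp]: "?ev (S.tn f m) = f m" if "f \<in> carrier R.RH" "m \<in> carrier M" for f m
    using S.T.tens_ext_tens[OF abN bal] that by simp
  note evSI = M.P.SI_hom[OF S.T_ab abN am] M.P.SJ_hom[OF S.T_ab abN am]
  note comps = additive_map_comp[OF am] additive_map_comp[OF _ am]
  note ind = S.T_induct[where G = N]
  show ?thesis
  proof (rule rep_homI; (unfold tens_rep_simps S.additive_TR)?)
    show "additive_map S.T N ?ev" by (rule am)
    fix a t assume [simp]: "a \<in> carrier (dalg E)" and t: "t \<in> carrier S.T"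
    show "?ev (a \<odot>\<^bsub>S.T\<^esub> t) = sl N a (?ev t)"
      by (rule ind[OF additive_map_comp[OF S.T.smult_additive am] additive_map_comp[OF am N.sl_am] t])
        (simp_all, simp add: R.RH_ops)
    show "?ev (t \<ddagger>\<^bsub>S.T\<^esub> a) = tr N a (?ev t)"
      by (rule ind[OF additive_map_comp[OF S.T.rsmult_additive am] additive_map_comp[OF am N.tr_am] t]) simp_all
  next
    fix x w t assume [simp]: "x \<in> carrier (dX E)" "w \<in> carrier (dW E)" and t: "t \<in> carrier S.T"
    show "?ev (PP S.TR x w t) = PP N x w (?ev t)"
    proof (rule ind[OF additive_map_comp[OF S.PT_am am] additive_map_comp[OF am N.P_am] t])
      fix f m assume f [simp]: "f \<in> carrier R.RH" and m [simp]: "m \<in> carrier M"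
      have "?ev (PP S.TR x w (S.tn f m)) = SI E N (\<lambda>w' x'. SJ E N (\<lambda>y r. PP N x r (f (QQ M w' y (PP M x' w m)))))"
        by (simp add: S.PT_tn evSI cong: M.P.SI_cong) (simp add: R.RH_ops cong: M.P.SI_cong)
      also have "\<dots> = SJ E N (\<lambda>y r. SI E N (\<lambda>w' x'. PP N x r (f (QQ M w' y (PP M x' w m)))))"
        by (rule M.P.SI_SJ) simp_all
      also have "\<dots> = SJ E N (\<lambda>y r. PP N x (dE E w y \<odot>\<^bsub>dW E\<^esub> r) (f m))"
        using M.H1h[OF abN additive_map_comp[OF R.RH_am[OF f] N.P_am]] by (intro M.P.SJ_cong) simp
      also have "\<dots> = PP N x w (f m)"
        by (rule M.P.C3[OF abN]) (simp_all add: additive_mapI)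
      finally show "?ev (PP S.TR x w (S.tn f m)) = PP N x w (?ev (S.tn f m))" by simp
    qed simp_all
    show "?ev (QQ S.TR w x t) = QQ N w x (?ev t)"
    proof (rule ind[OF additive_map_comp[OF S.QT_am am] additive_map_comp[OF am N.Q_am] t])
      fix f m assume f [simp]: "f \<in> carrier R.RH" and m [simp]: "m \<in> carrier M"
      have "?ev (QQ S.TR w x (S.tn f m)) = SJ E N (\<lambda>y r. SI E N (\<lambda>w' x'. QQ N w x' (f (PP M y w' (QQ M r x m)))))"
        by (simp add: S.QT_tn evSI cong: M.P.SJ_cong) (simp add: R.RH_ops cong: M.P.SJ_cong)
      also have "\<dots> = SI E N (\<lambda>w' x'. SJ E N (\<lambda>y r. QQ N w x' (f (PP M y w' (QQ M r x m)))))"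
        by (rule M.P.SJ_SI) simp_all
      also have "\<dots> = SI E N (\<lambda>w' x'. QQ N w (de E x w' \<odot>\<^bsub>dX E\<^esub> x') (f m))"
        using M.H3h[OF abN additive_map_comp[OF R.RH_am[OF f] N.Q_am]] by (intro M.P.SI_cong) simp
      also have "\<dots> = QQ N w x (f m)"
        by (rule M.P.C2[OF abN]) (simp_all add: additive_mapI)
      finally show "?ev (QQ S.TR w x (S.tn f m)) = QQ N w x (?ev (S.tn f m))" by simp
    qed simp_all
  next
    fix x t assume [simp]: "x \<in> carrier (dX E)" and t: "t \<in> carrier S.T"
    show "?ev (S.LT x t) = LN x (?ev t)"
    proof (rule ind[OF additive_map_comp[OF S.LT_am am] additive_map_comp[OF am N.L_am] t])
      fix f m assume f [simp]: "f \<in> carrier R.RH" and m [simp]: "m \<in> carrier M"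
      let ?s = "SI E N (\<lambda>w' x'. SJ E N (\<lambda>y r. PP N x r (f (QQ M w' y (LM x' m)))))"
      have sw: "SJ E N (\<lambda>y r. SI E N (\<lambda>w' x'. PP N x r (f (QQ M w' y (LM x' m))))) = ?s"
        by (rule M.P.SJ_SI) simp_all
      have "?ev (S.LT x (S.tn f m)) = R.LR x f m \<oplus>\<^bsub>N\<^esub> SI E N (\<lambda>w' x'. PP R.RH x w' f (LM x' m))"
        by (simp add: S.LT_tn additive_map_add[OF am] evSI R.LR_closed cong: M.P.SI_cong)
      also have "\<dots> = (LN x (f m) \<ominus>\<^bsub>N\<^esub> ?s) \<oplus>\<^bsub>N\<^esub> ?s"
        by (simp add: R.LR_app R.RH_ops sw cong: M.P.SI_cong)
      also have "\<dots> = LN x (f m)"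
        by (simp add: a_minus_def N.P.V.a_assoc N.P.V.l_neg)
      finally show "?ev (S.LT x (S.tn f m)) = LN x (?ev (S.tn f m))" by simp
    qed simp_all
  qed
qed

text \<open>The third relation on \<open>M\<close> settles (x, \<omega>) and the first (\<omega>,
  x). For x the remaining sum over (y_j, \<omega>_i)(\<rho>_j, x) m \<otimes> x_i n collapses by the
  third relation as well.\<close>

lemma unit_l: "rep_hom E N LN (lhom_rep E M (tens_rep E M N)) (lhomL E M LM (tens_rep E M N) (tensL E M LM N LN))
    (\<lambda>n. \<lambda>m\<in>carrier M. tens (dalg E) (bim M) (bim N) m n)"
proof -
  interpret S: xreps2 E d M LM N LN by unfold_locales
  interpret TX: xrep E S.TR d S.LT by (rule S.xrep_T)
  interpret R: xreps2 E d M LM S.TR S.LT by unfold_locales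
  have eta [simp]: "(\<lambda>m\<in>carrier M. S.tn m n) \<in> carrier R.LH" if [simp]: "n \<in> carrier N" for n
    by (rule R.LH_I) simp_all
  note [simp] = R.LH_sl R.LH_tr R.LH_add_cl R.LH_P R.LH_Q R.LL_closed
  note T [simp] = S.T_ab
  note cl [simp] = M.P.X.lmod_closed M.P.X.rcl M.P.W.lmod_closed M.P.W.rcl
  show ?thesis
  proof (rule rep_homI)
    show "additive_map N R.LH (\<lambda>n. \<lambda>m\<in>carrier M. S.tn m n)"
      by (rule additive_mapI, simp, rule R.LH_eqI) (simp_all, simp add: R.LH_ops)
    fix a n assume [simp]: "a \<in> carrier (dalg E)" "n \<in> carrier N"
    show "(\<lambda>m\<in>carrier M. S.tn m (sl N a n)) = sl R.LH a (\<lambda>m\<in>carrier M. S.tn m n)"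
      by (rule R.LH_eqI) (simp_all, simp add: R.LH_ops)
    show "(\<lambda>m\<in>carrier M. S.tn m (tr N a n)) = tr R.LH a (\<lambda>m\<in>carrier M. S.tn m n)"
      by (rule R.LH_eqI) (simp_all, simp add: R.LH_ops)
  next
    fix x w n assume [simp]: "x \<in> carrier (dX E)" "w \<in> carrier (dW E)" "n \<in> carrier N"
    show "(\<lambda>m\<in>carrier M. S.tn m (PP N x w n)) = PP R.LH x w (\<lambda>m\<in>carrier M. S.tn m n)"
    proof (rule R.LH_eqI)
      fix m assume m [simp]: "m \<in> carrier M"
      have "PP R.LH x w (\<lambda>m\<in>carrier M. S.tn m n) m =
          SJ E S.T (\<lambda>y r. SI E S.T (\<lambda>w' x'. S.tn (PP M y w' (QQ M r x m)) (PP N x' w n)))"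
        by (simp add: R.LH_ops S.SJ_TR S.PT_tn cong: M.P.SJ_cong)
      also have "\<dots> = SI E S.T (\<lambda>w' x'. SJ E S.T (\<lambda>y r. S.tn (PP M y w' (QQ M r x m)) (PP N x' w n)))"
        by (rule M.P.SJ_SI) simp_all
      also have "\<dots> = SI E S.T (\<lambda>w' x'. S.tn m (PP N (de E x w' \<odot>\<^bsub>dX E\<^esub> x') w n))"
        by (intro M.P.SI_cong) (simp add: M.H3h[OF T S.tn_am1])
      also have "\<dots> = S.tn m (PP N x w n)"
        by (rule M.P.C2[OF T]) (simp_all add: additive_mapI)
      finally show "(\<lambda>m\<in>carrier M. S.tn m (PP N x w n)) m = PP R.LH x w (\<lambda>m\<in>carrier M. S.tn m n) m" by simp
    qed simp_all
    show "(\<lambda>m\<in>carrier M. S.tn m (QQ N w x n)) = QQ R.LH w x (\<lambda>m\<in>carrier M. S.tn m n)"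
    proof (rule R.LH_eqI)
      fix m assume m [simp]: "m \<in> carrier M"
      have "QQ R.LH w x (\<lambda>m\<in>carrier M. S.tn m n) m =
          SI E S.T (\<lambda>w' x'. SJ E S.T (\<lambda>y r. S.tn (QQ M w' y (PP M x' w m)) (QQ N r x n)))"
        by (simp add: R.LH_ops S.SI_TR S.QT_tn cong: M.P.SI_cong)
      also have "\<dots> = SJ E S.T (\<lambda>y r. SI E S.T (\<lambda>w' x'. S.tn (QQ M w' y (PP M x' w m)) (QQ N r x n)))"
        by (rule M.P.SI_SJ) simp_all
      also have "\<dots> = SJ E S.T (\<lambda>y r. S.tn m (QQ N (dE E w y \<odot>\<^bsub>dW E\<^esub> r) x n))"
        by (intro M.P.SJ_cong) (simp add: M.H1h[OF T S.tn_am1])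
      also have "\<dots> = S.tn m (QQ N w x n)"
        by (rule M.P.C3[OF T]) (simp_all add: additive_mapI)
      finally show "(\<lambda>m\<in>carrier M. S.tn m (QQ N w x n)) m = QQ R.LH w x (\<lambda>m\<in>carrier M. S.tn m n) m" by simp
    qed simp_all
  next
    fix x n assume [simp]: "x \<in> carrier (dX E)" "n \<in> carrier N"
    show "(\<lambda>m\<in>carrier M. S.tn m (LN x n)) = R.LL x (\<lambda>m\<in>carrier M. S.tn m n)"
    proof (rule R.LH_eqI)
      fix m assume m [simp]: "m \<in> carrier M"
      let ?f = "\<lambda>y r w' x'. S.tn (PP M y w' (QQ M r x m)) (LN x' n)"
      \<comment> \<open>Of the coproduct of y_j, the summand y_j (\<rho>_j, x) m \<otimes> n is what
        the second sum of the action subtracts.\<close>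
      have can: "(u \<oplus>\<^bsub>S.T\<^esub> v) \<ominus>\<^bsub>S.T\<^esub> u = v" if "u \<in> carrier S.T" "v \<in> carrier S.T" for u v
        using S.T.T.diff_cancel[of v "\<zero>\<^bsub>S.T\<^esub>" u] that by (simp add: a_minus_def S.T.T.a_comm)
      have "R.LL x (\<lambda>m\<in>carrier M. S.tn m n) m = SJ E S.T (\<lambda>y r. SI E S.T (?f y r))"
        by (simp add: R.LL_app S.SJ_TR S.diff_TR S.LT_tn can cong: M.P.SJ_cong)
      also have "\<dots> = SI E S.T (\<lambda>w' x'. SJ E S.T (\<lambda>y r. ?f y r w' x'))"
        by (rule M.P.SJ_SI) simp_all
      also have "\<dots> = SI E S.T (\<lambda>w' x'. S.tn m (LN (de E x w' \<odot>\<^bsub>dX E\<^esub> x') n))"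
        by (intro M.P.SI_cong) (simp add: M.H3h[OF T S.tn_am1])
      also have "\<dots> = S.tn m (LN x n)"
        by (rule M.P.C2[OF T]) (simp_all add: additive_mapI)
      finally show "(\<lambda>m\<in>carrier M. S.tn m (LN x n)) m = R.LL x (\<lambda>m\<in>carrier M. S.tn m n) m" by simp
    qed simp_all
  qed
qed

text \<open>The fourth relation on \<open>M\<close> settles (x, \<omega>) and the second (\<omega>,
  x). For x the sum of [x_i g]((x, \<omega>_i) m) has to equal x g(m) - g(x m); the fourth relation
  reduces it to a sum over y_j and \<rho>_j, which \<open>C4\<close> evaluates.\<close>

lemma counit_l: "rep_hom E (tens_rep E M (lhom_rep E M N)) (tensL E M LM (lhom_rep E M N) (lhomL E M LM N LN)) N LN
    (tens_ext N (\<lambda>m g. g m))"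
proof -
  interpret R: xreps2 E d M LM N LN by unfold_locales
  interpret RX: xrep E R.LH d R.LL by (rule R.xrep_LH)
  interpret S: xreps2 E d M LM R.LH R.LL by unfold_locales
  note abN [simp] = N.P.V.abelian_group_axioms
  note cl [simp] = M.P.X.lmod_closed M.P.X.rcl M.P.W.lmod_closed M.P.W.rcl
  note [simp] = R.LH_cl R.LH_add R.LH_lin
  have bal: "balanced (dalg E) (bim M) (bim R.LH) N (\<lambda>m g. g m)"
    by (rule S.T_balancedI) (simp_all, simp_all add: R.LH_ops)
  let ?ev = "tens_ext N (\<lambda>m g. g m)"
  have am: "additive_map S.T N ?ev" by (rule S.T.tens_ext_additive[OF abN bal])
  have ev [simp]: "?ev (S.tn m g) = g m" if "g \<in> carrier R.LH" "m \<in> carrier M" for g m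
    using S.T.tens_ext_tens[OF abN bal] that by simp
  note evSI = M.P.SI_hom[OF S.T_ab abN am] M.P.SJ_hom[OF S.T_ab abN am]
  note ind = S.T_induct[where G = N]
  show ?thesis
  proof (rule rep_homI; (unfold tens_rep_simps S.additive_TR)?)
    show "additive_map S.T N ?ev" by (rule am)
    fix a t assume [simp]: "a \<in> carrier (dalg E)" and t: "t \<in> carrier S.T"
    show "?ev (a \<odot>\<^bsub>S.T\<^esub> t) = sl N a (?ev t)"
      by (rule ind[OF additive_map_comp[OF S.T.smult_additive am] additive_map_comp[OF am N.sl_am] t]) simp_all
    show "?ev (t \<ddagger>\<^bsub>S.T\<^esub> a) = tr N a (?ev t)"
      by (rule ind[OF additive_map_comp[OF S.T.rsmult_additive am] additive_map_comp[OF am N.tr_am] t])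
        (simp_all, simp add: R.LH_ops)
  next
    fix x w t assume [simp]: "x \<in> carrier (dX E)" "w \<in> carrier (dW E)" and t: "t \<in> carrier S.T"
    show "?ev (PP S.TR x w t) = PP N x w (?ev t)"
    proof (rule ind[OF additive_map_comp[OF S.PT_am am] additive_map_comp[OF am N.P_am] t])
      fix m g assume m [simp]: "m \<in> carrier M" and g [simp]: "g \<in> carrier R.LH"
      have "?ev (PP S.TR x w (S.tn m g)) = SI E N (\<lambda>w' x'. SJ E N (\<lambda>y r. PP N y w (g (QQ M r x' (PP M x w' m)))))"
        by (simp add: S.PT_tn evSI cong: M.P.SI_cong) (simp add: R.LH_ops cong: M.P.SI_cong)
      also have "\<dots> = SJ E N (\<lambda>y r. SI E N (\<lambda>w' x'. PP N y w (g (QQ M r x' (PP M x w' m)))))"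
        by (rule M.P.SI_SJ) simp_all
      also have "\<dots> = SJ E N (\<lambda>y r. PP N (y \<ddagger>\<^bsub>dX E\<^esub> dE E r x) w (g m))"
        using M.H4h[OF abN additive_map_comp[OF R.LH_am[OF g] N.P_am]] by (intro M.P.SJ_cong) simp
      also have "\<dots> = PP N x w (g m)"
        by (rule M.P.C4[OF abN]) (simp_all add: additive_mapI)
      finally show "?ev (PP S.TR x w (S.tn m g)) = PP N x w (?ev (S.tn m g))" by simp
    qed simp_all
    show "?ev (QQ S.TR w x t) = QQ N w x (?ev t)"
    proof (rule ind[OF additive_map_comp[OF S.QT_am am] additive_map_comp[OF am N.Q_am] t])
      fix m g assume m [simp]: "m \<in> carrier M" and g [simp]: "g \<in> carrier R.LH"
      have "?ev (QQ S.TR w x (S.tn m g)) = SJ E N (\<lambda>y r. SI E N (\<lambda>w' x'. QQ N w' x (g (PP M x' r (QQ M w y m)))))"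
        by (simp add: S.QT_tn evSI cong: M.P.SJ_cong) (simp add: R.LH_ops cong: M.P.SJ_cong)
      also have "\<dots> = SI E N (\<lambda>w' x'. SJ E N (\<lambda>y r. QQ N w' x (g (PP M x' r (QQ M w y m)))))"
        by (rule M.P.SJ_SI) simp_all
      also have "\<dots> = SI E N (\<lambda>w' x'. QQ N (w' \<ddagger>\<^bsub>dW E\<^esub> de E x' w) x (g m))"
        using M.H2h[OF abN additive_map_comp[OF R.LH_am[OF g] N.Q_am]] by (intro M.P.SI_cong) simp
      also have "\<dots> = QQ N w x (g m)"
        by (rule M.P.C1[OF abN]) (simp_all add: additive_mapI)
      finally show "?ev (QQ S.TR w x (S.tn m g)) = QQ N w x (?ev (S.tn m g))" by simp
    qed simp_all
  next
    fix x t assume [simp]: "x \<in> carrier (dX E)" and t: "t \<in> carrier S.T"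
    show "?ev (S.LT x t) = LN x (?ev t)"
    proof (rule ind[OF additive_map_comp[OF S.LT_am am] additive_map_comp[OF am N.L_am] t])
      fix m g assume m [simp]: "m \<in> carrier M" and g [simp]: "g \<in> carrier R.LH"
      let ?f = "\<lambda>w' x' y r. R.Lphi x' g (PP M x w' m) y r"
      have "?ev (S.LT x (S.tn m g)) = g (LM x m) \<oplus>\<^bsub>N\<^esub> SI E N (\<lambda>w' x'. SJ E N (?f w' x'))"
        by (simp add: S.LT_tn additive_map_add[OF am] evSI R.LL_closed R.LL_app cong: M.P.SI_cong)
      also have "SI E N (\<lambda>w' x'. SJ E N (?f w' x')) = SJ E N (\<lambda>y r. SI E N (\<lambda>w' x'. ?f w' x' y r))"
        by (rule M.P.SI_SJ) simp_all
      also have "\<dots> = SJ E N (\<lambda>y r. LN (y \<ddagger>\<^bsub>dX E\<^esub> dE E r x) (g m) \<ominus>\<^bsub>N\<^esub> g (LM (y \<ddagger>\<^bsub>dX E\<^esub> dE E r x) m))"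
      proof (intro M.P.SJ_cong)
        fix y r assume [simp]: "y \<in> carrier (dX E)" "r \<in> carrier (dW E)"
        \<comment> \<open>The relation is applied under the whole difference as one additive map.
          The coefficient left on m then becomes a right factor of y, and the two derivation terms
          cancel.\<close>
        have "SI E N (\<lambda>w' x'. ?f w' x' y r) = LN y (g (sl M (dE E r x) m)) \<ominus>\<^bsub>N\<^esub> g (LM y (sl M (dE E r x) m))"
          by (rule M.H4h[OF abN, where h = "\<lambda>q. LN y (g q) \<ominus>\<^bsub>N\<^esub> g (LM y q)"])
             (simp_all add: additive_mapI N.P.V.add_diff)
        then show "SI E N (\<lambda>w' x'. ?f w' x' y r) = LN (y \<ddagger>\<^bsub>dX E\<^esub> dE E r x) (g m) \<ominus>\<^bsub>N\<^esub> g (LM (y \<ddagger>\<^bsub>dX E\<^esub> dE E r x) m)"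
          by (simp add: N.P.V.diff_cancel)
      qed
      also have "\<dots> = LN x (g m) \<ominus>\<^bsub>N\<^esub> g (LM x m)"
        by (rule M.P.C4[OF abN]) (simp_all add: additive_mapI N.P.V.add_diff)
      also have "g (LM x m) \<oplus>\<^bsub>N\<^esub> (LN x (g m) \<ominus>\<^bsub>N\<^esub> g (LM x m)) = LN x (g m)"
        by (simp add: a_minus_def N.P.V.a_lcomm N.P.V.r_neg)
      finally show "?ev (S.LT x (S.tn m g)) = LN x (?ev (S.tn m g))" by simp
    qed simp_all
  qed
qed

end

text \<open>The operators on a tensor product are sums of products of operators of the factors, all
  of which commute with \<open>F\<close> or \<open>G\<close>.\<close>

lemma rep_hom_tens:
  assumes "xrep E M d LM" "xrep E N d LN" "xrep E M' d LM'" "xrep E N' d LN'"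
    and F: "rep_hom E M LM M' LM' F" and G: "rep_hom E N LN N' LN' G"
  shows "rep_hom E (tens_rep E M N) (tensL E M LM N LN) (tens_rep E M' N') (tensL E M' LM' N' LN')
     (tens_ext (tensor (dalg E) (bim M') (bim N')) (\<lambda>m n. tens (dalg E) (bim M') (bim N') (F m) (G n)))"
proof -
  interpret M: xrep E M d LM by fact
  interpret N: xrep E N d LN by fact
  interpret M': xrep E M' d LM' by fact
  interpret N': xrep E N' d LN' by fact
  interpret S: xreps2 E d M LM N LN by unfold_locales
  interpret S': xreps2 E d M' LM' N' LN' by unfold_locales
  have [simp]: "F m \<in> carrier M'" if "m \<in> carrier M" for m using F that by (auto simp: rep_hom_def additive_map_def)
  have [simp]: "G m \<in> carrier N'" if "m \<in> carrier N" for m using G that by (auto simp: rep_hom_def additive_map_def)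
  have [simp]: "F (m \<oplus>\<^bsub>M\<^esub> m') = F m \<oplus>\<^bsub>M'\<^esub> F m'" if "m \<in> carrier M" "m' \<in> carrier M" for m m'
    using F that by (auto simp: rep_hom_def additive_map_def)
  have [simp]: "G (m \<oplus>\<^bsub>N\<^esub> m') = G m \<oplus>\<^bsub>N'\<^esub> G m'" if "m \<in> carrier N" "m' \<in> carrier N" for m m'
    using G that by (auto simp: rep_hom_def additive_map_def)
  have [simp]: "F (sl M a m) = sl M' a (F m)" "F (tr M a m) = tr M' a (F m)" if "a \<in> carrier (dalg E)" "m \<in> carrier M" for a m
    using F that by (auto simp: rep_hom_def)
  have [simp]: "G (sl N a m) = sl N' a (G m)" "G (tr N a m) = tr N' a (G m)" if "a \<in> carrier (dalg E)" "m \<in> carrier N" for a m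
    using G that by (auto simp: rep_hom_def)
  have [simp]: "F (PP M x w m) = PP M' x w (F m)" "F (QQ M w x m) = QQ M' w x (F m)" "F (LM x m) = LM' x (F m)"
    if "x \<in> carrier (dX E)" "w \<in> carrier (dW E)" "m \<in> carrier M" for x w m
    using F that by (auto simp: rep_hom_def)
  have [simp]: "G (PP N x w m) = PP N' x w (G m)" "G (QQ N w x m) = QQ N' w x (G m)" "G (LN x m) = LN' x (G m)"
    if "x \<in> carrier (dX E)" "w \<in> carrier (dW E)" "m \<in> carrier N" for x w m
    using G that by (auto simp: rep_hom_def)
  have L [simp]: "F (LM x m) = LM' x (F m)" "G (LN x n) = LN' x (G n)"
    if "x \<in> carrier (dX E)" "m \<in> carrier M" "n \<in> carrier N" for x m n
    using F G that by (auto simp: rep_hom_def)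
  note T' [simp] = S'.T_ab
  have bal: "balanced (dalg E) (bim M) (bim N) S'.T (\<lambda>m n. S'.tn (F m) (G n))"
    by (rule S.T_balancedI) simp_all
  let ?h = "tens_ext S'.T (\<lambda>m n. S'.tn (F m) (G n))"
  have am: "additive_map S.T S'.T ?h" by (rule S.T.tens_ext_additive[OF T' bal])
  have ev [simp]: "?h (S.tn m n) = S'.tn (F m) (G n)" if "m \<in> carrier M" "n \<in> carrier N" for m n
    using S.T.tens_ext_tens[OF T' bal] that by simp
  note hSI = M.P.SI_hom[OF S.T_ab T' am] M.P.SJ_hom[OF S.T_ab T' am]
  note ind = S.T_induct[where G = S'.T]
  show ?thesis
  proof (rule rep_homI; (unfold tens_rep_simps S.additive_TR)?)
    show "additive_map S.T S'.TR ?h" using am by (simp add: additive_map_def)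
    fix a t assume [simp]: "a \<in> carrier (dalg E)" and t: "t \<in> carrier S.T"
    show "?h (a \<odot>\<^bsub>S.T\<^esub> t) = a \<odot>\<^bsub>S'.T\<^esub> ?h t"
      by (rule ind[OF additive_map_comp[OF S.T.smult_additive am] additive_map_comp[OF am S'.T.smult_additive] t]) simp_all
    show "?h (t \<ddagger>\<^bsub>S.T\<^esub> a) = ?h t \<ddagger>\<^bsub>S'.T\<^esub> a"
      by (rule ind[OF additive_map_comp[OF S.T.rsmult_additive am] additive_map_comp[OF am S'.T.rsmult_additive] t]) simp_all
  next
    fix x w t assume [simp]: "x \<in> carrier (dX E)" "w \<in> carrier (dW E)" and t: "t \<in> carrier S.T"
    show "?h (PP S.TR x w t) = PP S'.TR x w (?h t)"
      by (rule ind[OF additive_map_comp[OF S.PT_am am] additive_map_comp[OF am S'.PT_am] t])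
         (simp_all add: S.PT_tn S'.PT_tn hSI cong: M.P.SI_cong)
    show "?h (QQ S.TR w x t) = QQ S'.TR w x (?h t)"
      by (rule ind[OF additive_map_comp[OF S.QT_am am] additive_map_comp[OF am S'.QT_am] t])
         (simp_all add: S.QT_tn S'.QT_tn hSI cong: M.P.SJ_cong)
  next
    fix x t assume [simp]: "x \<in> carrier (dX E)" and t: "t \<in> carrier S.T"
    show "?h (S.LT x t) = S'.LT x (?h t)"
    proof (rule ind[OF additive_map_comp[OF S.LT_am am] additive_map_comp[OF am S'.LT_am] t])
      fix m n assume [simp]: "m \<in> carrier M" "n \<in> carrier N"
      \<comment> \<open>The rule \<open>L\<close> speaks of one element from each factor; zero
        stands in for the other one.\<close>
      have "F (LM x m) = LM' x (F m)" using L(1)[of x m "\<zero>\<^bsub>N\<^esub>"] by simp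
      moreover have "G (LN y n) = LN' y (G n)" if "y \<in> carrier (dX E)" for y
        using L(2)[of y "\<zero>\<^bsub>M\<^esub>" n] that by simp
      ultimately show "?h (S.LT x (S.tn m n)) = S'.LT x (?h (S.tn m n))"
        by (simp add: S.LT_tn S'.LT_tn hSI additive_map_add[OF am] cong: M.P.SI_cong)
    qed simp_all
  qed
qed

section \<open>The enveloping algebra and its bimodules\<close>

text \<open>The pattern of the product of \<open>A^e\<close> and of its two actions on
  \<open>Z\<close>. The outer map is balanced because, as a function of the second tensor, both
  sides of each law are additive and may be compared on pure tensors.\<close>

lemma double_ext:
  assumes 1: "bimod_pair R1 M1 N1" and 2: "bimod_pair R2 M2 N2" and G: "abelian_group G"
    and b1: "\<And>m n. \<lbrakk>m \<in> carrier M2; n \<in> carrier N2\<rbrakk> \<Longrightarrow> balanced R1 M1 N1 G (\<lambda>m1 n1. \<theta> m1 n1 m n)"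
    and b2: "\<And>m n. \<lbrakk>m \<in> carrier M1; n \<in> carrier N1\<rbrakk> \<Longrightarrow> balanced R2 M2 N2 G (\<theta> m n)"
  defines "\<Theta> \<equiv> \<lambda>u z. tens_ext G (\<lambda>m1 n1. tens_ext G (\<theta> m1 n1) z) u"
  shows double_ext_left: "z \<in> carrier (tensor R2 M2 N2) \<Longrightarrow> additive_map (tensor R1 M1 N1) G (\<lambda>u. \<Theta> u z)"
    and double_ext_right: "u \<in> carrier (tensor R1 M1 N1) \<Longrightarrow> additive_map (tensor R2 M2 N2) G (\<Theta> u)"
    and double_ext_tens: "\<lbrakk>m1 \<in> carrier M1; n1 \<in> carrier N1; m2 \<in> carrier M2; n2 \<in> carrier N2\<rbrakk>
      \<Longrightarrow> \<Theta> (tens R1 M1 N1 m1 n1) (tens R2 M2 N2 m2 n2) = \<theta> m1 n1 m2 n2"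
proof -
  interpret A: bimod_pair R1 M1 N1 by fact
  interpret B: bimod_pair R2 M2 N2 by fact
  interpret G: abelian_group G by fact
  have am2: "additive_map B.T G (tens_ext G (\<theta> m n))" if "m \<in> carrier M1" "n \<in> carrier N1" for m n
    by (rule B.tens_ext_additive[OF G b2[OF that]])
  have v2: "tens_ext G (\<theta> m n) (B.tn m2 n2) = \<theta> m n m2 n2"
    if "m \<in> carrier M1" "n \<in> carrier N1" "m2 \<in> carrier M2" "n2 \<in> carrier N2" for m n m2 n2
    by (rule B.tens_ext_tens[OF G b2[OF that(1,2)] that(3,4)])
  have bal: "balanced R1 M1 N1 G (\<lambda>m1 n1. tens_ext G (\<theta> m1 n1) z)" if z: "z \<in> carrier B.T" for z
  proof (rule balancedI)
    note eqI = B.tensor_map_eqI[OF G _ _ _ z]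
    fix m m' n assume m: "m \<in> carrier M1" "m' \<in> carrier M1" and n: "n \<in> carrier N1"
    show "tens_ext G (\<theta> m n) z \<in> carrier G" using additive_map_closed[OF am2[OF m(1) n] z] .
    show "tens_ext G (\<theta> (m \<oplus>\<^bsub>M1\<^esub> m') n) z = tens_ext G (\<theta> m n) z \<oplus>\<^bsub>G\<^esub> tens_ext G (\<theta> m' n) z"
    proof (rule eqI)
      show "additive_map B.T G (\<lambda>z. tens_ext G (\<theta> m n) z \<oplus>\<^bsub>G\<^esub> tens_ext G (\<theta> m' n) z)"
        by (rule additive_map_sub[OF G am2 am2 B.T.abelian_group_axioms]) (use m n in auto)
      fix m2 n2 assume "m2 \<in> carrier M2" "n2 \<in> carrier N2"
      then show "tens_ext G (\<theta> (m \<oplus>\<^bsub>M1\<^esub> m') n) (B.tn m2 n2) = tens_ext G (\<theta> m n) (B.tn m2 n2) \<oplus>\<^bsub>G\<^esub> tens_ext G (\<theta> m' n) (B.tn m2 n2)"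
        using m n b1[of m2 n2] by (simp add: v2 balanced_def additive_map_def)
    qed (use m n in \<open>auto intro!: am2\<close>)
  next
    note eqI = B.tensor_map_eqI[OF G _ _ _ z]
    fix m n n' assume m: "m \<in> carrier M1" and n: "n \<in> carrier N1" "n' \<in> carrier N1"
    show "tens_ext G (\<theta> m (n \<oplus>\<^bsub>N1\<^esub> n')) z = tens_ext G (\<theta> m n) z \<oplus>\<^bsub>G\<^esub> tens_ext G (\<theta> m n') z"
    proof (rule eqI)
      show "additive_map B.T G (\<lambda>z. tens_ext G (\<theta> m n) z \<oplus>\<^bsub>G\<^esub> tens_ext G (\<theta> m n') z)"
        by (rule additive_map_sub[OF G am2 am2 B.T.abelian_group_axioms]) (use m n in auto)
      fix m2 n2 assume "m2 \<in> carrier M2" "n2 \<in> carrier N2"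
      then show "tens_ext G (\<theta> m (n \<oplus>\<^bsub>N1\<^esub> n')) (B.tn m2 n2) = tens_ext G (\<theta> m n) (B.tn m2 n2) \<oplus>\<^bsub>G\<^esub> tens_ext G (\<theta> m n') (B.tn m2 n2)"
        using m n b1[of m2 n2] by (simp add: v2 balanced_def additive_map_def)
    qed (use m n in \<open>auto intro!: am2\<close>)
  next
    note eqI = B.tensor_map_eqI[OF G _ _ _ z]
    fix m n r assume m: "m \<in> carrier M1" and n: "n \<in> carrier N1" and r: "r \<in> carrier R1"
    show "tens_ext G (\<theta> (m \<ddagger>\<^bsub>M1\<^esub> r) n) z = tens_ext G (\<theta> m (r \<odot>\<^bsub>N1\<^esub> n)) z"
    proof (rule eqI)
      fix m2 n2 assume "m2 \<in> carrier M2" "n2 \<in> carrier N2"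
      then show "tens_ext G (\<theta> (m \<ddagger>\<^bsub>M1\<^esub> r) n) (B.tn m2 n2) = tens_ext G (\<theta> m (r \<odot>\<^bsub>N1\<^esub> n)) (B.tn m2 n2)"
        using m n r b1[of m2 n2] by (simp add: v2 balanced_def A.M.rcl A.N.lmod_closed)
    qed (use m n r in \<open>auto intro!: am2 simp: A.M.rcl A.N.lmod_closed\<close>)
  qed
  show left: "additive_map A.T G (\<lambda>u. \<Theta> u z)" if "z \<in> carrier B.T" for z
    unfolding \<Theta>_def by (rule A.tens_ext_additive[OF G bal[OF that]])
  have v1: "\<Theta> (A.tn m n) z = tens_ext G (\<theta> m n) z" if "z \<in> carrier B.T" "m \<in> carrier M1" "n \<in> carrier N1" for m n z
    unfolding \<Theta>_def by (rule A.tens_ext_tens[OF G bal[OF that(1)] that(2,3)])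
  show "\<Theta> (A.tn m1 n1) (B.tn m2 n2) = \<theta> m1 n1 m2 n2"
    if "m1 \<in> carrier M1" "n1 \<in> carrier N1" "m2 \<in> carrier M2" "n2 \<in> carrier N2"
    using that by (simp add: v1 v2 B.tens_closed)
  show "additive_map B.T G (\<Theta> u)" if u: "u \<in> carrier A.T"
  proof (rule additive_mapI)
    fix z z' assume z: "z \<in> carrier B.T" "z' \<in> carrier B.T"
    show "\<Theta> u z \<in> carrier G" using additive_map_closed[OF left[OF z(1)] u] .
    show "\<Theta> u (z \<oplus>\<^bsub>B.T\<^esub> z') = \<Theta> u z \<oplus>\<^bsub>G\<^esub> \<Theta> u z'"
    proof (rule A.tensor_map_eqI[OF G left _ _ u])
      show "additive_map A.T G (\<lambda>u. \<Theta> u z \<oplus>\<^bsub>G\<^esub> \<Theta> u z')"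
        by (rule additive_map_sub[OF G left left A.T.abelian_group_axioms]) (use z in auto)
      fix m n assume "m \<in> carrier M1" "n \<in> carrier N1"
      then show "\<Theta> (A.tn m n) (z \<oplus>\<^bsub>B.T\<^esub> z') = \<Theta> (A.tn m n) z \<oplus>\<^bsub>G\<^esub> \<Theta> (A.tn m n) z'"
        using z additive_map_add[OF am2] by (simp add: v1)
    qed (use z in auto)
  qed
qed

lemma bimodule_bimod:
  assumes "bimodule K A M"
  shows "bimod A M"
proof -
  interpret bimodule K A M by fact
  show ?thesis
    by unfold_locales (simp_all add: rmod_closed rmod_r_distr rmod_l_distr rmod_assoc rmod_one bimod_assoc)
qed

context assoc_algebra
begin

lemma smult_one [simp]: "l \<in> carrier K \<Longrightarrow> l \<odot>\<^bsub>A\<^esub> \<one>\<^bsub>A\<^esub> \<in> carrier A"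
  by simp

lemma scal_mult: "\<lbrakk>l \<in> carrier K; a \<in> carrier A\<rbrakk> \<Longrightarrow> (l \<odot>\<^bsub>A\<^esub> \<one>\<^bsub>A\<^esub>) \<otimes>\<^bsub>A\<^esub> a = l \<odot>\<^bsub>A\<^esub> a"
  by (simp add: scalar_mult_left)

lemma mult_scal: "\<lbrakk>l \<in> carrier K; a \<in> carrier A\<rbrakk> \<Longrightarrow> a \<otimes>\<^bsub>A\<^esub> (l \<odot>\<^bsub>A\<^esub> \<one>\<^bsub>A\<^esub>) = l \<odot>\<^bsub>A\<^esub> a"
  by (simp add: scalar_mult_right)

lemma bimod_alg_scalars: "bimod K (alg_scalars A)"
proof (intro bimod.intro left_module.intro left_module_axioms.intro bimod_axioms.intro)
  show "ring K" by unfold_locales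
  show "abelian_group (alg_scalars A)"
    by (rule abelian_group_cong[of A]) (simp_all add: alg_scalars_def A.abelian_group_axioms)
qed (simp_all add: alg_scalars_def KA.smult_l_distr KA.smult_r_distr KA.smult_assoc1[symmetric] K.m_comm)

end

context bimodule
begin

lemma bimod_scalars: "bimod K (scalars A M)"
proof (intro bimod.intro left_module.intro left_module_axioms.intro bimod_axioms.intro)
  show "ring K" by unfold_locales
  show "abelian_group (scalars A M)"
    by (rule abelian_group_cong[of M]) (simp_all add: scalars_def M.M.abelian_group_axioms)
  have m: "((l \<otimes>\<^bsub>K\<^esub> l') \<odot>\<^bsub>A\<^esub> \<one>\<^bsub>A\<^esub>) \<odot>\<^bsub>M\<^esub> m = (l \<odot>\<^bsub>A\<^esub> \<one>\<^bsub>A\<^esub>) \<odot>\<^bsub>M\<^esub> ((l' \<odot>\<^bsub>A\<^esub> \<one>\<^bsub>A\<^esub>) \<odot>\<^bsub>M\<^esub> m)"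
    if "l \<in> carrier K" "l' \<in> carrier K" "m \<in> carrier M" for l l' m
    using that by (simp add: M.lmod_assoc[symmetric] scal_mult KA.smult_assoc1)
  note rules = M.lmod_closed M.lmod_l_distr M.lmod_r_distr M.lmod_one KA.smult_l_distr KA.smult_one
  fix l l' m assume k: "l \<in> carrier K" "l' \<in> carrier K" "m \<in> carrier (scalars A M)"
  show "(l \<otimes>\<^bsub>K\<^esub> l') \<odot>\<^bsub>scalars A M\<^esub> m = l \<odot>\<^bsub>scalars A M\<^esub> (l' \<odot>\<^bsub>scalars A M\<^esub> m)"
    using k m by (simp add: scalars_def)
  show "m \<ddagger>\<^bsub>scalars A M\<^esub> (l \<otimes>\<^bsub>K\<^esub> l') = (m \<ddagger>\<^bsub>scalars A M\<^esub> l) \<ddagger>\<^bsub>scalars A M\<^esub> l'"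
    using k m[of l' l m] by (simp add: scalars_def K.m_comm)
  show "(l \<odot>\<^bsub>scalars A M\<^esub> m) \<ddagger>\<^bsub>scalars A M\<^esub> l' = l \<odot>\<^bsub>scalars A M\<^esub> (m \<ddagger>\<^bsub>scalars A M\<^esub> l')"
    using k m[of l' l m] m[of l l' m] by (simp add: scalars_def K.m_comm)
qed (simp_all add: scalars_def M.lmod_closed M.lmod_l_distr M.lmod_r_distr M.lmod_one KA.smult_l_distr KA.smult_one)

end

definition dualD :: "('k, 'a, 'w, 'x) calculus \<Rightarrow> ('k, 'a, 'w, 'x) dual_data" where
  "dualD D = \<lparr>dbase = base D, dalg = alg D, dW = form D, dX = vect D,
     de = (\<lambda>x w. ev D (tenXW D x w)), dE = (\<lambda>w x. evu D (tenWX D w x)),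
     dI = nI D, dom = om D, dxb = xb D, dJ = nJ D, dyb = yb D, drb = rb D\<rparr>"

lemma dualD_simps [simp]:
  "dbase (dualD D) = base D" "dalg (dualD D) = alg D" "dW (dualD D) = form D" "dX (dualD D) = vect D"
  "de (dualD D) x w = ev D (tenXW D x w)" "dE (dualD D) w x = evu D (tenWX D w x)"
  "dI (dualD D) = nI D" "dom (dualD D) = om D" "dxb (dualD D) = xb D"
  "dJ (dualD D) = nJ D" "dyb (dualD D) = yb D" "drb (dualD D) = rb D"
  by (simp_all add: dualD_def)

text \<open>The passage from a bimodule map on the tensor product to a curried pairing, the form
  required by \<open>dual_data\<close>.\<close>

lemma pairing:
  assumes "bimod_pair R M N" "bimodule_map R (tensor R M N) (regular R) f"
  shows "balanced R M N R (\<lambda>m n. f (tens R M N m n))"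
    "\<And>r m n. \<lbrakk>r \<in> carrier R; m \<in> carrier M; n \<in> carrier N\<rbrakk> \<Longrightarrow> f (tens R M N (r \<odot>\<^bsub>M\<^esub> m) n) = r \<otimes>\<^bsub>R\<^esub> f (tens R M N m n)"
    "\<And>r m n. \<lbrakk>r \<in> carrier R; m \<in> carrier M; n \<in> carrier N\<rbrakk> \<Longrightarrow> f (tens R M N m (n \<ddagger>\<^bsub>N\<^esub> r)) = f (tens R M N m n) \<otimes>\<^bsub>R\<^esub> r"
proof -
  interpret bimod_pair R M N by fact
  have f: "additive_map T R f" and l: "\<forall>r\<in>carrier R. \<forall>t\<in>carrier T. f (r \<odot>\<^bsub>T\<^esub> t) = r \<otimes>\<^bsub>R\<^esub> f t"
    and r: "\<forall>r\<in>carrier R. \<forall>t\<in>carrier T. f (t \<ddagger>\<^bsub>T\<^esub> r) = f t \<otimes>\<^bsub>R\<^esub> r"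
    using assms(2) by (simp_all add: bimodule_map_def left_map_def right_map_def regular_def additive_map_def)
  note fa = additive_map_add[OF f] additive_map_closed[OF f]
  show "balanced R M N R (\<lambda>m n. f (tn m n))"
    by (rule balancedI) (simp_all add: fa tens_closed tens_add_left tens_add_right tens_balance)
  show "f (tn (r \<odot>\<^bsub>M\<^esub> m) n) = r \<otimes>\<^bsub>R\<^esub> f (tn m n)" if "r \<in> carrier R" "m \<in> carrier M" "n \<in> carrier N" for r m n
    using that l by (simp add: smult_tens[symmetric] tens_closed)
  show "f (tn m (n \<ddagger>\<^bsub>N\<^esub> r)) = f (tn m n) \<otimes>\<^bsub>R\<^esub> r" if "r \<in> carrier R" "m \<in> carrier M" "n \<in> carrier N" for r m n
    using that r by (simp add: rsmult_tens[symmetric] tens_closed)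
qed

section \<open>The dual data of a pivotal calculus\<close>

context pivotal_calculus
begin

sublocale C: first_order_calculus "base D" "alg D" "form D" "dd D" by (rule calculus)
sublocale V: bimodule "base D" "alg D" "vect D" by (rule vect)

lemma bimod_form: "bimod (alg D) (form D)" by (rule bimodule_bimod[OF C.bimodule_axioms])
lemma bimod_vect: "bimod (alg D) (vect D)" by (rule bimodule_bimod[OF vect])

lemma basis_closed: "i < nI D \<Longrightarrow> om D i \<in> carrier (form D)" "i < nI D \<Longrightarrow> xb D i \<in> carrier (vect D)"
  "j < nJ D \<Longrightarrow> rb D j \<in> carrier (form D)" "j < nJ D \<Longrightarrow> yb D j \<in> carrier (vect D)"
  using basis_I basis_J by auto

lemma dual_D: "dual (dualD D)"
proof -
  have 1: "bimod_pair (alg D) (vect D) (form D)" "bimod_pair (alg D) (form D) (vect D)"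
    using bimod_form bimod_vect by (auto intro: bimod_pair.intro)
  note pe = pairing[OF 1(1) ev, folded tenXW_def]
  note pe' = pairing[OF 1(2) evu, folded tenWX_def]
  note [simp] = dualD_simps SI_def SJ_def
  show ?thesis
  proof (rule dual.intro)
    show "balanced (dalg (dualD D)) (dX (dualD D)) (dW (dualD D)) (dalg (dualD D)) (de (dualD D))"
      using pe(1) by (simp add: dualD_def)
    show "balanced (dalg (dualD D)) (dW (dualD D)) (dX (dualD D)) (dalg (dualD D)) (dE (dualD D))"
      using pe'(1) by (simp add: dualD_def)
    show "ring (dalg (dualD D))" by (simp add: C.A.A.ring_axioms)
    show "dom (dualD D) i \<in> carrier (dW (dualD D))" "dxb (dualD D) i \<in> carrier (dX (dualD D))" if "i < dI (dualD D)" for i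
      using basis_I that by auto
    show "dyb (dualD D) i \<in> carrier (dX (dualD D))" "drb (dualD D) i \<in> carrier (dW (dualD D))" if "i < dJ (dualD D)" for i
      using basis_J that by auto
  qed (simp_all add: bimod_form bimod_vect pe pe' form_left_dual[symmetric] form_right_dual[symmetric]
     vect_left_dual[symmetric] vect_right_dual[symmetric])
qed

end

text \<open>Passing to the opposite algebra changes the product only, so as a group
  \<open>A^e\<close> is the tensor square of \<open>A\<close> over \<open>K\<close>.\<close>

lemma alg_scalars_opposite [simp]: "alg_scalars (opposite A) = alg_scalars A"
  by (simp add: alg_scalars_def opposite_def)

lemma mult_opposite [simp]: "a \<otimes>\<^bsub>opposite A\<^esub> b = b \<otimes>\<^bsub>A\<^esub> a" "\<one>\<^bsub>opposite A\<^esub> = \<one>\<^bsub>A\<^esub>"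
  by (simp_all add: opposite_def)

lemma alg_scalars_simps [simp]:
  "carrier (alg_scalars A) = carrier A" "add (alg_scalars A) = add A" "smult (alg_scalars A) = smult A"
  "a \<ddagger>\<^bsub>alg_scalars A\<^esub> l = l \<odot>\<^bsub>A\<^esub> a"
  by (simp_all add: alg_scalars_def)

lemma scalars_simps [simp]:
  "carrier (scalars A M) = carrier M" "add (scalars A M) = add M" "zero (scalars A M) = zero M"
  "l \<odot>\<^bsub>scalars A M\<^esub> m = (l \<odot>\<^bsub>A\<^esub> \<one>\<^bsub>A\<^esub>) \<odot>\<^bsub>M\<^esub> m" "m \<ddagger>\<^bsub>scalars A M\<^esub> l = (l \<odot>\<^bsub>A\<^esub> \<one>\<^bsub>A\<^esub>) \<odot>\<^bsub>M\<^esub> m"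
  by (simp_all add: scalars_def)

section \<open>The product of the enveloping algebra\<close>

context assoc_algebra
begin

abbreviation "EA \<equiv> enveloping K A"
abbreviation "t2 \<equiv> alg_tens K A (opposite A)"

sublocale S: bimod_pair K "alg_scalars A" "alg_scalars A"
  by (intro bimod_pair.intro bimod_alg_scalars)

lemma t2_eq: "t2 = S.tn"
  by (simp add: alg_tens_def)

lemma t2_closed: "a \<in> carrier A \<Longrightarrow> b \<in> carrier A \<Longrightarrow> t2 a b \<in> carrier S.T"
  using S.tens_closed by (simp add: t2_eq)

lemma t2_add1: "\<lbrakk>a \<in> carrier A; a' \<in> carrier A; b \<in> carrier A\<rbrakk> \<Longrightarrow> t2 (a \<oplus>\<^bsub>A\<^esub> a') b = t2 a b \<oplus>\<^bsub>S.T\<^esub> t2 a' b"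
  and t2_add2: "\<lbrakk>a \<in> carrier A; b \<in> carrier A; b' \<in> carrier A\<rbrakk> \<Longrightarrow> t2 a (b \<oplus>\<^bsub>A\<^esub> b') = t2 a b \<oplus>\<^bsub>S.T\<^esub> t2 a b'"
  and t2_scal: "\<lbrakk>a \<in> carrier A; b \<in> carrier A; l \<in> carrier K\<rbrakk> \<Longrightarrow> t2 (l \<odot>\<^bsub>A\<^esub> a) b = t2 a (l \<odot>\<^bsub>A\<^esub> b)"
  using S.tens_add_left S.tens_add_right S.tens_balance by (simp_all add: t2_eq)

lemma EA_simps: "carrier EA = carrier S.T" "add EA = add S.T" "zero EA = zero S.T" "one EA = t2 \<one>\<^bsub>A\<^esub> \<one>\<^bsub>A\<^esub>" "smult EA = smult S.T"
  "u \<otimes>\<^bsub>EA\<^esub> v = tens_ext S.T (\<lambda>a b. tens_ext S.T (\<lambda>a' b'. t2 (a \<otimes>\<^bsub>A\<^esub> a') (b' \<otimes>\<^bsub>A\<^esub> b)) v) u"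
  by (simp_all add: enveloping_def alg_tensor_def Let_def)

lemma EA_mult: 
  shows EA_mult1: "v \<in> carrier EA \<Longrightarrow> additive_map EA EA (\<lambda>u. u \<otimes>\<^bsub>EA\<^esub> v)"
    and EA_mult2: "u \<in> carrier EA \<Longrightarrow> additive_map EA EA (\<lambda>v. u \<otimes>\<^bsub>EA\<^esub> v)"
    and EA_mult_t2: "\<lbrakk>a \<in> carrier A; b \<in> carrier A; a' \<in> carrier A; b' \<in> carrier A\<rbrakk>
      \<Longrightarrow> t2 a b \<otimes>\<^bsub>EA\<^esub> t2 a' b' = t2 (a \<otimes>\<^bsub>A\<^esub> a') (b' \<otimes>\<^bsub>A\<^esub> b)"
proof -
  have b1: "balanced K (alg_scalars A) (alg_scalars A) S.T (\<lambda>a b. t2 (a \<otimes>\<^bsub>A\<^esub> m) (n \<otimes>\<^bsub>A\<^esub> b))"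
    if "m \<in> carrier (alg_scalars A)" "n \<in> carrier (alg_scalars A)" for m n
    using that by (intro balancedI)
      (simp_all add: t2_closed t2_add1 t2_add2 t2_scal A.l_distr A.r_distr scalar_mult_left scalar_mult_right)
  have b2: "balanced K (alg_scalars A) (alg_scalars A) S.T (\<lambda>a b. t2 (m \<otimes>\<^bsub>A\<^esub> a) (b \<otimes>\<^bsub>A\<^esub> n))"
    if "m \<in> carrier (alg_scalars A)" "n \<in> carrier (alg_scalars A)" for m n
    using that by (intro balancedI)
      (simp_all add: t2_closed t2_add1 t2_add2 t2_scal A.l_distr A.r_distr scalar_mult_left scalar_mult_right)
  note d = double_ext[where \<theta> = "\<lambda>a b a' b'. t2 (a \<otimes>\<^bsub>A\<^esub> a') (b' \<otimes>\<^bsub>A\<^esub> b)",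
      OF S.bimod_pair_axioms S.bimod_pair_axioms S.T.abelian_group_axioms b1 b2]
  show "additive_map EA EA (\<lambda>u. u \<otimes>\<^bsub>EA\<^esub> v)" if "v \<in> carrier EA"
    using d(1)[of v] that by (simp add: additive_map_def EA_simps)
  show "additive_map EA EA (\<lambda>v. u \<otimes>\<^bsub>EA\<^esub> v)" if "u \<in> carrier EA"
    using d(2)[of u] that by (simp add: additive_map_def EA_simps)
  show "t2 a b \<otimes>\<^bsub>EA\<^esub> t2 a' b' = t2 (a \<otimes>\<^bsub>A\<^esub> a') (b' \<otimes>\<^bsub>A\<^esub> b)"
    if "a \<in> carrier A" "b \<in> carrier A" "a' \<in> carrier A" "b' \<in> carrier A"
    using d(3)[of a b a' b'] that by (simp add: EA_simps t2_eq)
qed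

lemma EA_smult: "l \<in> carrier K \<Longrightarrow> additive_map EA EA (smult EA l)"
  using S.smult_additive[of l] by (simp add: additive_map_def EA_simps)

lemma EA_smult_t2: "\<lbrakk>l \<in> carrier K; a \<in> carrier A; b \<in> carrier A\<rbrakk> \<Longrightarrow> l \<odot>\<^bsub>EA\<^esub> t2 a b = t2 (l \<odot>\<^bsub>A\<^esub> a) b"
  using S.smult_tens[of l a b] by (simp add: EA_simps t2_eq)

lemma opsclosed_EA: "opsclosed K EA"
proof -
  have "t2 \<one>\<^bsub>A\<^esub> \<one>\<^bsub>A\<^esub> \<in> carrier S.T" by (simp add: t2_closed)
  moreover have "u \<otimes>\<^bsub>EA\<^esub> v \<in> carrier S.T" if "u \<in> carrier S.T" "v \<in> carrier S.T" for u v
    using additive_map_closed[OF EA_mult2] that by (simp add: EA_simps(1))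
  moreover have "l \<odot>\<^bsub>EA\<^esub> v \<in> carrier S.T" if "l \<in> carrier K" "v \<in> carrier S.T" for l v
    using additive_map_closed[OF EA_smult] that by (simp add: EA_simps(1))
  ultimately show ?thesis by (simp add: opsclosed_def EA_simps(1-4))
qed

lemma EA_induct:
  assumes "abelian_group G" "additive_map EA G f" "additive_map EA G g"
    and "\<And>a b. \<lbrakk>a \<in> carrier A; b \<in> carrier A\<rbrakk> \<Longrightarrow> f (t2 a b) = g (t2 a b)"
    and "u \<in> carrier EA"
  shows "f u = g u"
  using S.tensor_map_eqI[OF assms(1), of f g u] assms(2-) by (simp add: additive_map_def EA_simps t2_eq)

end

text \<open>Used twice, for the pair of vector fields and forms and for the reversed pair: these are
  the two summands of \<open>ZZ\<close>.\<close>

locale env_pair = P: bimodule K A P + Q: bimodule K A Q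
  for K :: "'k ring" and A :: "('k, 'a) module" and P :: "('a, 'p) bimodule" and Q :: "('a, 'q) bimodule"
begin

sublocale T: bimod_pair K "scalars A P" "scalars A Q"
  by (intro bimod_pair.intro P.bimod_scalars Q.bimod_scalars)

abbreviation "Z \<equiv> env_tensor K A P Q"
abbreviation "tz \<equiv> tens K (scalars A P) (scalars A Q)"

lemma Z_simps: "carrier Z = carrier T.T" "add Z = add T.T" "zero Z = zero T.T"
  "u \<odot>\<^bsub>Z\<^esub> z = tens_ext T.T (\<lambda>a a'. tens_ext T.T (\<lambda>p q. tz (a \<odot>\<^bsub>P\<^esub> p) (q \<ddagger>\<^bsub>Q\<^esub> a')) z) u"
  "z \<ddagger>\<^bsub>Z\<^esub> u = tens_ext T.T (\<lambda>b b'. tens_ext T.T (\<lambda>p q. tz (p \<ddagger>\<^bsub>P\<^esub> b) (b' \<odot>\<^bsub>Q\<^esub> q)) z) u"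
  by (simp_all add: env_tensor_def Let_def)

lemma tz_closed: "p \<in> carrier P \<Longrightarrow> q \<in> carrier Q \<Longrightarrow> tz p q \<in> carrier Z"
  using T.tens_closed by (simp add: Z_simps)

lemma tz_add1: "\<lbrakk>p \<in> carrier P; p' \<in> carrier P; q \<in> carrier Q\<rbrakk> \<Longrightarrow> tz (p \<oplus>\<^bsub>P\<^esub> p') q = tz p q \<oplus>\<^bsub>Z\<^esub> tz p' q"
  and tz_add2: "\<lbrakk>p \<in> carrier P; q \<in> carrier Q; q' \<in> carrier Q\<rbrakk> \<Longrightarrow> tz p (q \<oplus>\<^bsub>Q\<^esub> q') = tz p q \<oplus>\<^bsub>Z\<^esub> tz p q'"
  and tz_scal: "\<lbrakk>p \<in> carrier P; q \<in> carrier Q; l \<in> carrier K\<rbrakk>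
    \<Longrightarrow> tz ((l \<odot>\<^bsub>A\<^esub> \<one>\<^bsub>A\<^esub>) \<odot>\<^bsub>P\<^esub> p) q = tz p ((l \<odot>\<^bsub>A\<^esub> \<one>\<^bsub>A\<^esub>) \<odot>\<^bsub>Q\<^esub> q)"
  using T.tens_add_left T.tens_add_right T.tens_balance by (simp_all add: Z_simps)

text \<open>All scalars are brought to the far left, where balance over \<open>K\<close> lets them
  change the factor. This is the only place where centrality of \<open>K\<close> in the bimodules
  \<open>P\<close> and \<open>Q\<close> is invoked.\<close>

lemma scal_rules:
  assumes "l \<in> carrier K" "a \<in> carrier A"
  shows "p \<in> carrier P \<Longrightarrow> (l \<odot>\<^bsub>A\<^esub> a) \<odot>\<^bsub>P\<^esub> p = (l \<odot>\<^bsub>A\<^esub> \<one>\<^bsub>A\<^esub>) \<odot>\<^bsub>P\<^esub> (a \<odot>\<^bsub>P\<^esub> p)"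
    "p \<in> carrier P \<Longrightarrow> a \<odot>\<^bsub>P\<^esub> ((l \<odot>\<^bsub>A\<^esub> \<one>\<^bsub>A\<^esub>) \<odot>\<^bsub>P\<^esub> p) = (l \<odot>\<^bsub>A\<^esub> \<one>\<^bsub>A\<^esub>) \<odot>\<^bsub>P\<^esub> (a \<odot>\<^bsub>P\<^esub> p)"
    "p \<in> carrier P \<Longrightarrow> p \<ddagger>\<^bsub>P\<^esub> (l \<odot>\<^bsub>A\<^esub> a) = (l \<odot>\<^bsub>A\<^esub> \<one>\<^bsub>A\<^esub>) \<odot>\<^bsub>P\<^esub> (p \<ddagger>\<^bsub>P\<^esub> a)"
    "p \<in> carrier P \<Longrightarrow> ((l \<odot>\<^bsub>A\<^esub> \<one>\<^bsub>A\<^esub>) \<odot>\<^bsub>P\<^esub> p) \<ddagger>\<^bsub>P\<^esub> a = (l \<odot>\<^bsub>A\<^esub> \<one>\<^bsub>A\<^esub>) \<odot>\<^bsub>P\<^esub> (p \<ddagger>\<^bsub>P\<^esub> a)"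
    "q \<in> carrier Q \<Longrightarrow> (l \<odot>\<^bsub>A\<^esub> a) \<odot>\<^bsub>Q\<^esub> q = (l \<odot>\<^bsub>A\<^esub> \<one>\<^bsub>A\<^esub>) \<odot>\<^bsub>Q\<^esub> (a \<odot>\<^bsub>Q\<^esub> q)"
    "q \<in> carrier Q \<Longrightarrow> a \<odot>\<^bsub>Q\<^esub> ((l \<odot>\<^bsub>A\<^esub> \<one>\<^bsub>A\<^esub>) \<odot>\<^bsub>Q\<^esub> q) = (l \<odot>\<^bsub>A\<^esub> \<one>\<^bsub>A\<^esub>) \<odot>\<^bsub>Q\<^esub> (a \<odot>\<^bsub>Q\<^esub> q)"
    "q \<in> carrier Q \<Longrightarrow> q \<ddagger>\<^bsub>Q\<^esub> (l \<odot>\<^bsub>A\<^esub> a) = (l \<odot>\<^bsub>A\<^esub> \<one>\<^bsub>A\<^esub>) \<odot>\<^bsub>Q\<^esub> (q \<ddagger>\<^bsub>Q\<^esub> a)"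
    "q \<in> carrier Q \<Longrightarrow> ((l \<odot>\<^bsub>A\<^esub> \<one>\<^bsub>A\<^esub>) \<odot>\<^bsub>Q\<^esub> q) \<ddagger>\<^bsub>Q\<^esub> a = (l \<odot>\<^bsub>A\<^esub> \<one>\<^bsub>A\<^esub>) \<odot>\<^bsub>Q\<^esub> (q \<ddagger>\<^bsub>Q\<^esub> a)"
proof -
  have s: "l \<odot>\<^bsub>A\<^esub> a = (l \<odot>\<^bsub>A\<^esub> \<one>\<^bsub>A\<^esub>) \<otimes>\<^bsub>A\<^esub> a" "l \<odot>\<^bsub>A\<^esub> a = a \<otimes>\<^bsub>A\<^esub> (l \<odot>\<^bsub>A\<^esub> \<one>\<^bsub>A\<^esub>)"
    using assms by (simp_all add: P.scal_mult P.mult_scal)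
  note one = P.smult_one[OF assms(1)]
  note c = one assms(2)
  show "(l \<odot>\<^bsub>A\<^esub> a) \<odot>\<^bsub>P\<^esub> p = (l \<odot>\<^bsub>A\<^esub> \<one>\<^bsub>A\<^esub>) \<odot>\<^bsub>P\<^esub> (a \<odot>\<^bsub>P\<^esub> p)" if "p \<in> carrier P"
    using P.M.lmod_assoc[OF one assms(2) that] s(1) by simp
  show "a \<odot>\<^bsub>P\<^esub> ((l \<odot>\<^bsub>A\<^esub> \<one>\<^bsub>A\<^esub>) \<odot>\<^bsub>P\<^esub> p) = (l \<odot>\<^bsub>A\<^esub> \<one>\<^bsub>A\<^esub>) \<odot>\<^bsub>P\<^esub> (a \<odot>\<^bsub>P\<^esub> p)" if "p \<in> carrier P"
    using P.M.lmod_assoc[OF one assms(2) that] P.M.lmod_assoc[OF assms(2) one that] s by simp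
  show "p \<ddagger>\<^bsub>P\<^esub> (l \<odot>\<^bsub>A\<^esub> a) = (l \<odot>\<^bsub>A\<^esub> \<one>\<^bsub>A\<^esub>) \<odot>\<^bsub>P\<^esub> (p \<ddagger>\<^bsub>P\<^esub> a)" if "p \<in> carrier P"
    using P.rmod_assoc[OF assms(2) one that] P.central[OF assms(1) P.rmod_closed[OF assms(2) that]] s by simp
  show "((l \<odot>\<^bsub>A\<^esub> \<one>\<^bsub>A\<^esub>) \<odot>\<^bsub>P\<^esub> p) \<ddagger>\<^bsub>P\<^esub> a = (l \<odot>\<^bsub>A\<^esub> \<one>\<^bsub>A\<^esub>) \<odot>\<^bsub>P\<^esub> (p \<ddagger>\<^bsub>P\<^esub> a)" if "p \<in> carrier P"
    using P.bimod_assoc[OF one assms(2) that] .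
  show "(l \<odot>\<^bsub>A\<^esub> a) \<odot>\<^bsub>Q\<^esub> q = (l \<odot>\<^bsub>A\<^esub> \<one>\<^bsub>A\<^esub>) \<odot>\<^bsub>Q\<^esub> (a \<odot>\<^bsub>Q\<^esub> q)" if "q \<in> carrier Q"
    using Q.M.lmod_assoc[OF one assms(2) that] s(1) by simp
  show "a \<odot>\<^bsub>Q\<^esub> ((l \<odot>\<^bsub>A\<^esub> \<one>\<^bsub>A\<^esub>) \<odot>\<^bsub>Q\<^esub> q) = (l \<odot>\<^bsub>A\<^esub> \<one>\<^bsub>A\<^esub>) \<odot>\<^bsub>Q\<^esub> (a \<odot>\<^bsub>Q\<^esub> q)" if "q \<in> carrier Q"
    using Q.M.lmod_assoc[OF one assms(2) that] Q.M.lmod_assoc[OF assms(2) one that] s by simp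
  show "q \<ddagger>\<^bsub>Q\<^esub> (l \<odot>\<^bsub>A\<^esub> a) = (l \<odot>\<^bsub>A\<^esub> \<one>\<^bsub>A\<^esub>) \<odot>\<^bsub>Q\<^esub> (q \<ddagger>\<^bsub>Q\<^esub> a)" if "q \<in> carrier Q"
    using Q.rmod_assoc[OF assms(2) one that] Q.central[OF assms(1) Q.rmod_closed[OF assms(2) that]] s by simp
  show "((l \<odot>\<^bsub>A\<^esub> \<one>\<^bsub>A\<^esub>) \<odot>\<^bsub>Q\<^esub> q) \<ddagger>\<^bsub>Q\<^esub> a = (l \<odot>\<^bsub>A\<^esub> \<one>\<^bsub>A\<^esub>) \<odot>\<^bsub>Q\<^esub> (q \<ddagger>\<^bsub>Q\<^esub> a)" if "q \<in> carrier Q"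
    using Q.bimod_assoc[OF one assms(2) that] .
qed

lemma Z_abelian: "abelian_group Z"
  by (rule abelian_group_cong[OF T.T.abelian_group_axioms]) (simp_all add: Z_simps)

lemma Z_smult:
  shows Z_smult1: "z \<in> carrier Z \<Longrightarrow> additive_map P.EA Z (\<lambda>u. u \<odot>\<^bsub>Z\<^esub> z)"
    and Z_smult2: "u \<in> carrier P.EA \<Longrightarrow> additive_map Z Z (\<lambda>z. u \<odot>\<^bsub>Z\<^esub> z)"
    and Z_smult_tz: "\<lbrakk>a \<in> carrier A; a' \<in> carrier A; p \<in> carrier P; q \<in> carrier Q\<rbrakk>
      \<Longrightarrow> P.t2 a a' \<odot>\<^bsub>Z\<^esub> tz p q = tz (a \<odot>\<^bsub>P\<^esub> p) (q \<ddagger>\<^bsub>Q\<^esub> a')"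
proof -
  note cl = P.M.lmod_closed Q.rmod_closed tz_closed[unfolded Z_simps]
  note r = tz_add1[unfolded Z_simps] tz_add2[unfolded Z_simps]
    P.M.lmod_l_distr P.M.lmod_r_distr Q.rmod_l_distr Q.rmod_r_distr
  have b1: "balanced K (alg_scalars A) (alg_scalars A) T.T (\<lambda>a b. tz (a \<odot>\<^bsub>P\<^esub> m) (n \<ddagger>\<^bsub>Q\<^esub> b))"
    if "m \<in> carrier (scalars A P)" "n \<in> carrier (scalars A Q)" for m n
    proof (rule balancedI)
    fix a b l assume "a \<in> carrier (alg_scalars A)" "b \<in> carrier (alg_scalars A)" "l \<in> carrier K"
    then show "tz ((a \<ddagger>\<^bsub>alg_scalars A\<^esub> l) \<odot>\<^bsub>P\<^esub> m) (n \<ddagger>\<^bsub>Q\<^esub> b) = tz (a \<odot>\<^bsub>P\<^esub> m) (n \<ddagger>\<^bsub>Q\<^esub> (l \<odot>\<^bsub>alg_scalars A\<^esub> b))"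
      using that scal_rules(1)[of l a m] scal_rules(7)[of l b n] tz_scal[of "a \<odot>\<^bsub>P\<^esub> m" "n \<ddagger>\<^bsub>Q\<^esub> b" l]
      by (simp add: cl)
  qed (use that in \<open>simp_all add: cl r\<close>)
  have b2: "balanced K (scalars A P) (scalars A Q) T.T (\<lambda>a b. tz (m \<odot>\<^bsub>P\<^esub> a) (b \<ddagger>\<^bsub>Q\<^esub> n))"
    if "m \<in> carrier (alg_scalars A)" "n \<in> carrier (alg_scalars A)" for m n
    proof (rule balancedI)
    fix a b l assume "a \<in> carrier (scalars A P)" "b \<in> carrier (scalars A Q)" "l \<in> carrier K"
    then show "tz (m \<odot>\<^bsub>P\<^esub> (a \<ddagger>\<^bsub>scalars A P\<^esub> l)) (b \<ddagger>\<^bsub>Q\<^esub> n) = tz (m \<odot>\<^bsub>P\<^esub> a) ((l \<odot>\<^bsub>scalars A Q\<^esub> b) \<ddagger>\<^bsub>Q\<^esub> n)"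
      using that scal_rules(2)[of l m a] scal_rules(8)[of l n b] tz_scal[of "m \<odot>\<^bsub>P\<^esub> a" "b \<ddagger>\<^bsub>Q\<^esub> n" l]
      by (simp add: cl)
  qed (use that in \<open>simp_all add: cl r\<close>)
  note d = double_ext[where \<theta> = "\<lambda>a b p q. tz (a \<odot>\<^bsub>P\<^esub> p) (q \<ddagger>\<^bsub>Q\<^esub> b)",
      OF P.S.bimod_pair_axioms T.bimod_pair_axioms T.T.abelian_group_axioms b1 b2]
  show "additive_map P.EA Z (\<lambda>u. u \<odot>\<^bsub>Z\<^esub> z)" if "z \<in> carrier Z"
    using d(1)[of z] that by (simp add: additive_map_def P.EA_simps Z_simps)
  show "additive_map Z Z (\<lambda>z. u \<odot>\<^bsub>Z\<^esub> z)" if "u \<in> carrier P.EA"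
    using d(2)[of u] that by (simp add: additive_map_def P.EA_simps Z_simps)
  show "P.t2 a a' \<odot>\<^bsub>Z\<^esub> tz p q = tz (a \<odot>\<^bsub>P\<^esub> p) (q \<ddagger>\<^bsub>Q\<^esub> a')"
    if "a \<in> carrier A" "a' \<in> carrier A" "p \<in> carrier P" "q \<in> carrier Q"
    using d(3)[of a a' p q] that by (simp add: Z_simps P.t2_eq)
qed

lemma Z_rsmult:
  shows Z_rsmult1: "z \<in> carrier Z \<Longrightarrow> additive_map P.EA Z (\<lambda>u. z \<ddagger>\<^bsub>Z\<^esub> u)"
    and Z_rsmult2: "u \<in> carrier P.EA \<Longrightarrow> additive_map Z Z (\<lambda>z. z \<ddagger>\<^bsub>Z\<^esub> u)"
    and Z_rsmult_tz: "\<lbrakk>b \<in> carrier A; b' \<in> carrier A; p \<in> carrier P; q \<in> carrier Q\<rbrakk>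
      \<Longrightarrow> tz p q \<ddagger>\<^bsub>Z\<^esub> P.t2 b b' = tz (p \<ddagger>\<^bsub>P\<^esub> b) (b' \<odot>\<^bsub>Q\<^esub> q)"
proof -
  note cl = P.rmod_closed Q.M.lmod_closed tz_closed[unfolded Z_simps]
  note r = tz_add1[unfolded Z_simps] tz_add2[unfolded Z_simps]
    Q.M.lmod_l_distr Q.M.lmod_r_distr P.rmod_l_distr P.rmod_r_distr
  have b1: "balanced K (alg_scalars A) (alg_scalars A) T.T (\<lambda>a b. tz (m \<ddagger>\<^bsub>P\<^esub> a) (b \<odot>\<^bsub>Q\<^esub> n))"
    if "m \<in> carrier (scalars A P)" "n \<in> carrier (scalars A Q)" for m n
    proof (rule balancedI)
    fix a b l assume "a \<in> carrier (alg_scalars A)" "b \<in> carrier (alg_scalars A)" "l \<in> carrier K"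
    then show "tz (m \<ddagger>\<^bsub>P\<^esub> (a \<ddagger>\<^bsub>alg_scalars A\<^esub> l)) (b \<odot>\<^bsub>Q\<^esub> n) = tz (m \<ddagger>\<^bsub>P\<^esub> a) ((l \<odot>\<^bsub>alg_scalars A\<^esub> b) \<odot>\<^bsub>Q\<^esub> n)"
      using that scal_rules(3)[of l a m] scal_rules(5)[of l b n] tz_scal[of "m \<ddagger>\<^bsub>P\<^esub> a" "b \<odot>\<^bsub>Q\<^esub> n" l]
      by (simp add: cl)
  qed (use that in \<open>simp_all add: cl r\<close>)
  have b2: "balanced K (scalars A P) (scalars A Q) T.T (\<lambda>a b. tz (a \<ddagger>\<^bsub>P\<^esub> m) (n \<odot>\<^bsub>Q\<^esub> b))"
    if "m \<in> carrier (alg_scalars A)" "n \<in> carrier (alg_scalars A)" for m n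
    proof (rule balancedI)
    fix a b l assume "a \<in> carrier (scalars A P)" "b \<in> carrier (scalars A Q)" "l \<in> carrier K"
    then show "tz ((a \<ddagger>\<^bsub>scalars A P\<^esub> l) \<ddagger>\<^bsub>P\<^esub> m) (n \<odot>\<^bsub>Q\<^esub> b) = tz (a \<ddagger>\<^bsub>P\<^esub> m) (n \<odot>\<^bsub>Q\<^esub> (l \<odot>\<^bsub>scalars A Q\<^esub> b))"
      using that scal_rules(4)[of l m a] scal_rules(6)[of l n b] tz_scal[of "a \<ddagger>\<^bsub>P\<^esub> m" "n \<odot>\<^bsub>Q\<^esub> b" l]
      by (simp add: cl)
  qed (use that in \<open>simp_all add: cl r\<close>)
  note d = double_ext[where \<theta> = "\<lambda>a b p q. tz (p \<ddagger>\<^bsub>P\<^esub> a) (b \<odot>\<^bsub>Q\<^esub> q)",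
      OF P.S.bimod_pair_axioms T.bimod_pair_axioms T.T.abelian_group_axioms b1 b2]
  show "additive_map P.EA Z (\<lambda>u. z \<ddagger>\<^bsub>Z\<^esub> u)" if "z \<in> carrier Z"
    using d(1)[of z] that by (simp add: additive_map_def P.EA_simps Z_simps)
  show "additive_map Z Z (\<lambda>z. z \<ddagger>\<^bsub>Z\<^esub> u)" if "u \<in> carrier P.EA"
    using d(2)[of u] that by (simp add: additive_map_def P.EA_simps Z_simps)
  show "tz p q \<ddagger>\<^bsub>Z\<^esub> P.t2 b b' = tz (p \<ddagger>\<^bsub>P\<^esub> b) (b' \<odot>\<^bsub>Q\<^esub> q)"
    if "b \<in> carrier A" "b' \<in> carrier A" "p \<in> carrier P" "q \<in> carrier Q"
    using d(3)[of b b' p q] that by (simp add: Z_simps P.t2_eq)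
qed

lemma Z_induct:
  assumes "abelian_group G" "additive_map Z G f" "additive_map Z G g"
    and "\<And>p q. \<lbrakk>p \<in> carrier P; q \<in> carrier Q\<rbrakk> \<Longrightarrow> f (tz p q) = g (tz p q)"
    and "z \<in> carrier Z"
  shows "f z = g z"
  using T.tensor_map_eqI[OF assms(1), of f g z] assms(2-) by (simp add: additive_map_def Z_simps)

lemma Z_zero_smult: "u \<in> carrier P.EA \<Longrightarrow> u \<odot>\<^bsub>Z\<^esub> \<zero>\<^bsub>Z\<^esub> = \<zero>\<^bsub>Z\<^esub>" "u \<in> carrier P.EA \<Longrightarrow> \<zero>\<^bsub>Z\<^esub> \<ddagger>\<^bsub>Z\<^esub> u = \<zero>\<^bsub>Z\<^esub>"
  using additive_map_zero[OF Z_abelian Z_abelian Z_smult2] additive_map_zero[OF Z_abelian Z_abelian Z_rsmult2] by auto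

end

section \<open>The presentation of the algebra of differential operators\<close>

context pivotal_calculus
begin

lemma assoc_D: "assoc_algebra (base D) (alg D)" by unfold_locales
lemma pair_xw: "env_pair (base D) (alg D) (vect D) (form D)" by (intro env_pair.intro V.bimodule_axioms C.bimodule_axioms)
lemma pair_wx: "env_pair (base D) (alg D) (form D) (vect D)" by (intro env_pair.intro V.bimodule_axioms C.bimodule_axioms)

interpretation XW: env_pair "base D" "alg D" "vect D" "form D" by (rule pair_xw)
interpretation WX: env_pair "base D" "alg D" "form D" "vect D" by (rule pair_wx)

lemma ZZ_simps: "carrier (ZZ D) = carrier XW.Z \<times> carrier WX.Z"
  "(u, v) \<oplus>\<^bsub>ZZ D\<^esub> (u', v') = (u \<oplus>\<^bsub>XW.Z\<^esub> u', v \<oplus>\<^bsub>WX.Z\<^esub> v')"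
  "r \<odot>\<^bsub>ZZ D\<^esub> (u, v) = (r \<odot>\<^bsub>XW.Z\<^esub> u, r \<odot>\<^bsub>WX.Z\<^esub> v)"
  "(u, v) \<ddagger>\<^bsub>ZZ D\<^esub> r = (u \<ddagger>\<^bsub>XW.Z\<^esub> r, v \<ddagger>\<^bsub>WX.Z\<^esub> r)"
  by (simp_all add: ZZ_def direct_sum_def)

lemma envA_eq: "envA D = enveloping (base D) (alg D)" by (simp add: envA_def)

lemma K_cring: "cring (base D)" by unfold_locales

lemma opsclosed_envA: "opsclosed (base D) (envA D)"
  unfolding envA_eq by (rule assoc_algebra.opsclosed_EA[OF assoc_D])

interpretation XG: abelian_group XW.Z by (rule XW.Z_abelian)
interpretation WG: abelian_group WX.Z by (rule WX.Z_abelian)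

lemma talg_TZ: "talg (base D) (envA D) (ZZ D)"
proof (intro talg.intro talg_axioms.intro K_cring opsclosed_envA)
  fix v w r
  show "v \<oplus>\<^bsub>ZZ D\<^esub> w \<in> carrier (ZZ D)" if "v \<in> carrier (ZZ D)" "w \<in> carrier (ZZ D)"
    using that by (cases v; cases w) (simp add: ZZ_simps)
  show "r \<odot>\<^bsub>ZZ D\<^esub> v \<in> carrier (ZZ D)" "v \<ddagger>\<^bsub>ZZ D\<^esub> r \<in> carrier (ZZ D)" if "r \<in> carrier (envA D)" "v \<in> carrier (ZZ D)"
    using that additive_map_closed[OF XW.Z_smult2] additive_map_closed[OF WX.Z_smult2]
      additive_map_closed[OF XW.Z_rsmult2] additive_map_closed[OF WX.Z_rsmult2]
    by (cases v; simp add: ZZ_simps envA_eq)+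
qed

interpretation TZ: talg "base D" "envA D" "ZZ D" by (rule talg_TZ)

lemma TZ_eq: "TZ.TA = TZ D" by (simp add: TZ_def)

lemma kalg_TZ: "kalg (base D) (TZ D)" using TZ.kalg_TA by (simp add: TZ_eq)

interpretation TZa: kalg "base D" "TZ D" by (rule kalg_TZ)

abbreviation "tt \<equiv> alg_tens (base D) (alg D) (opposite (alg D))"

lemma tt_closed: "a \<in> carrier (alg D) \<Longrightarrow> b \<in> carrier (alg D) \<Longrightarrow> tt a b \<in> carrier (envA D)"
  using assoc_algebra.t2_closed[OF assoc_D] by (simp add: envA_eq assoc_algebra.EA_simps[OF assoc_D])

lemma TZ_env_eq: "TZ_env D a b = TZ.bs (tt a b)" by (simp add: TZ_env_def)
lemma TZ_xw_eq: "TZ_xw D x w = TZ.gn (XW.tz x w, \<zero>\<^bsub>WX.Z\<^esub>)" by (simp add: TZ_xw_def)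
lemma TZ_wx_eq: "TZ_wx D w x = TZ.gn (\<zero>\<^bsub>XW.Z\<^esub>, WX.tz w x)" by (simp add: TZ_wx_def)

lemma bs_hom: "TZ.bs \<in> ring_hom (envA D) (TZ D)"
  using TZ.base_premap by (simp add: premap_def TZ_eq)

lemma envA_add: "\<lbrakk>a \<in> carrier (alg D); a' \<in> carrier (alg D); b \<in> carrier (alg D)\<rbrakk> \<Longrightarrow> tt (a \<oplus>\<^bsub>alg D\<^esub> a') b = tt a b \<oplus>\<^bsub>envA D\<^esub> tt a' b"
  "\<lbrakk>a \<in> carrier (alg D); b \<in> carrier (alg D); b' \<in> carrier (alg D)\<rbrakk> \<Longrightarrow> tt a (b \<oplus>\<^bsub>alg D\<^esub> b') = tt a b \<oplus>\<^bsub>envA D\<^esub> tt a b'"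
  using assoc_algebra.t2_add1[OF assoc_D] assoc_algebra.t2_add2[OF assoc_D]
  by (simp_all add: envA_eq assoc_algebra.EA_simps[OF assoc_D])

lemma envA_one: "\<one>\<^bsub>envA D\<^esub> = tt \<one>\<^bsub>alg D\<^esub> \<one>\<^bsub>alg D\<^esub>"
  by (simp add: envA_eq assoc_algebra.EA_simps[OF assoc_D])

lemma TZ_env_closed: "a \<in> carrier (alg D) \<Longrightarrow> b \<in> carrier (alg D) \<Longrightarrow> TZ_env D a b \<in> carrier (TZ D)"
  unfolding TZ_env_eq by (rule ring_hom_closed[OF bs_hom tt_closed])

lemma TZ_env_one: "TZ_env D \<one>\<^bsub>alg D\<^esub> \<one>\<^bsub>alg D\<^esub> = \<one>\<^bsub>TZ D\<^esub>"
  using ring_hom_one[OF bs_hom] by (simp add: TZ_env_eq envA_one)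

lemma TZ_env_mult: "\<lbrakk>a \<in> carrier (alg D); b \<in> carrier (alg D); a' \<in> carrier (alg D); b' \<in> carrier (alg D)\<rbrakk>
  \<Longrightarrow> TZ_env D a b \<otimes>\<^bsub>TZ D\<^esub> TZ_env D a' b' = TZ_env D (a \<otimes>\<^bsub>alg D\<^esub> a') (b' \<otimes>\<^bsub>alg D\<^esub> b)"
  unfolding TZ_env_eq
  by (subst ring_hom_mult[OF bs_hom, symmetric])
     (simp_all add: tt_closed envA_eq assoc_algebra.EA_mult_t2[OF assoc_D] tt_closed[unfolded envA_eq])

lemma TZ_env_add: "\<lbrakk>a \<in> carrier (alg D); a' \<in> carrier (alg D); b \<in> carrier (alg D)\<rbrakk> \<Longrightarrow> TZ_env D (a \<oplus>\<^bsub>alg D\<^esub> a') b = TZ_env D a b \<oplus>\<^bsub>TZ D\<^esub> TZ_env D a' b"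
  "\<lbrakk>a \<in> carrier (alg D); b \<in> carrier (alg D); b' \<in> carrier (alg D)\<rbrakk> \<Longrightarrow> TZ_env D a (b \<oplus>\<^bsub>alg D\<^esub> b') = TZ_env D a b \<oplus>\<^bsub>TZ D\<^esub> TZ_env D a b'"
  unfolding TZ_env_eq by (simp_all add: envA_add ring_hom_add[OF bs_hom] tt_closed)

text \<open>The two embeddings of \<open>K\<close> into \<open>A^e\<close> agree because the tensor
  product is formed over \<open>K\<close>.\<close>

lemma TZ_env_scal: "l \<in> carrier (base D) \<Longrightarrow> TZ_env D (l \<odot>\<^bsub>alg D\<^esub> \<one>\<^bsub>alg D\<^esub>) \<one>\<^bsub>alg D\<^esub> = l \<odot>\<^bsub>TZ D\<^esub> \<one>\<^bsub>TZ D\<^esub>"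
  "l \<in> carrier (base D) \<Longrightarrow> TZ_env D \<one>\<^bsub>alg D\<^esub> (l \<odot>\<^bsub>alg D\<^esub> \<one>\<^bsub>alg D\<^esub>) = l \<odot>\<^bsub>TZ D\<^esub> \<one>\<^bsub>TZ D\<^esub>"
proof -
  assume l: "l \<in> carrier (base D)"
  have s: "l \<odot>\<^bsub>envA D\<^esub> \<one>\<^bsub>envA D\<^esub> = tt (l \<odot>\<^bsub>alg D\<^esub> \<one>\<^bsub>alg D\<^esub>) \<one>\<^bsub>alg D\<^esub>"
    unfolding envA_one unfolding envA_eq by (rule assoc_algebra.EA_smult_t2[OF assoc_D l]) simp_all
  have "TZ_env D (l \<odot>\<^bsub>alg D\<^esub> \<one>\<^bsub>alg D\<^esub>) \<one>\<^bsub>alg D\<^esub> = TZ.bs (l \<odot>\<^bsub>envA D\<^esub> \<one>\<^bsub>envA D\<^esub>)"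
    using s by (simp add: TZ_env_eq)
  also have "\<dots> = (l \<odot>\<^bsub>TZ D\<^esub> \<one>\<^bsub>TZ D\<^esub>) \<otimes>\<^bsub>TZ D\<^esub> TZ.bs \<one>\<^bsub>envA D\<^esub>"
    using TZ.base_premap l tt_closed by (simp add: premap_def TZ_eq envA_one)
  also have "\<dots> = l \<odot>\<^bsub>TZ D\<^esub> \<one>\<^bsub>TZ D\<^esub>"
    using l by (simp add: ring_hom_one[OF bs_hom] TZa.smult_cl)
  finally show 1: "TZ_env D (l \<odot>\<^bsub>alg D\<^esub> \<one>\<^bsub>alg D\<^esub>) \<one>\<^bsub>alg D\<^esub> = l \<odot>\<^bsub>TZ D\<^esub> \<one>\<^bsub>TZ D\<^esub>" .
  show "TZ_env D \<one>\<^bsub>alg D\<^esub> (l \<odot>\<^bsub>alg D\<^esub> \<one>\<^bsub>alg D\<^esub>) = l \<odot>\<^bsub>TZ D\<^esub> \<one>\<^bsub>TZ D\<^esub>"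
    unfolding 1[symmetric] using assoc_algebra.t2_scal[OF assoc_D, of "\<one>\<^bsub>alg D\<^esub>" "\<one>\<^bsub>alg D\<^esub>" l] l by (simp add: TZ_env_eq)
qed

lemma ZZ_mem: "x \<in> carrier (vect D) \<Longrightarrow> w \<in> carrier (form D) \<Longrightarrow> (XW.tz x w, \<zero>\<^bsub>WX.Z\<^esub>) \<in> carrier (ZZ D)"
  "x \<in> carrier (vect D) \<Longrightarrow> w \<in> carrier (form D) \<Longrightarrow> (\<zero>\<^bsub>XW.Z\<^esub>, WX.tz w x) \<in> carrier (ZZ D)"
  by (simp_all add: ZZ_simps XW.tz_closed WX.tz_closed)

lemma TZ_xw_closed: "x \<in> carrier (vect D) \<Longrightarrow> w \<in> carrier (form D) \<Longrightarrow> TZ_xw D x w \<in> carrier (TZ D)"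
  and TZ_wx_closed: "x \<in> carrier (vect D) \<Longrightarrow> w \<in> carrier (form D) \<Longrightarrow> TZ_wx D w x \<in> carrier (TZ D)"
  unfolding TZ_xw_eq TZ_wx_eq using TZ.gen_closed ZZ_mem by (simp_all add: TZ_eq)

lemma TZ_xw_add: "\<lbrakk>x \<in> carrier (vect D); x' \<in> carrier (vect D); w \<in> carrier (form D)\<rbrakk>
    \<Longrightarrow> TZ_xw D (x \<oplus>\<^bsub>vect D\<^esub> x') w = TZ_xw D x w \<oplus>\<^bsub>TZ D\<^esub> TZ_xw D x' w"
  "\<lbrakk>x \<in> carrier (vect D); w \<in> carrier (form D); w' \<in> carrier (form D)\<rbrakk>
    \<Longrightarrow> TZ_xw D x (w \<oplus>\<^bsub>form D\<^esub> w') = TZ_xw D x w \<oplus>\<^bsub>TZ D\<^esub> TZ_xw D x w'"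
  "\<lbrakk>x \<in> carrier (vect D); x' \<in> carrier (vect D); w \<in> carrier (form D)\<rbrakk>
    \<Longrightarrow> TZ_wx D w (x \<oplus>\<^bsub>vect D\<^esub> x') = TZ_wx D w x \<oplus>\<^bsub>TZ D\<^esub> TZ_wx D w x'"
  "\<lbrakk>x \<in> carrier (vect D); w \<in> carrier (form D); w' \<in> carrier (form D)\<rbrakk>
    \<Longrightarrow> TZ_wx D (w \<oplus>\<^bsub>form D\<^esub> w') x = TZ_wx D w x \<oplus>\<^bsub>TZ D\<^esub> TZ_wx D w' x"
  unfolding TZ_xw_eq TZ_wx_eq TZ_eq[symmetric]
  by (subst TZ.gen_add[symmetric]; simp add: XW.tz_closed WX.tz_closed ZZ_simps XW.tz_add1 XW.tz_add2 WX.tz_add1 WX.tz_add2)+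

lemma TZ_env_xw: "\<lbrakk>a \<in> carrier (alg D); a' \<in> carrier (alg D); x \<in> carrier (vect D); w \<in> carrier (form D)\<rbrakk>
    \<Longrightarrow> TZ_env D a a' \<otimes>\<^bsub>TZ D\<^esub> TZ_xw D x w = TZ_xw D (a \<odot>\<^bsub>vect D\<^esub> x) (w \<ddagger>\<^bsub>form D\<^esub> a')"
  "\<lbrakk>a \<in> carrier (alg D); a' \<in> carrier (alg D); x \<in> carrier (vect D); w \<in> carrier (form D)\<rbrakk>
    \<Longrightarrow> TZ_xw D x w \<otimes>\<^bsub>TZ D\<^esub> TZ_env D a a' = TZ_xw D (x \<ddagger>\<^bsub>vect D\<^esub> a) (a' \<odot>\<^bsub>form D\<^esub> w)"
  "\<lbrakk>a \<in> carrier (alg D); a' \<in> carrier (alg D); x \<in> carrier (vect D); w \<in> carrier (form D)\<rbrakk>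
    \<Longrightarrow> TZ_env D a a' \<otimes>\<^bsub>TZ D\<^esub> TZ_wx D w x = TZ_wx D (a \<odot>\<^bsub>form D\<^esub> w) (x \<ddagger>\<^bsub>vect D\<^esub> a')"
  "\<lbrakk>a \<in> carrier (alg D); a' \<in> carrier (alg D); x \<in> carrier (vect D); w \<in> carrier (form D)\<rbrakk>
    \<Longrightarrow> TZ_wx D w x \<otimes>\<^bsub>TZ D\<^esub> TZ_env D a a' = TZ_wx D (w \<ddagger>\<^bsub>form D\<^esub> a) (a' \<odot>\<^bsub>vect D\<^esub> x)"
  unfolding TZ_xw_eq TZ_wx_eq TZ_env_eq TZ_eq[symmetric]
  by (subst TZ.gen_smult[symmetric] TZ.gen_rsmult[symmetric];
      simp add: XW.tz_closed WX.tz_closed tt_closed ZZ_simps XW.Z_smult_tz WX.Z_smult_tz XW.Z_rsmult_tz WX.Z_rsmult_tz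
        XW.Z_zero_smult WX.Z_zero_smult tt_closed[unfolded envA_eq])+

lemma HO_rels_carrier: "HO_rels D \<subseteq> carrier (TZ D)"
proof -
  have e: "ev D (tenXW D x w) \<in> carrier (alg D)" "evu D (tenWX D w x) \<in> carrier (alg D)"
    if "x \<in> carrier (vect D)" "w \<in> carrier (form D)" for x w
    using dual.e_cl[OF dual_D, of x w] dual.e'_cl[OF dual_D, of w x] that by simp_all
  note b = basis_closed(1,2) and c = basis_closed(3,4)
  show ?thesis
    unfolding HO_rels_def Let_def
    by (auto intro!: TZa.minus_closed TZa.finsum_closed TZa.m_closed simp: TZ_env_closed e b c TZ_xw_closed TZ_wx_closed)
qed

lemma kalg_HO: "kalg (base D) (HO D)"
  unfolding HO_def by (rule kalg.kalg_quot[OF kalg_TZ HO_rels_carrier])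

section \<open>Adjoining the vector fields\<close>

lemma talg_TX: "talg (base D) (field_algebra (base D)) (scalars (alg D) (vect D))"
proof (intro talg.intro talg_axioms.intro K_cring)
  show "opsclosed (base D) (field_algebra (base D))" by (simp add: opsclosed_def field_algebra_def)
qed (simp_all add: field_algebra_def V.M.lmod_closed)

interpretation TX: talg "base D" "field_algebra (base D)" "scalars (alg D) (vect D)" by (rule talg_TX)

lemma TX_eq: "TX.TA = TX D" by (simp add: TX_def)

lemma kalg_TX: "kalg (base D) (TX D)" using TX.kalg_TA by (simp add: TX_eq)

lemma fprod_D: "fprod (base D) (HO D) (TX D)"
  by (intro fprod.intro fprod_axioms.intro K_cring kalg_HO kalg_TX)

interpretation FP: fprod "base D" "HO D" "TX D" by (rule fprod_D)

lemma FP_eq: "FP.P = FP D" by (simp add: FP_def)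

lemma kalg_FP: "kalg (base D) (FP D)" using FP.kalg_P by (simp add: FP_eq)

interpretation FPa: kalg "base D" "FP D" by (rule kalg_FP)
interpretation HOq: quot_alg "TZ D" "HO_rels D" by unfold_locales (rule HO_rels_carrier)

lemma FP_of_TZ_hom: "FP_of_TZ D \<in> ring_hom (TZ D) (FP D)"
  using ring_hom_trans[OF HOq.cls_hom[folded HO_def] FP.lf_hom] by (simp add: FP_eq FP_of_TZ_def[abs_def] o_def)

lemma FP_of_TZ_scal: "l \<in> carrier (base D) \<Longrightarrow> FP_of_TZ D (l \<odot>\<^bsub>TZ D\<^esub> \<one>\<^bsub>TZ D\<^esub>) = l \<odot>\<^bsub>FP D\<^esub> \<one>\<^bsub>FP D\<^esub>"
  using FP.lf_khom TZa.cls_scal[OF HO_rels_carrier, folded HO_def] by (simp add: FP_of_TZ_def khom_def FP_eq)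

lemma FP_x_closed: "x \<in> carrier (vect D) \<Longrightarrow> FP_x D x \<in> carrier (FP D)"
  using ring_hom_closed[OF FP.rt_hom TX.gen_closed[unfolded TX_eq]] by (simp add: FP_x_def FP_eq)

lemma FP_x_add: "\<lbrakk>x \<in> carrier (vect D); x' \<in> carrier (vect D)\<rbrakk> \<Longrightarrow> FP_x D (x \<oplus>\<^bsub>vect D\<^esub> x') = FP_x D x \<oplus>\<^bsub>FP D\<^esub> FP_x D x'"
  using TX.gen_add[of x x'] ring_hom_add[OF FP.rt_hom, of "TX.gn x" "TX.gn x'"] TX.gen_closed
  by (simp add: FP_x_def FP_eq TX_eq)

lemma ev_closed: "x \<in> carrier (vect D) \<Longrightarrow> w \<in> carrier (form D) \<Longrightarrow> ev D (tenXW D x w) \<in> carrier (alg D)"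
    "x \<in> carrier (vect D) \<Longrightarrow> w \<in> carrier (form D) \<Longrightarrow> evu D (tenWX D w x) \<in> carrier (alg D)"
    using dual.e_cl[OF dual_D, of x w] dual.e'_cl[OF dual_D, of w x] by simp_all

lemma d_closed: "a \<in> carrier (alg D) \<Longrightarrow> dd D a \<in> carrier (form D)"
  using additive_map_closed[OF C.d_additive] .

lemma HX_rels_carrier: "HX_rels D \<subseteq> carrier (FP D)"
  unfolding HX_rels_def Let_def
  by (auto intro!: FPa.minus_closed FPa.a_closed FPa.m_closed ring_hom_closed[OF FP_of_TZ_hom] FP_x_closed
     TZ_env_closed TZ_xw_closed ev_closed d_closed simp: V.M.lmod_closed V.rmod_closed)

lemma kalg_HX: "kalg (base D) (HX D)"
  unfolding HX_def by (rule kalg.kalg_quot[OF kalg_FP HX_rels_carrier])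

lemma ring_HX: "ring (HX D)"
  using kalg_HX by (simp add: kalg_def)

interpretation HXq: quot_alg "FP D" "HX_rels D" by unfold_locales (rule HX_rels_carrier)
interpretation H: ring "HX D" by (rule ring_HX)

text \<open>The composite of the quotient map to \<open>HO\<close>, the inclusion into the free
  product and the quotient map to \<open>HX\<close>. As a ring homomorphism it transports the
  relations of \<open>TZ\<close> in one go.\<close>

definition "HX_of_TZ z = cls (FP D) (HX_rels D) (FP_of_TZ D z)"

lemma HX_of_TZ_hom: "HX_of_TZ \<in> ring_hom (TZ D) (HX D)"
  using ring_hom_trans[OF FP_of_TZ_hom HXq.cls_hom[folded HX_def]] by (simp add: HX_of_TZ_def[abs_def] o_def)

lemma HX_gens: "HX_env D a b = HX_of_TZ (TZ_env D a b)" "HX_xw D x w = HX_of_TZ (TZ_xw D x w)" "HX_wx D w x = HX_of_TZ (TZ_wx D w x)"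
  by (simp_all add: HX_env_def HX_xw_def HX_wx_def HX_of_TZ_def)

lemmas HX_hom = ring_hom_closed[OF HX_of_TZ_hom] ring_hom_mult[OF HX_of_TZ_hom, symmetric] ring_hom_add[OF HX_of_TZ_hom, symmetric]
  ring_hom_one[OF HX_of_TZ_hom, symmetric]

lemma HX_env_closed: "a \<in> carrier (alg D) \<Longrightarrow> b \<in> carrier (alg D) \<Longrightarrow> HX_env D a b \<in> carrier (HX D)"
  and HX_xw_closed: "x \<in> carrier (vect D) \<Longrightarrow> w \<in> carrier (form D) \<Longrightarrow> HX_xw D x w \<in> carrier (HX D)"
  and HX_wx_closed: "x \<in> carrier (vect D) \<Longrightarrow> w \<in> carrier (form D) \<Longrightarrow> HX_wx D w x \<in> carrier (HX D)"
  by (simp_all add: HX_gens HX_hom TZ_env_closed TZ_xw_closed TZ_wx_closed)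

lemma HX_env_one: "HX_env D \<one>\<^bsub>alg D\<^esub> \<one>\<^bsub>alg D\<^esub> = \<one>\<^bsub>HX D\<^esub>"
  by (simp add: HX_gens HX_hom TZ_env_one)

lemma HX_env_mult: "\<lbrakk>a \<in> carrier (alg D); b \<in> carrier (alg D); a' \<in> carrier (alg D); b' \<in> carrier (alg D)\<rbrakk>
  \<Longrightarrow> HX_env D a b \<otimes>\<^bsub>HX D\<^esub> HX_env D a' b' = HX_env D (a \<otimes>\<^bsub>alg D\<^esub> a') (b' \<otimes>\<^bsub>alg D\<^esub> b)"
  by (simp add: HX_gens HX_hom TZ_env_mult TZ_env_closed)

lemma HX_env_add: "\<lbrakk>a \<in> carrier (alg D); a' \<in> carrier (alg D); b \<in> carrier (alg D)\<rbrakk> \<Longrightarrow> HX_env D (a \<oplus>\<^bsub>alg D\<^esub> a') b = HX_env D a b \<oplus>\<^bsub>HX D\<^esub> HX_env D a' b"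
  "\<lbrakk>a \<in> carrier (alg D); b \<in> carrier (alg D); b' \<in> carrier (alg D)\<rbrakk> \<Longrightarrow> HX_env D a (b \<oplus>\<^bsub>alg D\<^esub> b') = HX_env D a b \<oplus>\<^bsub>HX D\<^esub> HX_env D a b'"
  by (simp_all add: HX_gens HX_hom TZ_env_add TZ_env_closed)

lemma HX_env_scal: "l \<in> carrier (base D) \<Longrightarrow> HX_env D (l \<odot>\<^bsub>alg D\<^esub> \<one>\<^bsub>alg D\<^esub>) \<one>\<^bsub>alg D\<^esub> = l \<odot>\<^bsub>HX D\<^esub> \<one>\<^bsub>HX D\<^esub>"
  "l \<in> carrier (base D) \<Longrightarrow> HX_env D \<one>\<^bsub>alg D\<^esub> (l \<odot>\<^bsub>alg D\<^esub> \<one>\<^bsub>alg D\<^esub>) = l \<odot>\<^bsub>HX D\<^esub> \<one>\<^bsub>HX D\<^esub>"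
  using FPa.cls_scal[OF HX_rels_carrier, folded HX_def]
  by (simp_all add: HX_gens TZ_env_scal, simp_all add: HX_of_TZ_def FP_of_TZ_scal)

lemma HX_xw_add: "\<lbrakk>x \<in> carrier (vect D); x' \<in> carrier (vect D); w \<in> carrier (form D)\<rbrakk>
    \<Longrightarrow> HX_xw D (x \<oplus>\<^bsub>vect D\<^esub> x') w = HX_xw D x w \<oplus>\<^bsub>HX D\<^esub> HX_xw D x' w"
  "\<lbrakk>x \<in> carrier (vect D); w \<in> carrier (form D); w' \<in> carrier (form D)\<rbrakk>
    \<Longrightarrow> HX_xw D x (w \<oplus>\<^bsub>form D\<^esub> w') = HX_xw D x w \<oplus>\<^bsub>HX D\<^esub> HX_xw D x w'"
  "\<lbrakk>x \<in> carrier (vect D); x' \<in> carrier (vect D); w \<in> carrier (form D)\<rbrakk>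
    \<Longrightarrow> HX_wx D w (x \<oplus>\<^bsub>vect D\<^esub> x') = HX_wx D w x \<oplus>\<^bsub>HX D\<^esub> HX_wx D w x'"
  "\<lbrakk>x \<in> carrier (vect D); w \<in> carrier (form D); w' \<in> carrier (form D)\<rbrakk>
    \<Longrightarrow> HX_wx D (w \<oplus>\<^bsub>form D\<^esub> w') x = HX_wx D w x \<oplus>\<^bsub>HX D\<^esub> HX_wx D w' x"
  by (simp_all add: HX_gens HX_hom TZ_xw_add TZ_xw_closed TZ_wx_closed)

lemma HX_env_xw: "\<lbrakk>a \<in> carrier (alg D); a' \<in> carrier (alg D); x \<in> carrier (vect D); w \<in> carrier (form D)\<rbrakk>
    \<Longrightarrow> HX_env D a a' \<otimes>\<^bsub>HX D\<^esub> HX_xw D x w = HX_xw D (a \<odot>\<^bsub>vect D\<^esub> x) (w \<ddagger>\<^bsub>form D\<^esub> a')"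
  "\<lbrakk>a \<in> carrier (alg D); a' \<in> carrier (alg D); x \<in> carrier (vect D); w \<in> carrier (form D)\<rbrakk>
    \<Longrightarrow> HX_xw D x w \<otimes>\<^bsub>HX D\<^esub> HX_env D a a' = HX_xw D (x \<ddagger>\<^bsub>vect D\<^esub> a) (a' \<odot>\<^bsub>form D\<^esub> w)"
  "\<lbrakk>a \<in> carrier (alg D); a' \<in> carrier (alg D); x \<in> carrier (vect D); w \<in> carrier (form D)\<rbrakk>
    \<Longrightarrow> HX_env D a a' \<otimes>\<^bsub>HX D\<^esub> HX_wx D w x = HX_wx D (a \<odot>\<^bsub>form D\<^esub> w) (x \<ddagger>\<^bsub>vect D\<^esub> a')"
  "\<lbrakk>a \<in> carrier (alg D); a' \<in> carrier (alg D); x \<in> carrier (vect D); w \<in> carrier (form D)\<rbrakk>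
    \<Longrightarrow> HX_wx D w x \<otimes>\<^bsub>HX D\<^esub> HX_env D a a' = HX_wx D (w \<ddagger>\<^bsub>form D\<^esub> a) (a' \<odot>\<^bsub>vect D\<^esub> x)"
  by (simp_all add: HX_gens HX_hom TZ_env_xw TZ_xw_closed TZ_wx_closed TZ_env_closed)

lemma HX_of_TZ_rel:
  assumes "u \<in> carrier (TZ D)" "v \<in> carrier (TZ D)" "u \<ominus>\<^bsub>TZ D\<^esub> v \<in> HO_rels D"
  shows "HX_of_TZ u = HX_of_TZ v"
  using HOq.cls_eq[OF assms] by (simp add: HX_of_TZ_def FP_of_TZ_def)

lemma HX_of_TZ_finsum:
  assumes "finite I" "g \<in> I \<rightarrow> carrier (TZ D)"
  shows "HX_of_TZ (finsum (TZ D) g I) = finsum (HX D) (\<lambda>i. HX_of_TZ (g i)) I"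
proof (rule additive_map_finsum[OF _ _ _ assms])
  show "additive_map (TZ D) (HX D) HX_of_TZ"
    using HX_of_TZ_hom by (auto simp: additive_map_def ring_hom_def)
qed unfold_locales

lemma HX_ho:
  assumes x: "x \<in> carrier (vect D)" and w: "w \<in> carrier (form D)"
  shows "(\<Oplus>\<^bsub>HX D\<^esub>i\<in>{..<nI D}. HX_wx D (om D i) x \<otimes>\<^bsub>HX D\<^esub> HX_xw D (xb D i) w) = HX_env D \<one>\<^bsub>alg D\<^esub> (evu D (tenWX D w x))"
    "(\<Oplus>\<^bsub>HX D\<^esub>j\<in>{..<nJ D}. HX_xw D x (rb D j) \<otimes>\<^bsub>HX D\<^esub> HX_wx D w (yb D j)) = HX_env D (ev D (tenXW D x w)) \<one>\<^bsub>alg D\<^esub>"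
    "(\<Oplus>\<^bsub>HX D\<^esub>j\<in>{..<nJ D}. HX_xw D (yb D j) w \<otimes>\<^bsub>HX D\<^esub> HX_wx D (rb D j) x) = HX_env D \<one>\<^bsub>alg D\<^esub> (ev D (tenXW D x w))"
    "(\<Oplus>\<^bsub>HX D\<^esub>i\<in>{..<nI D}. HX_wx D w (xb D i) \<otimes>\<^bsub>HX D\<^esub> HX_xw D x (om D i)) = HX_env D (evu D (tenWX D w x)) \<one>\<^bsub>alg D\<^esub>"
proof -
  note b = basis_closed(1,2) and c = basis_closed(3,4)
  note cl = x w b c TZ_xw_closed TZ_wx_closed TZ_env_closed ev_closed
  \<comment> \<open>The common shape of the four relations: a sum of products identified with one
    element of \<open>A^e\<close>.\<close>
  have f: "(\<Oplus>\<^bsub>HX D\<^esub>i\<in>{..<n}. HX_of_TZ (g i) \<otimes>\<^bsub>HX D\<^esub> HX_of_TZ (h i)) = HX_of_TZ v"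
    if "\<And>i. i < n \<Longrightarrow> g i \<in> carrier (TZ D)" "\<And>i. i < n \<Longrightarrow> h i \<in> carrier (TZ D)" "v \<in> carrier (TZ D)"
      "(\<Oplus>\<^bsub>TZ D\<^esub>i\<in>{..<n}. g i \<otimes>\<^bsub>TZ D\<^esub> h i) \<ominus>\<^bsub>TZ D\<^esub> v \<in> HO_rels D" for n :: nat and g h v
  proof -
    have gh: "(\<lambda>i. g i \<otimes>\<^bsub>TZ D\<^esub> h i) \<in> {..<n} \<rightarrow> carrier (TZ D)" using that by auto
    have "(\<Oplus>\<^bsub>HX D\<^esub>i\<in>{..<n}. HX_of_TZ (g i) \<otimes>\<^bsub>HX D\<^esub> HX_of_TZ (h i)) = HX_of_TZ (\<Oplus>\<^bsub>TZ D\<^esub>i\<in>{..<n}. g i \<otimes>\<^bsub>TZ D\<^esub> h i)"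
      unfolding HX_of_TZ_finsum[OF finite_lessThan gh]
      by (rule finsum_cong_weak) (use that in \<open>simp add: ring_hom_mult[OF HX_of_TZ_hom]\<close>)
    also have "\<dots> = HX_of_TZ v"
      using that TZa.finsum_closed[OF gh] by (intro HX_of_TZ_rel) auto
    finally show ?thesis .
  qed
  show "(\<Oplus>\<^bsub>HX D\<^esub>i\<in>{..<nI D}. HX_wx D (om D i) x \<otimes>\<^bsub>HX D\<^esub> HX_xw D (xb D i) w) = HX_env D \<one>\<^bsub>alg D\<^esub> (evu D (tenWX D w x))"
    unfolding HX_gens by (rule f) (simp_all add: cl, use x w in \<open>auto simp: HO_rels_def Let_def\<close>)
  show "(\<Oplus>\<^bsub>HX D\<^esub>j\<in>{..<nJ D}. HX_xw D x (rb D j) \<otimes>\<^bsub>HX D\<^esub> HX_wx D w (yb D j)) = HX_env D (ev D (tenXW D x w)) \<one>\<^bsub>alg D\<^esub>"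
    unfolding HX_gens by (rule f) (simp_all add: cl, use x w in \<open>auto simp: HO_rels_def Let_def\<close>)
  show "(\<Oplus>\<^bsub>HX D\<^esub>j\<in>{..<nJ D}. HX_xw D (yb D j) w \<otimes>\<^bsub>HX D\<^esub> HX_wx D (rb D j) x) = HX_env D \<one>\<^bsub>alg D\<^esub> (ev D (tenXW D x w))"
    unfolding HX_gens by (rule f) (simp_all add: cl, use x w in \<open>auto simp: HO_rels_def Let_def\<close>)
  show "(\<Oplus>\<^bsub>HX D\<^esub>i\<in>{..<nI D}. HX_wx D w (xb D i) \<otimes>\<^bsub>HX D\<^esub> HX_xw D x (om D i)) = HX_env D (evu D (tenWX D w x)) \<one>\<^bsub>alg D\<^esub>"
    unfolding HX_gens by (rule f) (simp_all add: cl, use x w in \<open>auto simp: HO_rels_def Let_def\<close>)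
qed

lemma HX_x_closed: "x \<in> carrier (vect D) \<Longrightarrow> HX_x D x \<in> carrier (HX D)"
  using ring_hom_closed[OF HXq.cls_hom FP_x_closed] by (simp add: HX_x_def HX_def)

lemma HX_x_add: "\<lbrakk>x \<in> carrier (vect D); x' \<in> carrier (vect D)\<rbrakk> \<Longrightarrow> HX_x D (x \<oplus>\<^bsub>vect D\<^esub> x') = HX_x D x \<oplus>\<^bsub>HX D\<^esub> HX_x D x'"
  using ring_hom_add[OF HXq.cls_hom FP_x_closed FP_x_closed] by (simp add: HX_x_def HX_def FP_x_add)

lemma HX_x_rels:
  assumes a: "a \<in> carrier (alg D)" and x: "x \<in> carrier (vect D)"
  shows "HX_env D a \<one>\<^bsub>alg D\<^esub> \<otimes>\<^bsub>HX D\<^esub> HX_x D x = HX_x D (a \<odot>\<^bsub>vect D\<^esub> x)"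
    "HX_x D x \<otimes>\<^bsub>HX D\<^esub> HX_env D a \<one>\<^bsub>alg D\<^esub> = HX_x D (x \<ddagger>\<^bsub>vect D\<^esub> a) \<oplus>\<^bsub>HX D\<^esub> HX_env D (ev D (tenXW D x (dd D a))) \<one>\<^bsub>alg D\<^esub>"
    "HX_x D x \<otimes>\<^bsub>HX D\<^esub> HX_env D \<one>\<^bsub>alg D\<^esub> a = HX_env D \<one>\<^bsub>alg D\<^esub> a \<otimes>\<^bsub>HX D\<^esub> HX_x D x \<oplus>\<^bsub>HX D\<^esub> HX_xw D x (dd D a)"
proof -
  note cl = a x V.M.lmod_closed V.rmod_closed FP_x_closed ring_hom_closed[OF FP_of_TZ_hom] TZ_env_closed TZ_xw_closed d_closed ev_closed
  note hom = ring_hom_mult[OF HXq.cls_hom[folded HX_def], symmetric] ring_hom_add[OF HXq.cls_hom[folded HX_def], symmetric]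
  let ?E = "\<lambda>a b. FP_of_TZ D (TZ_env D a b)" and ?u = "\<one>\<^bsub>alg D\<^esub>"
  have "?E a ?u \<otimes>\<^bsub>FP D\<^esub> FP_x D x \<ominus>\<^bsub>FP D\<^esub> FP_x D (a \<odot>\<^bsub>vect D\<^esub> x) \<in> HX_rels D"
    unfolding HX_rels_def Let_def by (rule UnI1, rule UnI1, rule CollectI, intro exI conjI, rule refl) (rule a x)+
  from HXq.cls_eq[OF _ _ this]
  show "HX_env D a ?u \<otimes>\<^bsub>HX D\<^esub> HX_x D x = HX_x D (a \<odot>\<^bsub>vect D\<^esub> x)"
    by (simp add: HX_env_def HX_x_def hom cl)
  have "FP_x D x \<otimes>\<^bsub>FP D\<^esub> ?E a ?u
        \<ominus>\<^bsub>FP D\<^esub> (FP_x D (x \<ddagger>\<^bsub>vect D\<^esub> a) \<oplus>\<^bsub>FP D\<^esub> ?E (ev D (tenXW D x (dd D a))) ?u) \<in> HX_rels D"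
    unfolding HX_rels_def Let_def by (rule UnI1, rule UnI2, rule CollectI, intro exI conjI, rule refl) (rule a x)+
  from HXq.cls_eq[OF _ _ this]
  show "HX_x D x \<otimes>\<^bsub>HX D\<^esub> HX_env D a ?u = HX_x D (x \<ddagger>\<^bsub>vect D\<^esub> a) \<oplus>\<^bsub>HX D\<^esub> HX_env D (ev D (tenXW D x (dd D a))) ?u"
    by (simp add: HX_env_def HX_x_def hom cl)
  have "FP_x D x \<otimes>\<^bsub>FP D\<^esub> ?E ?u a
        \<ominus>\<^bsub>FP D\<^esub> (?E ?u a \<otimes>\<^bsub>FP D\<^esub> FP_x D x \<oplus>\<^bsub>FP D\<^esub> FP_of_TZ D (TZ_xw D x (dd D a))) \<in> HX_rels D"
    unfolding HX_rels_def Let_def by (rule UnI2, rule CollectI, intro exI conjI, rule refl) (rule a x)+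
  from HXq.cls_eq[OF _ _ this]
  show "HX_x D x \<otimes>\<^bsub>HX D\<^esub> HX_env D ?u a = HX_env D ?u a \<otimes>\<^bsub>HX D\<^esub> HX_x D x \<oplus>\<^bsub>HX D\<^esub> HX_xw D x (dd D a)"
    by (simp add: HX_env_def HX_x_def HX_xw_def hom cl)
qed

end

section \<open>Modules over the algebra of differential operators\<close>

context pivotal_calculus
begin

interpretation XW: env_pair "base D" "alg D" "vect D" "form D" by (rule pair_xw)
interpretation WX: env_pair "base D" "alg D" "form D" "vect D" by (rule pair_wx)
interpretation TZ: talg "base D" "envA D" "ZZ D" by (rule talg_TZ)
interpretation TX: talg "base D" "field_algebra (base D)" "scalars (alg D) (vect D)" by (rule talg_TX)
interpretation FP: fprod "base D" "HO D" "TX D" by (rule fprod_D)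
interpretation Ha: kalg "base D" "HX D" by (rule kalg_HX)
interpretation XG: abelian_group XW.Z by (rule XW.Z_abelian)
interpretation WG: abelian_group WX.Z by (rule WX.Z_abelian)

lemma field_algebra_simps [simp]: "carrier (field_algebra K) = carrier K" "\<one>\<^bsub>field_algebra K\<^esub> = \<one>\<^bsub>K\<^esub>"
  "\<zero>\<^bsub>field_algebra K\<^esub> = \<zero>\<^bsub>K\<^esub>" "mult (field_algebra K) = mult K" "add (field_algebra K) = add K" "smult (field_algebra K) = mult K"
  by (simp_all add: field_algebra_def)

lemma TX_bs: "l \<in> carrier (base D) \<Longrightarrow> TX.bs l = l \<odot>\<^bsub>TX D\<^esub> \<one>\<^bsub>TX D\<^esub>"
proof -
  assume l: "l \<in> carrier (base D)"
  have "TX.bs (l \<odot>\<^bsub>field_algebra (base D)\<^esub> \<one>\<^bsub>field_algebra (base D)\<^esub>) =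
      (l \<odot>\<^bsub>TX D\<^esub> \<one>\<^bsub>TX D\<^esub>) \<otimes>\<^bsub>TX D\<^esub> TX.bs \<one>\<^bsub>field_algebra (base D)\<^esub>"
    using TX.base_premap l cring.axioms(1)[OF K_cring] unfolding premap_def TX_eq field_algebra_simps
    by (meson ring.ring_simprules(6))
  moreover have "TX.bs \<one>\<^bsub>field_algebra (base D)\<^esub> = \<one>\<^bsub>TX D\<^esub>"
    using TX.base_premap ring_hom_one[of TX.bs "field_algebra (base D)" "TX D"] by (simp add: premap_def TX_eq)
  ultimately show ?thesis using l by (simp add: FP.C.smult_cl)
qed

text \<open>Generation is followed through the layers of the presentation: generators of the tensor
  algebras, of the quotient \<open>HO\<close>, of the free product and of \<open>HX\<close>. The
  elements of \<open>A^e\<close> and \<open>Z\<close> among them are reduced to pure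
  tensors.\<close>

lemma HX_induct [consumes 1, case_names env xw wx x add mult]:
  assumes b: "b \<in> carrier (HX D)"
    and env: "\<And>a b. \<lbrakk>a \<in> carrier (alg D); b \<in> carrier (alg D)\<rbrakk> \<Longrightarrow> P (HX_env D a b)"
    and xw: "\<And>x w. \<lbrakk>x \<in> carrier (vect D); w \<in> carrier (form D)\<rbrakk> \<Longrightarrow> P (HX_xw D x w)"
    and wx: "\<And>x w. \<lbrakk>x \<in> carrier (vect D); w \<in> carrier (form D)\<rbrakk> \<Longrightarrow> P (HX_wx D w x)"
    and x: "\<And>x. x \<in> carrier (vect D) \<Longrightarrow> P (HX_x D x)"
    and add: "\<And>b c. \<lbrakk>b \<in> carrier (HX D); c \<in> carrier (HX D); P b; P c\<rbrakk> \<Longrightarrow> P (b \<oplus>\<^bsub>HX D\<^esub> c)"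
    and mult: "\<And>b c. \<lbrakk>b \<in> carrier (HX D); c \<in> carrier (HX D); P b; P c\<rbrakk> \<Longrightarrow> P (b \<otimes>\<^bsub>HX D\<^esub> c)"
  shows "P b"
proof -
  have scal: "P (l \<odot>\<^bsub>HX D\<^esub> \<one>\<^bsub>HX D\<^esub>)" if "l \<in> carrier (base D)" for l
    using env[of "l \<odot>\<^bsub>alg D\<^esub> \<one>\<^bsub>alg D\<^esub>" "\<one>\<^bsub>alg D\<^esub>"] HX_env_scal(1)[OF that] that by simp
  have zero: "P \<zero>\<^bsub>HX D\<^esub>"
    using scal[of "\<zero>\<^bsub>base D\<^esub>"] ring_hom_zero[OF Ha.scal_hom cring.axioms(1)[OF K_cring] Ha.ring_axioms] by simp
  \<comment> \<open>\<open>tensor_induct\<close> asks for differences. They come from multiplication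
    by the scalar -1, which lies in the image of \<open>A^e\<close>.\<close>
  have neg: "P (b \<ominus>\<^bsub>HX D\<^esub> c)" if "b \<in> carrier (HX D)" "c \<in> carrier (HX D)" "P b" "P c" for b c
  proof -
    let ?m = "(\<ominus>\<^bsub>base D\<^esub> \<one>\<^bsub>base D\<^esub>) \<odot>\<^bsub>HX D\<^esub> \<one>\<^bsub>HX D\<^esub>"
    have "additive_map (base D) (HX D) (\<lambda>l. l \<odot>\<^bsub>HX D\<^esub> \<one>\<^bsub>HX D\<^esub>)"
      using Ha.scal_hom by (auto simp: additive_map_def ring_hom_def)
    then have "?m = \<ominus>\<^bsub>HX D\<^esub> (\<one>\<^bsub>base D\<^esub> \<odot>\<^bsub>HX D\<^esub> \<one>\<^bsub>HX D\<^esub>)"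
      by (rule additive_map_inv[OF ring.is_abelian_group[OF cring.axioms(1)[OF K_cring]] Ha.abelian_group_axioms]) simp
    also have "\<dots> = \<ominus>\<^bsub>HX D\<^esub> \<one>\<^bsub>HX D\<^esub>" using ring_hom_one[OF Ha.scal_hom] by simp
    finally have m: "?m = \<ominus>\<^bsub>HX D\<^esub> \<one>\<^bsub>HX D\<^esub>" .
    have "?m \<otimes>\<^bsub>HX D\<^esub> c = \<ominus>\<^bsub>HX D\<^esub> c" unfolding m using that by (simp add: Ha.l_minus)
    moreover have "P (?m \<otimes>\<^bsub>HX D\<^esub> c)" using that by (intro mult scal Ha.smult_cl) auto
    ultimately show ?thesis using that add[of b "\<ominus>\<^bsub>HX D\<^esub> c"] by (simp add: a_minus_def)
  qed
  have am: "additive_map (TZ D) (HX D) HX_of_TZ"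
    using HX_of_TZ_hom by (auto simp: additive_map_def ring_hom_def)
  interpret T: kalg "base D" "TZ D" by (rule kalg_TZ)
  have ambs: "additive_map (enveloping (base D) (alg D)) (HX D) (\<lambda>u. HX_of_TZ (TZ.bs u))"
    by (rule additive_map_comp[OF _ am]) (use bs_hom in \<open>auto simp: additive_map_def ring_hom_def envA_eq\<close>)
  have ambs': "additive_map C.S.T (HX D) (\<lambda>u. HX_of_TZ (TZ.bs u))"
    using ambs by (simp add: additive_map_def assoc_algebra.EA_simps[OF assoc_D])
  have g1: "P (HX_of_TZ (TZ.bs u))" if "u \<in> carrier (envA D)" for u
  proof -
    have "u \<in> carrier C.S.T" using that by (simp add: envA_eq assoc_algebra.EA_simps[OF assoc_D])
    then show ?thesis
    proof (induction rule: C.S.tensor_induct)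
      case zero
      then show ?case using additive_map_zero[OF C.S.T.abelian_group_axioms Ha.abelian_group_axioms ambs'] \<open>P \<zero>\<^bsub>HX D\<^esub>\<close> by simp
    next
      case (tens a b)
      then show ?case using env[of a b] by (simp add: HX_gens TZ_env_eq assoc_algebra.t2_eq[OF assoc_D])
    next
      case (diff t u)
      then show ?case
        using additive_map_diff[OF C.S.T.abelian_group_axioms Ha.abelian_group_axioms ambs'] neg additive_map_closed[OF ambs'] by simp
    qed
  qed
  have gnam: "additive_map (ZZ D) (TZ D) TZ.gn"
    by (rule additive_mapI) (use TZ.gen_closed TZ.gen_add in \<open>auto simp: TZ_eq\<close>)
  have 1: "additive_map XW.T.T (HX D) (\<lambda>z. HX_of_TZ (TZ.gn (z, \<zero>\<^bsub>WX.Z\<^esub>)))"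
    by (rule additive_map_comp[OF additive_map_comp[OF _ gnam] am])
       (auto simp: additive_map_def ZZ_simps XW.Z_simps(1,2)[symmetric])
  have 2: "additive_map WX.T.T (HX D) (\<lambda>z. HX_of_TZ (TZ.gn (\<zero>\<^bsub>XW.Z\<^esub>, z)))"
    by (rule additive_map_comp[OF additive_map_comp[OF _ gnam] am])
       (auto simp: additive_map_def ZZ_simps WX.Z_simps(1,2)[symmetric])
  have g2: "P (HX_of_TZ (TZ.gn (z, \<zero>\<^bsub>WX.Z\<^esub>)))" if "z \<in> carrier XW.T.T" for z
    using that
  proof (induction rule: XW.T.tensor_induct)
    case zero
    then show ?case using additive_map_zero[OF XW.T.T.abelian_group_axioms Ha.abelian_group_axioms 1] \<open>P \<zero>\<^bsub>HX D\<^esub>\<close> by simp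
  next
    case (tens a b)
    then show ?case using xw[of a b] by (simp add: HX_gens TZ_xw_eq)
  next
    case (diff t u)
    then show ?case
      using additive_map_diff[OF XW.T.T.abelian_group_axioms Ha.abelian_group_axioms 1] neg additive_map_closed[OF 1] by simp
  qed
  have g3: "P (HX_of_TZ (TZ.gn (\<zero>\<^bsub>XW.Z\<^esub>, z)))" if "z \<in> carrier WX.T.T" for z
    using that
  proof (induction rule: WX.T.tensor_induct)
    case zero
    then show ?case using additive_map_zero[OF WX.T.T.abelian_group_axioms Ha.abelian_group_axioms 2] \<open>P \<zero>\<^bsub>HX D\<^esub>\<close> by simp
  next
    case (tens a b)
    then show ?case using wx[of b a] by (simp add: HX_gens TZ_wx_eq)
  next
    case (diff t u)
    then show ?case
      using additive_map_diff[OF WX.T.T.abelian_group_axioms Ha.abelian_group_axioms 2] neg additive_map_closed[OF 2] by simp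
  qed
  have g4: "P (HX_of_TZ (TZ.gn z))" if z: "z \<in> carrier (ZZ D)" for z
  proof -
    obtain u v where uv: "z = (u, v)" "u \<in> carrier XW.Z" "v \<in> carrier WX.Z" using z by (auto simp: ZZ_simps)
    have m: "(u, \<zero>\<^bsub>WX.Z\<^esub>) \<in> carrier (ZZ D)" "(\<zero>\<^bsub>XW.Z\<^esub>, v) \<in> carrier (ZZ D)" using uv by (simp_all add: ZZ_simps)
    have "TZ.gn z = TZ.gn (u, \<zero>\<^bsub>WX.Z\<^esub>) \<oplus>\<^bsub>TZ D\<^esub> TZ.gn (\<zero>\<^bsub>XW.Z\<^esub>, v)"
      using additive_map_add[OF gnam m] uv by (simp add: ZZ_simps)
    then have "HX_of_TZ (TZ.gn z) = HX_of_TZ (TZ.gn (u, \<zero>\<^bsub>WX.Z\<^esub>)) \<oplus>\<^bsub>HX D\<^esub> HX_of_TZ (TZ.gn (\<zero>\<^bsub>XW.Z\<^esub>, v))"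
      using additive_map_add[OF am] additive_map_closed[OF gnam] m by simp
    then show ?thesis
      using add[OF _ _ g2 g3] uv additive_map_closed[OF am] additive_map_closed[OF gnam] m by (simp add: XW.Z_simps(1) WX.Z_simps(1))
  qed
  \<comment> \<open>The generators contributed by the two factors of the free product:
    \<open>A^e\<close> and \<open>Z\<close> on the side of \<open>HO\<close>, \<open>K\<close> and
    the vector fields on the side of \<open>TX\<close>.\<close>
  let ?G1 = "cls (TZ D) (HO_rels D) ` (TZ.bs ` carrier (envA D) \<union> TZ.gn ` carrier (ZZ D))"
  let ?G2 = "TX.bs ` carrier (field_algebra (base D)) \<union> TX.gn ` carrier (scalars (alg D) (vect D))"
  have k1: "kgen (base D) (HO D) ?G1"
    unfolding HO_def by (rule kgen_quot[OF kalg_TZ HO_rels_carrier TZ.kgen_TA[unfolded TZ_eq]])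
  have k2: "kgen (base D) (HX D) (cls (FP D) (HX_rels D) ` (FP.lf ` ?G1 \<union> FP.rt ` ?G2))"
    unfolding HX_def
    by (rule kgen_quot[OF kalg_FP HX_rels_carrier FP.kgen_P[OF k1 TX.kgen_TA[unfolded TX_eq], unfolded FP_eq]])
  show ?thesis
    using k2 b
  proof (induction rule: kgen_induct)
    case (gen g)
    then consider u where "u \<in> carrier (envA D)" "g = HX_of_TZ (TZ.bs u)"
      | z where "z \<in> carrier (ZZ D)" "g = HX_of_TZ (TZ.gn z)"
      | l where "l \<in> carrier (base D)" "g = cls (FP D) (HX_rels D) (FP.rt (TX.bs l))"
      | x where "x \<in> carrier (vect D)" "g = HX_x D x"
      by (auto simp: HX_of_TZ_def FP_of_TZ_def HX_x_def FP_x_def)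
    then show ?case
    proof cases
      \<comment> \<open>The base field of the tensor algebra of vector fields gives scalars of
        \<open>HX\<close>, which are already covered by \<open>A^e\<close>.\<close>
      case 3
      have "FP.rt (TX.bs l) = l \<odot>\<^bsub>FP D\<^esub> \<one>\<^bsub>FP D\<^esub>"
        using FP.rt_khom 3(1) by (simp add: TX_bs khom_def FP_eq)
      then have "g = l \<odot>\<^bsub>HX D\<^esub> \<one>\<^bsub>HX D\<^esub>"
        using 3 kalg.cls_scal[OF kalg_FP HX_rels_carrier 3(1)] by (simp add: HX_def)
      then show ?thesis using scal 3 by simp
    qed (use g1 g4 x in auto)
  qed (use scal add mult in auto)
qed

end

section \<open>Modules as representations\<close>

definition rep_of :: "('k, 'a, 'w, 'x) calculus \<Rightarrow> (('k, 'a, 'w, 'x) hx, 'm) module \<Rightarrow> ('a, 'w, 'x, 'm) rep" where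
  "rep_of D M = \<lparr>carrier = carrier M, mult = undefined, one = undefined, zero = zero M, add = add M,
     sl = (\<lambda>a m. HX_env D a \<one>\<^bsub>alg D\<^esub> \<odot>\<^bsub>M\<^esub> m), tr = (\<lambda>a m. HX_env D \<one>\<^bsub>alg D\<^esub> a \<odot>\<^bsub>M\<^esub> m),
     PP = (\<lambda>x w m. HX_xw D x w \<odot>\<^bsub>M\<^esub> m), QQ = (\<lambda>w x m. HX_wx D w x \<odot>\<^bsub>M\<^esub> m)\<rparr>"

abbreviation lie :: "('k, 'a, 'w, 'x) calculus \<Rightarrow> (('k, 'a, 'w, 'x) hx, 'm) module \<Rightarrow> 'x \<Rightarrow> 'm \<Rightarrow> 'm" where
  "lie D M \<equiv> \<lambda>x m. HX_x D x \<odot>\<^bsub>M\<^esub> m"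

lemma rep_of_simps [simp]:
  "carrier (rep_of D M) = carrier M" "zero (rep_of D M) = zero M" "add (rep_of D M) = add M"
  "sl (rep_of D M) a m = HX_env D a \<one>\<^bsub>alg D\<^esub> \<odot>\<^bsub>M\<^esub> m" "tr (rep_of D M) a m = HX_env D \<one>\<^bsub>alg D\<^esub> a \<odot>\<^bsub>M\<^esub> m"
  "PP (rep_of D M) x w m = HX_xw D x w \<odot>\<^bsub>M\<^esub> m" "QQ (rep_of D M) w x m = HX_wx D w x \<odot>\<^bsub>M\<^esub> m"
  by (simp_all add: rep_of_def)

lemma bim_rep_of [simp]: "bim (rep_of D M) = underlying D M"
  by (simp add: bim_def rep_of_def underlying_def)

context pivotal_calculus
begin

interpretation H: ring "HX D" by (rule ring_HX)

text \<open>Associativity of the action turns each relation of \<open>HX\<close> into the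
  corresponding law of operators.\<close>

lemma module_xrep:
  assumes "left_module (HX D) M"
  shows "xrep (dualD D) (rep_of D M) (dd D) (lie D M)"
proof -
  interpret M: left_module "HX D" M by fact
  let ?E = "dualD D" and ?V = "rep_of D M" and ?u = "\<one>\<^bsub>alg D\<^esub>"
  have ab: "abelian_group ?V"
    by (rule abelian_group_cong[OF M.abelian_group_axioms]) simp_all
  note cl [simp] = HX_env_closed HX_xw_closed HX_wx_closed HX_x_closed M.lmod_closed V.M.lmod_closed V.rmod_closed
    C.M.lmod_closed C.rmod_closed d_closed ev_closed
  note [simp] = M.lmod_r_distr M.lmod_l_distr
  note ma = M.lmod_assoc[symmetric]
  have sums: "SI ?E ?V = SI ?E M" "SJ ?E ?V = SJ ?E M"
    by (simp_all add: SI_def SJ_def fun_eq_iff finsum_cong_group[of ?V M])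
  \<comment> \<open>A sum of composed operators is the action of one element of \<open>HX\<close>,
    to which the relations apply.\<close>
  have fs: "(\<Oplus>\<^bsub>M\<^esub>i\<in>{..<n}. g i \<odot>\<^bsub>M\<^esub> (h i \<odot>\<^bsub>M\<^esub> m)) = (\<Oplus>\<^bsub>HX D\<^esub>i\<in>{..<n}. g i \<otimes>\<^bsub>HX D\<^esub> h i) \<odot>\<^bsub>M\<^esub> m"
    if "m \<in> carrier M" "\<And>i. i < n \<Longrightarrow> g i \<in> carrier (HX D)" "\<And>i. i < n \<Longrightarrow> h i \<in> carrier (HX D)" for g h m and n :: nat
  proof -
    have am: "additive_map (HX D) M (\<lambda>r. r \<odot>\<^bsub>M\<^esub> m)" using that by (intro additive_mapI) simp_all
    have "(\<Oplus>\<^bsub>HX D\<^esub>i\<in>{..<n}. g i \<otimes>\<^bsub>HX D\<^esub> h i) \<odot>\<^bsub>M\<^esub> m = (\<Oplus>\<^bsub>M\<^esub>i\<in>{..<n}. (g i \<otimes>\<^bsub>HX D\<^esub> h i) \<odot>\<^bsub>M\<^esub> m)"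
      by (rule additive_map_finsum[OF H.abelian_group_axioms M.abelian_group_axioms am]) (use that in auto)
    also have "\<dots> = (\<Oplus>\<^bsub>M\<^esub>i\<in>{..<n}. g i \<odot>\<^bsub>M\<^esub> (h i \<odot>\<^bsub>M\<^esub> m))"
      by (rule finsum_cong_weak) (use that in \<open>simp add: M.lmod_assoc\<close>)
    finally show ?thesis ..
  qed
  note basis_closed [simp]
  have pre: "prerep ?E ?V"
  proof (intro prerep.intro prerep_axioms.intro dual_D ab)
    show "bimod (dalg ?E) (bim ?V)"
    proof (intro bimod.intro left_module.intro left_module_axioms.intro bimod_axioms.intro; (unfold dualD_simps)?; (unfold bim_simps rep_of_simps)?)
      show "ring (alg D)" by unfold_locales
      show "abelian_group (bim ?V)"
        by (rule abelian_group_cong[OF M.abelian_group_axioms]) (simp_all add: underlying_def)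
      show "HX_env D ?u ?u \<odot>\<^bsub>M\<^esub> m = m" if "m \<in> carrier M" for m using that by (simp add: HX_env_one M.lmod_one)
      show "HX_env D ?u ?u \<odot>\<^bsub>M\<^esub> m = m" if "m \<in> carrier M" for m using that by (simp add: HX_env_one M.lmod_one)
    qed (simp_all add: HX_env_add HX_env_mult ma)
  qed (simp add: HX_env_scal)
  have pre': "prerep (swapd ?E) (swapr ?V)"
    using pre unfolding prerep_def prerep_axioms_def
    by (auto simp: dual_swapd intro: abelian_group_cong[OF ab])
  have "hrep ?E ?V"
    by (intro hrep.intro hrep_axioms.intro pre) (simp_all add: HX_xw_add ma HX_env_xw C.rmod_one V.rmod_one V.M.lmod_one C.M.lmod_one)
  moreover have "hrep (swapd ?E) (swapr ?V)"
    by (intro hrep.intro hrep_axioms.intro pre') (simp_all add: HX_xw_add ma HX_env_xw C.rmod_one V.rmod_one V.M.lmod_one C.M.lmod_one)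
  moreover have "rels ?E ?V"
    by (intro rels.intro rels_axioms.intro pre; simp add: sums) (simp_all add: SI_def SJ_def fs HX_ho)
  moreover have "rels (swapd ?E) (swapr ?V)"
    by (intro rels.intro rels_axioms.intro pre'; simp add: sums) (simp_all add: SI_def SJ_def fs HX_ho)
  ultimately have "rep ?E ?V" by (intro rep.intro)
  then show ?thesis
    by (intro xrep.intro xrep_axioms.intro)
       (simp_all add: HX_x_add ma HX_x_rels M.lmod_l_distr[symmetric] del: M.lmod_l_distr)
qed

text \<open>The elements that commute with \<open>F\<close> on all of \<open>U\<close> are closed
  under sums and products, and \<open>HX_induct\<close> reduces the rest to generators.\<close>

lemma intertwine:
  assumes U: "left_module (HX D) U" and V: "left_module (HX D) V" and F: "additive_map U V F"
    and env: "\<And>a u. \<lbrakk>a \<in> carrier (alg D); u \<in> carrier U\<rbrakk> \<Longrightarrow> F (HX_env D a \<one>\<^bsub>alg D\<^esub> \<odot>\<^bsub>U\<^esub> u) = HX_env D a \<one>\<^bsub>alg D\<^esub> \<odot>\<^bsub>V\<^esub> F u"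
      "\<And>a u. \<lbrakk>a \<in> carrier (alg D); u \<in> carrier U\<rbrakk> \<Longrightarrow> F (HX_env D \<one>\<^bsub>alg D\<^esub> a \<odot>\<^bsub>U\<^esub> u) = HX_env D \<one>\<^bsub>alg D\<^esub> a \<odot>\<^bsub>V\<^esub> F u"
    and xw: "\<And>x w u. \<lbrakk>x \<in> carrier (vect D); w \<in> carrier (form D); u \<in> carrier U\<rbrakk> \<Longrightarrow> F (HX_xw D x w \<odot>\<^bsub>U\<^esub> u) = HX_xw D x w \<odot>\<^bsub>V\<^esub> F u"
    and wx: "\<And>x w u. \<lbrakk>x \<in> carrier (vect D); w \<in> carrier (form D); u \<in> carrier U\<rbrakk> \<Longrightarrow> F (HX_wx D w x \<odot>\<^bsub>U\<^esub> u) = HX_wx D w x \<odot>\<^bsub>V\<^esub> F u"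
    and x: "\<And>x u. \<lbrakk>x \<in> carrier (vect D); u \<in> carrier U\<rbrakk> \<Longrightarrow> F (HX_x D x \<odot>\<^bsub>U\<^esub> u) = HX_x D x \<odot>\<^bsub>V\<^esub> F u"
    and b: "b \<in> carrier (HX D)" and u: "u \<in> carrier U"
  shows "F (b \<odot>\<^bsub>U\<^esub> u) = b \<odot>\<^bsub>V\<^esub> F u"
proof -
  interpret U: left_module "HX D" U by fact
  interpret V: left_module "HX D" V by fact
  note F' [simp] = additive_map_closed[OF F] additive_map_add[OF F]
  have "\<forall>u\<in>carrier U. F (b \<odot>\<^bsub>U\<^esub> u) = b \<odot>\<^bsub>V\<^esub> F u"
    using b
  proof (induction rule: HX_induct)
    case (env a b)
    \<comment> \<open>Commutation is assumed for a and for b-bar separately; their product is the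
      general element of this kind.\<close>
    have "HX_env D a b = HX_env D a \<one>\<^bsub>alg D\<^esub> \<otimes>\<^bsub>HX D\<^esub> HX_env D \<one>\<^bsub>alg D\<^esub> b"
      using env by (simp add: HX_env_mult)
    then show ?case
      using env assms(4,5) by (simp add: HX_env_closed U.lmod_assoc V.lmod_assoc U.lmod_closed)
  next
    case (add b c)
    then show ?case by (simp add: U.lmod_l_distr V.lmod_l_distr U.lmod_closed)
  next
    case (mult b c)
    then show ?case by (simp add: U.lmod_assoc V.lmod_assoc U.lmod_closed)
  qed (use xw wx x in auto)
  then show ?thesis using u by blast
qed

end

section \<open>The universal property of the algebra of differential operators\<close>

text \<open>Images \<open>s\<close>, \<open>t\<close>, \<open>p\<close>, \<open>q\<close>,
  \<open>l\<close> in \<open>R\<close> of a, a-bar, (x, \<omega>), (\<omega>, x) and x, with the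
  defining relations as assumptions. The ring \<open>R\<close> has no scalars of its own, so
  \<open>K\<close> acts through \<open>s\<close>.\<close>

locale hx_target = pivotal_calculus D + R: ring R
  for D :: "('k, 'a, 'w, 'x) calculus" and R :: "('c, 'd) ring_scheme" +
  fixes s t :: "'a \<Rightarrow> 'c" and p :: "'x \<Rightarrow> 'w \<Rightarrow> 'c" and q :: "'w \<Rightarrow> 'x \<Rightarrow> 'c" and l :: "'x \<Rightarrow> 'c"
  assumes s_am: "additive_map (alg D) R s" and t_am: "additive_map (alg D) R t"
    and s_one [simp]: "s \<one>\<^bsub>alg D\<^esub> = \<one>\<^bsub>R\<^esub>" and t_one [simp]: "t \<one>\<^bsub>alg D\<^esub> = \<one>\<^bsub>R\<^esub>"
    and s_mult: "\<lbrakk>a \<in> carrier (alg D); b \<in> carrier (alg D)\<rbrakk> \<Longrightarrow> s (a \<otimes>\<^bsub>alg D\<^esub> b) = s a \<otimes>\<^bsub>R\<^esub> s b"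
    and t_mult: "\<lbrakk>a \<in> carrier (alg D); b \<in> carrier (alg D)\<rbrakk> \<Longrightarrow> t (a \<otimes>\<^bsub>alg D\<^esub> b) = t b \<otimes>\<^bsub>R\<^esub> t a"
    and t_s: "\<lbrakk>a \<in> carrier (alg D); b \<in> carrier (alg D)\<rbrakk> \<Longrightarrow> t b \<otimes>\<^bsub>R\<^esub> s a = s a \<otimes>\<^bsub>R\<^esub> t b"
    and s_t_scal: "c \<in> carrier (base D) \<Longrightarrow> t (c \<odot>\<^bsub>alg D\<^esub> \<one>\<^bsub>alg D\<^esub>) = s (c \<odot>\<^bsub>alg D\<^esub> \<one>\<^bsub>alg D\<^esub>)"
    and p_am1: "w \<in> carrier (form D) \<Longrightarrow> additive_map (vect D) R (\<lambda>x. p x w)"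
    and p_am2: "x \<in> carrier (vect D) \<Longrightarrow> additive_map (form D) R (\<lambda>w. p x w)"
    and q_am1: "x \<in> carrier (vect D) \<Longrightarrow> additive_map (form D) R (\<lambda>w. q w x)"
    and q_am2: "w \<in> carrier (form D) \<Longrightarrow> additive_map (vect D) R (\<lambda>x. q w x)"
    and s_p: "\<lbrakk>a \<in> carrier (alg D); x \<in> carrier (vect D); w \<in> carrier (form D)\<rbrakk> \<Longrightarrow> s a \<otimes>\<^bsub>R\<^esub> p x w = p (a \<odot>\<^bsub>vect D\<^esub> x) w"
    and t_p: "\<lbrakk>a \<in> carrier (alg D); x \<in> carrier (vect D); w \<in> carrier (form D)\<rbrakk> \<Longrightarrow> t a \<otimes>\<^bsub>R\<^esub> p x w = p x (w \<ddagger>\<^bsub>form D\<^esub> a)"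
    and p_s: "\<lbrakk>a \<in> carrier (alg D); x \<in> carrier (vect D); w \<in> carrier (form D)\<rbrakk> \<Longrightarrow> p x w \<otimes>\<^bsub>R\<^esub> s a = p (x \<ddagger>\<^bsub>vect D\<^esub> a) w"
    and p_t: "\<lbrakk>a \<in> carrier (alg D); x \<in> carrier (vect D); w \<in> carrier (form D)\<rbrakk> \<Longrightarrow> p x w \<otimes>\<^bsub>R\<^esub> t a = p x (a \<odot>\<^bsub>form D\<^esub> w)"
    and s_q: "\<lbrakk>a \<in> carrier (alg D); x \<in> carrier (vect D); w \<in> carrier (form D)\<rbrakk> \<Longrightarrow> s a \<otimes>\<^bsub>R\<^esub> q w x = q (a \<odot>\<^bsub>form D\<^esub> w) x"
    and t_q: "\<lbrakk>a \<in> carrier (alg D); x \<in> carrier (vect D); w \<in> carrier (form D)\<rbrakk> \<Longrightarrow> t a \<otimes>\<^bsub>R\<^esub> q w x = q w (x \<ddagger>\<^bsub>vect D\<^esub> a)"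
    and q_s: "\<lbrakk>a \<in> carrier (alg D); x \<in> carrier (vect D); w \<in> carrier (form D)\<rbrakk> \<Longrightarrow> q w x \<otimes>\<^bsub>R\<^esub> s a = q (w \<ddagger>\<^bsub>form D\<^esub> a) x"
    and q_t: "\<lbrakk>a \<in> carrier (alg D); x \<in> carrier (vect D); w \<in> carrier (form D)\<rbrakk> \<Longrightarrow> q w x \<otimes>\<^bsub>R\<^esub> t a = q w (a \<odot>\<^bsub>vect D\<^esub> x)"
    and ho1: "\<lbrakk>x \<in> carrier (vect D); w \<in> carrier (form D)\<rbrakk>
      \<Longrightarrow> (\<Oplus>\<^bsub>R\<^esub>i\<in>{..<nI D}. q (om D i) x \<otimes>\<^bsub>R\<^esub> p (xb D i) w) = t (evu D (tenWX D w x))"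
    and ho2: "\<lbrakk>x \<in> carrier (vect D); w \<in> carrier (form D)\<rbrakk>
      \<Longrightarrow> (\<Oplus>\<^bsub>R\<^esub>j\<in>{..<nJ D}. p x (rb D j) \<otimes>\<^bsub>R\<^esub> q w (yb D j)) = s (ev D (tenXW D x w))"
    and ho3: "\<lbrakk>x \<in> carrier (vect D); w \<in> carrier (form D)\<rbrakk>
      \<Longrightarrow> (\<Oplus>\<^bsub>R\<^esub>j\<in>{..<nJ D}. p (yb D j) w \<otimes>\<^bsub>R\<^esub> q (rb D j) x) = t (ev D (tenXW D x w))"
    and ho4: "\<lbrakk>x \<in> carrier (vect D); w \<in> carrier (form D)\<rbrakk>
      \<Longrightarrow> (\<Oplus>\<^bsub>R\<^esub>i\<in>{..<nI D}. q w (xb D i) \<otimes>\<^bsub>R\<^esub> p x (om D i)) = s (evu D (tenWX D w x))"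
    and l_am: "additive_map (vect D) R l"
    and s_l: "\<lbrakk>a \<in> carrier (alg D); x \<in> carrier (vect D)\<rbrakk> \<Longrightarrow> s a \<otimes>\<^bsub>R\<^esub> l x = l (a \<odot>\<^bsub>vect D\<^esub> x)"
    and l_s: "\<lbrakk>a \<in> carrier (alg D); x \<in> carrier (vect D)\<rbrakk>
      \<Longrightarrow> l x \<otimes>\<^bsub>R\<^esub> s a = l (x \<ddagger>\<^bsub>vect D\<^esub> a) \<oplus>\<^bsub>R\<^esub> s (ev D (tenXW D x (dd D a)))"
    and l_t: "\<lbrakk>a \<in> carrier (alg D); x \<in> carrier (vect D)\<rbrakk>
      \<Longrightarrow> l x \<otimes>\<^bsub>R\<^esub> t a = t a \<otimes>\<^bsub>R\<^esub> l x \<oplus>\<^bsub>R\<^esub> p x (dd D a)"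
begin

interpretation XW: env_pair "base D" "alg D" "vect D" "form D" by (rule pair_xw)
interpretation WX: env_pair "base D" "alg D" "form D" "vect D" by (rule pair_wx)
interpretation TZ: talg "base D" "envA D" "ZZ D" by (rule talg_TZ)
interpretation TX: talg "base D" "field_algebra (base D)" "scalars (alg D) (vect D)" by (rule talg_TX)
interpretation FP: fprod "base D" "HO D" "TX D" by (rule fprod_D)

lemmas Rab = R.abelian_group_axioms

text \<open>\<open>kap\<close>, \<open>bet\<close> and \<open>gam\<close> prescribe the homomorphism
  on \<open>K\<close>, on \<open>A^e\<close> and on \<open>Z\<close>, the inputs of the lift from
  the tensor algebra.\<close>

definition "kap c = s (c \<odot>\<^bsub>alg D\<^esub> \<one>\<^bsub>alg D\<^esub>)"
definition "bet = tens_ext R (\<lambda>a b. s a \<otimes>\<^bsub>R\<^esub> t b)"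
definition "gam z = tens_ext R p (fst z) \<oplus>\<^bsub>R\<^esub> tens_ext R q (snd z)"

lemmas s_cl [simp] = additive_map_closed[OF s_am] and t_cl [simp] = additive_map_closed[OF t_am]
  and p_cl [simp] = additive_map_closed[OF p_am1] and q_cl [simp] = additive_map_closed[OF q_am1]
  and l_cl [simp] = additive_map_closed[OF l_am]
lemmas s_add [simp] = additive_map_add[OF s_am] and t_add [simp] = additive_map_add[OF t_am]
  and p_add1 [simp] = additive_map_add[OF p_am1] and q_add1 [simp] = additive_map_add[OF q_am1]
  and p_add2 [simp] = additive_map_add[OF p_am2] and q_add2 [simp] = additive_map_add[OF q_am2]
  and l_add [simp] = additive_map_add[OF l_am]

lemma scal_one [simp]: "c \<in> carrier (base D) \<Longrightarrow> c \<odot>\<^bsub>alg D\<^esub> \<one>\<^bsub>alg D\<^esub> \<in> carrier (alg D)"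
  by simp

lemma kap_hom: "kap \<in> ring_hom (base D) R"
proof (rule ring_hom_memI)
  show "kap (c \<otimes>\<^bsub>base D\<^esub> c') = kap c \<otimes>\<^bsub>R\<^esub> kap c'" if "c \<in> carrier (base D)" "c' \<in> carrier (base D)" for c c'
    unfolding kap_def using that
    by (subst s_mult[symmetric]) (simp_all add: C.scalar_mult_left C.KA.smult_assoc1)
qed (simp_all add: kap_def C.KA.smult_l_distr)

lemma s_scal: "c \<in> carrier (base D) \<Longrightarrow> a \<in> carrier (alg D) \<Longrightarrow> s (c \<odot>\<^bsub>alg D\<^esub> a) = kap c \<otimes>\<^bsub>R\<^esub> s a"
  "c \<in> carrier (base D) \<Longrightarrow> a \<in> carrier (alg D) \<Longrightarrow> s (c \<odot>\<^bsub>alg D\<^esub> a) = s a \<otimes>\<^bsub>R\<^esub> kap c"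
  "c \<in> carrier (base D) \<Longrightarrow> a \<in> carrier (alg D) \<Longrightarrow> t (c \<odot>\<^bsub>alg D\<^esub> a) = kap c \<otimes>\<^bsub>R\<^esub> t a"
  "c \<in> carrier (base D) \<Longrightarrow> a \<in> carrier (alg D) \<Longrightarrow> t (c \<odot>\<^bsub>alg D\<^esub> a) = t a \<otimes>\<^bsub>R\<^esub> kap c"
  unfolding kap_def
  using s_mult[of "c \<odot>\<^bsub>alg D\<^esub> \<one>\<^bsub>alg D\<^esub>" a] s_mult[of a "c \<odot>\<^bsub>alg D\<^esub> \<one>\<^bsub>alg D\<^esub>"]
    t_mult[of "c \<odot>\<^bsub>alg D\<^esub> \<one>\<^bsub>alg D\<^esub>" a] t_mult[of a "c \<odot>\<^bsub>alg D\<^esub> \<one>\<^bsub>alg D\<^esub>"]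
  by (simp_all add: C.scalar_mult_left C.scalar_mult_right s_t_scal)

lemma kap_cl [simp]: "c \<in> carrier (base D) \<Longrightarrow> kap c \<in> carrier R"
  by (simp add: kap_def)

lemma bet_bal: "balanced (base D) (alg_scalars (alg D)) (alg_scalars (alg D)) R (\<lambda>a b. s a \<otimes>\<^bsub>R\<^esub> t b)"
proof (rule balancedI)
  fix a b c assume "a \<in> carrier (alg_scalars (alg D))" "b \<in> carrier (alg_scalars (alg D))" "c \<in> carrier (base D)"
  then show "s (a \<ddagger>\<^bsub>alg_scalars (alg D)\<^esub> c) \<otimes>\<^bsub>R\<^esub> t b = s a \<otimes>\<^bsub>R\<^esub> t (c \<odot>\<^bsub>alg_scalars (alg D)\<^esub> b)"
    by (simp add: s_scal(2) s_scal(3) R.m_assoc)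
qed (simp_all add: R.l_distr R.r_distr)

lemma bet_am: "additive_map (envA D) R bet"
  using C.S.tens_ext_additive[OF Rab bet_bal]
  by (simp add: bet_def additive_map_def envA_eq C.EA_simps)

lemma bet_tt: "a \<in> carrier (alg D) \<Longrightarrow> b \<in> carrier (alg D) \<Longrightarrow> bet (tt a b) = s a \<otimes>\<^bsub>R\<^esub> t b"
  using C.S.tens_ext_tens[OF Rab bet_bal, of a b] by (simp add: bet_def C.t2_eq)

lemma envA_induct:
  assumes "additive_map (envA D) R f" "additive_map (envA D) R g"
    and "\<And>a b. \<lbrakk>a \<in> carrier (alg D); b \<in> carrier (alg D)\<rbrakk> \<Longrightarrow> f (tt a b) = g (tt a b)" and "u \<in> carrier (envA D)"
  shows "f u = g u"
  using C.EA_induct[OF Rab, of f g u] assms by (simp add: envA_eq)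

lemma mult_am: "r \<in> carrier R \<Longrightarrow> additive_map R R (\<lambda>x. x \<otimes>\<^bsub>R\<^esub> r)" "r \<in> carrier R \<Longrightarrow> additive_map R R (\<lambda>x. r \<otimes>\<^bsub>R\<^esub> x)"
  by (auto intro!: additive_mapI simp: R.l_distr R.r_distr)

lemma bet_cl [simp]: "u \<in> carrier (envA D) \<Longrightarrow> bet u \<in> carrier R"
  using additive_map_closed[OF bet_am] .

text \<open>Multiplicativity on pure tensors holds because \<open>s\<close> and \<open>t\<close>
  commute and \<open>t\<close> reverses products, as the second factor of \<open>A^e\<close> is the
  opposite algebra.\<close>

lemma bet_premap: "premap (base D) (envA D) R kap bet"
  unfolding premap_def
proof (intro conjI ring_hom_memI ballI)
  fix u v assume u: "u \<in> carrier (envA D)" and v: "v \<in> carrier (envA D)"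
  show "bet u \<in> carrier R" using u by simp
  show "bet (u \<oplus>\<^bsub>envA D\<^esub> v) = bet u \<oplus>\<^bsub>R\<^esub> bet v" using additive_map_add[OF bet_am u v] .
  note m = C.EA_mult1[folded envA_eq] C.EA_mult2[folded envA_eq]
  show "bet (u \<otimes>\<^bsub>envA D\<^esub> v) = bet u \<otimes>\<^bsub>R\<^esub> bet v"
  proof (rule envA_induct[OF additive_map_comp[OF m(1)[OF v] bet_am] additive_map_comp[OF bet_am mult_am(1)] _ u])
    fix a b assume [simp]: "a \<in> carrier (alg D)" "b \<in> carrier (alg D)"
    have ab: "tt a b \<in> carrier (envA D)" by (simp add: tt_closed)
    show "bet (tt a b \<otimes>\<^bsub>envA D\<^esub> v) = bet (tt a b) \<otimes>\<^bsub>R\<^esub> bet v"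
    proof (rule envA_induct[OF additive_map_comp[OF m(2)[OF ab] bet_am] additive_map_comp[OF bet_am mult_am(2)] _ v])
      fix a' b' assume [simp]: "a' \<in> carrier (alg D)" "b' \<in> carrier (alg D)"
      have "(s a \<otimes>\<^bsub>R\<^esub> s a') \<otimes>\<^bsub>R\<^esub> (t b \<otimes>\<^bsub>R\<^esub> t b') = s a \<otimes>\<^bsub>R\<^esub> (s a' \<otimes>\<^bsub>R\<^esub> t b) \<otimes>\<^bsub>R\<^esub> t b'"
        by (simp add: R.m_assoc)
      also have "\<dots> = (s a \<otimes>\<^bsub>R\<^esub> t b) \<otimes>\<^bsub>R\<^esub> (s a' \<otimes>\<^bsub>R\<^esub> t b')"
        by (simp add: t_s[of a' b, symmetric] R.m_assoc)
      finally show "bet (tt a b \<otimes>\<^bsub>envA D\<^esub> tt a' b') = bet (tt a b) \<otimes>\<^bsub>R\<^esub> bet (tt a' b')"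
        by (simp add: envA_eq C.EA_mult_t2 bet_tt s_mult t_mult)
    qed (simp add: bet_tt)
  qed (use v in simp)
next
  show "bet \<one>\<^bsub>envA D\<^esub> = \<one>\<^bsub>R\<^esub>" by (simp add: envA_one bet_tt)
  fix c u assume c [simp]: "c \<in> carrier (base D)" and u: "u \<in> carrier (envA D)"
  show "bet (c \<odot>\<^bsub>envA D\<^esub> u) = kap c \<otimes>\<^bsub>R\<^esub> bet u"
    by (rule envA_induct[OF additive_map_comp[OF C.EA_smult[OF c, folded envA_eq] bet_am] additive_map_comp[OF bet_am mult_am(2)] _ u])
       (simp_all add: envA_eq C.EA_smult_t2 bet_tt s_scal(1) R.m_assoc)
qed

lemma scal_vf: "c \<in> carrier (base D) \<Longrightarrow> x \<in> carrier (vect D) \<Longrightarrow> x \<ddagger>\<^bsub>vect D\<^esub> (c \<odot>\<^bsub>alg D\<^esub> \<one>\<^bsub>alg D\<^esub>) = (c \<odot>\<^bsub>alg D\<^esub> \<one>\<^bsub>alg D\<^esub>) \<odot>\<^bsub>vect D\<^esub> x"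
  "c \<in> carrier (base D) \<Longrightarrow> w \<in> carrier (form D) \<Longrightarrow> w \<ddagger>\<^bsub>form D\<^esub> (c \<odot>\<^bsub>alg D\<^esub> \<one>\<^bsub>alg D\<^esub>) = (c \<odot>\<^bsub>alg D\<^esub> \<one>\<^bsub>alg D\<^esub>) \<odot>\<^bsub>form D\<^esub> w"
  by (simp_all add: V.central C.central)

text \<open>On scalars \<open>s\<close> and \<open>t\<close> coincide; multiplied from the right,
  they are absorbed into the first and the second argument respectively.\<close>

lemma pq_bal: "balanced (base D) (scalars (alg D) (vect D)) (scalars (alg D) (form D)) R p"
  "balanced (base D) (scalars (alg D) (form D)) (scalars (alg D) (vect D)) R q"
  by (rule balancedI; simp add: scal_vf(1)[symmetric] p_s[symmetric] p_t[symmetric] s_t_scal)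
     (rule balancedI; simp add: scal_vf(2)[symmetric] q_s[symmetric] q_t[symmetric] s_t_scal)

lemma pe_am: "additive_map XW.Z R (tens_ext R p)" "additive_map WX.Z R (tens_ext R q)"
  using XW.T.tens_ext_additive[OF Rab pq_bal(1)] WX.T.tens_ext_additive[OF Rab pq_bal(2)]
  by (simp_all add: additive_map_def XW.Z_simps WX.Z_simps)

lemma pe_tz: "x \<in> carrier (vect D) \<Longrightarrow> w \<in> carrier (form D) \<Longrightarrow> tens_ext R p (XW.tz x w) = p x w"
  "x \<in> carrier (vect D) \<Longrightarrow> w \<in> carrier (form D) \<Longrightarrow> tens_ext R q (WX.tz w x) = q w x"
  using XW.T.tens_ext_tens[OF Rab pq_bal(1)] WX.T.tens_ext_tens[OF Rab pq_bal(2)] by simp_all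

lemma gam_am: "additive_map (ZZ D) R gam"
  using additive_map_add[OF pe_am(1)] additive_map_add[OF pe_am(2)] additive_map_closed[OF pe_am(1)] additive_map_closed[OF pe_am(2)]
  by (intro additive_mapI) (auto simp: gam_def ZZ_simps R.a_ac)

text \<open>Reduction to pure tensors, first in \<open>A^e\<close> and then in \<open>Z\<close>;
  there each claim is a bimodule law of \<open>p\<close> or \<open>q\<close>.\<close>

lemma pe_smult:
  assumes u: "u \<in> carrier (envA D)"
  shows "z \<in> carrier XW.Z \<Longrightarrow> tens_ext R p (u \<odot>\<^bsub>XW.Z\<^esub> z) = bet u \<otimes>\<^bsub>R\<^esub> tens_ext R p z"
    "z \<in> carrier XW.Z \<Longrightarrow> tens_ext R p (z \<ddagger>\<^bsub>XW.Z\<^esub> u) = tens_ext R p z \<otimes>\<^bsub>R\<^esub> bet u"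
    "z' \<in> carrier WX.Z \<Longrightarrow> tens_ext R q (u \<odot>\<^bsub>WX.Z\<^esub> z') = bet u \<otimes>\<^bsub>R\<^esub> tens_ext R q z'"
    "z' \<in> carrier WX.Z \<Longrightarrow> tens_ext R q (z' \<ddagger>\<^bsub>WX.Z\<^esub> u) = tens_ext R q z' \<otimes>\<^bsub>R\<^esub> bet u"
proof -
  note e = envA_eq
  note cl = additive_map_closed[OF pe_am(1)] additive_map_closed[OF pe_am(2)]
  note tcl = tt_closed[unfolded e]
  show "tens_ext R p (u \<odot>\<^bsub>XW.Z\<^esub> z) = bet u \<otimes>\<^bsub>R\<^esub> tens_ext R p z" if z: "z \<in> carrier XW.Z"
    apply (rule envA_induct[OF additive_map_comp[OF XW.Z_smult1[OF z, folded e] pe_am(1)] additive_map_comp[OF bet_am mult_am(1)[OF cl(1)[OF z]]] _ u])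
    apply (rule XW.Z_induct[OF Rab additive_map_comp[OF XW.Z_smult2 pe_am(1)] additive_map_comp[OF pe_am(1) mult_am(2)] _ z])
      apply (simp_all add: tcl tt_closed bet_tt XW.Z_smult_tz pe_tz V.M.lmod_closed C.rmod_closed R.m_assoc t_p s_p)
    done
  show "tens_ext R p (z \<ddagger>\<^bsub>XW.Z\<^esub> u) = tens_ext R p z \<otimes>\<^bsub>R\<^esub> bet u" if z: "z \<in> carrier XW.Z"
    apply (rule envA_induct[OF additive_map_comp[OF XW.Z_rsmult1[OF z, folded e] pe_am(1)] additive_map_comp[OF bet_am mult_am(2)[OF cl(1)[OF z]]] _ u])
    apply (rule XW.Z_induct[OF Rab additive_map_comp[OF XW.Z_rsmult2 pe_am(1)] additive_map_comp[OF pe_am(1) mult_am(1)] _ z])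
      apply (simp_all add: tcl tt_closed bet_tt XW.Z_rsmult_tz pe_tz V.rmod_closed C.M.lmod_closed R.m_assoc[symmetric] p_s p_t)
    done
  show "tens_ext R q (u \<odot>\<^bsub>WX.Z\<^esub> z) = bet u \<otimes>\<^bsub>R\<^esub> tens_ext R q z" if z: "z \<in> carrier WX.Z" for z
    apply (rule envA_induct[OF additive_map_comp[OF WX.Z_smult1[OF z, folded e] pe_am(2)] additive_map_comp[OF bet_am mult_am(1)[OF cl(2)[OF z]]] _ u])
    apply (rule WX.Z_induct[OF Rab additive_map_comp[OF WX.Z_smult2 pe_am(2)] additive_map_comp[OF pe_am(2) mult_am(2)] _ z])
      apply (simp_all add: tcl tt_closed bet_tt WX.Z_smult_tz pe_tz C.M.lmod_closed V.rmod_closed R.m_assoc t_q s_q)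
    done
  show "tens_ext R q (z \<ddagger>\<^bsub>WX.Z\<^esub> u) = tens_ext R q z \<otimes>\<^bsub>R\<^esub> bet u" if z: "z \<in> carrier WX.Z" for z
    apply (rule envA_induct[OF additive_map_comp[OF WX.Z_rsmult1[OF z, folded e] pe_am(2)] additive_map_comp[OF bet_am mult_am(2)[OF cl(2)[OF z]]] _ u])
    apply (rule WX.Z_induct[OF Rab additive_map_comp[OF WX.Z_rsmult2 pe_am(2)] additive_map_comp[OF pe_am(2) mult_am(1)] _ z])
      apply (simp_all add: tcl tt_closed bet_tt WX.Z_rsmult_tz pe_tz C.rmod_closed V.M.lmod_closed R.m_assoc[symmetric] q_s q_t)
    done
qed

lemma gam_smult:
  assumes "u \<in> carrier (envA D)" "z \<in> carrier (ZZ D)"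
  shows "gam (u \<odot>\<^bsub>ZZ D\<^esub> z) = bet u \<otimes>\<^bsub>R\<^esub> gam z" "gam (z \<ddagger>\<^bsub>ZZ D\<^esub> u) = gam z \<otimes>\<^bsub>R\<^esub> bet u"
proof -
  note cl = additive_map_closed[OF pe_am(1)] additive_map_closed[OF pe_am(2)]
  show "gam (u \<odot>\<^bsub>ZZ D\<^esub> z) = bet u \<otimes>\<^bsub>R\<^esub> gam z" "gam (z \<ddagger>\<^bsub>ZZ D\<^esub> u) = gam z \<otimes>\<^bsub>R\<^esub> bet u"
    using assms by (cases z; simp add: gam_def ZZ_simps pe_smult cl R.l_distr R.r_distr)+
qed

lemma bet_kap:
  assumes c [simp]: "c \<in> carrier (base D)" and u: "u \<in> carrier (envA D)"
  shows "bet u \<otimes>\<^bsub>R\<^esub> kap c = kap c \<otimes>\<^bsub>R\<^esub> bet u"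
proof (rule envA_induct[OF additive_map_comp[OF bet_am mult_am(1)] additive_map_comp[OF bet_am mult_am(2)] _ u])
  fix a b assume [simp]: "a \<in> carrier (alg D)" "b \<in> carrier (alg D)"
  have "s a \<otimes>\<^bsub>R\<^esub> t b \<otimes>\<^bsub>R\<^esub> kap c = s a \<otimes>\<^bsub>R\<^esub> (kap c \<otimes>\<^bsub>R\<^esub> t b)"
    by (simp add: R.m_assoc s_scal(3)[symmetric] s_scal(4)[symmetric])
  also have "\<dots> = kap c \<otimes>\<^bsub>R\<^esub> (s a \<otimes>\<^bsub>R\<^esub> t b)"
    by (simp add: R.m_assoc[symmetric] s_scal(1)[symmetric] s_scal(2)[symmetric])
  finally show "bet (tt a b) \<otimes>\<^bsub>R\<^esub> kap c = kap c \<otimes>\<^bsub>R\<^esub> bet (tt a b)" by (simp add: bet_tt)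
qed simp_all

lemma gam_kap:
  assumes c [simp]: "c \<in> carrier (base D)" and z: "z \<in> carrier (ZZ D)"
  shows "gam z \<otimes>\<^bsub>R\<^esub> kap c = kap c \<otimes>\<^bsub>R\<^esub> gam z"
proof -
  note cl = additive_map_closed[OF pe_am(1)] additive_map_closed[OF pe_am(2)]
  have 1: "tens_ext R p u \<otimes>\<^bsub>R\<^esub> kap c = kap c \<otimes>\<^bsub>R\<^esub> tens_ext R p u" if "u \<in> carrier XW.Z" for u
    by (rule XW.Z_induct[OF Rab additive_map_comp[OF pe_am(1) mult_am(1)] additive_map_comp[OF pe_am(1) mult_am(2)] _ that])
       (simp_all add: pe_tz, simp add: kap_def p_s s_p scal_vf)
  have 2: "tens_ext R q u \<otimes>\<^bsub>R\<^esub> kap c = kap c \<otimes>\<^bsub>R\<^esub> tens_ext R q u" if "u \<in> carrier WX.Z" for u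
    by (rule WX.Z_induct[OF Rab additive_map_comp[OF pe_am(2) mult_am(1)] additive_map_comp[OF pe_am(2) mult_am(2)] _ that])
       (simp_all add: pe_tz, simp add: kap_def q_s s_q scal_vf)
  show ?thesis using z by (cases z) (simp add: gam_def ZZ_simps cl R.l_distr R.r_distr 1 2)
qed

lemma TZ_lift: "\<exists>\<psi>. khom (base D) (TZ D) R kap \<psi> \<and>
    (\<forall>a\<in>carrier (alg D). \<forall>b\<in>carrier (alg D). \<psi> (TZ_env D a b) = s a \<otimes>\<^bsub>R\<^esub> t b) \<and>
    (\<forall>x\<in>carrier (vect D). \<forall>w\<in>carrier (form D). \<psi> (TZ_xw D x w) = p x w \<and> \<psi> (TZ_wx D w x) = q w x)"
proof -
  obtain \<psi> where \<psi>: "khom (base D) (TZ D) R kap \<psi>" "\<And>u. u \<in> carrier (envA D) \<Longrightarrow> \<psi> (TZ.bs u) = bet u"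
      "\<And>z. z \<in> carrier (ZZ D) \<Longrightarrow> \<psi> (TZ.gn z) = gam z"
    using TZ.talg_lift[OF R.ring_axioms kap_hom bet_premap bet_kap gam_am gam_kap gam_smult, unfolded TZ_eq] by blast
  have z: "tens_ext R p \<zero>\<^bsub>XW.Z\<^esub> = \<zero>\<^bsub>R\<^esub>" "tens_ext R q \<zero>\<^bsub>WX.Z\<^esub> = \<zero>\<^bsub>R\<^esub>"
    using additive_map_zero[OF XW.Z_abelian Rab pe_am(1)] additive_map_zero[OF WX.Z_abelian Rab pe_am(2)] by auto
  show ?thesis
  proof (intro exI[of _ \<psi>] conjI ballI \<psi>(1))
    show "\<psi> (TZ_env D a b) = s a \<otimes>\<^bsub>R\<^esub> t b" if "a \<in> carrier (alg D)" "b \<in> carrier (alg D)" for a b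
      using that by (simp add: TZ_env_eq \<psi> tt_closed bet_tt)
    fix x w assume "x \<in> carrier (vect D)" "w \<in> carrier (form D)"
    then show "\<psi> (TZ_xw D x w) = p x w" "\<psi> (TZ_wx D w x) = q w x"
      by (simp_all add: TZ_xw_eq TZ_wx_eq \<psi> ZZ_mem gam_def pe_tz z)
  qed
qed

lemma HO_lift: "\<exists>\<psi>. khom (base D) (HO D) R kap \<psi> \<and>
    (\<forall>a\<in>carrier (alg D). \<forall>b\<in>carrier (alg D). \<psi> (cls (TZ D) (HO_rels D) (TZ_env D a b)) = s a \<otimes>\<^bsub>R\<^esub> t b) \<and>
    (\<forall>x\<in>carrier (vect D). \<forall>w\<in>carrier (form D). \<psi> (cls (TZ D) (HO_rels D) (TZ_xw D x w)) = p x w \<and>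
       \<psi> (cls (TZ D) (HO_rels D) (TZ_wx D w x)) = q w x)"
proof -
  obtain \<psi> where \<psi>: "khom (base D) (TZ D) R kap \<psi>"
    "\<And>a b. \<lbrakk>a \<in> carrier (alg D); b \<in> carrier (alg D)\<rbrakk> \<Longrightarrow> \<psi> (TZ_env D a b) = s a \<otimes>\<^bsub>R\<^esub> t b"
    "\<And>x w. \<lbrakk>x \<in> carrier (vect D); w \<in> carrier (form D)\<rbrakk> \<Longrightarrow> \<psi> (TZ_xw D x w) = p x w"
    "\<And>x w. \<lbrakk>x \<in> carrier (vect D); w \<in> carrier (form D)\<rbrakk> \<Longrightarrow> \<psi> (TZ_wx D w x) = q w x"
    using TZ_lift by blast
  have hom: "\<psi> \<in> ring_hom (TZ D) R" using \<psi>(1) by (simp add: khom_def)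
  have Tr: "ring (TZ D)" using kalg_TZ by (simp add: kalg_def)
  then interpret T: ring "TZ D" .
  have am: "additive_map (TZ D) R \<psi>" using hom by (auto simp: additive_map_def ring_hom_def)
  note fin = additive_map_finsum[OF T.abelian_group_axioms Rab am finite_lessThan]
  note diff = additive_map_diff[OF T.abelian_group_axioms Rab am]
  note basis_closed [simp]
  note cl [simp] = TZ_xw_closed TZ_wx_closed TZ_env_closed ev_closed
  have sum: "\<psi> (\<Oplus>\<^bsub>TZ D\<^esub>i\<in>{..<n}. f i \<otimes>\<^bsub>TZ D\<^esub> g i) = (\<Oplus>\<^bsub>R\<^esub>i\<in>{..<n}. \<psi> (f i) \<otimes>\<^bsub>R\<^esub> \<psi> (g i))"
    if "\<And>i. i < n \<Longrightarrow> f i \<in> carrier (TZ D)" "\<And>i. i < n \<Longrightarrow> g i \<in> carrier (TZ D)" for f g and n :: nat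
    by (subst fin) (use that in \<open>auto intro!: finsum_cong_weak simp: ring_hom_mult[OF hom]\<close>)
  have kill0: "\<psi> ((\<Oplus>\<^bsub>TZ D\<^esub>i\<in>{..<n}. f i \<otimes>\<^bsub>TZ D\<^esub> g i) \<ominus>\<^bsub>TZ D\<^esub> e) = \<zero>\<^bsub>R\<^esub>"
    if "\<And>i. i < n \<Longrightarrow> f i \<in> carrier (TZ D)" "\<And>i. i < n \<Longrightarrow> g i \<in> carrier (TZ D)" "e \<in> carrier (TZ D)"
      "(\<Oplus>\<^bsub>R\<^esub>i\<in>{..<n}. \<psi> (f i) \<otimes>\<^bsub>R\<^esub> \<psi> (g i)) = \<psi> e" for f g e and n :: nat
  proof -
    have "(\<Oplus>\<^bsub>TZ D\<^esub>i\<in>{..<n}. f i \<otimes>\<^bsub>TZ D\<^esub> g i) \<in> carrier (TZ D)"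
      by (rule T.finsum_closed) (use that in auto)
    then show ?thesis
      using that ring_hom_closed[OF hom] by (subst diff) (simp_all add: sum a_minus_def R.r_neg)
  qed
  have cong: "(\<Oplus>\<^bsub>R\<^esub>i\<in>{..<n}. f i) = e" if "(\<Oplus>\<^bsub>R\<^esub>i\<in>{..<n}. g i) = e" "\<And>i. i < n \<Longrightarrow> f i = g i" for f g e and n :: nat
    using that(1) by (subst finsum_cong_weak[of _ _ g]) (use that in auto)
  \<comment> \<open>After pushing the homomorphism through the sum, the four families become
    \<open>ho1\<close> to \<open>ho4\<close>.\<close>
  have kill: "\<psi> r = \<zero>\<^bsub>R\<^esub>" if "r \<in> HO_rels D" for r
    using that unfolding HO_rels_def Let_def
    by (elim UnE CollectE exE conjE; simp only:)
      (rule kill0; (rule cong)?; (rule ho1 ho2 ho3 ho4)?; simp add: \<psi> ho1 ho2 ho3 ho4)+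
  obtain \<chi> where \<chi>: "khom (base D) (HO D) R kap \<chi>" "\<And>b. b \<in> carrier (TZ D) \<Longrightarrow> \<chi> (cls (TZ D) (HO_rels D) b) = \<psi> b"
    using khom_quot_lift[OF kalg_TZ HO_rels_carrier R.ring_axioms \<psi>(1) kill] unfolding HO_def by blast
  show ?thesis
    by (intro exI[of _ \<chi>] conjI ballI \<chi>(1)) (simp_all add: \<chi>(2) \<psi>)
qed

text \<open>The point to check is that the images of vector fields commute with those of scalars. By
  \<open>l_s\<close> the deviation is a value of ev on d(c 1), and d vanishes on scalars.\<close>

lemma TX_lift: "\<exists>\<psi>. khom (base D) (TX D) R kap \<psi> \<and> (\<forall>x\<in>carrier (vect D). \<psi> (TX.gn x) = l x)"
proof -
  have zero_d: "dd D (c \<odot>\<^bsub>alg D\<^esub> \<one>\<^bsub>alg D\<^esub>) = \<zero>\<^bsub>form D\<^esub>" if c: "c \<in> carrier (base D)" for c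
  proof -
    \<comment> \<open>The Leibniz rule for 1 = 1 1 gives d 1 = d 1 + d 1, hence d 1 = 0.\<close>
    have "dd D \<one>\<^bsub>alg D\<^esub> = dd D \<one>\<^bsub>alg D\<^esub> \<oplus>\<^bsub>form D\<^esub> dd D \<one>\<^bsub>alg D\<^esub>"
      using C.d_leibniz[of "\<one>\<^bsub>alg D\<^esub>" "\<one>\<^bsub>alg D\<^esub>"] d_closed by (simp add: C.rmod_one C.M.lmod_one)
    then have "dd D \<one>\<^bsub>alg D\<^esub> = \<zero>\<^bsub>form D\<^esub>"
      using d_closed[of "\<one>\<^bsub>alg D\<^esub>"] C.M.add.l_cancel_one' by fastforce
    moreover have "(c \<odot>\<^bsub>alg D\<^esub> \<one>\<^bsub>alg D\<^esub>) \<odot>\<^bsub>form D\<^esub> \<zero>\<^bsub>form D\<^esub> = \<zero>\<^bsub>form D\<^esub>"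
      by (rule additive_map_zero[OF C.M.abelian_group_axioms C.M.abelian_group_axioms])
         (rule additive_mapI, simp_all add: c C.M.lmod_closed C.M.lmod_r_distr)
    ultimately show ?thesis using C.d_scalar[of c "\<one>\<^bsub>alg D\<^esub>"] c by simp
  qed
  have ev0: "s (ev D (tenXW D x \<zero>\<^bsub>form D\<^esub>)) = \<zero>\<^bsub>R\<^esub>" if [simp]: "x \<in> carrier (vect D)" for x
  proof -
    have am: "additive_map (form D) (alg D) (de (dualD D) x)"
      using dual.bal_e[OF dual_D] by (simp add: balanced_def)
    then show ?thesis
      using additive_map_zero[OF C.M.abelian_group_axioms Rab additive_map_comp[OF am s_am]] by simp
  qed
  have lk: "l x \<otimes>\<^bsub>R\<^esub> kap c = kap c \<otimes>\<^bsub>R\<^esub> l x" if "c \<in> carrier (base D)" "x \<in> carrier (vect D)" for c x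
    using that by (simp add: kap_def l_s zero_d ev0 scal_vf s_l V.M.lmod_closed)
  have "\<exists>\<psi>. khom (base D) (TX D) R kap \<psi> \<and> (\<forall>c\<in>carrier (field_algebra (base D)). \<psi> (TX.bs c) = kap c) \<and>
      (\<forall>x\<in>carrier (scalars (alg D) (vect D)). \<psi> (TX.gn x) = l x)"
  proof (rule TX.talg_lift[OF R.ring_axioms kap_hom, unfolded TX_eq])
    show "premap (base D) (field_algebra (base D)) R kap kap"
      using kap_hom by (auto simp: premap_def ring_hom_def)
    show "kap c \<otimes>\<^bsub>R\<^esub> kap c' = kap c' \<otimes>\<^bsub>R\<^esub> kap c" if "c' \<in> carrier (base D)" "c \<in> carrier (field_algebra (base D))" for c c'
      using ring_hom_mult[OF kap_hom, symmetric] that by (simp add: C.K.m_comm)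
    show "additive_map (scalars (alg D) (vect D)) R l" using l_am by (simp add: additive_map_def)
  qed (simp_all add: lk, simp_all add: kap_def s_l)
  then show ?thesis by auto
qed

text \<open>The lifts from \<open>HO\<close> and \<open>TX\<close> are glued along the free product.
  The assumptions \<open>s_l\<close>, \<open>l_s\<close> and \<open>l_t\<close> say precisely that
  the result kills \<open>HX_rels\<close>.\<close>

theorem HX_lift: "\<exists>\<psi>. \<psi> \<in> ring_hom (HX D) R \<and>
    (\<forall>a\<in>carrier (alg D). \<forall>b\<in>carrier (alg D). \<psi> (HX_env D a b) = s a \<otimes>\<^bsub>R\<^esub> t b) \<and>
    (\<forall>x\<in>carrier (vect D). \<forall>w\<in>carrier (form D). \<psi> (HX_xw D x w) = p x w \<and> \<psi> (HX_wx D w x) = q w x) \<and>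
    (\<forall>x\<in>carrier (vect D). \<psi> (HX_x D x) = l x)"
proof -
  obtain \<psi>1 where 1: "khom (base D) (HO D) R kap \<psi>1"
    "\<And>a b. \<lbrakk>a \<in> carrier (alg D); b \<in> carrier (alg D)\<rbrakk> \<Longrightarrow> \<psi>1 (cls (TZ D) (HO_rels D) (TZ_env D a b)) = s a \<otimes>\<^bsub>R\<^esub> t b"
    "\<And>x w. \<lbrakk>x \<in> carrier (vect D); w \<in> carrier (form D)\<rbrakk> \<Longrightarrow> \<psi>1 (cls (TZ D) (HO_rels D) (TZ_xw D x w)) = p x w"
    "\<And>x w. \<lbrakk>x \<in> carrier (vect D); w \<in> carrier (form D)\<rbrakk> \<Longrightarrow> \<psi>1 (cls (TZ D) (HO_rels D) (TZ_wx D w x)) = q w x"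
    using HO_lift by blast
  obtain \<psi>2 where 2: "khom (base D) (TX D) R kap \<psi>2" "\<And>x. x \<in> carrier (vect D) \<Longrightarrow> \<psi>2 (TX.gn x) = l x"
    using TX_lift by blast
  obtain \<psi> where \<psi>: "khom (base D) (FP D) R kap \<psi>" "\<And>b. b \<in> carrier (HO D) \<Longrightarrow> \<psi> (FP.lf b) = \<psi>1 b"
      "\<And>b. b \<in> carrier (TX D) \<Longrightarrow> \<psi> (FP.rt b) = \<psi>2 b"
    using FP.fprod_lift[OF R.ring_axioms kap_hom 1(1) 2(1), unfolded FP_eq] by blast
  interpret T: kalg "base D" "TZ D" by (rule kalg_TZ)
  interpret HOq: quot_alg "TZ D" "HO_rels D" by unfold_locales (rule HO_rels_carrier)
  have HOc: "cls (TZ D) (HO_rels D) b \<in> carrier (HO D)" if "b \<in> carrier (TZ D)" for b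
    using ring_hom_closed[OF HOq.cls_hom that] by (simp add: HO_def)
  have g: "\<And>a b. \<lbrakk>a \<in> carrier (alg D); b \<in> carrier (alg D)\<rbrakk> \<Longrightarrow> \<psi> (FP_of_TZ D (TZ_env D a b)) = s a \<otimes>\<^bsub>R\<^esub> t b"
    "\<And>x w. \<lbrakk>x \<in> carrier (vect D); w \<in> carrier (form D)\<rbrakk> \<Longrightarrow> \<psi> (FP_of_TZ D (TZ_xw D x w)) = p x w"
    "\<And>x w. \<lbrakk>x \<in> carrier (vect D); w \<in> carrier (form D)\<rbrakk> \<Longrightarrow> \<psi> (FP_of_TZ D (TZ_wx D w x)) = q w x"
    "\<And>x. x \<in> carrier (vect D) \<Longrightarrow> \<psi> (FP_x D x) = l x"
    using TX.gen_closed
    by (simp_all add: FP_of_TZ_def FP_x_def \<psi> HOc 1 2 TZ_env_closed TZ_xw_closed TZ_wx_closed TX_eq)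
  have hom: "\<psi> \<in> ring_hom (FP D) R" using \<psi>(1) by (simp add: khom_def)
  interpret P: kalg "base D" "FP D" by (rule kalg_FP)
  have am: "additive_map (FP D) R \<psi>" using hom by (auto simp: additive_map_def ring_hom_def)
  note diff = additive_map_diff[OF P.abelian_group_axioms Rab am]
  note cl = FP_x_closed ring_hom_closed[OF FP_of_TZ_hom] TZ_env_closed TZ_xw_closed ev_closed d_closed V.M.lmod_closed V.rmod_closed
  have kill: "\<psi> r = \<zero>\<^bsub>R\<^esub>" if "r \<in> HX_rels D" for r
    using that unfolding HX_rels_def Let_def
    by (elim UnE CollectE exE conjE)
       (simp_all add: diff cl ring_hom_mult[OF hom] ring_hom_add[OF hom] g s_l l_s l_t, simp_all add: cl a_minus_def R.r_neg)
  obtain \<chi> where \<chi>: "khom (base D) (HX D) R kap \<chi>" "\<And>b. b \<in> carrier (FP D) \<Longrightarrow> \<chi> (cls (FP D) (HX_rels D) b) = \<psi> b"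
    using khom_quot_lift[OF kalg_FP HX_rels_carrier R.ring_axioms \<psi>(1) kill] unfolding HX_def by blast
  show ?thesis
    using \<chi>(1)
    by (intro exI[of _ \<chi>] conjI ballI)
      (simp_all add: khom_def HX_env_def HX_xw_def HX_wx_def HX_x_def \<chi>(2) g cl TZ_wx_closed)
qed

end

text \<open>Extensional functions, so that two endomorphisms are equal as soon as they agree on the
  carrier.\<close>

definition End_ring :: "('v, 'c) ring_scheme \<Rightarrow> ('v \<Rightarrow> 'v) ring" where
  "End_ring V = \<lparr>carrier = {f \<in> extensional (carrier V). additive_map V V f},
     mult = (\<lambda>f g. \<lambda>v\<in>carrier V. f (g v)), one = (\<lambda>v\<in>carrier V. v),
     zero = (\<lambda>v\<in>carrier V. \<zero>\<^bsub>V\<^esub>), add = (\<lambda>f g. \<lambda>v\<in>carrier V. f v \<oplus>\<^bsub>V\<^esub> g v)\<rparr>"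

lemma End_simps:
  "f \<in> carrier (End_ring V) \<longleftrightarrow> f \<in> extensional (carrier V) \<and> additive_map V V f"
  "f \<otimes>\<^bsub>End_ring V\<^esub> g = (\<lambda>v\<in>carrier V. f (g v))" "\<one>\<^bsub>End_ring V\<^esub> = (\<lambda>v\<in>carrier V. v)"
  "\<zero>\<^bsub>End_ring V\<^esub> = (\<lambda>v\<in>carrier V. \<zero>\<^bsub>V\<^esub>)" "f \<oplus>\<^bsub>End_ring V\<^esub> g = (\<lambda>v\<in>carrier V. f v \<oplus>\<^bsub>V\<^esub> g v)"
  by (simp_all add: End_ring_def)

lemma End_cl: "f \<in> carrier (End_ring V) \<Longrightarrow> v \<in> carrier V \<Longrightarrow> f v \<in> carrier V"
  by (auto simp: End_simps additive_map_def)

lemma End_eqI: "\<lbrakk>f \<in> carrier (End_ring V); g \<in> carrier (End_ring V); \<And>v. v \<in> carrier V \<Longrightarrow> f v = g v\<rbrakk> \<Longrightarrow> f = g"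
  unfolding End_simps by (blast intro: extensionalityI)

lemma End_restrict: "additive_map V V h \<Longrightarrow> abelian_group V \<Longrightarrow> restrict h (carrier V) \<in> carrier (End_ring V)"
proof -
  assume "additive_map V V h" "abelian_group V"
  then interpret abelian_group V by simp
  show ?thesis using \<open>additive_map V V h\<close> by (auto simp: End_simps additive_map_def)
qed

lemma ring_End:
  assumes "abelian_group V"
  shows "ring (End_ring V)"
proof -
  interpret V: abelian_group V by fact
  note ams = additive_map_closed additive_map_add
  have add: "f \<oplus>\<^bsub>End_ring V\<^esub> g \<in> carrier (End_ring V)" if "f \<in> carrier (End_ring V)" "g \<in> carrier (End_ring V)" for f g
    unfolding End_simps(5) by (rule End_restrict) (use that assms in \<open>auto simp: End_simps intro: additive_map_sub\<close>)
  have mult: "f \<otimes>\<^bsub>End_ring V\<^esub> g \<in> carrier (End_ring V)" if "f \<in> carrier (End_ring V)" "g \<in> carrier (End_ring V)" for f g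
    unfolding End_simps(2) by (rule End_restrict) (use that assms in \<open>auto simp: End_simps intro: additive_map_comp\<close>)
  have one: "\<one>\<^bsub>End_ring V\<^esub> \<in> carrier (End_ring V)"
    unfolding End_simps(3) by (rule End_restrict) (use assms in \<open>auto intro: additive_mapI\<close>)
  have ab: "abelian_group (End_ring V)"
  proof (rule hom_group[OF assms])
    show "\<zero>\<^bsub>End_ring V\<^esub> \<in> carrier (End_ring V)"
      unfolding End_simps(4) by (rule End_restrict) (use assms in \<open>auto intro: additive_mapI\<close>)
    show "(\<lambda>m\<in>carrier V. \<ominus>\<^bsub>V\<^esub> f m) \<in> carrier (End_ring V)" if "f \<in> carrier (End_ring V)" for f
      by (rule End_restrict) (use that assms in \<open>auto intro!: additive_mapI simp: ams End_simps V.minus_add\<close>)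
  qed (auto simp: add End_cl, simp_all add: End_simps)
  show ?thesis
  proof (rule ringI[OF ab])
    show "monoid (End_ring V)"
      by (rule monoidI; (rule End_eqI[of _ V])?; (simp add: mult one)?; (simp add: End_simps(2,3) End_cl)?)
  next
    fix f g h assume c: "f \<in> carrier (End_ring V)" "g \<in> carrier (End_ring V)" "h \<in> carrier (End_ring V)"
    show "(f \<oplus>\<^bsub>End_ring V\<^esub> g) \<otimes>\<^bsub>End_ring V\<^esub> h = f \<otimes>\<^bsub>End_ring V\<^esub> h \<oplus>\<^bsub>End_ring V\<^esub> g \<otimes>\<^bsub>End_ring V\<^esub> h"
      by (rule End_eqI[of _ V]) (use c in \<open>simp_all add: add mult\<close>, use c in \<open>simp add: End_simps(2,5) End_cl\<close>)
    show "h \<otimes>\<^bsub>End_ring V\<^esub> (f \<oplus>\<^bsub>End_ring V\<^esub> g) = h \<otimes>\<^bsub>End_ring V\<^esub> f \<oplus>\<^bsub>End_ring V\<^esub> h \<otimes>\<^bsub>End_ring V\<^esub> g"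
      by (rule End_eqI[of _ V]) (use c in \<open>simp_all add: add mult\<close>, use c in \<open>simp add: End_simps additive_map_closed[of V V] additive_map_add[of V V]\<close>)
  qed
qed

section \<open>From representations to modules\<close>

context pivotal_calculus
begin

text \<open>The operators are restricted in order to be extensional; an identity in
  \<open>End_ring\<close> is then a law of the representation at every vector.\<close>

lemma xrep_target:
  assumes X: "xrep (dualD D) V (dd D) L"
  shows "hx_target D (End_ring V) (\<lambda>a. restrict (sl V a) (carrier V)) (\<lambda>a. restrict (tr V a) (carrier V))
     (\<lambda>x w. restrict (PP V x w) (carrier V)) (\<lambda>w x. restrict (QQ V w x) (carrier V)) (\<lambda>x. restrict (L x) (carrier V))"
proof -
  interpret X: xrep "dualD D" V "dd D" L by fact
  note ab = X.P.V.abelian_group_axioms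
  interpret R: ring "End_ring V" by (rule ring_End[OF ab])
  have E: "restrict (sl V a) (carrier V) \<in> carrier (End_ring V)" "restrict (tr V a) (carrier V) \<in> carrier (End_ring V)"
    if "a \<in> carrier (alg D)" for a using that by (auto intro!: End_restrict ab X.sl_am X.tr_am)
  have E': "restrict (PP V x w) (carrier V) \<in> carrier (End_ring V)" "restrict (QQ V w x) (carrier V) \<in> carrier (End_ring V)"
    "restrict (L x) (carrier V) \<in> carrier (End_ring V)"
    if "x \<in> carrier (vect D)" "w \<in> carrier (form D)" for x w using that by (auto intro!: End_restrict ab X.P_am X.Q_am X.L_am)
  have E'': "restrict (L x) (carrier V) \<in> carrier (End_ring V)"
    if "x \<in> carrier (vect D)" for x using that by (auto intro!: End_restrict ab X.L_am)
  note cl = E E' E'' R.m_closed R.a_closed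
  note ext = End_eqI[of _ V]
  note ops = End_simps(2-5)
  have eval: "finsum (End_ring V) f I v = finsum V (\<lambda>i. f i v) I"
    if "finite I" "\<And>i. i \<in> I \<Longrightarrow> f i \<in> carrier (End_ring V)" "v \<in> carrier V" for f v and I :: "nat set"
  proof (rule additive_map_finsum[OF R.abelian_group_axioms ab _ that(1)])
    show "additive_map (End_ring V) V (\<lambda>f. f v)"
      by (rule additive_mapI) (use that(3) in \<open>simp_all add: End_cl, simp add: End_simps\<close>)
  qed (use that in auto)
  note basis_closed [simp]
  note [simp] = ev_closed d_closed C.M.lmod_closed C.rmod_closed V.M.lmod_closed V.rmod_closed
  \<comment> \<open>Shared by the four relations: a sum in \<open>End_ring\<close>, evaluated at v,
    is the sum over a dual basis in \<open>V\<close>.\<close>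
  have sum: "(\<Oplus>\<^bsub>End_ring V\<^esub>i\<in>{..<n}. restrict (F i) (carrier V) \<otimes>\<^bsub>End_ring V\<^esub> restrict (G i) (carrier V)) = restrict H (carrier V)"
    if "\<And>i. i < n \<Longrightarrow> restrict (F i) (carrier V) \<in> carrier (End_ring V)" "\<And>i. i < n \<Longrightarrow> restrict (G i) (carrier V) \<in> carrier (End_ring V)"
      "restrict H (carrier V) \<in> carrier (End_ring V)"
      "\<And>v. v \<in> carrier V \<Longrightarrow> (\<Oplus>\<^bsub>V\<^esub>i\<in>{..<n}. F i (G i v)) = H v" for F G H and n :: nat
  proof (rule ext)
    show "(\<Oplus>\<^bsub>End_ring V\<^esub>i\<in>{..<n}. restrict (F i) (carrier V) \<otimes>\<^bsub>End_ring V\<^esub> restrict (G i) (carrier V)) \<in> carrier (End_ring V)"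
      by (rule R.finsum_closed) (use that in auto)
    fix v assume v: "v \<in> carrier V"
    have *: "restrict (F i) (carrier V) \<otimes>\<^bsub>End_ring V\<^esub> restrict (G i) (carrier V) \<in> carrier (End_ring V)" if "i \<in> {..<n}" for i
      using that \<open>\<And>i. i < n \<Longrightarrow> restrict (F i) (carrier V) \<in> carrier (End_ring V)\<close> \<open>\<And>i. i < n \<Longrightarrow> restrict (G i) (carrier V) \<in> carrier (End_ring V)\<close> by simp
    have "(\<Oplus>\<^bsub>End_ring V\<^esub>i\<in>{..<n}. restrict (F i) (carrier V) \<otimes>\<^bsub>End_ring V\<^esub> restrict (G i) (carrier V)) v
        = (\<Oplus>\<^bsub>V\<^esub>i\<in>{..<n}. (restrict (F i) (carrier V) \<otimes>\<^bsub>End_ring V\<^esub> restrict (G i) (carrier V)) v)"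
      by (rule eval[OF _ * v]) simp_all
    also have "\<dots> = (\<Oplus>\<^bsub>V\<^esub>i\<in>{..<n}. F i (G i v))"
    proof (rule finsum_cong_weak)
      fix i assume "i \<in> {..<n}"
      then have "G i v \<in> carrier V" using End_cl[OF that(2) v, of i] v by simp
      then show "(restrict (F i) (carrier V) \<otimes>\<^bsub>End_ring V\<^esub> restrict (G i) (carrier V)) v = F i (G i v)"
        using v by (simp add: ops)
    qed
    also have "\<dots> = restrict H (carrier V) v" using that(4)[OF v] v by simp
    finally show "(\<Oplus>\<^bsub>End_ring V\<^esub>i\<in>{..<n}. restrict (F i) (carrier V) \<otimes>\<^bsub>End_ring V\<^esub> restrict (G i) (carrier V)) v = restrict H (carrier V) v" .
  qed (use that in simp)
  note rules [simp] = X.P.sl_addA X.P.sl_one X.P.sl_mult X.P.tr_addA X.P.tr_one X.P.tr_mult X.P.tr_sl X.P.P_addX X.P.P_addW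
    X.P.P_l X.P.P_r X.P.P_l' X.P.P_r' X.Q_addX X.Q_addW X.Q_l X.Q_r X.Q_l' X.Q_r' X.L_addX X.L_l X.L_sl X.L_tr
  note [simp] = rules[unfolded dualD_simps]
  show ?thesis
  proof (intro hx_target.intro hx_target_axioms.intro pivotal_calculus_axioms R.ring_axioms)
    fix x w assume x: "x \<in> carrier (vect D)" "w \<in> carrier (form D)"
    show "(\<Oplus>\<^bsub>End_ring V\<^esub>i\<in>{..<nI D}. restrict (QQ V (om D i) x) (carrier V) \<otimes>\<^bsub>End_ring V\<^esub> restrict (PP V (xb D i) w) (carrier V))
        = restrict (tr V (evu D (tenWX D w x))) (carrier V)"
      by (rule sum) (use x X.R.H1[of x w] in \<open>simp_all add: cl SI_def\<close>)
    show "(\<Oplus>\<^bsub>End_ring V\<^esub>j\<in>{..<nJ D}. restrict (PP V x (rb D j)) (carrier V) \<otimes>\<^bsub>End_ring V\<^esub> restrict (QQ V w (yb D j)) (carrier V))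
        = restrict (sl V (ev D (tenXW D x w))) (carrier V)"
      by (rule sum) (use x X.R.H2[of x w] in \<open>simp_all add: cl SJ_def\<close>)
    show "(\<Oplus>\<^bsub>End_ring V\<^esub>j\<in>{..<nJ D}. restrict (PP V (yb D j) w) (carrier V) \<otimes>\<^bsub>End_ring V\<^esub> restrict (QQ V (rb D j) x) (carrier V))
        = restrict (tr V (ev D (tenXW D x w))) (carrier V)"
      by (rule sum) (use x X.H3[of w x] in \<open>simp_all add: cl SJ_def\<close>)
    show "(\<Oplus>\<^bsub>End_ring V\<^esub>i\<in>{..<nI D}. restrict (QQ V w (xb D i)) (carrier V) \<otimes>\<^bsub>End_ring V\<^esub> restrict (PP V x (om D i)) (carrier V))
        = restrict (sl V (evu D (tenWX D w x))) (carrier V)"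
      by (rule sum) (use x X.H4[of w x] in \<open>simp_all add: cl SI_def\<close>)
  next
    fix c assume "c \<in> carrier (base D)"
    then show "restrict (tr V (c \<odot>\<^bsub>alg D\<^esub> \<one>\<^bsub>alg D\<^esub>)) (carrier V) = restrict (sl V (c \<odot>\<^bsub>alg D\<^esub> \<one>\<^bsub>alg D\<^esub>)) (carrier V)"
      using X.P.V_scal[of c] by (intro restrict_ext) simp
  qed (auto intro!: additive_mapI ext simp: cl, auto simp: ops)
qed

text \<open>Stated for every record with the given group and action, so that it can be applied to
  \<open>with_action\<close> of any bimodule with the same additive group.\<close>

theorem xrep_module:
  assumes X: "xrep (dualD D) V (dd D) L"
  shows "\<exists>act. act \<in> carrier (HX D) \<rightarrow>\<^sub>E carrier V \<rightarrow>\<^sub>E carrier V \<and>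
    (\<forall>U :: (('k, 'a, 'w, 'x) hx, 'v) module. carrier U = carrier V \<longrightarrow> add U = add V \<longrightarrow> zero U = zero V \<longrightarrow> smult U = act \<longrightarrow> left_module (HX D) U) \<and>
    (\<forall>v\<in>carrier V. (\<forall>a\<in>carrier (alg D). \<forall>b\<in>carrier (alg D). act (HX_env D a b) v = sl V a (tr V b v)) \<and>
      (\<forall>x\<in>carrier (vect D). \<forall>w\<in>carrier (form D). act (HX_xw D x w) v = PP V x w v \<and> act (HX_wx D w x) v = QQ V w x v) \<and>
      (\<forall>x\<in>carrier (vect D). act (HX_x D x) v = L x v))"
proof -
  interpret X: xrep "dualD D" V "dd D" L by fact
  note ab = X.P.V.abelian_group_axioms
  interpret H: ring "HX D" by (rule ring_HX)
  obtain \<psi> where hom: "\<psi> \<in> ring_hom (HX D) (End_ring V)"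
    and \<psi>: "\<And>a b. \<lbrakk>a \<in> carrier (alg D); b \<in> carrier (alg D)\<rbrakk> \<Longrightarrow> \<psi> (HX_env D a b) = restrict (sl V a) (carrier V) \<otimes>\<^bsub>End_ring V\<^esub> restrict (tr V b) (carrier V)"
    "\<And>x w. \<lbrakk>x \<in> carrier (vect D); w \<in> carrier (form D)\<rbrakk> \<Longrightarrow> \<psi> (HX_xw D x w) = restrict (PP V x w) (carrier V)"
    "\<And>x w. \<lbrakk>x \<in> carrier (vect D); w \<in> carrier (form D)\<rbrakk> \<Longrightarrow> \<psi> (HX_wx D w x) = restrict (QQ V w x) (carrier V)"
    "\<And>x. x \<in> carrier (vect D) \<Longrightarrow> \<psi> (HX_x D x) = restrict (L x) (carrier V)"
    using hx_target.HX_lift[OF xrep_target[OF X]] by blast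
  let ?act = "restrict \<psi> (carrier (HX D))"
  have cl: "\<psi> b \<in> carrier (End_ring V)" if "b \<in> carrier (HX D)" for b using ring_hom_closed[OF hom that] .
  show ?thesis
  proof (intro exI[of _ ?act] conjI allI impI ballI)
    show "?act \<in> carrier (HX D) \<rightarrow>\<^sub>E carrier V \<rightarrow>\<^sub>E carrier V"
      using cl by (auto simp: End_simps additive_map_def PiE_iff)
    fix U :: "(('k, 'a, 'w, 'x) hx, 'v) module"
    assume U [simp]: "carrier U = carrier V" "add U = add V" "zero U = zero V" "smult U = ?act"
    have "abelian_group U" by (rule abelian_group_cong[OF ab]) simp_all
    then show "left_module (HX D) U"
      by (intro left_module.intro left_module_axioms.intro ring_HX)
        (auto simp: End_cl[OF cl] ring_hom_mult[OF hom] ring_hom_add[OF hom] ring_hom_one[OF hom],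
         simp_all add: End_simps(2-5) additive_map_add[OF cl[unfolded End_simps, THEN conjunct2]])
  qed (simp_all add: \<psi> HX_env_closed HX_xw_closed HX_wx_closed HX_x_closed End_simps(2))
qed

end

section \<open>Actions on inner homs\<close>

text \<open>The module \<open>U\<close> is the representation \<open>(V, L)\<close>; the operators of \<open>V\<close> need not agree with those of
  \<open>U\<close> outside the carrier.\<close>

definition realizes ::
    "('k, 'a, 'w, 'x) calculus \<Rightarrow> (('k, 'a, 'w, 'x) hx, 'v) module \<Rightarrow> ('a, 'w, 'x, 'v) rep \<Rightarrow> ('x \<Rightarrow> 'v \<Rightarrow> 'v) \<Rightarrow> bool" where
  "realizes D U V L \<longleftrightarrow> left_module (HX D) U \<and> carrier U = carrier V \<and> zero U = zero V \<and> add U = add V \<and>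
    (\<forall>u\<in>carrier V.
      (\<forall>a\<in>carrier (alg D). HX_env D a \<one>\<^bsub>alg D\<^esub> \<odot>\<^bsub>U\<^esub> u = sl V a u \<and> HX_env D \<one>\<^bsub>alg D\<^esub> a \<odot>\<^bsub>U\<^esub> u = tr V a u) \<and>
      (\<forall>x\<in>carrier (vect D). \<forall>w\<in>carrier (form D). HX_xw D x w \<odot>\<^bsub>U\<^esub> u = PP V x w u \<and> HX_wx D w x \<odot>\<^bsub>U\<^esub> u = QQ V w x u) \<and>
      (\<forall>x\<in>carrier (vect D). HX_x D x \<odot>\<^bsub>U\<^esub> u = L x u))"

lemma realizesD:
  assumes "realizes D U V L"
  shows "left_module (HX D) U" "carrier U = carrier V" "zero U = zero V" "add U = add V"
    "\<And>a u. \<lbrakk>a \<in> carrier (alg D); u \<in> carrier V\<rbrakk> \<Longrightarrow> HX_env D a \<one>\<^bsub>alg D\<^esub> \<odot>\<^bsub>U\<^esub> u = sl V a u"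
    "\<And>a u. \<lbrakk>a \<in> carrier (alg D); u \<in> carrier V\<rbrakk> \<Longrightarrow> HX_env D \<one>\<^bsub>alg D\<^esub> a \<odot>\<^bsub>U\<^esub> u = tr V a u"
    "\<And>x w u. \<lbrakk>x \<in> carrier (vect D); w \<in> carrier (form D); u \<in> carrier V\<rbrakk> \<Longrightarrow> HX_xw D x w \<odot>\<^bsub>U\<^esub> u = PP V x w u"
    "\<And>x w u. \<lbrakk>x \<in> carrier (vect D); w \<in> carrier (form D); u \<in> carrier V\<rbrakk> \<Longrightarrow> HX_wx D w x \<odot>\<^bsub>U\<^esub> u = QQ V w x u"
    "\<And>x u. \<lbrakk>x \<in> carrier (vect D); u \<in> carrier V\<rbrakk> \<Longrightarrow> HX_x D x \<odot>\<^bsub>U\<^esub> u = L x u"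
  using assms by (simp_all add: realizes_def)

lemma realizes_self: "left_module (HX D) M \<Longrightarrow> realizes D M (rep_of D M) (lie D M)"
  by (simp add: realizes_def)

lemma minus_ring_cong:
  assumes "carrier G = carrier G'" "add G = add G'" "zero G = zero G'"
  shows "u \<ominus>\<^bsub>G\<^esub> v = u \<ominus>\<^bsub>G'\<^esub> v"
  using assms by (simp add: a_minus_def a_inv_def m_inv_def)

lemma with_action_simps [simp]:
  "carrier (with_action F act) = carrier F" "add (with_action F act) = add F" "zero (with_action F act) = zero F"
  "smult (with_action F act) = act"
  by (simp_all add: with_action_def)

section \<open>Modules that realize a given representation\<close>

context pivotal_calculus
begin

lemma realizes_hom_eq:
  assumes U: "realizes D U V L" and U': "realizes D U' V' L'" and F: "rep_hom (dualD D) V L V' L' F"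
    and "b \<in> carrier (HX D)" "u \<in> carrier V"
  shows "F (b \<odot>\<^bsub>U\<^esub> u) = b \<odot>\<^bsub>U'\<^esub> F u"
proof -
  note D = realizesD[OF U] realizesD[OF U']
  have am: "additive_map U U' F" using F by (simp add: rep_hom_def additive_map_def D)
  have cl: "F u \<in> carrier V'" if "u \<in> carrier V" for u using F that by (auto simp: rep_hom_def additive_map_def)
  show ?thesis
    by (rule intertwine[OF D(1) _ am]) (use assms(4,5) F in \<open>simp_all add: D cl rep_hom_def\<close>)
qed

lemma realizes_left_module_hom:
  assumes U: "realizes D U V L" and U': "realizes D U' V' L'" and F: "rep_hom (dualD D) V L V' L' F"
  shows "left_module_hom (HX D) U U' F"
  using realizes_hom_eq[OF assms] F
  by (simp add: left_module_hom_def left_map_def realizesD[OF U] realizesD[OF U'] rep_hom_def additive_map_def)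

text \<open>On the carrier the operators of \<open>U\<close> are those of \<open>V\<close>, but
  elsewhere \<open>rep_of D U\<close> and \<open>V\<close> may differ. The identity mediates between
  the two.\<close>

lemma realizes_id:
  assumes "realizes D U V L"
  shows "rep_hom (dualD D) (rep_of D U) (lie D U) V L (\<lambda>u. u)"
  using realizesD[OF assms] by (simp add: rep_hom_def additive_map_def)

lemma xrep_realizes:
  assumes "xrep (dualD D) V (dd D) L"
  shows "\<exists>act. act \<in> carrier (HX D) \<rightarrow>\<^sub>E carrier V \<rightarrow>\<^sub>E carrier V \<and>
    (\<forall>U. carrier U = carrier V \<longrightarrow> zero U = zero V \<longrightarrow> add U = add V \<longrightarrow> smult U = act \<longrightarrow> realizes D U V L) \<and>
    (\<forall>a\<in>carrier (alg D). \<forall>b\<in>carrier (alg D). \<forall>v\<in>carrier V. act (HX_env D a b) v = sl V a (tr V b v))"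
proof -
  interpret xrep "dualD D" V "dd D" L by fact
  note s = P.sl_one P.tr_one P.tr_cl
  note s' = s[unfolded dualD_simps]
  obtain act where "act \<in> carrier (HX D) \<rightarrow>\<^sub>E carrier V \<rightarrow>\<^sub>E carrier V"
    "\<And>U :: (('k, 'a, 'w, 'x) hx, _) module. carrier U = carrier V \<Longrightarrow> add U = add V \<Longrightarrow> zero U = zero V \<Longrightarrow> smult U = act \<Longrightarrow> left_module (HX D) U"
    "\<And>v. v \<in> carrier V \<Longrightarrow> (\<forall>a\<in>carrier (alg D). \<forall>b\<in>carrier (alg D). act (HX_env D a b) v = sl V a (tr V b v)) \<and>
      (\<forall>x\<in>carrier (vect D). \<forall>w\<in>carrier (form D). act (HX_xw D x w) v = PP V x w v \<and> act (HX_wx D w x) v = QQ V w x v) \<and>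
      (\<forall>x\<in>carrier (vect D). act (HX_x D x) v = L x v)"
    using xrep_module[OF assms] by blast
  then show ?thesis
    by (intro exI[of _ act]) (simp add: realizes_def s')
qed

text \<open>The identity is an endomorphism of the representation, so by
  \<open>realizes_hom_eq\<close> the two actions agree on carriers; extensionality in both arguments
  does the rest.\<close>

lemma action_unique:
  assumes "act \<in> carrier (HX D) \<rightarrow>\<^sub>E carrier F \<rightarrow>\<^sub>E carrier F" "act' \<in> carrier (HX D) \<rightarrow>\<^sub>E carrier F \<rightarrow>\<^sub>E carrier F"
    and "realizes D (with_action F act) V L" "realizes D (with_action F act') V L"
  shows "act = act'"
proof -
  note D = realizesD(2-4)[OF assms(3)]
  have "rep_hom (dualD D) V L V L (\<lambda>v. v)" by (simp add: rep_hom_def additive_map_def)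
  from realizes_hom_eq[OF assms(3,4) this]
  have eq: "act b u = act' b u" if "b \<in> carrier (HX D)" "u \<in> carrier F" for b u
    using that D by simp
  show ?thesis
  proof (rule PiE_ext[OF assms(1,2)])
    fix b assume b: "b \<in> carrier (HX D)"
    show "act b = act' b"
      by (rule PiE_ext[OF PiE_mem[OF assms(1) b] PiE_mem[OF assms(2) b] eq[OF b]])
  qed
qed

text \<open>\<open>N\<close> is not tied to \<open>rep_of D N\<close>, because for the units it is a
  tensor product, to be described by \<open>tens_rep\<close> and \<open>tensL\<close>.\<close>

context
  fixes M :: "(('k, 'a, 'w, 'x) hx, 'm) module" and N :: "(('k, 'a, 'w, 'x) hx, 'n) module"
    and V :: "('a, 'w, 'x, 'n) rep" and L :: "'x \<Rightarrow> 'n \<Rightarrow> 'n"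
  assumes M: "left_module (HX D) M" and N: "realizes D N V L" and X: "xrep (dualD D) V (dd D) L"
begin

interpretation M: left_module "HX D" M by (rule M)
interpretation N: left_module "HX D" N by (rule realizesD(1)[OF N])
interpretation MX: xrep "dualD D" "rep_of D M" "dd D" "lie D M" by (rule module_xrep[OF M])
interpretation NX: xrep "dualD D" V "dd D" L by (rule X)
interpretation S: xreps2 "dualD D" "dd D" "rep_of D M" "lie D M" V L ..

lemma carrier_right_homs: "carrier (right_homs D M N) = carrier S.RH"
  "zero (right_homs D M N) = zero S.RH" "add (right_homs D M N) = add S.RH"
proof -
  note D = realizesD[OF N]
  have "right_map (alg D) (underlying D M) (underlying D N) f = right_map (alg D) (underlying D M) (bim V) f" for f
    using D by (auto simp: right_map_def additive_map_def underlying_def Pi_iff)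
  then show "carrier (right_homs D M N) = carrier S.RH"
    by (simp add: rhom_rep_def Let_def right_inner_hom_def)
  show "zero (right_homs D M N) = zero S.RH" "add (right_homs D M N) = add S.RH"
    using D by (simp_all add: rhom_rep_def Let_def right_inner_hom_def underlying_def)
qed

lemma carrier_left_homs: "carrier (left_homs D M N) = carrier S.LH"
  "zero (left_homs D M N) = zero S.LH" "add (left_homs D M N) = add S.LH"
proof -
  note D = realizesD[OF N]
  have "left_map (alg D) (underlying D M) (underlying D N) f = left_map (alg D) (underlying D M) (bim V) f" for f
    using D by (auto simp: left_map_def additive_map_def underlying_def Pi_iff)
  then show "carrier (left_homs D M N) = carrier S.LH"
    by (simp add: lhom_rep_def Let_def left_inner_hom_def)
  show "zero (left_homs D M N) = zero S.LH" "add (left_homs D M N) = add S.LH"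
    using D by (simp_all add: lhom_rep_def Let_def left_inner_hom_def underlying_def)
qed

text \<open>The left sides are the expressions of the theorem, the right sides the operators of the
  hom representation. They match once products in \<open>HX\<close> are read as successive actions
  and sums in \<open>N\<close> as sums in \<open>V\<close>.\<close>

lemma right_formulas:
  assumes f: "f \<in> carrier S.RH" and m: "m \<in> carrier M"
  shows "a \<in> carrier (alg D) \<Longrightarrow> b \<in> carrier (alg D) \<Longrightarrow>
      HX_env D a \<one>\<^bsub>alg D\<^esub> \<odot>\<^bsub>N\<^esub> f (HX_env D b \<one>\<^bsub>alg D\<^esub> \<odot>\<^bsub>M\<^esub> m) = sl S.RH a (tr S.RH b f) m"
    "x \<in> carrier (vect D) \<Longrightarrow> w \<in> carrier (form D) \<Longrightarrow>
      (\<Oplus>\<^bsub>N\<^esub>j\<in>{..<nJ D}. HX_xw D x (rb D j) \<odot>\<^bsub>N\<^esub> f (HX_wx D w (yb D j) \<odot>\<^bsub>M\<^esub> m)) = PP S.RH x w f m"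
    "x \<in> carrier (vect D) \<Longrightarrow> w \<in> carrier (form D) \<Longrightarrow>
      (\<Oplus>\<^bsub>N\<^esub>i\<in>{..<nI D}. HX_wx D w (xb D i) \<odot>\<^bsub>N\<^esub> f (HX_xw D x (om D i) \<odot>\<^bsub>M\<^esub> m)) = QQ S.RH w x f m"
    "x \<in> carrier (vect D) \<Longrightarrow> HX_x D x \<odot>\<^bsub>N\<^esub> f m \<ominus>\<^bsub>N\<^esub>
          (\<Oplus>\<^bsub>N\<^esub>j\<in>{..<nJ D}. \<Oplus>\<^bsub>N\<^esub>i\<in>{..<nI D}. HX_xw D x (rb D j) \<odot>\<^bsub>N\<^esub>
             f ((HX_wx D (om D i) (yb D j) \<otimes>\<^bsub>HX D\<^esub> HX_x D (xb D i)) \<odot>\<^bsub>M\<^esub> m)) = S.LR x f m"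
proof -
  note D = realizesD[OF N]
  note cl = S.RH_cl[OF f, simplified] M.lmod_closed HX_xw_closed HX_wx_closed HX_x_closed HX_env_closed basis_closed m
  have sum: "(\<Oplus>\<^bsub>N\<^esub>i\<in>{..<n}. F i) = (\<Oplus>\<^bsub>V\<^esub>i\<in>{..<n}. G i)" if "\<And>i. i < n \<Longrightarrow> F i = G i" for F G and n :: nat
    using that by (subst finsum_cong_weak[of _ F G]) (auto simp: finsum_cong_group[OF D(2,4,3)])
  note minus = minus_ring_cong[OF D(2,4,3)]
  show "HX_env D a \<one>\<^bsub>alg D\<^esub> \<odot>\<^bsub>N\<^esub> f (HX_env D b \<one>\<^bsub>alg D\<^esub> \<odot>\<^bsub>M\<^esub> m) = sl S.RH a (tr S.RH b f) m"
    if "a \<in> carrier (alg D)" "b \<in> carrier (alg D)" using that by (simp add: S.RH_ops cl D)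
  show "(\<Oplus>\<^bsub>N\<^esub>j\<in>{..<nJ D}. HX_xw D x (rb D j) \<odot>\<^bsub>N\<^esub> f (HX_wx D w (yb D j) \<odot>\<^bsub>M\<^esub> m)) = PP S.RH x w f m"
    if "x \<in> carrier (vect D)" "w \<in> carrier (form D)" using that
    by (simp add: S.RH_ops m SJ_def, intro sum) (simp add: cl D)
  show "(\<Oplus>\<^bsub>N\<^esub>i\<in>{..<nI D}. HX_wx D w (xb D i) \<odot>\<^bsub>N\<^esub> f (HX_xw D x (om D i) \<odot>\<^bsub>M\<^esub> m)) = QQ S.RH w x f m"
    if "x \<in> carrier (vect D)" "w \<in> carrier (form D)" using that
    by (simp add: S.RH_ops m SI_def, intro sum) (simp add: cl D)
  show "HX_x D x \<odot>\<^bsub>N\<^esub> f m \<ominus>\<^bsub>N\<^esub>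
          (\<Oplus>\<^bsub>N\<^esub>j\<in>{..<nJ D}. \<Oplus>\<^bsub>N\<^esub>i\<in>{..<nI D}. HX_xw D x (rb D j) \<odot>\<^bsub>N\<^esub>
             f ((HX_wx D (om D i) (yb D j) \<otimes>\<^bsub>HX D\<^esub> HX_x D (xb D i)) \<odot>\<^bsub>M\<^esub> m)) = S.LR x f m"
    if "x \<in> carrier (vect D)" using that
    by (simp add: S.LR_app m minus cl D SI_def SJ_def, intro arg_cong2[of _ _ _ _ "\<lambda>u v. u \<ominus>\<^bsub>V\<^esub> v"] refl sum)
       (simp add: cl D M.lmod_assoc)
qed

lemma left_formulas:
  assumes g: "g \<in> carrier S.LH" and m: "m \<in> carrier M"
  shows "a \<in> carrier (alg D) \<Longrightarrow> b \<in> carrier (alg D) \<Longrightarrow>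
      HX_env D \<one>\<^bsub>alg D\<^esub> b \<odot>\<^bsub>N\<^esub> g (HX_env D \<one>\<^bsub>alg D\<^esub> a \<odot>\<^bsub>M\<^esub> m) = sl S.LH a (tr S.LH b g) m"
    "x \<in> carrier (vect D) \<Longrightarrow> w \<in> carrier (form D) \<Longrightarrow>
      (\<Oplus>\<^bsub>N\<^esub>j\<in>{..<nJ D}. HX_xw D (yb D j) w \<odot>\<^bsub>N\<^esub> g (HX_wx D (rb D j) x \<odot>\<^bsub>M\<^esub> m)) = PP S.LH x w g m"
    "x \<in> carrier (vect D) \<Longrightarrow> w \<in> carrier (form D) \<Longrightarrow>
      (\<Oplus>\<^bsub>N\<^esub>i\<in>{..<nI D}. HX_wx D (om D i) x \<odot>\<^bsub>N\<^esub> g (HX_xw D (xb D i) w \<odot>\<^bsub>M\<^esub> m)) = QQ S.LH w x g m"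
    "x \<in> carrier (vect D) \<Longrightarrow>
          (\<Oplus>\<^bsub>N\<^esub>j\<in>{..<nJ D}. HX_x D (yb D j) \<odot>\<^bsub>N\<^esub> g (HX_wx D (rb D j) x \<odot>\<^bsub>M\<^esub> m)) \<ominus>\<^bsub>N\<^esub>
          (\<Oplus>\<^bsub>N\<^esub>j\<in>{..<nJ D}. g ((HX_x D (yb D j) \<otimes>\<^bsub>HX D\<^esub> HX_wx D (rb D j) x) \<odot>\<^bsub>M\<^esub> m)) = S.LL x g m"
proof -
  note D = realizesD[OF N]
  note cl = S.LH_cl[OF g, simplified] M.lmod_closed HX_xw_closed HX_wx_closed HX_x_closed HX_env_closed basis_closed m
  have sum: "(\<Oplus>\<^bsub>N\<^esub>i\<in>{..<n}. F i) = (\<Oplus>\<^bsub>V\<^esub>i\<in>{..<n}. G i)" if "\<And>i. i < n \<Longrightarrow> F i = G i" for F G and n :: nat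
    using that by (subst finsum_cong_weak[of _ F G]) (auto simp: finsum_cong_group[OF D(2,4,3)])
  note minus = minus_ring_cong[OF D(2,4,3)]
  show "HX_env D \<one>\<^bsub>alg D\<^esub> b \<odot>\<^bsub>N\<^esub> g (HX_env D \<one>\<^bsub>alg D\<^esub> a \<odot>\<^bsub>M\<^esub> m) = sl S.LH a (tr S.LH b g) m"
    if "a \<in> carrier (alg D)" "b \<in> carrier (alg D)" using that by (simp add: S.LH_ops cl D)
  show "(\<Oplus>\<^bsub>N\<^esub>j\<in>{..<nJ D}. HX_xw D (yb D j) w \<odot>\<^bsub>N\<^esub> g (HX_wx D (rb D j) x \<odot>\<^bsub>M\<^esub> m)) = PP S.LH x w g m"
    if "x \<in> carrier (vect D)" "w \<in> carrier (form D)" using that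
    by (simp add: S.LH_ops m SJ_def, intro sum) (simp add: cl D)
  show "(\<Oplus>\<^bsub>N\<^esub>i\<in>{..<nI D}. HX_wx D (om D i) x \<odot>\<^bsub>N\<^esub> g (HX_xw D (xb D i) w \<odot>\<^bsub>M\<^esub> m)) = QQ S.LH w x g m"
    if "x \<in> carrier (vect D)" "w \<in> carrier (form D)" using that
    by (simp add: S.LH_ops m SI_def, intro sum) (simp add: cl D)
  show "(\<Oplus>\<^bsub>N\<^esub>j\<in>{..<nJ D}. HX_x D (yb D j) \<odot>\<^bsub>N\<^esub> g (HX_wx D (rb D j) x \<odot>\<^bsub>M\<^esub> m)) \<ominus>\<^bsub>N\<^esub>
          (\<Oplus>\<^bsub>N\<^esub>j\<in>{..<nJ D}. g ((HX_x D (yb D j) \<otimes>\<^bsub>HX D\<^esub> HX_wx D (rb D j) x) \<odot>\<^bsub>M\<^esub> m)) = S.LL x g m"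
    if "x \<in> carrier (vect D)" using that
    by (simp add: lhomL_def m minus SJ_def, intro arg_cong2[of _ _ _ _ "\<lambda>u v. u \<ominus>\<^bsub>V\<^esub> v"] sum)
       (simp_all add: cl D M.lmod_assoc)
qed

text \<open>The clauses of the definition fix the action of each generator pointwise on
  \<open>M\<close>, and homs are extensional.\<close>

lemma right_action_realizes:
  assumes "is_right_hom_action D M N act"
  shows "realizes D (with_action (right_homs D M N) act) S.RH S.LR"
proof -
  note a = assms[unfolded is_right_hom_action_def Let_def carrier_right_homs]
  interpret RX: xrep "dualD D" S.RH "dd D" S.LR by (rule S.xrep_RH)
  note [simp] = RX.P.sl_cl[unfolded dualD_simps] RX.P.tr_cl[unfolded dualD_simps] RX.P.P_cl[unfolded dualD_simps]
    RX.Q_cl[unfolded dualD_simps] RX.L_cl[unfolded dualD_simps]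
    RX.P.sl_one[unfolded dualD_simps] RX.P.tr_one[unfolded dualD_simps]
  have cl: "act b f \<in> carrier S.RH" if "b \<in> carrier (HX D)" "f \<in> carrier S.RH" for b f
    using a that by (auto dest: PiE_mem)
  note gens = HX_env_closed HX_xw_closed HX_wx_closed HX_x_closed
  have eq: "act b f = h" if "b \<in> carrier (HX D)" "f \<in> carrier S.RH" "h \<in> carrier S.RH" "\<And>m. m \<in> carrier M \<Longrightarrow> act b f m = h m" for b f h
    by (rule S.RH_eqI) (use that cl in auto)
  show ?thesis
    unfolding realizes_def with_action_simps carrier_right_homs
  proof (intro conjI ballI refl)
    show "left_module (HX D) (with_action (right_homs D M N) act)" using a by blast
    fix f assume f: "f \<in> carrier S.RH"
    have v: "\<And>a b m. \<lbrakk>a \<in> carrier (alg D); b \<in> carrier (alg D); m \<in> carrier M\<rbrakk> \<Longrightarrow> act (HX_env D a b) f m = sl S.RH a (tr S.RH b f) m"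
      "\<And>x w m. \<lbrakk>x \<in> carrier (vect D); w \<in> carrier (form D); m \<in> carrier M\<rbrakk> \<Longrightarrow> act (HX_xw D x w) f m = PP S.RH x w f m"
      "\<And>x w m. \<lbrakk>x \<in> carrier (vect D); w \<in> carrier (form D); m \<in> carrier M\<rbrakk> \<Longrightarrow> act (HX_wx D w x) f m = QQ S.RH w x f m"
      "\<And>x m. \<lbrakk>x \<in> carrier (vect D); m \<in> carrier M\<rbrakk> \<Longrightarrow> act (HX_x D x) f m = S.LR x f m"
      using a f by (simp_all only: right_formulas[OF f, symmetric])
    show "act (HX_env D a \<one>\<^bsub>alg D\<^esub>) f = sl S.RH a f" "act (HX_env D \<one>\<^bsub>alg D\<^esub> a) f = tr S.RH a f" if "a \<in> carrier (alg D)" for a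
      using that f by (auto intro!: eq gens simp: v)
    show "act (HX_xw D x w) f = PP S.RH x w f" "act (HX_wx D w x) f = QQ S.RH w x f" if "x \<in> carrier (vect D)" "w \<in> carrier (form D)" for x w
      using that f by (auto intro!: eq gens simp: v)
    show "act (HX_x D x) f = S.LR x f" if "x \<in> carrier (vect D)" for x
      using that f by (auto intro!: eq gens simp: v)
  qed
qed

lemma left_action_realizes:
  assumes "is_left_hom_action D M N act"
  shows "realizes D (with_action (left_homs D M N) act) S.LH S.LL"
proof -
  note a = assms[unfolded is_left_hom_action_def Let_def carrier_left_homs]
  interpret RX: xrep "dualD D" S.LH "dd D" S.LL by (rule S.xrep_LH)
  note [simp] = RX.P.sl_cl[unfolded dualD_simps] RX.P.tr_cl[unfolded dualD_simps] RX.P.P_cl[unfolded dualD_simps]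
    RX.Q_cl[unfolded dualD_simps] RX.L_cl[unfolded dualD_simps]
    RX.P.sl_one[unfolded dualD_simps] RX.P.tr_one[unfolded dualD_simps]
  have cl: "act b f \<in> carrier S.LH" if "b \<in> carrier (HX D)" "f \<in> carrier S.LH" for b f
    using a that by (auto dest: PiE_mem)
  note gens = HX_env_closed HX_xw_closed HX_wx_closed HX_x_closed
  have eq: "act b f = h" if "b \<in> carrier (HX D)" "f \<in> carrier S.LH" "h \<in> carrier S.LH" "\<And>m. m \<in> carrier M \<Longrightarrow> act b f m = h m" for b f h
    by (rule S.LH_eqI) (use that cl in auto)
  show ?thesis
    unfolding realizes_def with_action_simps carrier_left_homs
  proof (intro conjI ballI refl)
    show "left_module (HX D) (with_action (left_homs D M N) act)" using a by blast
    fix f assume f: "f \<in> carrier S.LH"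
    have v: "\<And>a b m. \<lbrakk>a \<in> carrier (alg D); b \<in> carrier (alg D); m \<in> carrier M\<rbrakk> \<Longrightarrow> act (HX_env D a b) f m = sl S.LH a (tr S.LH b f) m"
      "\<And>x w m. \<lbrakk>x \<in> carrier (vect D); w \<in> carrier (form D); m \<in> carrier M\<rbrakk> \<Longrightarrow> act (HX_xw D x w) f m = PP S.LH x w f m"
      "\<And>x w m. \<lbrakk>x \<in> carrier (vect D); w \<in> carrier (form D); m \<in> carrier M\<rbrakk> \<Longrightarrow> act (HX_wx D w x) f m = QQ S.LH w x f m"
      "\<And>x m. \<lbrakk>x \<in> carrier (vect D); m \<in> carrier M\<rbrakk> \<Longrightarrow> act (HX_x D x) f m = S.LL x f m"
      using a f by (simp_all only: left_formulas[OF f, symmetric])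
    show "act (HX_env D a \<one>\<^bsub>alg D\<^esub>) f = sl S.LH a f" "act (HX_env D \<one>\<^bsub>alg D\<^esub> a) f = tr S.LH a f" if "a \<in> carrier (alg D)" for a
      using that f by (auto intro!: eq gens simp: v)
    show "act (HX_xw D x w) f = PP S.LH x w f" "act (HX_wx D w x) f = QQ S.LH w x f" if "x \<in> carrier (vect D)" "w \<in> carrier (form D)" for x w
      using that f by (auto intro!: eq gens simp: v)
    show "act (HX_x D x) f = S.LL x f" if "x \<in> carrier (vect D)" for x
      using that f by (auto intro!: eq gens simp: v)
  qed
qed

text \<open>The universal property applied to the hom representation supplies an action; any two
  realize this representation and are therefore equal.\<close>

lemma ex1_right_hom_action: "\<exists>!act. is_right_hom_action D M N act"
proof (rule ex_ex1I)
  obtain act where act: "act \<in> carrier (HX D) \<rightarrow>\<^sub>E carrier S.RH \<rightarrow>\<^sub>E carrier S.RH"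
      "\<forall>U. carrier U = carrier S.RH \<longrightarrow> zero U = zero S.RH \<longrightarrow> add U = add S.RH \<longrightarrow> smult U = act \<longrightarrow> realizes D U S.RH S.LR"
      "\<And>a b f. \<lbrakk>a \<in> carrier (alg D); b \<in> carrier (alg D); f \<in> carrier S.RH\<rbrakk> \<Longrightarrow> act (HX_env D a b) f = sl S.RH a (tr S.RH b f)"
    using xrep_realizes[OF S.xrep_RH] by blast
  have r: "realizes D (with_action (right_homs D M N) act) S.RH S.LR"
    using act(2) by (simp add: carrier_right_homs)
  note D = realizesD[OF r, unfolded with_action_simps]
  have "is_right_hom_action D M N act"
    unfolding is_right_hom_action_def Let_def carrier_right_homs
    by (intro conjI ballI act(1) realizesD(1)[OF r]) (simp_all only: right_formulas act(3) D)
  then show "\<exists>act. is_right_hom_action D M N act" by blast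
  fix act act' assume 1: "is_right_hom_action D M N act" and 2: "is_right_hom_action D M N act'"
  show "act = act'"
    by (rule action_unique[OF _ _ right_action_realizes[OF 1] right_action_realizes[OF 2]])
       (use 1 2 in \<open>simp_all add: is_right_hom_action_def Let_def\<close>)
qed

lemma ex1_left_hom_action: "\<exists>!act. is_left_hom_action D M N act"
proof (rule ex_ex1I)
  obtain act where act: "act \<in> carrier (HX D) \<rightarrow>\<^sub>E carrier S.LH \<rightarrow>\<^sub>E carrier S.LH"
      "\<forall>U. carrier U = carrier S.LH \<longrightarrow> zero U = zero S.LH \<longrightarrow> add U = add S.LH \<longrightarrow> smult U = act \<longrightarrow> realizes D U S.LH S.LL"
      "\<And>a b f. \<lbrakk>a \<in> carrier (alg D); b \<in> carrier (alg D); f \<in> carrier S.LH\<rbrakk> \<Longrightarrow> act (HX_env D a b) f = sl S.LH a (tr S.LH b f)"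
    using xrep_realizes[OF S.xrep_LH] by blast
  have r: "realizes D (with_action (left_homs D M N) act) S.LH S.LL"
    using act(2) by (simp add: carrier_left_homs)
  note D = realizesD[OF r, unfolded with_action_simps]
  have "is_left_hom_action D M N act"
    unfolding is_left_hom_action_def Let_def carrier_left_homs
    by (intro conjI ballI act(1) realizesD(1)[OF r]) (simp_all only: left_formulas act(3) D)
  then show "\<exists>act. is_left_hom_action D M N act" by blast
  fix act act' assume 1: "is_left_hom_action D M N act" and 2: "is_left_hom_action D M N act'"
  show "act = act'"
    by (rule action_unique[OF _ _ left_action_realizes[OF 1] left_action_realizes[OF 2]])
       (use 1 2 in \<open>simp_all add: is_left_hom_action_def Let_def\<close>)
qed

lemma realizes_right_hom_module: "realizes D (right_hom_module D M N) S.RH S.LR"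
  unfolding right_hom_module_def by (rule right_action_realizes[OF theI'[OF ex1_right_hom_action]])

lemma realizes_left_hom_module: "realizes D (left_hom_module D M N) S.LH S.LL"
  unfolding left_hom_module_def by (rule left_action_realizes[OF theI'[OF ex1_left_hom_action]])

end

end

section \<open>The coproduct and tensor products of modules\<close>

lemma left_module_cong:
  fixes U U' :: "('r, 'm) module"
  assumes "left_module R U" "carrier U' = carrier U" "add U' = add U" "zero U' = zero U"
    and s: "\<And>r u. \<lbrakk>r \<in> carrier R; u \<in> carrier U\<rbrakk> \<Longrightarrow> r \<odot>\<^bsub>U'\<^esub> u = r \<odot>\<^bsub>U\<^esub> u"
  shows "left_module R U'"
proof -
  interpret U: left_module R U by fact
  have "abelian_group U'" by (rule abelian_group_cong[OF U.M.abelian_group_axioms]) (simp_all add: assms)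
  then show ?thesis
    by (intro left_module.intro left_module_axioms.intro U.R.ring_axioms)
       (simp_all add: assms U.lmod_closed U.lmod_l_distr U.lmod_r_distr U.lmod_assoc U.lmod_one)
qed

lemma underlying_simps [simp]: "carrier (underlying D M) = carrier M" "zero (underlying D M) = zero M" "add (underlying D M) = add M"
  by (simp_all add: underlying_def)

section \<open>The coproduct obtained from the tensor square of the regular module\<close>

context pivotal_calculus
begin

interpretation H: ring "HX D" by (rule ring_HX)

lemma HX_regular_simps [simp]: "carrier (HX_regular D) = carrier (HX D)" "add (HX_regular D) = add (HX D)"
  "zero (HX_regular D) = zero (HX D)" "smult (HX_regular D) = mult (HX D)"
  by (simp_all add: HX_regular_def)

lemma module_regular: "left_module (HX D) (HX_regular D)"
proof -
  have "abelian_group (HX_regular D)" by (rule abelian_group_cong[OF H.abelian_group_axioms]) simp_all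
  then show ?thesis
    by (intro left_module.intro left_module_axioms.intro ring_HX) (simp_all add: H.l_distr H.r_distr H.m_assoc)
qed

abbreviation "tens_of M N \<equiv> tens_rep (dualD D) (rep_of D M) (rep_of D N)"
abbreviation "lie_tens M N \<equiv> tensL (dualD D) (rep_of D M) (lie D M) (rep_of D N) (lie D N)"
abbreviation "one2 \<equiv> HX_tens D \<one>\<^bsub>HX D\<^esub> \<one>\<^bsub>HX D\<^esub>"

lemma tensor_of: "tensor (dalg (dualD D)) (bim (rep_of D M)) (bim (rep_of D N)) = tensor (alg D) (underlying D M) (underlying D N)"
  "tens (dalg (dualD D)) (bim (rep_of D M)) (bim (rep_of D N)) = mod_tens D M N"
  by (simp_all add: mod_tens_def)

lemma xreps2_modules:
  assumes "left_module (HX D) M" "left_module (HX D) N"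
  shows "xreps2 (dualD D) (dd D) (rep_of D M) (lie D M) (rep_of D N) (lie D N)"
  using assms by (intro xreps2.intro module_xrep)

text \<open>A module structure on the tensor product that does not refer to the coproduct, so that
  it can serve to construct it.\<close>

lemma tens_module_ex:
  assumes "left_module (HX D) M" "left_module (HX D) N"
  shows "\<exists>U. realizes D U (tens_of M N) (lie_tens M N)"
proof -
  interpret S: xreps2 "dualD D" "dd D" "rep_of D M" "lie D M" "rep_of D N" "lie D N" by (rule xreps2_modules[OF assms])
  obtain act where act: "\<forall>U. carrier U = carrier (tens_of M N) \<longrightarrow> zero U = zero (tens_of M N) \<longrightarrow> add U = add (tens_of M N) \<longrightarrow>
      smult U = act \<longrightarrow> realizes D U (tens_of M N) (lie_tens M N)"
    using xrep_realizes[OF S.xrep_T] by blast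
  show ?thesis
    by (rule exI[of _ "with_action S.T act"]) (use act in simp)
qed

text \<open>By naturality the action on a tensor product is determined by the action on \<open>1 \<otimes> 1\<close> in the tensor
  square of the regular module.\<close>

lemma act_tens:
  assumes M: "left_module (HX D) M" and N: "left_module (HX D) N"
    and B: "realizes D B (tens_of (HX_regular D) (HX_regular D)) (lie_tens (HX_regular D) (HX_regular D))"
    and U: "realizes D U (tens_of M N) (lie_tens M N)"
    and b: "b \<in> carrier (HX D)"
  shows "\<lbrakk>m \<in> carrier M; n \<in> carrier N\<rbrakk> \<Longrightarrow> b \<odot>\<^bsub>U\<^esub> mod_tens D M N m n =
      tens_ext (tensor (alg D) (underlying D M) (underlying D N)) (\<lambda>b1 b2. mod_tens D M N (b1 \<odot>\<^bsub>M\<^esub> m) (b2 \<odot>\<^bsub>N\<^esub> n)) (b \<odot>\<^bsub>B\<^esub> one2)"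
    "t \<in> carrier U \<Longrightarrow> b \<odot>\<^bsub>U\<^esub> t = tens_ext (tensor (alg D) (underlying D M) (underlying D N)) (\<lambda>m n.
      tens_ext (tensor (alg D) (underlying D M) (underlying D N)) (\<lambda>b1 b2. mod_tens D M N (b1 \<odot>\<^bsub>M\<^esub> m) (b2 \<odot>\<^bsub>N\<^esub> n)) (b \<odot>\<^bsub>B\<^esub> one2)) t"
proof -
  interpret M: left_module "HX D" M by (rule M)
  interpret N: left_module "HX D" N by (rule N)
  interpret R: left_module "HX D" "HX_regular D" by (rule module_regular)
  interpret S: xreps2 "dualD D" "dd D" "rep_of D M" "lie D M" "rep_of D N" "lie D N" by (rule xreps2_modules[OF M N])
  interpret SB: xreps2 "dualD D" "dd D" "rep_of D (HX_regular D)" "lie D (HX_regular D)" "rep_of D (HX_regular D)" "lie D (HX_regular D)"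
    by (rule xreps2_modules[OF module_regular module_regular])
  let ?T = "tensor (alg D) (underlying D M) (underlying D N)"
  let ?\<phi> = "\<lambda>m n. tens_ext ?T (\<lambda>b1 b2. mod_tens D M N (b1 \<odot>\<^bsub>M\<^esub> m) (b2 \<odot>\<^bsub>N\<^esub> n)) (b \<odot>\<^bsub>B\<^esub> one2)"
  note cl = M.lmod_closed N.lmod_closed HX_env_closed HX_xw_closed HX_wx_closed HX_x_closed
  have one2: "one2 \<in> carrier (tens_of (HX_regular D) (HX_regular D))"
    using SB.tn_cl[of "\<one>\<^bsub>HX D\<^esub>" "\<one>\<^bsub>HX D\<^esub>"] by (simp add: HX_tens_def mod_tens_def)
  show 1: "b \<odot>\<^bsub>U\<^esub> mod_tens D M N m n = ?\<phi> m n" if m: "m \<in> carrier M" and n: "n \<in> carrier N" for m n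
  proof -
    \<comment> \<open>The map b \<mapsto> b m is linear on the regular module; with its analogue for
      n it induces a linear map of tensor products that sends \<open>one2\<close> to m \<otimes>
      n.\<close>
    have F: "rep_hom (dualD D) (rep_of D (HX_regular D)) (lie D (HX_regular D)) (rep_of D M) (lie D M) (\<lambda>b. b \<odot>\<^bsub>M\<^esub> m)"
      using m by (intro rep_homI) (auto intro!: additive_mapI simp: cl M.lmod_l_distr M.lmod_assoc)
    have G: "rep_hom (dualD D) (rep_of D (HX_regular D)) (lie D (HX_regular D)) (rep_of D N) (lie D N) (\<lambda>b. b \<odot>\<^bsub>N\<^esub> n)"
      using n by (intro rep_homI) (auto intro!: additive_mapI simp: cl N.lmod_l_distr N.lmod_assoc)
    let ?h = "tens_ext ?T (\<lambda>b1 b2. mod_tens D M N (b1 \<odot>\<^bsub>M\<^esub> m) (b2 \<odot>\<^bsub>N\<^esub> n))"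
    have h: "rep_hom (dualD D) (tens_of (HX_regular D) (HX_regular D)) (lie_tens (HX_regular D) (HX_regular D)) (tens_of M N) (lie_tens M N) ?h"
      using rep_hom_tens[OF module_xrep[OF module_regular] module_xrep[OF module_regular] module_xrep[OF M] module_xrep[OF N] F G]
      by (simp only: tensor_of)
    have bal: "balanced (dalg (dualD D)) (bim (rep_of D (HX_regular D))) (bim (rep_of D (HX_regular D))) S.T
        (\<lambda>b1 b2. S.tn (b1 \<odot>\<^bsub>M\<^esub> m) (b2 \<odot>\<^bsub>N\<^esub> n))"
    proof (rule SB.T_balancedI)
      fix b1 b2 a assume "b1 \<in> carrier (rep_of D (HX_regular D))" "b2 \<in> carrier (rep_of D (HX_regular D))" "a \<in> carrier (dalg (dualD D))"
      then show "S.tn (tr (rep_of D (HX_regular D)) a b1 \<odot>\<^bsub>M\<^esub> m) (b2 \<odot>\<^bsub>N\<^esub> n) = S.tn (b1 \<odot>\<^bsub>M\<^esub> m) (sl (rep_of D (HX_regular D)) a b2 \<odot>\<^bsub>N\<^esub> n)"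
        using m n S.tn_tr[of "b1 \<odot>\<^bsub>M\<^esub> m" "b2 \<odot>\<^bsub>N\<^esub> n" a] by (simp add: cl M.lmod_assoc N.lmod_assoc)
    qed (use m n in \<open>simp_all add: cl M.lmod_l_distr N.lmod_l_distr S.tn_cl[simplified] S.tn_add1[simplified] S.tn_add2[simplified]\<close>)
    have "?h one2 = mod_tens D M N m n"
      using SB.T.tens_ext_tens[OF S.T_ab bal, of "\<one>\<^bsub>HX D\<^esub>" "\<one>\<^bsub>HX D\<^esub>"] m n
      by (simp add: HX_tens_def mod_tens_def M.lmod_one N.lmod_one)
    then show ?thesis using realizes_hom_eq[OF B U h b one2] by simp
  qed
  show "b \<odot>\<^bsub>U\<^esub> t = tens_ext ?T ?\<phi> t" if t: "t \<in> carrier U"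
  proof -
    interpret U: left_module "HX D" U by (rule realizesD(1)[OF U])
    note D = realizesD(2-4)[OF U]
    have am: "additive_map S.T S.T (\<lambda>t. b \<odot>\<^bsub>U\<^esub> t)"
      using b D U.lmod_closed[of b] U.lmod_r_distr[of b] by (intro additive_mapI) simp_all
    note a = additive_map_closed[OF am] additive_map_add[OF am]
    have \<phi>: "?\<phi> m n = b \<odot>\<^bsub>U\<^esub> S.tn m n" if "m \<in> carrier (rep_of D M)" "n \<in> carrier (rep_of D N)" for m n
      using 1[of m n] that by (simp add: mod_tens_def)
    \<comment> \<open>By the first claim the map is the action of b after forming the pure tensor,
      hence balanced.\<close>
    have bal: "balanced (dalg (dualD D)) (bim (rep_of D M)) (bim (rep_of D N)) S.T ?\<phi>"
      by (rule S.T_balancedI) (simp_all only: \<phi> a S.tn_cl S.tn_add1 S.tn_add2 S.tn_tr S.M.P.tr_cl S.N.P.sl_cl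
          S.M.P.V.a_closed S.N.P.V.a_closed)
    show ?thesis
      using S.T_induct[OF am S.T.tens_ext_additive[OF S.T_ab bal] _ _ S.T_ab, of t] S.T.tens_ext_tens[OF S.T_ab bal] t D \<phi>
      by simp
  qed
qed

text \<open>The values on generators are prescribed, and multiplicativity expresses the value on a
  product through the values on its factors.\<close>

lemma is_coproduct_unique:
  assumes 1: "is_coproduct D \<Delta>" and 2: "is_coproduct D \<Delta>'"
  shows "\<Delta> = \<Delta>'"
proof -
  note a = 1[unfolded is_coproduct_def Let_def] and b = 2[unfolded is_coproduct_def Let_def]
  have "\<Delta> b = \<Delta>' b" if "b \<in> carrier (HX D)" for b
    using that
  proof (induction rule: HX_induct)
    case (add b c)
    have "additive_map (HX D) (HX2 D) \<Delta>" "additive_map (HX D) (HX2 D) \<Delta>'" using a b by blast+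
    with add show ?case by (simp add: additive_map_add)
  next
    case (mult m n)
    have "\<Delta> (m \<otimes>\<^bsub>HX D\<^esub> n) = tens_ext (HX2 D) (\<lambda>n1 n2. tens_ext (HX2 D) (\<lambda>m1 m2.
          HX_tens D (m1 \<otimes>\<^bsub>HX D\<^esub> n1) (m2 \<otimes>\<^bsub>HX D\<^esub> n2)) (\<Delta> m)) (\<Delta> n)" using a mult by blast
    also have "\<dots> = \<Delta>' (m \<otimes>\<^bsub>HX D\<^esub> n)" using b mult by simp
    finally show ?case .
  qed (use a b in simp_all)
  moreover have "\<Delta> \<in> extensional (carrier (HX D))" "\<Delta>' \<in> extensional (carrier (HX D))" using a b by blast+
  ultimately show ?thesis using extensionalityI by blast
qed

text \<open>The values on generators are the operators of the tensor square applied to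
  \<open>one2\<close>. Multiplicativity is \<open>act_tens\<close> for the tensor square itself,
  applied to m acting on n (1 \<otimes> 1).\<close>

lemma coproduct_eq:
  assumes B: "realizes D B (tens_of (HX_regular D) (HX_regular D)) (lie_tens (HX_regular D) (HX_regular D))"
    and b: "b \<in> carrier (HX D)"
  shows "coproduct D b = b \<odot>\<^bsub>B\<^esub> one2"
proof -
  interpret SB: xreps2 "dualD D" "dd D" "rep_of D (HX_regular D)" "lie D (HX_regular D)" "rep_of D (HX_regular D)" "lie D (HX_regular D)"
    by (rule xreps2_modules[OF module_regular module_regular])
  interpret B: left_module "HX D" B by (rule realizesD(1)[OF B])
  note D = realizesD[OF B]
  have T: "HX2 D = SB.T" "HX_tens D = SB.tn" by (simp_all add: HX2_def HX_tens_def mod_tens_def)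
  have one [simp]: "\<one>\<^bsub>HX D\<^esub> \<in> carrier (rep_of D (HX_regular D))" by simp
  have one2: "one2 \<in> carrier SB.T" unfolding T by (rule SB.tn_cl) simp_all
  have cB: "carrier B = carrier SB.T" "add B = add SB.T" using D by simp_all
  let ?\<Delta> = "\<lambda>b\<in>carrier (HX D). b \<odot>\<^bsub>B\<^esub> one2"
  note cl = HX_env_closed HX_xw_closed HX_wx_closed HX_x_closed
  have SIT: "SI (dualD D) SB.T \<phi> = (\<Oplus>\<^bsub>SB.T\<^esub>i\<in>{..<nI D}. \<phi> (om D i) (xb D i))"
    and SJT: "SJ (dualD D) SB.T \<psi> = (\<Oplus>\<^bsub>SB.T\<^esub>j\<in>{..<nJ D}. \<psi> (yb D j) (rb D j))" for \<phi> \<psi>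
    by (simp_all add: SI_def SJ_def)
  have "is_coproduct D ?\<Delta>"
    unfolding is_coproduct_def Let_def
  proof (intro conjI ballI)
    show "?\<Delta> \<in> extensional (carrier (HX D))" by simp
    show "additive_map (HX D) (HX2 D) ?\<Delta>"
      unfolding T(1) using B.lmod_closed[of _ one2] B.lmod_l_distr[of _ _ one2] one2 cB by (intro additive_mapI) simp_all
    show "?\<Delta> (HX_env D a b) = HX_tens D (HX_env D a \<one>\<^bsub>alg D\<^esub>) (HX_env D \<one>\<^bsub>alg D\<^esub> b)"
      if ab: "a \<in> carrier (alg D)" "b \<in> carrier (alg D)" for a b
    proof -
      have b1: "b \<in> carrier (dalg (dualD D))" using ab by simp
      have "HX_env D a b = HX_env D a \<one>\<^bsub>alg D\<^esub> \<otimes>\<^bsub>HX D\<^esub> HX_env D \<one>\<^bsub>alg D\<^esub> b"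
        using ab by (simp add: HX_env_mult)
      then have "HX_env D a b \<odot>\<^bsub>B\<^esub> one2 = HX_env D a \<one>\<^bsub>alg D\<^esub> \<odot>\<^bsub>B\<^esub> (HX_env D \<one>\<^bsub>alg D\<^esub> b \<odot>\<^bsub>B\<^esub> one2)"
        using ab one2 cB by (simp add: B.lmod_assoc cl)
      also have "\<dots> = a \<odot>\<^bsub>SB.T\<^esub> (one2 \<ddagger>\<^bsub>SB.T\<^esub> b)"
        using ab one2 D(5)[of a] D(6)[of b] SB.T.rsmult_additive[of b] by (simp add: additive_map_def Pi_iff)
      also have "\<dots> = SB.tn (sl (rep_of D (HX_regular D)) a \<one>\<^bsub>HX D\<^esub>) (tr (rep_of D (HX_regular D)) b \<one>\<^bsub>HX D\<^esub>)"
        unfolding T SB.tr_tn[OF b1 one one] by (rule SB.sl_tn) (use ab b1 SB.M.P.tr_cl[OF b1 one] in simp_all)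
      also have "\<dots> = SB.tn (HX_env D a \<one>\<^bsub>alg D\<^esub>) (HX_env D \<one>\<^bsub>alg D\<^esub> b)" using ab by (simp add: cl)
      finally show ?thesis using ab by (simp add: cl T)
    qed
    show "?\<Delta> (HX_xw D x w) = (\<Oplus>\<^bsub>HX2 D\<^esub>i\<in>{..<nI D}. HX_tens D (HX_xw D x (om D i)) (HX_xw D (xb D i) w))"
      if "x \<in> carrier (vect D)" "w \<in> carrier (form D)" for x w
    proof -
      have "?\<Delta> (HX_xw D x w) = PP SB.TR x w (SB.tn \<one>\<^bsub>HX D\<^esub> \<one>\<^bsub>HX D\<^esub>)"
        using that one2 D(7)[of x w one2] by (simp add: cl T)
      also have "\<dots> = SI (dualD D) SB.T (\<lambda>w' x'. SB.tn (HX_xw D x w' \<otimes>\<^bsub>HX D\<^esub> \<one>\<^bsub>HX D\<^esub>) (HX_xw D x' w \<otimes>\<^bsub>HX D\<^esub> \<one>\<^bsub>HX D\<^esub>))"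
        using SB.PT_tn[of x w "\<one>\<^bsub>HX D\<^esub>" "\<one>\<^bsub>HX D\<^esub>"] that by simp
      also have "\<dots> = (\<Oplus>\<^bsub>SB.T\<^esub>i\<in>{..<nI D}. SB.tn (HX_xw D x (om D i)) (HX_xw D (xb D i) w))"
        unfolding SIT by (rule finsum_cong_weak) (use that basis_closed in \<open>simp add: cl\<close>)
      finally show ?thesis unfolding T .
    qed
    show "?\<Delta> (HX_wx D w x) = (\<Oplus>\<^bsub>HX2 D\<^esub>j\<in>{..<nJ D}. HX_tens D (HX_wx D w (yb D j)) (HX_wx D (rb D j) x))"
      if "w \<in> carrier (form D)" "x \<in> carrier (vect D)" for x w
    proof -
      have "?\<Delta> (HX_wx D w x) = QQ SB.TR w x (SB.tn \<one>\<^bsub>HX D\<^esub> \<one>\<^bsub>HX D\<^esub>)"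
        using that one2 D(8)[of x w one2] by (simp add: cl T)
      also have "\<dots> = SJ (dualD D) SB.T (\<lambda>y r. SB.tn (HX_wx D w y \<otimes>\<^bsub>HX D\<^esub> \<one>\<^bsub>HX D\<^esub>) (HX_wx D r x \<otimes>\<^bsub>HX D\<^esub> \<one>\<^bsub>HX D\<^esub>))"
        using SB.QT_tn[of w x "\<one>\<^bsub>HX D\<^esub>" "\<one>\<^bsub>HX D\<^esub>"] that by simp
      also have "\<dots> = (\<Oplus>\<^bsub>SB.T\<^esub>j\<in>{..<nJ D}. SB.tn (HX_wx D w (yb D j)) (HX_wx D (rb D j) x))"
        unfolding SJT by (rule finsum_cong_weak) (use that basis_closed in \<open>simp add: cl\<close>)
      finally show ?thesis unfolding T .
    qed
    show "?\<Delta> (HX_x D x) = HX_tens D (HX_x D x) \<one>\<^bsub>HX D\<^esub> \<oplus>\<^bsub>HX2 D\<^esub>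
        (\<Oplus>\<^bsub>HX2 D\<^esub>i\<in>{..<nI D}. HX_tens D (HX_xw D x (om D i)) (HX_x D (xb D i)))"
      if "x \<in> carrier (vect D)" for x
    proof -
      have "?\<Delta> (HX_x D x) = SB.LT x (SB.tn \<one>\<^bsub>HX D\<^esub> \<one>\<^bsub>HX D\<^esub>)"
        using that one2 D(9)[of x one2] by (simp add: cl T)
      also have "\<dots> = SB.tn (HX_x D x) \<one>\<^bsub>HX D\<^esub> \<oplus>\<^bsub>SB.T\<^esub>
          SI (dualD D) SB.T (\<lambda>w' x'. SB.tn (HX_xw D x w' \<otimes>\<^bsub>HX D\<^esub> \<one>\<^bsub>HX D\<^esub>) (HX_x D x' \<otimes>\<^bsub>HX D\<^esub> \<one>\<^bsub>HX D\<^esub>))"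
        using SB.LT_tn[of x "\<one>\<^bsub>HX D\<^esub>" "\<one>\<^bsub>HX D\<^esub>"] that by (simp add: cl)
      also have "SI (dualD D) SB.T (\<lambda>w' x'. SB.tn (HX_xw D x w' \<otimes>\<^bsub>HX D\<^esub> \<one>\<^bsub>HX D\<^esub>) (HX_x D x' \<otimes>\<^bsub>HX D\<^esub> \<one>\<^bsub>HX D\<^esub>))
          = (\<Oplus>\<^bsub>SB.T\<^esub>i\<in>{..<nI D}. SB.tn (HX_xw D x (om D i)) (HX_x D (xb D i)))"
        unfolding SIT by (rule finsum_cong_weak) (use that basis_closed in \<open>simp add: cl\<close>)
      finally show ?thesis unfolding T .
    qed
    fix m n assume mn: "m \<in> carrier (HX D)" "n \<in> carrier (HX D)"
    \<comment> \<open>The vector n (1 \<otimes> 1) is the value of the candidate at n; acting on it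
      with m gives the value at the product by associativity.\<close>
    have "n \<odot>\<^bsub>B\<^esub> one2 \<in> carrier B" using mn one2 cB by (intro B.lmod_closed) simp_all
    from act_tens(2)[OF module_regular module_regular B B mn(1) this]
    show "?\<Delta> (m \<otimes>\<^bsub>HX D\<^esub> n) = tens_ext (HX2 D) (\<lambda>n1 n2. tens_ext (HX2 D) (\<lambda>m1 m2.
          HX_tens D (m1 \<otimes>\<^bsub>HX D\<^esub> n1) (m2 \<otimes>\<^bsub>HX D\<^esub> n2)) (?\<Delta> m)) (?\<Delta> n)"
      using mn one2 cB by (simp add: B.lmod_assoc HX2_def HX_tens_def)
  qed
  then have "coproduct D = ?\<Delta>"
    unfolding coproduct_def by (intro the_equality is_coproduct_unique)
  then show ?thesis using b by simp
qed

text \<open>With \<open>coproduct_eq\<close>, the action that defines \<open>mod_tensor\<close> is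
  the formula of \<open>act_tens\<close> for the abstract module \<open>U\<close>. They agree on the
  carrier, which is enough to transport the module laws.\<close>

lemma realizes_mod_tensor:
  assumes M: "left_module (HX D) M" and N: "left_module (HX D) N"
  shows "realizes D (mod_tensor D M N) (tens_of M N) (lie_tens M N)"
proof -
  obtain B where B: "realizes D B (tens_of (HX_regular D) (HX_regular D)) (lie_tens (HX_regular D) (HX_regular D))"
    using tens_module_ex[OF module_regular module_regular] by blast
  obtain U where U: "realizes D U (tens_of M N) (lie_tens M N)" using tens_module_ex[OF M N] by blast
  note D = realizesD[OF U]
  have c: "carrier (mod_tensor D M N) = carrier U" "add (mod_tensor D M N) = add U" "zero (mod_tensor D M N) = zero U"
    using D by (simp_all add: mod_tensor_def Let_def)
  have s: "b \<odot>\<^bsub>mod_tensor D M N\<^esub> t = b \<odot>\<^bsub>U\<^esub> t" if "b \<in> carrier (HX D)" "t \<in> carrier U" for b t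
    using act_tens(2)[OF M N B U that] coproduct_eq[OF B that(1)] by (simp add: mod_tensor_def Let_def)
  have "left_module (HX D) (mod_tensor D M N)"
    by (rule left_module_cong[OF D(1) c s])
  moreover have "b \<odot>\<^bsub>mod_tensor D M N\<^esub> t = b \<odot>\<^bsub>U\<^esub> t" if "b \<in> carrier (HX D)" "t \<in> carrier (tens_of M N)" for b t
    using s that D by simp
  ultimately show ?thesis
    using c D by (simp add: realizes_def HX_env_closed HX_xw_closed HX_wx_closed HX_x_closed)
qed

section \<open>Units and counits as module maps\<close>

lemma rep_hom_comp: "rep_hom E U LU V LV F \<Longrightarrow> rep_hom E V LV W LW G \<Longrightarrow> rep_hom E U LU W LW (\<lambda>u. G (F u))"
  by (auto simp: rep_hom_def additive_map_def Pi_iff)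

text \<open>The counit and the composite obtained from representations coincide on the carrier
  only.\<close>

lemma left_module_hom_cong:
  assumes "left_module_hom (HX D) U U' F" "\<And>u. u \<in> carrier U \<Longrightarrow> G u = F u"
  shows "left_module_hom (HX D) U U' G"
proof -
  interpret left_module "HX D" U using assms(1) by (simp add: left_module_hom_def)
  show ?thesis
    using assms by (simp add: left_module_hom_def left_map_def additive_map_def Pi_iff lmod_closed)
qed

lemma unit_right:
  assumes M: "left_module (HX D) M" and N: "left_module (HX D) N"
  shows "left_module_hom (HX D) N (right_hom_module D M (mod_tensor D N M)) (\<lambda>n. \<lambda>m\<in>carrier M. mod_tens D N M n m)"
proof -
  interpret S: xreps2 "dualD D" "dd D" "rep_of D N" "lie D N" "rep_of D M" "lie D M" by (rule xreps2_modules[OF N M])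
  interpret P: xreps_pair "dualD D" "dd D" "rep_of D M" "lie D M" "rep_of D N" "lie D N" ..
  show ?thesis
    using realizes_left_module_hom[OF realizes_self[OF N]
        realizes_right_hom_module[OF M realizes_mod_tensor[OF N M] S.xrep_T] P.unit_r]
    by (simp add: mod_tens_def)
qed

lemma unit_left:
  assumes M: "left_module (HX D) M" and N: "left_module (HX D) N"
  shows "left_module_hom (HX D) N (left_hom_module D M (mod_tensor D M N)) (\<lambda>n. \<lambda>m\<in>carrier M. mod_tens D M N m n)"
proof -
  interpret S: xreps2 "dualD D" "dd D" "rep_of D M" "lie D M" "rep_of D N" "lie D N" by (rule xreps2_modules[OF M N])
  interpret P: xreps_pair "dualD D" "dd D" "rep_of D M" "lie D M" "rep_of D N" "lie D N" ..
  show ?thesis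
    using realizes_left_module_hom[OF realizes_self[OF N]
        realizes_left_hom_module[OF M realizes_mod_tensor[OF M N] S.xrep_T] P.unit_l]
    by (simp add: mod_tens_def)
qed

text \<open>\<open>counit_r\<close> concerns the tensor product with the explicit hom
  representation, whereas \<open>mod_tensor\<close> is formed from the operators of
  \<open>right_hom_module\<close>. The identity intertwines these; tensored with the identity of
  \<open>M\<close> it is composed with \<open>counit_r\<close>.\<close>

lemma counit_right:
  assumes M: "left_module (HX D) M" and N: "left_module (HX D) N"
  shows "left_module_hom (HX D) (mod_tensor D (right_hom_module D M N) M) N (tens_ext N (\<lambda>f m. f m))"
proof -
  interpret S: xreps2 "dualD D" "dd D" "rep_of D M" "lie D M" "rep_of D N" "lie D N" by (rule xreps2_modules[OF M N])
  interpret P: xreps_pair "dualD D" "dd D" "rep_of D M" "lie D M" "rep_of D N" "lie D N" ..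
  let ?Q = "right_hom_module D M N"
  note Q = realizes_right_hom_module[OF M realizes_self[OF N] module_xrep[OF N]]
  have Qm: "left_module (HX D) ?Q" by (rule realizesD(1)[OF Q])
  interpret T: xreps2 "dualD D" "dd D" "rep_of D ?Q" "lie D ?Q" "rep_of D M" "lie D M" by (rule xreps2_modules[OF Qm M])
  interpret T': xreps2 "dualD D" "dd D" S.RH S.LR "rep_of D M" "lie D M"
    by (intro xreps2.intro S.xrep_RH module_xrep[OF M])
  have idM: "rep_hom (dualD D) (rep_of D M) (lie D M) (rep_of D M) (lie D M) (\<lambda>m. m)"
    by (rule realizes_id[OF realizes_self[OF M]])
  note h = rep_hom_tens[OF module_xrep[OF Qm] module_xrep[OF M] S.xrep_RH module_xrep[OF M] realizes_id[OF Q] idM]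
  note hom = realizes_left_module_hom[OF realizes_mod_tensor[OF Qm M] realizes_self[OF N] rep_hom_comp[OF h P.counit_r]]
  note D = realizesD[OF Q]
  note abN = S.N.P.V.abelian_group_axioms
  have bal: "balanced (dalg (dualD D)) (bim (rep_of D ?Q)) (bim (rep_of D M)) (rep_of D N) (\<lambda>f m. f m)"
    by (rule T.T_balancedI) (use D S.RH_cl S.RH_add in \<open>simp_all add: S.RH_ops\<close>)
  have bal': "balanced (dalg (dualD D)) (bim S.RH) (bim (rep_of D M)) (rep_of D N) (\<lambda>f m. f m)"
    by (rule T'.T_balancedI) (use S.RH_cl S.RH_add in \<open>simp_all add: S.RH_ops\<close>)
  have balh: "balanced (dalg (dualD D)) (bim (rep_of D ?Q)) (bim (rep_of D M)) T'.T (\<lambda>f m. T'.tn f m)"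
    by (rule T.T_balancedI) (use D T'.tn_cl T'.tn_add1 T'.tn_add2 T'.tn_tr in \<open>simp_all\<close>)
  have am: "additive_map T.T (rep_of D N) (tens_ext (rep_of D N) (\<lambda>f m. f m))" by (rule T.T.tens_ext_additive[OF abN bal])
  have am': "additive_map T'.T (rep_of D N) (tens_ext (rep_of D N) (\<lambda>f m. f m))" by (rule T'.T.tens_ext_additive[OF abN bal'])
  have amh: "additive_map T.T T'.T (tens_ext T'.T (\<lambda>f m. T'.tn f m))" by (rule T.T.tens_ext_additive[OF T'.T_ab balh])
  \<comment> \<open>The composite contains the change of tensor product; on a pure tensor both sides
    give f(m).\<close>
  have eq: "tens_ext (rep_of D N) (\<lambda>f m. f m) t = tens_ext (rep_of D N) (\<lambda>f m. f m) (tens_ext T'.T (\<lambda>f m. T'.tn f m) t)"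
    if t: "t \<in> carrier T.T" for t
  proof (rule T.T_induct[OF am additive_map_comp[OF amh am'] t _ abN])
    fix f m assume fm: "f \<in> carrier (rep_of D ?Q)" "m \<in> carrier (rep_of D M)"
    show "tens_ext (rep_of D N) (\<lambda>f m. f m) (T.tn f m) = tens_ext (rep_of D N) (\<lambda>f m. f m) (tens_ext T'.T (\<lambda>f m. T'.tn f m) (T.tn f m))"
      using T.T.tens_ext_tens[OF abN bal, of f m] T.T.tens_ext_tens[OF T'.T_ab balh, of f m]
        T'.T.tens_ext_tens[OF abN bal', of f m] fm D by simp
  qed
  show ?thesis
    by (rule left_module_hom_cong[OF hom]) (use eq in \<open>simp add: mod_tensor_def Let_def tens_ext_cong_group[of "rep_of D N" N, symmetric]\<close>)
qed

text \<open>The same detour as for right homs, with the hom in the second tensor factor.\<close>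

lemma counit_left:
  assumes M: "left_module (HX D) M" and N: "left_module (HX D) N"
  shows "left_module_hom (HX D) (mod_tensor D M (left_hom_module D M N)) N (tens_ext N (\<lambda>m g. g m))"
proof -
  interpret S: xreps2 "dualD D" "dd D" "rep_of D M" "lie D M" "rep_of D N" "lie D N" by (rule xreps2_modules[OF M N])
  interpret P: xreps_pair "dualD D" "dd D" "rep_of D M" "lie D M" "rep_of D N" "lie D N" ..
  let ?Q = "left_hom_module D M N"
  note Q = realizes_left_hom_module[OF M realizes_self[OF N] module_xrep[OF N]]
  have Qm: "left_module (HX D) ?Q" by (rule realizesD(1)[OF Q])
  interpret T: xreps2 "dualD D" "dd D" "rep_of D M" "lie D M" "rep_of D ?Q" "lie D ?Q" by (rule xreps2_modules[OF M Qm])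
  interpret T': xreps2 "dualD D" "dd D" "rep_of D M" "lie D M" S.LH S.LL
    by (intro xreps2.intro S.xrep_LH module_xrep[OF M])
  have idM: "rep_hom (dualD D) (rep_of D M) (lie D M) (rep_of D M) (lie D M) (\<lambda>m. m)"
    by (rule realizes_id[OF realizes_self[OF M]])
  note h = rep_hom_tens[OF module_xrep[OF M] module_xrep[OF Qm] module_xrep[OF M] S.xrep_LH idM realizes_id[OF Q]]
  note hom = realizes_left_module_hom[OF realizes_mod_tensor[OF M Qm] realizes_self[OF N] rep_hom_comp[OF h P.counit_l]]
  note D = realizesD[OF Q]
  note abN = S.N.P.V.abelian_group_axioms
  have bal: "balanced (dalg (dualD D)) (bim (rep_of D M)) (bim (rep_of D ?Q)) (rep_of D N) (\<lambda>m f. f m)"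
    by (rule T.T_balancedI) (use D S.LH_cl S.LH_add in \<open>simp_all add: S.LH_ops\<close>)
  have bal': "balanced (dalg (dualD D)) (bim (rep_of D M)) (bim S.LH) (rep_of D N) (\<lambda>m f. f m)"
    by (rule T'.T_balancedI) (use S.LH_cl S.LH_add in \<open>simp_all add: S.LH_ops\<close>)
  have balh: "balanced (dalg (dualD D)) (bim (rep_of D M)) (bim (rep_of D ?Q)) T'.T (\<lambda>m f. T'.tn m f)"
    by (rule T.T_balancedI) (use D T'.tn_cl T'.tn_add1 T'.tn_add2 T'.tn_tr in \<open>simp_all\<close>)
  have am: "additive_map T.T (rep_of D N) (tens_ext (rep_of D N) (\<lambda>m f. f m))" by (rule T.T.tens_ext_additive[OF abN bal])
  have am': "additive_map T'.T (rep_of D N) (tens_ext (rep_of D N) (\<lambda>m f. f m))" by (rule T'.T.tens_ext_additive[OF abN bal'])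
  have amh: "additive_map T.T T'.T (tens_ext T'.T (\<lambda>m f. T'.tn m f))" by (rule T.T.tens_ext_additive[OF T'.T_ab balh])
  have eq: "tens_ext (rep_of D N) (\<lambda>m f. f m) t = tens_ext (rep_of D N) (\<lambda>m f. f m) (tens_ext T'.T (\<lambda>m f. T'.tn m f) t)"
    if t: "t \<in> carrier T.T" for t
  proof (rule T.T_induct[OF am additive_map_comp[OF amh am'] t _ abN])
    fix f m assume fm: "f \<in> carrier (rep_of D ?Q)" "m \<in> carrier (rep_of D M)"
    show "tens_ext (rep_of D N) (\<lambda>m f. f m) (T.tn m f) = tens_ext (rep_of D N) (\<lambda>m f. f m) (tens_ext T'.T (\<lambda>m f. T'.tn m f) (T.tn m f))"
      using T.T.tens_ext_tens[OF abN bal, of m f] T.T.tens_ext_tens[OF T'.T_ab balh, of m f]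
        T'.T.tens_ext_tens[OF abN bal', of m f] fm D by simp
  qed
  show ?thesis
    by (rule left_module_hom_cong[OF hom]) (use eq in \<open>simp add: mod_tensor_def Let_def tens_ext_cong_group[of "rep_of D N" N, symmetric]\<close>)
qed

end

theorem theorem4p12:
  fixes D :: "('k, 'a, 'w, 'x) calculus"
    and M :: "(('k, 'a, 'w, 'x) hx, 'm) module"
    and N :: "(('k, 'a, 'w, 'x) hx, 'n) module"
  assumes "pivotal_calculus D"
    and "left_module (HX D) M"
    and "left_module (HX D) N"
  shows "(\<exists>!act. is_right_hom_action D M N act)
    \<and> (\<exists>!act. is_left_hom_action D M N act)
    \<and> (left_module_hom (HX D) N (right_hom_module D M (mod_tensor D N M))
           (\<lambda>n. \<lambda>m\<in>carrier M. mod_tens D N M n m))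
    \<and> (left_module_hom (HX D) (mod_tensor D (right_hom_module D M N) M) N
           (tens_ext N (\<lambda>f m. f m)))
    \<and> (left_module_hom (HX D) N (left_hom_module D M (mod_tensor D M N))
           (\<lambda>n. \<lambda>m\<in>carrier M. mod_tens D M N m n))
    \<and> (left_module_hom (HX D) (mod_tensor D M (left_hom_module D M N)) N
           (tens_ext N (\<lambda>m g. g m)))"
proof -
  interpret pivotal_calculus D by fact
  \<comment> \<open>Every module realizes the representation formed by its own operators.\<close>
  note N = realizes_self[OF assms(3)] module_xrep[OF assms(3)]
  show ?thesis
    using ex1_right_hom_action[OF assms(2) N] ex1_left_hom_action[OF assms(2) N]
      unit_right[OF assms(2,3)] counit_right[OF assms(2,3)] unit_left[OF assms(2,3)] counit_left[OF assms(2,3)]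
    by blast
qed

end
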